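(* For every prime power $q>2$, every non-trivial conjugacy class of the finite simple Chevalley group $G_2(q)$ is of type C, D, or F.
   Context: For $H\leqslant G$, $\mathcal O_g^H$ is the orbit of $g$ under conjugation by $H$. A conjugacy class $\mathcal O$ of a finite group $G$ is: of type C if there are $H\leqslant G$ and $r,s\in H\cap\mathcal O$ with $rs\neq sr$, $H=\langle \mathcal O_r^H,\mathcal O_s^H\rangle$, $\mathcal O_r^H\neq\mathcal O_s^H$, and $\min\{|\mathcal O_r^H|,|\mathcal O_s^H|\}>2$ or $\max\{|\mathcal O_r^H|,|\mathcal O_s^H|\}>4$; of type D if there are $r,s\in\mathcal O$ with $\mathcal O_r^{\langle r,s\rangle}\neq\mathcal O_s^{\langle r,s\rangle}$ and $(rs)^2\neq(sr)^2$; of type F if there are $r_1,r_2,r_3,r_4\in\mathcal O$ such that, with $K=\langle r_1,\dots,r_4\rangle$, $\mathcal O_{r_a}^K\neq\mathcal O_{r_b}^K$ and $r_ar_b\neq r_br_a$ for all $a\neq b$. *)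

theory Defs
  imports "HOL-Algebra.Algebra"
begin

definition conj_orbit :: "('g, 'b) monoid_scheme \<Rightarrow> 'g set \<Rightarrow> 'g \<Rightarrow> 'g set" where
  "conj_orbit G H g = {h \<otimes>\<^bsub>G\<^esub> g \<otimes>\<^bsub>G\<^esub> inv\<^bsub>G\<^esub> h | h. h \<in> H}"

definition conj_classes :: "('g, 'b) monoid_scheme \<Rightarrow> 'g set set" where
  "conj_classes G = {conj_orbit G (carrier G) g | g. g \<in> carrier G}"

definition type_C :: "('g, 'b) monoid_scheme \<Rightarrow> 'g set \<Rightarrow> bool" where
  "type_C G Cl \<longleftrightarrow> (\<exists>H r s. subgroup H G \<and> r \<in> H \<inter> Cl \<and> s \<in> H \<inter> Cl \<and>
      r \<otimes>\<^bsub>G\<^esub> s \<noteq> s \<otimes>\<^bsub>G\<^esub> r \<and>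
      H = generate G (conj_orbit G H r \<union> conj_orbit G H s) \<and>
      conj_orbit G H r \<noteq> conj_orbit G H s \<and>
      (min (card (conj_orbit G H r)) (card (conj_orbit G H s)) > 2 \<or>
       max (card (conj_orbit G H r)) (card (conj_orbit G H s)) > 4))"

definition type_D :: "('g, 'b) monoid_scheme \<Rightarrow> 'g set \<Rightarrow> bool" where
  "type_D G Cl \<longleftrightarrow> (\<exists>r s. r \<in> Cl \<and> s \<in> Cl \<and>
      conj_orbit G (generate G {r, s}) r \<noteq> conj_orbit G (generate G {r, s}) s \<and>
      (r \<otimes>\<^bsub>G\<^esub> s) [^]\<^bsub>G\<^esub> (2::nat) \<noteq> (s \<otimes>\<^bsub>G\<^esub> r) [^]\<^bsub>G\<^esub> (2::nat))"

definition type_F :: "('g, 'b) monoid_scheme \<Rightarrow> 'g set \<Rightarrow> bool" where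
  "type_F G Cl \<longleftrightarrow> (\<exists>r :: nat \<Rightarrow> 'g. (\<forall>a<4. r a \<in> Cl) \<and>
      (let K = generate G (r ` {0..<4}) in
        \<forall>a<4. \<forall>b<4. a \<noteq> b \<longrightarrow>
          conj_orbit G K (r a) \<noteq> conj_orbit G K (r b) \<and>
          r a \<otimes>\<^bsub>G\<^esub> r b \<noteq> r b \<otimes>\<^bsub>G\<^esub> r a))"

type_synonym 'a vec3 = "'a \<times> 'a \<times> 'a"
type_synonym 'a zorn = "'a \<times> 'a vec3 \<times> 'a vec3 \<times> 'a"

fun dot3 :: "'a::field vec3 \<Rightarrow> 'a vec3 \<Rightarrow> 'a" where
  "dot3 (x1, x2, x3) (y1, y2, y3) = x1 * y1 + x2 * y2 + x3 * y3"

fun cross3 :: "'a::field vec3 \<Rightarrow> 'a vec3 \<Rightarrow> 'a vec3" where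
  "cross3 (x1, x2, x3) (y1, y2, y3) = (x2 * y3 - x3 * y2, x3 * y1 - x1 * y3, x1 * y2 - x2 * y1)"

fun smul3 :: "'a::field \<Rightarrow> 'a vec3 \<Rightarrow> 'a vec3" where
  "smul3 c (x1, x2, x3) = (c * x1, c * x2, c * x3)"

fun add3 :: "'a::field vec3 \<Rightarrow> 'a vec3 \<Rightarrow> 'a vec3" where
  "add3 (x1, x2, x3) (y1, y2, y3) = (x1 + y1, x2 + y2, x3 + y3)"

fun sub3 :: "'a::field vec3 \<Rightarrow> 'a vec3 \<Rightarrow> 'a vec3" where
  "sub3 (x1, x2, x3) (y1, y2, y3) = (x1 - y1, x2 - y2, x3 - y3)"

text \<open>Zorn's vector-matrix multiplication: the split octonion algebra over the field.\<close>
fun zmul :: "'a::field zorn \<Rightarrow> 'a zorn \<Rightarrow> 'a zorn" where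
  "zmul (a, u, v, b) (a', u', v', b') =
     (a * a' + dot3 u v',
      sub3 (add3 (smul3 a u') (smul3 b' u)) (cross3 v v'),
      add3 (add3 (smul3 a' v) (smul3 b v')) (cross3 u u'),
      b * b' + dot3 v u')"

fun zadd :: "'a::field zorn \<Rightarrow> 'a zorn \<Rightarrow> 'a zorn" where
  "zadd (a, u, v, b) (a', u', v', b') = (a + a', add3 u u', add3 v v', b + b')"

fun zsmul :: "'a::field \<Rightarrow> 'a zorn \<Rightarrow> 'a zorn" where
  "zsmul c (a, u, v, b) = (c * a, smul3 c u, smul3 c v, c * b)"

definition octonion_auts :: "('a::field zorn \<Rightarrow> 'a zorn) set" where
  "octonion_auts = {f. bij f \<and> (\<forall>x y. f (zadd x y) = zadd (f x) (f y)) \<and>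
      (\<forall>c x. f (zsmul c x) = zsmul c (f x)) \<and>
      (\<forall>x y. f (zmul x y) = zmul (f x) (f y))}"

definition G2 :: "('a::field zorn \<Rightarrow> 'a zorn) monoid" where
  "G2 = \<lparr>carrier = octonion_auts, monoid.mult = (\<circ>), one = id\<rparr>"

end

theory Submission
  imports Defs "HOL-Library.Product_Plus" "HOL-Algebra.Algebraic_Closure_Type"
begin

text \<open>Let \<open>r\<close> be a nontrivial automorphism of the split octonions. Suppose \<open>r\<close> and a conjugate \<open>s\<close> of \<open>r\<close>
  lie in a subgroup \<open>M\<close> in which they are not conjugate, e.g. because they act differently on a section
  on which \<open>M\<close> acts through an abelian group. With \<open>H = \<langle>r, s\<rangle>\<close>, the class of \<open>r\<close> is of type C if
  \<open>r\<^sup>2\<close> does not commute with \<open>s\<close> nor \<open>s\<^sup>2\<close> with \<open>r\<close>, and of type D if \<open>(r s)\<^sup>2 \<noteq> (s r)\<^sup>2\<close>.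
  Replacing \<open>s\<close> by its conjugates under a one-parameter subgroup of \<open>M\<close>, each of the two conditions
  for type C fails for at most one parameter, so that \<open>q > 2\<close> leaves a good one.

  An eigenvector argument over the algebraic closure shows that \<open>r\<close> fixes a noncentral element \<open>c\<close>.
  Either \<open>r\<close> fixes a nonzero null vector, or it fixes an idempotent, or \<open>F[c]\<close> is a field. In the last
  two cases consider the action of \<open>r\<close> on the orthogonal complement of \<open>F[c]\<close>, which carries an
  \<open>r\<close>-equivariant cross product. An \<open>r\<close>-invariant line over \<open>F[c]\<close> yields an invariant null line, an
  invariant special null line or an invariant quaternion subalgebra, and these are dealt with
  separately. If there is none, \<open>s\<close> is the conjugate of \<open>r\<close> by an automorphism that induces the
  conjugation of \<open>F[c]\<close>; an automorphism of that kind commuting with \<open>r\<close> would force a fixed vector.\<close>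

section \<open>Split octonions\<close>

text \<open>The criterion through squares says nothing when r^2 is trivial, and this shapes the
  treatment of unipotent elements. In characteristic 2 long root elements are involutions; for them
  triples of conjugates are written down, inside a group H that is larger than \<langle>r,
  s\<rangle> and must be shown to be generated by the two classes. In most cases without
  eigenvectors s acts as the adjugate of r on some plane. The adjugate commutes with r there and
  corresponds to the conjugate in a quadratic field, so that it can differ from r only through that
  conjugation. Over a split F[c] the group fixing c is SL3. If an automorphism inducing the
  conjugation of F[c] commuted with r, the 3 by 3 matrix of r would be conjugate to its inverse
  transpose; having determinant 1 it would have the eigenvalue 1. Over a field the same computation
  is made after extending scalars, and vectors return to F through a linear functional applied to
  coordinates, which works because automorphisms are given by matrices over F.\<close>

declare split_paired_All [simp del] split_paired_Ex [simp del]

notation zmul (infixl "\<star>" 70)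
notation zsmul (infixr "\<bullet>" 75)

lemma pair_eq_0 [simp]: "(a, b) = 0 \<longleftrightarrow> a = 0 \<and> b = 0"
  by (simp add: zero_prod_def)

lemma zorn_cases:
  obtains a u1 u2 u3 v1 v2 v3 b where "x = (a, (u1, u2, u3), (v1, v2, v3), b)"
  by (rule that[of "fst x" "fst (fst (snd x))" "fst (snd (fst (snd x)))" "snd (snd (fst (snd x)))"
        "fst (fst (snd (snd x)))" "fst (snd (fst (snd (snd x))))" "snd (snd (fst (snd (snd x))))"
        "snd (snd (snd x))"]) simp

lemma vec3_cases:
  obtains w1 w2 w3 where "w = (w1, w2, w3)"
  by (rule that[of "fst w" "fst (snd w)" "snd (snd w)"]) simp

lemma zadd_eq [simp]: "zadd x y = x + y"
proof (cases x rule: zorn_cases)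
  case 1: (1 a u1 u2 u3 v1 v2 v3 b)
  show ?thesis by (cases y rule: zorn_cases) (simp add: 1)
qed

abbreviation E1 :: "'a::field zorn" where "E1 \<equiv> (1, (0, 0, 0), (0, 0, 0), 0)"
abbreviation U1 :: "'a::field zorn" where "U1 \<equiv> (0, (1, 0, 0), (0, 0, 0), 0)"
abbreviation U2 :: "'a::field zorn" where "U2 \<equiv> (0, (0, 1, 0), (0, 0, 0), 0)"
abbreviation U3 :: "'a::field zorn" where "U3 \<equiv> (0, (0, 0, 1), (0, 0, 0), 0)"
abbreviation V1 :: "'a::field zorn" where "V1 \<equiv> (0, (0, 0, 0), (1, 0, 0), 0)"
abbreviation V2 :: "'a::field zorn" where "V2 \<equiv> (0, (0, 0, 0), (0, 1, 0), 0)"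
abbreviation V3 :: "'a::field zorn" where "V3 \<equiv> (0, (0, 0, 0), (0, 0, 1), 0)"
abbreviation E2 :: "'a::field zorn" where "E2 \<equiv> (0, (0, 0, 0), (0, 0, 0), 1)"
abbreviation Zid :: "'a::field zorn" where "Zid \<equiv> (1, (0, 0, 0), (0, 0, 0), 1)"

fun ztr :: "'a::field zorn \<Rightarrow> 'a" where "ztr (a, u, v, b) = a + b"
fun znorm :: "'a::field zorn \<Rightarrow> 'a" where "znorm (a, u, v, b) = a * b - dot3 u v"
fun zbil :: "'a::field zorn \<Rightarrow> 'a zorn \<Rightarrow> 'a" where
  "zbil (a, u, v, b) (a', u', v', b') = a * b' + a' * b - dot3 u v' - dot3 u' v"

lemma zsmul_0 [simp]: "0 \<bullet> x = 0" by (cases x rule: zorn_cases) simp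
lemma zsmul_zero [simp]: "c \<bullet> 0 = 0" by (simp add: zero_prod_def)
lemma zsmul_1 [simp]: "1 \<bullet> x = x" by (cases x rule: zorn_cases) simp
lemma zsmul_zsmul [simp]: "c \<bullet> d \<bullet> x = (c * d) \<bullet> x" by (cases x rule: zorn_cases) simp
lemma zsmul_add: "c \<bullet> (x + y) = c \<bullet> x + c \<bullet> y"
  by (cases x rule: zorn_cases; cases y rule: zorn_cases) (simp add: algebra_simps)
lemma zsmul_diff: "c \<bullet> (x - y) = c \<bullet> x - c \<bullet> y"
  by (cases x rule: zorn_cases; cases y rule: zorn_cases) (simp add: algebra_simps)
lemma zsmul_add_left: "(c + d) \<bullet> x = c \<bullet> x + d \<bullet> x"
  by (cases x rule: zorn_cases) (simp add: algebra_simps)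
lemma zsmul_diff_left: "(c - d) \<bullet> x = c \<bullet> x - d \<bullet> x"
  by (cases x rule: zorn_cases) (simp add: algebra_simps)
lemma zsmul_minus: "(- c) \<bullet> x = - (c \<bullet> x)"
  by (cases x rule: zorn_cases) simp
lemma zsmul_uminus: "c \<bullet> (- x) = - (c \<bullet> x)"
  by (cases x rule: zorn_cases) simp
lemma zsmul_eq_0 [simp]: "c \<bullet> x = 0 \<longleftrightarrow> c = 0 \<or> x = 0"
  by (cases x rule: zorn_cases) auto
lemma zsmul_cancel: "c \<noteq> 0 \<Longrightarrow> c \<bullet> x = c \<bullet> y \<longleftrightarrow> x = y"
  using zsmul_eq_0[of c "x - y"] by (simp only: zsmul_diff right_minus_eq) simp

lemma zmul_add_left: "(x + y) \<star> z = x \<star> z + y \<star> z"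
  by (cases x rule: zorn_cases; cases y rule: zorn_cases; cases z rule: zorn_cases)
     (simp add: algebra_simps)
lemma zmul_add_right: "z \<star> (x + y) = z \<star> x + z \<star> y"
  by (cases x rule: zorn_cases; cases y rule: zorn_cases; cases z rule: zorn_cases)
     (simp add: algebra_simps)
lemma zmul_smul_left: "(c \<bullet> x) \<star> z = c \<bullet> (x \<star> z)"
  by (cases x rule: zorn_cases; cases z rule: zorn_cases) (simp add: algebra_simps)
lemma zmul_smul_right: "z \<star> (c \<bullet> x) = c \<bullet> (z \<star> x)"
  by (cases x rule: zorn_cases; cases z rule: zorn_cases) (simp add: algebra_simps)
lemma zmul_Id [simp]: "x \<star> Zid = x" "Zid \<star> x = x"
  by (cases x rule: zorn_cases, simp)+

lemma znorm_0 [simp]: "znorm 0 = 0" by (simp add: zero_prod_def)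
lemma ztr_0 [simp]: "ztr 0 = 0" by (simp add: zero_prod_def)
lemma ztr_add [simp]: "ztr (x + y) = ztr x + ztr y"
  by (cases x rule: zorn_cases; cases y rule: zorn_cases) simp
lemma ztr_smul [simp]: "ztr (c \<bullet> x) = c * ztr x"
  by (cases x rule: zorn_cases) (simp add: algebra_simps)
lemma znorm_smul [simp]: "znorm (c \<bullet> x) = c * c * znorm x"
  by (cases x rule: zorn_cases) (simp add: algebra_simps)
lemma znorm_add: "znorm (x + y) = znorm x + znorm y + zbil x y"
  by (cases x rule: zorn_cases; cases y rule: zorn_cases) (simp add: algebra_simps)
lemma zbil_sym: "zbil x y = zbil y x"
  by (cases x rule: zorn_cases; cases y rule: zorn_cases) (simp add: algebra_simps)
lemma zbil_add: "zbil (x + y) z = zbil x z + zbil y z" "zbil z (x + y) = zbil z x + zbil z y"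
  by (cases x rule: zorn_cases; cases y rule: zorn_cases; cases z rule: zorn_cases;
      simp add: algebra_simps)+
lemma zbil_smul: "zbil (c \<bullet> x) y = c * zbil x y" "zbil y (c \<bullet> x) = c * zbil y x"
  by (cases x rule: zorn_cases; cases y rule: zorn_cases; simp add: algebra_simps)+
lemma zbil_0 [simp]: "zbil 0 x = 0" "zbil x 0 = 0"
  by (metis zbil_smul(1) zsmul_0 mult_zero_left, metis zbil_smul(2) zsmul_0 mult_zero_left)
lemma zbil_uminus: "zbil (- x) y = - zbil x y"
  by (cases x rule: zorn_cases; cases y rule: zorn_cases) (simp add: algebra_simps)
lemma zbil_diff: "zbil (x - y) z = zbil x z - zbil y z"
  by (cases x rule: zorn_cases; cases y rule: zorn_cases; cases z rule: zorn_cases)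
     (simp add: algebra_simps)
lemma znorm_mul: "znorm (x \<star> y) = znorm x * znorm y"
  by (cases x rule: zorn_cases; cases y rule: zorn_cases) (simp add: algebra_simps)
lemma zbil_Id: "zbil x Zid = ztr x" "zbil Zid x = ztr x"
  by (cases x rule: zorn_cases, simp)+
lemma quadratic: "x \<star> x = ztr x \<bullet> x - znorm x \<bullet> Zid"
  by (cases x rule: zorn_cases) (simp add: algebra_simps)
lemma zbil_nondeg: "x \<noteq> 0 \<Longrightarrow> \<exists>y. zbil x y \<noteq> 0"
proof (rule ccontr)
  assume x: "x \<noteq> 0" and "\<nexists>y. zbil x y \<noteq> 0"
  then have *: "zbil x y = 0" for y by blast
  obtain a u1 u2 u3 v1 v2 v3 b where e: "x = (a, (u1, u2, u3), (v1, v2, v3), b)"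
    by (rule zorn_cases)
  show False using x e *[of E1] *[of E2] *[of U1] *[of U2] *[of U3] *[of V1] *[of V2] *[of V3]
    by simp
qed
lemma zorn_expand: "(a, (u1, u2, u3), (v1, v2, v3), b) =
   a \<bullet> E1 + u1 \<bullet> U1 + u2 \<bullet> U2 + u3 \<bullet> U3 + v1 \<bullet> V1 + v2 \<bullet> V2 + v3 \<bullet> V3 + b \<bullet> E2"
  by simp

section \<open>Automorphisms\<close>

lemma autI:
  assumes "\<And>x y. f (x + y) = f x + f y" "\<And>c x. f (c \<bullet> x) = c \<bullet> f x"
    "\<And>x y. f (x \<star> y) = f x \<star> f y" "\<And>x. h (f x) = x" "\<And>x. f (h x) = x"
  shows "f \<in> octonion_auts"
proof -
  have "bij f"
    by (rule o_bij[where g = h]) (rule ext, simp only: o_def id_def assms)+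
  then show ?thesis by (simp only: octonion_auts_def mem_Collect_eq zadd_eq assms simp_thms)
qed

lemma aut_add: "f \<in> octonion_auts \<Longrightarrow> f (x + y) = f x + f y"
  by (auto simp: octonion_auts_def)
lemma aut_smul: "f \<in> octonion_auts \<Longrightarrow> f (c \<bullet> x) = c \<bullet> f x"
  by (auto simp: octonion_auts_def)
lemma aut_mul: "f \<in> octonion_auts \<Longrightarrow> f (x \<star> y) = f x \<star> f y"
  by (auto simp: octonion_auts_def)
lemma aut_bij: "f \<in> octonion_auts \<Longrightarrow> bij f"
  by (auto simp: octonion_auts_def)
lemma aut_inj: "f \<in> octonion_auts \<Longrightarrow> f x = f y \<longleftrightarrow> x = y"
  using aut_bij[of f] by (auto simp: bij_def inj_def)
lemma aut_0: "f \<in> octonion_auts \<Longrightarrow> f 0 = 0"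
  using aut_smul[of f 0 0] by simp
lemma aut_eq_0: "f \<in> octonion_auts \<Longrightarrow> f x = 0 \<longleftrightarrow> x = 0"
  using aut_0 aut_inj by metis
lemma aut_uminus: "f \<in> octonion_auts \<Longrightarrow> f (- x) = - f x"
  using aut_smul[of f "- 1" x] by (simp add: zsmul_minus)
lemma aut_diff: "f \<in> octonion_auts \<Longrightarrow> f (x - y) = f x - f y"
  using aut_add[of f x "- y"] by (simp add: aut_uminus)
lemmas aut_simps = aut_add aut_smul aut_mul aut_0 aut_uminus aut_diff

lemma aut_surj: assumes "f \<in> octonion_auts" obtains x where "f x = y"
  using aut_bij[OF assms] by (metis bij_pointE)

lemma aut_Id: assumes f: "f \<in> octonion_auts" shows "f Zid = Zid"
proof -
  obtain x where x: "f x = Zid" by (rule aut_surj[OF f])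
  have "f (Zid \<star> x) = f Zid \<star> f x" using f by (rule aut_mul)
  then show ?thesis by (simp add: x del: zmul.simps)
qed

text \<open>Comparing the image of the quadratic equation of \<open>x\<close> with the equation of
  \<open>f x\<close> leaves a linear relation between \<open>f x\<close> and \<open>Zid\<close>. If
  the traces differed, \<open>f x\<close> would be a scalar, hence equal to
  \<open>x\<close>.\<close>

lemma aut_tr_norm:
  assumes f: "f \<in> octonion_auts"
  shows aut_tr: "ztr (f x) = ztr x" and aut_norm: "znorm (f x) = znorm x"
proof -
  have "f (x \<star> x) = ztr x \<bullet> f x - znorm x \<bullet> Zid"
    by (subst quadratic) (simp only: aut_simps[OF f] aut_Id[OF f])
  moreover have "f (x \<star> x) = ztr (f x) \<bullet> f x - znorm (f x) \<bullet> Zid"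
    using aut_mul[OF f, of x x] quadratic[of "f x"] by simp
  ultimately have eq: "(ztr x - ztr (f x)) \<bullet> f x = (znorm x - znorm (f x)) \<bullet> Zid"
    by (simp add: zsmul_diff_left algebra_simps del: zsmul.simps)
  show t: "ztr (f x) = ztr x"
  proof (rule ccontr)
    assume n: "ztr (f x) \<noteq> ztr x"
    define k where "k = (znorm x - znorm (f x)) / (ztr x - ztr (f x))"
    have "f x = (1 / (ztr x - ztr (f x))) \<bullet> ((ztr x - ztr (f x)) \<bullet> f x)"
      using n by (simp del: zsmul.simps)
    also have "\<dots> = k \<bullet> Zid" by (simp only: eq) (simp add: k_def)
    finally have fx: "f x = k \<bullet> Zid" .
    then have "f x = f (k \<bullet> Zid)" by (simp only: aut_smul[OF f] aut_Id[OF f])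
    then have "x = k \<bullet> Zid" by (simp only: aut_inj[OF f])
    then show False using n fx by simp
  qed
  show "znorm (f x) = znorm x" using eq t by simp
qed

lemma aut_bil: "f \<in> octonion_auts \<Longrightarrow> zbil (f x) (f y) = zbil x y"
  using znorm_add[of "f x" "f y"] znorm_add[of x y] by (simp add: aut_norm aut_add[symmetric])

lemma aut_id [simp]: "id \<in> octonion_auts"
  by (simp add: octonion_auts_def)
lemma aut_comp [intro]: "f \<in> octonion_auts \<Longrightarrow> g \<in> octonion_auts \<Longrightarrow> f \<circ> g \<in> octonion_auts"
  by (auto simp: octonion_auts_def intro: bij_comp)
abbreviation finv :: "('a \<Rightarrow> 'b) \<Rightarrow> 'b \<Rightarrow> 'a" where "finv \<equiv> inv_into UNIV"

lemma aut_inv_f: "f \<in> octonion_auts \<Longrightarrow> finv f (f x) = x" "f \<in> octonion_auts \<Longrightarrow> f (finv f x) = x"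
  by (simp_all add: inv_f_f[OF bij_is_inj[OF aut_bij]] surj_f_inv_f[OF bij_is_surj[OF aut_bij]])
lemma aut_inv [intro]: assumes f: "f \<in> octonion_auts" shows "finv f \<in> octonion_auts"
proof (rule autI[where h = f])
  show "finv f (x + y) = finv f x + finv f y" for x y
    by (rule inv_f_eq[OF bij_is_inj[OF aut_bij[OF f]]]) (simp add: aut_add[OF f] aut_inv_f[OF f])
  show "finv f (c \<bullet> x) = c \<bullet> finv f x" for c x
    by (rule inv_f_eq[OF bij_is_inj[OF aut_bij[OF f]]]) (simp add: aut_smul[OF f] aut_inv_f[OF f])
  show "finv f (x \<star> y) = finv f x \<star> finv f y" for x y
    by (rule inv_f_eq[OF bij_is_inj[OF aut_bij[OF f]]]) (simp add: aut_mul[OF f] aut_inv_f[OF f])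
qed (simp_all add: aut_inv_f[OF f])

lemma aut_expand: "f \<in> octonion_auts \<Longrightarrow> f (a, (u1, u2, u3), (v1, v2, v3), b) =
   a \<bullet> f E1 + u1 \<bullet> f U1 + u2 \<bullet> f U2 + u3 \<bullet> f U3 + v1 \<bullet> f V1 + v2 \<bullet> f V2 + v3 \<bullet> f V3 + b \<bullet> f E2"
  by (subst zorn_expand) (simp only: aut_add aut_smul)

text \<open>With D the nilpotent derivation (a, u, v, b) \<mapsto> (- w.v, (a - b) w, w \<times> u,
  w.v) this is 1 + D + D^2 / 2; the division by 2 is carried out in the formula, which therefore
  makes sense in characteristic 2. These are short root elements, and \<open>theta'\<close> is the
  same with u and v exchanged.\<close>

fun theta :: "'a::field vec3 \<Rightarrow> 'a zorn \<Rightarrow> 'a zorn" where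
  "theta w (a, u, v, b) = (a - dot3 w v, u + smul3 (a - b - dot3 w v) w, v + cross3 w u, b + dot3 w v)"

fun theta' :: "'a::field vec3 \<Rightarrow> 'a zorn \<Rightarrow> 'a zorn" where
  "theta' w (a, u, v, b) = (a - dot3 w u, u + cross3 w v, v + smul3 (a - b - dot3 w u) w, b + dot3 w u)"

fun swp :: "'a::field zorn \<Rightarrow> 'a zorn" where "swp (a, u, v, b) = (b, - v, - u, a)"

text \<open>The matrix with columns p, q, r acts on u and its cofactor matrix on v. Determinant 1
  gives the subgroup SL3 fixing the idempotents \<open>E1\<close> and \<open>E2\<close>.\<close>

fun sl3 :: "'a::field vec3 \<Rightarrow> 'a vec3 \<Rightarrow> 'a vec3 \<Rightarrow> 'a zorn \<Rightarrow> 'a zorn" where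
  "sl3 p q r (a, (u1, u2, u3), (v1, v2, v3), b) =
     (a, smul3 u1 p + smul3 u2 q + smul3 u3 r,
      smul3 v1 (cross3 q r) + smul3 v2 (cross3 r p) + smul3 v3 (cross3 p q), b)"

lemma theta_aut [simp]: "theta w \<in> octonion_auts"
proof (rule autI[where h = "theta (- w)"])
  obtain w1 w2 w3 where w: "w = (w1, w2, w3)" by (rule vec3_cases)
  show "theta w (x + y) = theta w x + theta w y" for x y
    by (cases x rule: zorn_cases; cases y rule: zorn_cases) (simp add: w algebra_simps)
  show "theta w (c \<bullet> x) = c \<bullet> theta w x" for c x
    by (cases x rule: zorn_cases) (simp add: w algebra_simps)
  show "theta w (x \<star> y) = theta w x \<star> theta w y" for x y
    by (cases x rule: zorn_cases; cases y rule: zorn_cases) (simp add: w algebra_simps)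
  show "theta (- w) (theta w x) = x" "theta w (theta (- w) x) = x" for x
    by (cases x rule: zorn_cases, simp add: w algebra_simps)+
qed

lemma theta'_aut [simp]: "theta' w \<in> octonion_auts"
proof (rule autI[where h = "theta' (- w)"])
  obtain w1 w2 w3 where w: "w = (w1, w2, w3)" by (rule vec3_cases)
  show "theta' w (x + y) = theta' w x + theta' w y" for x y
    by (cases x rule: zorn_cases; cases y rule: zorn_cases) (simp add: w algebra_simps)
  show "theta' w (c \<bullet> x) = c \<bullet> theta' w x" for c x
    by (cases x rule: zorn_cases) (simp add: w algebra_simps)
  show "theta' w (x \<star> y) = theta' w x \<star> theta' w y" for x y
    by (cases x rule: zorn_cases; cases y rule: zorn_cases) (simp add: w algebra_simps)
  show "theta' (- w) (theta' w x) = x" "theta' w (theta' (- w) x) = x" for x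
    by (cases x rule: zorn_cases, simp add: w algebra_simps)+
qed

lemma swp_aut [simp]: "swp \<in> octonion_auts"
proof (rule autI[where h = swp])
  show "swp (x + y) = swp x + swp y" for x y :: "'a zorn"
    by (cases x rule: zorn_cases; cases y rule: zorn_cases) simp
  show "swp (c \<bullet> x) = c \<bullet> swp x" for c and x :: "'a zorn"
    by (cases x rule: zorn_cases) simp
  show "swp (x \<star> y) = swp x \<star> swp y" for x y :: "'a zorn"
    by (cases x rule: zorn_cases; cases y rule: zorn_cases) (simp add: algebra_simps)
  show "swp (swp x) = x" "swp (swp x) = x" for x :: "'a zorn"
    by (cases x rule: zorn_cases, simp)+
qed

lemma add3_eq [simp]: "add3 x y = x + y" and sub3_eq [simp]: "sub3 x y = x - y"
  by (cases x rule: vec3_cases; cases y rule: vec3_cases; simp)+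

fun colmul :: "'a::field vec3 \<Rightarrow> 'a vec3 \<Rightarrow> 'a vec3 \<Rightarrow> 'a vec3 \<Rightarrow> 'a vec3" where
  "colmul p q r (x1, x2, x3) = smul3 x1 p + smul3 x2 q + smul3 x3 r"

lemma sl3_colmul: "sl3 p q r (a, u, v, b) =
    (a, colmul p q r u, colmul (cross3 q r) (cross3 r p) (cross3 p q) v, b)"
  by (cases u rule: vec3_cases; cases v rule: vec3_cases) simp

lemma colmul_add: "colmul p q r (x + y) = colmul p q r x + colmul p q r y"
  by (cases x rule: vec3_cases; cases y rule: vec3_cases; cases p rule: vec3_cases;
      cases q rule: vec3_cases; cases r rule: vec3_cases) (simp add: algebra_simps)
lemma colmul_diff: "colmul p q r (x - y) = colmul p q r x - colmul p q r y"
  by (cases x rule: vec3_cases; cases y rule: vec3_cases; cases p rule: vec3_cases;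
      cases q rule: vec3_cases; cases r rule: vec3_cases) (simp add: algebra_simps)
lemma colmul_smul: "colmul p q r (smul3 c x) = smul3 c (colmul p q r x)"
  by (cases x rule: vec3_cases; cases p rule: vec3_cases;
      cases q rule: vec3_cases; cases r rule: vec3_cases) (simp add: algebra_simps)
text \<open>The cofactor identity A x \<times> A y = cof(A) (x \<times> y); it is the reason why the
  v-part has to transform by cofactors.\<close>

lemma cross_colmul: "cross3 (colmul p q r x) (colmul p q r y) =
    colmul (cross3 q r) (cross3 r p) (cross3 p q) (cross3 x y)"
  by (cases x rule: vec3_cases; cases y rule: vec3_cases; cases p rule: vec3_cases;
      cases q rule: vec3_cases; cases r rule: vec3_cases) (simp add: algebra_simps)
lemma dot_colmul: "dot3 (colmul p q r x) y = dot3 x (dot3 p y, dot3 q y, dot3 r y)"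
  by (cases x rule: vec3_cases; cases y rule: vec3_cases; cases p rule: vec3_cases;
      cases q rule: vec3_cases; cases r rule: vec3_cases) (simp add: algebra_simps)
lemma dot3_sym: "dot3 x y = dot3 y (x :: 'a::field vec3)"
  by (cases x rule: vec3_cases; cases y rule: vec3_cases) (simp add: algebra_simps)
lemma dot_colmul': "dot3 y (colmul p q r x) = dot3 x (dot3 p y, dot3 q y, dot3 r y)"
  by (subst dot3_sym) (rule dot_colmul)
lemma dot_cross_cyclic: "dot3 q (cross3 r p) = dot3 p (cross3 q r)" "dot3 r (cross3 p q) = dot3 p (cross3 q r)"
  "dot3 p (cross3 p q) = 0" "dot3 q (cross3 p q) = 0"
  by (cases p rule: vec3_cases; cases q rule: vec3_cases; cases r rule: vec3_cases;
      simp add: algebra_simps)+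
lemma cross_cross: "cross3 (cross3 r p) (cross3 p q) = smul3 (dot3 p (cross3 q r)) p"
  by (cases p rule: vec3_cases; cases q rule: vec3_cases; cases r rule: vec3_cases)
     (simp add: algebra_simps)
lemma cramer3: "colmul p q r (dot3 (cross3 q r) x, dot3 (cross3 r p) x, dot3 (cross3 p q) x)
     = smul3 (dot3 p (cross3 q r)) x"
  by (cases p rule: vec3_cases; cases q rule: vec3_cases; cases r rule: vec3_cases;
      cases x rule: vec3_cases) (simp add: algebra_simps)
lemma cramer3': "colmul (cross3 q r) (cross3 r p) (cross3 p q) (dot3 p x, dot3 q x, dot3 r x)
     = smul3 (dot3 p (cross3 q r)) x"
  by (cases p rule: vec3_cases; cases q rule: vec3_cases; cases r rule: vec3_cases;
      cases x rule: vec3_cases) (simp add: algebra_simps)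
lemma smul3_1 [simp]: "smul3 1 x = x"
  by (cases x rule: vec3_cases) simp

lemma smul3_0 [simp]: "smul3 0 x = 0"
  by (cases x rule: vec3_cases) simp

lemma sl3_aut:
  assumes d: "dot3 p (cross3 q r) = (1::'a::field)"
  shows "sl3 p q r \<in> octonion_auts"
proof -
  let ?P = "cross3 q r" and ?Q = "cross3 r p" and ?R = "cross3 p q"
  have d': "dot3 q ?Q = 1" "dot3 r ?R = 1" 
    using d dot_cross_cyclic(1)[of q r p] dot_cross_cyclic(2)[of r p q] by simp_all
  have z: "dot3 p ?Q = 0" "dot3 p ?R = 0" "dot3 q ?P = 0" "dot3 q ?R = 0" "dot3 r ?P = 0" "dot3 r ?Q = 0"
    by (rule dot_cross_cyclic(3,4))+
  have cc: "cross3 ?Q ?R = p" "cross3 ?R ?P = q" "cross3 ?P ?Q = r"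
    
    using cross_cross[where r = r and p = p and q = q] cross_cross[where r = p and p = q and q = r]
      cross_cross[where r = q and p = r and q = p] d d' by simp_all
  have ds: "dot3 ?P p = 1" "dot3 ?Q q = 1" "dot3 ?R r = 1" "dot3 ?Q p = 0" "dot3 ?R p = 0"
    "dot3 ?P q = 0" "dot3 ?R q = 0" "dot3 ?P r = 0" "dot3 ?Q r = 0"
    by (subst dot3_sym, simp only: d d' z)+
  have dc: "dot3 (x1, x2, x3) (1, 0, 0) = x1" "dot3 (x1, x2, x3) (0, 1, 0) = x2" "dot3 (x1, x2, x3) (0, 0, 1) = x3"
    for x1 x2 x3 :: 'a by simp_all
  have dd: "dot3 (colmul p q r x) (colmul ?P ?Q ?R y) = dot3 x y" for x y
  proof (cases y rule: vec3_cases)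
    case y: (1 y1 y2 y3)
    have "dot3 (colmul p q r x) (colmul ?P ?Q ?R y) =
       dot3 y (dot3 x (1, 0, 0), dot3 x (0, 1, 0), dot3 x (0, 0, 1))"
      by (simp only: dot_colmul dot_colmul' ds d d' z)
    also have "\<dots> = dot3 x y"
      by (cases x rule: vec3_cases) (simp only: y dc, simp)
    finally show ?thesis .
  qed
  define h :: "'a zorn \<Rightarrow> 'a zorn" where "h = (\<lambda>(a, u, v, b). (a, (dot3 ?P u, dot3 ?Q u, dot3 ?R u), (dot3 p v, dot3 q v, dot3 r v), b))"
  have h1: "dot3 ?P (colmul p q r u) = fst u" "dot3 ?Q (colmul p q r u) = fst (snd u)"
       "dot3 ?R (colmul p q r u) = snd (snd u)" for u
    by (simp_all only: dot_colmul' d d' z) (cases u rule: vec3_cases; simp)+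
  have h2: "dot3 p (colmul ?P ?Q ?R u) = fst u" "dot3 q (colmul ?P ?Q ?R u) = fst (snd u)"
       "dot3 r (colmul ?P ?Q ?R u) = snd (snd u)" for u
    by (simp_all only: dot_colmul' ds) (cases u rule: vec3_cases; simp)+
  show ?thesis
  proof (rule autI[where h = h])
    fix x y :: "'a zorn" and c :: 'a
    obtain a u v b where x: "x = (a, u, v, b)" by (cases x) auto
    obtain a' u' v' b' where y: "y = (a', u', v', b')" by (cases y) auto
    show "sl3 p q r (x + y) = sl3 p q r x + sl3 p q r y"
      by (simp add: x y sl3_colmul colmul_add)
    show "sl3 p q r (c \<bullet> x) = c \<bullet> sl3 p q r x"
      by (simp add: x y sl3_colmul colmul_smul)
    show "sl3 p q r (x \<star> y) = sl3 p q r x \<star> sl3 p q r y"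
      by (simp only: x y sl3_colmul zmul.simps add3_eq sub3_eq colmul_add colmul_diff colmul_smul cross_colmul cc dd)
         (simp add: dd dot3_sym[of "colmul ?P ?Q ?R v" "colmul p q r u'"] dot3_sym[of v u'])
    show "h (sl3 p q r x) = x"
      by (simp add: x h_def sl3_colmul h1 h2)
    show "sl3 p q r (h x) = x"
      by (simp add: x h_def sl3_colmul cramer3 cramer3' d del: colmul.simps)
  qed
qed

section \<open>Transitivity\<close>

definition noncen :: "'a::field zorn \<Rightarrow> bool" where "noncen c \<longleftrightarrow> (\<forall>k. c \<noteq> k \<bullet> Zid)"

lemma noncen_iff: "noncen (a, (u1, u2, u3), (v1, v2, v3), b) \<longleftrightarrow>
    \<not> (u1 = 0 \<and> u2 = 0 \<and> u3 = 0 \<and> v1 = 0 \<and> v2 = 0 \<and> v3 = 0 \<and> a = b)"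
  by (auto simp: noncen_def)

lemma aut_noncen: assumes "f \<in> octonion_auts" shows "noncen (f x) \<longleftrightarrow> noncen x"
proof -
  have "f x = k \<bullet> Zid \<longleftrightarrow> x = k \<bullet> Zid" for k
    using aut_inj[OF assms, of x "k \<bullet> Zid"] by (simp only: aut_smul[OF assms] aut_Id[OF assms])
  then show ?thesis by (simp add: noncen_def del: zsmul.simps)
qed

lemma sl3_first_column:
  assumes "u \<noteq> (0 :: 'a::field vec3)"
  obtains q r where "dot3 u (cross3 q r) = 1"
proof -
  obtain u1 u2 u3 where u: "u = (u1, u2, u3)" by (rule vec3_cases)
  consider "u1 \<noteq> 0" | "u2 \<noteq> 0" | "u3 \<noteq> 0" using assms by (auto simp: u)
  then show thesis
  proof cases
    case 1 then show ?thesis using that[of "(0, 1 / u1, 0)" "(0, 0, 1)"] by (simp add: u)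
  next
    case 2 then show ?thesis using that[of "(0, 0, 1 / u2)" "(1, 0, 0)"] by (simp add: u)
  next
    case 3 then show ?thesis using that[of "(1 / u3, 0, 0)" "(0, 1, 0)"] by (simp add: u)
  qed
qed

lemma move_u:
  assumes "u \<noteq> (0 :: 'a::field vec3)"
  obtains h where "h \<in> octonion_auts" "\<And>a v b. \<exists>v'. h (a, u, v, b) = (a, (1, 0, 0), v', b)"
proof -
  obtain q r where "dot3 u (cross3 q r) = 1" using sl3_first_column[OF assms] .
  then have f: "sl3 u q r \<in> octonion_auts" (is "?f \<in> _") by (rule sl3_aut)
  have "\<exists>v'. finv ?f (a, u, v, b) = (a, (1, 0, 0), v', b)" for a v b
  proof -
    obtain a' u1 u2 u3 v1 v2 v3 b' where e: "finv ?f (a, u, v, b) = (a', (u1, u2, u3), (v1, v2, v3), b')"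
      by (rule zorn_cases)
    have *: "?f (a', (u1, u2, u3), (v1, v2, v3), b') = (a, u, v, b)"
      using aut_inv_f(2)[OF f, of "(a, u, v, b)"] by (simp only: e)
    have "?f (0, (u1, u2, u3), (0, 0, 0), 0) = ?f U1"
    proof -
      have "smul3 u1 u + smul3 u2 q + smul3 u3 r = u" using * by simp
      then show ?thesis by (simp only: sl3.simps add3_eq) simp
    qed
    then have "(0, (u1, u2, u3), (0, 0, 0), 0) = U1" by (simp only: aut_inj[OF f])
    moreover have "a' = a" "b' = b" using * by simp_all
    ultimately show ?thesis unfolding e by simp
  qed
  then show thesis using that[of "finv ?f"] f by blast
qed

text \<open>Noncentral elements have no invariants besides trace and norm. \<open>swp\<close> or
  \<open>theta\<close> makes the u-part nonzero, SL3 turns it into the first basis vector, and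
  \<open>theta'\<close> clears the first diagonal entry.\<close>

lemma transitive_normal_form:
  assumes "noncen (c :: 'a::field zorn)"
  shows "\<exists>h \<in> octonion_auts. h c = (0, (1, 0, 0), (- znorm c, 0, 0), ztr c)"
proof -
  have 1: "\<exists>h \<in> octonion_auts. fst (snd (h c)) \<noteq> 0" if nc: "noncen c" for c :: "'a zorn"
  proof (cases c rule: zorn_cases)
    case c: (1 a u1 u2 u3 v1 v2 v3 b)
    consider "(u1, u2, u3) \<noteq> 0" | "(u1, u2, u3) = 0" "(v1, v2, v3) \<noteq> 0" | "(u1, u2, u3) = 0" "(v1, v2, v3) = 0" "a \<noteq> b"
      using nc unfolding c noncen_iff pair_eq_0 by blast
    then show ?thesis
    proof cases
      case 1 then show ?thesis by (intro bexI[of _ id]) (simp_all add: c)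
    next
      case 2 then show ?thesis by (intro bexI[of _ swp]) (auto simp: c)
    next
      case 3 then show ?thesis by (intro bexI[of _ "theta (1, 0, 0)"]) (auto simp: c)
    qed
  qed
  have 2: "\<exists>h \<in> octonion_auts. \<exists>a v b. h c = (a, (1, 0, 0), v, b)" if "noncen c" for c :: "'a zorn"
  proof -
    obtain h where h: "h \<in> octonion_auts" "fst (snd (h c)) \<noteq> 0" using 1[OF \<open>noncen c\<close>] by blast
    obtain a u v b where e: "h c = (a, u, v, b)" by (cases "h c") auto
    have "u \<noteq> 0" using h(2) by (simp add: e)
    then obtain k where k: "k \<in> octonion_auts" "\<And>a v b. \<exists>v'. k (a, u, v, b) = (a, (1, 0, 0), v', b)"
      by (rule move_u) blast
    obtain v' where "k (a, u, v, b) = (a, (1, 0, 0), v', b)" using k(2) by blast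
    then have "(k \<circ> h) c = (a, (1, 0, 0), v', b)" by (simp add: e)
    then show ?thesis using aut_comp[OF k(1) h(1)] by blast
  qed
  have 3: "\<exists>h \<in> octonion_auts. \<exists>v b. h c = (0, (1, 0, 0), v, b)" if "noncen c" for c :: "'a zorn"
  proof -
    obtain h a v b where h: "h \<in> octonion_auts" "h c = (a, (1, 0, 0), v, b)" using 2[OF \<open>noncen c\<close>] by blast
    obtain v1 v2 v3 where v: "v = (v1, v2, v3)" by (rule vec3_cases)
    have e: "theta' (a, 0, 0) (h c) = (0, (1, - a * v3, a * v2), (v1 - b * a, v2, v3), b + a)"
      by (simp add: h v algebra_simps)
    have "(1, - a * v3, a * v2) \<noteq> (0 :: 'a vec3)" by simp
    then obtain k where k: "k \<in> octonion_auts"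
       "\<And>a' v b. \<exists>v'. k (a', (1, - a * v3, a * v2), v, b) = (a', (1, 0, 0), v', b)"
      by (rule move_u) blast
    have "k \<circ> theta' (a, 0, 0) \<circ> h \<in> octonion_auts" using k h by (intro aut_comp) auto
    moreover obtain v' where "k (theta' (a, 0, 0) (h c)) = (0, (1, 0, 0), v', b + a)"
      using k(2)[of 0 "(v1 - b * a, v2, v3)" "b + a"] unfolding e by blast
    then have "(k \<circ> theta' (a, 0, 0) \<circ> h) c = (0, (1, 0, 0), v', b + a)" by simp
    ultimately show ?thesis by blast
  qed
  obtain h v b where h: "h \<in> octonion_auts" "h c = (0, (1, 0, 0), v, b)" using 3[OF assms] by blast
  obtain v1 v2 v3 where v: "v = (v1, v2, v3)" by (rule vec3_cases)
  \<comment> \<open>The vector w = (0, v3, - v2) is orthogonal to v, and w \<times> (1, 0, 0) = (0,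
    - v2, - v3), so \<open>theta\<close> clears the last two entries of v; the shear undoes the
    resulting change - b w of the u-part.\<close>
  let ?k = "sl3 (1, b * v3, - b * v2) (0, 1, 0) (0, 0, 1) \<circ> theta (0, v3, - v2) \<circ> h"
  have k: "?k \<in> octonion_auts" using h by (intro aut_comp sl3_aut) auto
  have "?k c = (0, (1, 0, 0), (v1, 0, 0), b)"
    by (simp add: h v algebra_simps)
  moreover have "ztr (?k c) = ztr c" "znorm (?k c) = znorm c" using aut_tr_norm[OF k] by auto
  ultimately show ?thesis using k
    by (intro bexI[of _ ?k]) (auto simp: minus_equation_iff[of v1])
qed

lemma transitive:
  assumes "noncen c" "noncen c'" "ztr c = ztr c'" "znorm c = znorm c'"
  obtains h where "h \<in> octonion_auts" "h c = c'"
proof -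
  obtain h where h: "h \<in> octonion_auts" "h c = (0, (1, 0, 0), (- znorm c, 0, 0), ztr c)"
    using transitive_normal_form[OF assms(1)] by blast
  obtain k where k: "k \<in> octonion_auts" "k c' = (0, (1, 0, 0), (- znorm c, 0, 0), ztr c)"
    using transitive_normal_form[OF assms(2)] unfolding assms(3,4) by blast
  have "(finv k \<circ> h) c = c'" using h k aut_inv_f(1)[OF k(1), of c'] by simp
  moreover have "finv k \<circ> h \<in> octonion_auts" using h k by blast
  ultimately show thesis using that by blast
qed

lemma null_noncen: "x \<noteq> 0 \<Longrightarrow> ztr x = 0 \<Longrightarrow> znorm x = 0 \<Longrightarrow> noncen x"
proof (rule ccontr)
  assume x: "x \<noteq> 0" "ztr x = 0" "znorm x = 0" and "\<not> noncen x"
  then obtain k where "x = k \<bullet> Zid" by (auto simp: noncen_def)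
  then show False using x by simp
qed

section \<open>The group and the three types\<close>

lemma G2_simps [simp]: "carrier G2 = octonion_auts" "f \<otimes>\<^bsub>G2\<^esub> g = f \<circ> g" "\<one>\<^bsub>G2\<^esub> = id"
  by (simp_all add: G2_def)

lemma finv_comp: assumes "f \<in> octonion_auts" shows "finv f \<circ> f = id" "f \<circ> finv f = id"
  by (simp_all add: fun_eq_iff aut_inv_f[OF assms])

lemma group_G2: "group G2"
proof (rule groupI)
  show "\<exists>y\<in>carrier G2. y \<otimes>\<^bsub>G2\<^esub> x = \<one>\<^bsub>G2\<^esub>" if "x \<in> carrier G2" for x :: "'a zorn \<Rightarrow> 'a zorn"
    using that finv_comp(1)[of x] aut_inv[of x] by auto
qed (auto simp: o_assoc)

lemma inv_G2: assumes "f \<in> octonion_auts" shows "inv\<^bsub>G2\<^esub> f = finv f"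
  using group.inv_equality[OF group_G2, of "finv f" f] assms finv_comp(1)[OF assms] aut_inv[OF assms]
  by simp

lemma conj_orbit_G2:
  assumes "H \<subseteq> octonion_auts"
  shows "conj_orbit G2 H g = {h \<circ> g \<circ> finv h | h. h \<in> H}"
proof -
  have "h \<otimes>\<^bsub>G2\<^esub> g \<otimes>\<^bsub>G2\<^esub> inv\<^bsub>G2\<^esub> h = h \<circ> g \<circ> finv h" if "h \<in> H" for h
    using that assms inv_G2[of h] by auto
  then show ?thesis unfolding conj_orbit_def by (intro Collect_cong iff_exI) auto
qed

lemma conj_eq_iff:
  assumes "h \<in> octonion_auts" shows "h \<circ> r \<circ> finv h = s \<longleftrightarrow> h \<circ> r = s \<circ> h"
proof
  assume "h \<circ> r \<circ> finv h = s"
  then have "s \<circ> h = h \<circ> r \<circ> (finv h \<circ> h)" by (simp only: o_assoc)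
  then show "h \<circ> r = s \<circ> h" by (simp add: finv_comp[OF assms])
next
  assume "h \<circ> r = s \<circ> h"
  then have "h \<circ> r \<circ> finv h = s \<circ> (h \<circ> finv h)" by (simp only: o_assoc)
  then show "h \<circ> r \<circ> finv h = s" by (simp add: finv_comp[OF assms])
qed

lemma subgroup_G2I:
  fixes M :: "('a::{finite,field} zorn \<Rightarrow> 'a zorn) set"
  assumes M: "M \<subseteq> octonion_auts" and 1: "id \<in> M" and c: "\<And>x y. x \<in> M \<Longrightarrow> y \<in> M \<Longrightarrow> x \<circ> y \<in> M"
  shows "subgroup M G2"
proof (rule group.subgroupI[OF group_G2])
  show "inv\<^bsub>G2\<^esub> x \<in> M" if x: "x \<in> M" for x
  proof -
    have xa: "x \<in> octonion_auts" using M x by blast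
    have "inj_on (\<lambda>y. x \<circ> y) M"
    proof (rule inj_onI)
      fix y z assume "x \<circ> y = x \<circ> z"
      then have "(finv x \<circ> x) \<circ> y = (finv x \<circ> x) \<circ> z" by (simp only: o_assoc[symmetric])
      then show "y = z" by (simp add: finv_comp[OF xa])
    qed
    moreover have "(\<lambda>y. x \<circ> y) ` M \<subseteq> M" using c x by auto
    ultimately have "(\<lambda>y. x \<circ> y) ` M = M" by (intro endo_inj_surj) auto
    then obtain y where y: "y \<in> M" "x \<circ> y = id" using 1 by (metis (no_types, lifting) imageE)
    have "finv x = finv x \<circ> (x \<circ> y)" by (simp add: y)
    also have "\<dots> = y" by (simp only: o_assoc finv_comp[OF xa]) simp
    finally show ?thesis using y inv_G2[OF xa] by simp
  qed
qed (use assms in auto)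

lemma aut_subgroup_finv: "subgroup M G2 \<Longrightarrow> h \<in> M \<Longrightarrow> finv h \<in> M"
  using subgroup.m_inv_closed[of M G2 h] subgroup.subset[of M G2] inv_G2[of h] by auto

abbreviation cls :: "('a::field zorn \<Rightarrow> 'a zorn) \<Rightarrow> ('a zorn \<Rightarrow> 'a zorn) set"
  where "cls g \<equiv> conj_orbit G2 octonion_auts g"

definition good :: "('a::field zorn \<Rightarrow> 'a zorn) \<Rightarrow> bool"
  where "good g \<longleftrightarrow> type_C G2 (cls g) \<or> type_D G2 (cls g) \<or> type_F G2 (cls g)"

definition conj_to :: "('a::field zorn \<Rightarrow> 'a zorn) \<Rightarrow> ('a zorn \<Rightarrow> 'a zorn) \<Rightarrow> bool"
  where "conj_to r s \<longleftrightarrow> r \<in> octonion_auts \<and> s \<in> octonion_auts \<and> (\<exists>h \<in> octonion_auts. h \<circ> r = s \<circ> h)"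

lemma conj_toI: "r \<in> octonion_auts \<Longrightarrow> h \<in> octonion_auts \<Longrightarrow> conj_to r (h \<circ> r \<circ> finv h)"
  using conj_eq_iff[of h r "h \<circ> r \<circ> finv h"] by (auto simp: conj_to_def intro!: aut_comp)
lemma conj_to_refl: "r \<in> octonion_auts \<Longrightarrow> conj_to r r"
  by (auto simp: conj_to_def intro!: bexI[of _ id])
lemma conj_to_trans: assumes "conj_to r s" "conj_to s t" shows "conj_to r t"
proof -
  obtain h k where h: "h \<in> octonion_auts" "h \<circ> r = s \<circ> h" and k: "k \<in> octonion_auts" "k \<circ> s = t \<circ> k"
    using assms by (auto simp: conj_to_def)
  have "k \<circ> h \<circ> r = k \<circ> s \<circ> h" by (simp only: o_assoc[symmetric] h)
  also have "\<dots> = t \<circ> (k \<circ> h)" by (simp only: k o_assoc)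
  finally show ?thesis using assms h k by (auto simp: conj_to_def)
qed
lemma conj_to_sym: assumes "conj_to r s" shows "conj_to s r"
proof -
  obtain h where h: "h \<in> octonion_auts" "h \<circ> r = s \<circ> h" using assms by (auto simp: conj_to_def)
  have "finv h \<circ> s = finv h \<circ> (s \<circ> h) \<circ> finv h"
    by (simp only: o_assoc[symmetric] finv_comp[OF h(1)]) simp
  also have "\<dots> = finv h \<circ> h \<circ> r \<circ> finv h" by (simp only: h(2)[symmetric] o_assoc)
  finally show ?thesis using assms h finv_comp[OF h(1)] by (auto simp: conj_to_def)
qed

lemma cls_iff: "r \<in> octonion_auts \<Longrightarrow> s \<in> cls r \<longleftrightarrow> conj_to r s"
proof
  assume r: "r \<in> octonion_auts" and "s \<in> cls r"
  then obtain h where "h \<in> octonion_auts" "s = h \<circ> r \<circ> finv h"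
    unfolding conj_orbit_G2[OF order_refl] by blast
  then show "conj_to r s" using conj_toI[OF r] by simp
next
  assume "r \<in> octonion_auts" and "conj_to r s"
  then obtain h where h: "h \<in> octonion_auts" "h \<circ> r = s \<circ> h" by (auto simp: conj_to_def)
  then have "s = h \<circ> r \<circ> finv h" using conj_eq_iff[of h r s] by simp
  then show "s \<in> cls r" using h unfolding conj_orbit_G2[OF order_refl] by blast
qed

lemma good_conj: assumes "conj_to r s" shows "good r \<longleftrightarrow> good s"
proof -
  have "cls r = cls s"
  proof (rule Set.set_eqI)
    fix t
    have a: "r \<in> octonion_auts" "s \<in> octonion_auts" using assms by (auto simp: conj_to_def)
    show "t \<in> cls r \<longleftrightarrow> t \<in> cls s"
      unfolding cls_iff[OF a(1)] cls_iff[OF a(2)]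
      using conj_to_trans[of s r t] conj_to_trans[OF assms, of t] conj_to_sym[OF assms] by blast
  qed
  then show ?thesis by (simp add: good_def)
qed

lemma three_card: "finite S \<Longrightarrow> a \<in> S \<Longrightarrow> b \<in> S \<Longrightarrow> c \<in> S \<Longrightarrow> a \<noteq> b \<Longrightarrow> b \<noteq> c \<Longrightarrow> a \<noteq> c \<Longrightarrow> 2 < card S"
  using card_mono[of S "{a, b, c}"] by auto

text \<open>Three elements in each orbit make the minimum exceed 2. Generation by the two orbits is
  a separate hypothesis because H is not always generated by r and s alone.\<close>

lemma type_C_general:
  fixes r :: "'a::{finite,field} zorn \<Rightarrow> 'a zorn"
  assumes rs: "conj_to r s" and H: "subgroup H G2" "r \<in> H" "s \<in> H"
    and gen: "H \<subseteq> generate G2 (conj_orbit G2 H r \<union> conj_orbit G2 H s)"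
    and nc: "\<And>k. k \<in> H \<Longrightarrow> k \<circ> r \<noteq> s \<circ> k" and "r \<circ> s \<noteq> s \<circ> r"
    and r3: "x \<in> conj_orbit G2 H r" "y \<in> conj_orbit G2 H r" "r \<noteq> x" "r \<noteq> y" "x \<noteq> y"
    and s3: "x' \<in> conj_orbit G2 H s" "y' \<in> conj_orbit G2 H s" "s \<noteq> x'" "s \<noteq> y'" "x' \<noteq> y'"
  shows "good r"
proof -
  have Ha: "H \<subseteq> octonion_auts" using subgroup.subset[OF H(1)] by simp
  have ra: "r \<in> octonion_auts" using rs by (simp add: conj_to_def)
  have id: "id \<in> H" using subgroup.one_closed[OF H(1)] by simp
  note orb = conj_orbit_G2[OF Ha]
  have self: "g \<in> conj_orbit G2 H g" for g
    unfolding orb using id by (auto intro!: exI[of _ id])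
  have sub: "conj_orbit G2 H g \<subseteq> H" if "g \<in> H" for g
    unfolding orb using that subgroup.m_closed[OF H(1)] aut_subgroup_finv[OF H(1)] by auto
  have "generate G2 (conj_orbit G2 H r \<union> conj_orbit G2 H s) \<subseteq> H"
    by (rule group.generate_subgroup_incl[OF group_G2 _ H(1)]) (use sub H in blast)
  then have "H = generate G2 (conj_orbit G2 H r \<union> conj_orbit G2 H s)" using gen by blast
  moreover have "conj_orbit G2 H r \<noteq> conj_orbit G2 H s"
  proof
    assume "conj_orbit G2 H r = conj_orbit G2 H s"
    then have "s \<in> conj_orbit G2 H r" using self by blast
    then obtain h where h: "h \<in> H" "h \<circ> r \<circ> finv h = s" unfolding orb by auto
    then show False using nc[OF h(1)] conj_eq_iff[of h r s] Ha by blast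
  qed
  moreover have "2 < card (conj_orbit G2 H r)" "2 < card (conj_orbit G2 H s)"
    using three_card[OF _ self r3(1,2)] three_card[OF _ self s3(1,2)] r3 s3 by auto
  ultimately have "type_C G2 (cls r)"
    unfolding type_C_def using H assms(7) rs conj_to_refl[OF ra]
    by (intro exI[of _ H] exI[of _ r] exI[of _ s]) (simp add: cls_iff[OF ra])
  then show ?thesis by (simp add: good_def)
qed

lemma generate_pair:
  fixes r s :: "'a::{finite,field} zorn \<Rightarrow> 'a zorn"
  assumes "r \<in> octonion_auts" "s \<in> octonion_auts" and M: "subgroup M G2" "r \<in> M" "s \<in> M"
  defines "H \<equiv> generate G2 {r, s}"
  shows "subgroup H G2" "r \<in> H" "s \<in> H" "H \<subseteq> M" "H \<subseteq> octonion_auts"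
    "H \<subseteq> generate G2 (conj_orbit G2 H r \<union> conj_orbit G2 H s)"
proof -
  show sg: "subgroup H G2" unfolding H_def
    by (rule group.generate_is_subgroup[OF group_G2]) (use assms in auto)
  show "r \<in> H" "s \<in> H" unfolding H_def by (auto intro: generate.incl)
  show "H \<subseteq> M" unfolding H_def
    by (rule group.generate_subgroup_incl[OF group_G2 _ M(1)]) (use M in blast)
  then show Ha: "H \<subseteq> octonion_auts" using subgroup.subset[OF M(1)] by auto
  have "id \<in> H" using subgroup.one_closed[OF sg] by simp
  then have "r \<in> conj_orbit G2 H r" "s \<in> conj_orbit G2 H s"
    unfolding conj_orbit_G2[OF Ha] by (auto intro!: exI[of _ id])
  then show "H \<subseteq> generate G2 (conj_orbit G2 H r \<union> conj_orbit G2 H s)"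
    unfolding H_def by (intro group.mono_generate[OF group_G2]) blast
qed

lemma comp_cancel: assumes "f \<in> octonion_auts" shows "f \<circ> g = f \<circ> h \<longleftrightarrow> g = h"
proof
  assume "f \<circ> g = f \<circ> h"
  then have "(finv f \<circ> f) \<circ> g = (finv f \<circ> f) \<circ> h" by (simp only: o_assoc[symmetric])
  then show "g = h" by (simp add: finv_comp[OF assms])
qed simp
lemma comp_cancel_right: assumes "f \<in> octonion_auts" shows "g \<circ> f = h \<circ> f \<longleftrightarrow> g = h"
proof
  assume "g \<circ> f = h \<circ> f"
  then have "g \<circ> (f \<circ> finv f) = h \<circ> (f \<circ> finv f)" by (simp only: o_assoc)
  then show "g = h" by (simp add: finv_comp[OF assms])
qed simp

text \<open>The orbit of r contains r, s r s^-1 and s^2 r s^-2, which are distinct because neither s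
  nor s^2 commutes with r; likewise for s. For H = \<langle>r, s\<rangle> the generation condition
  is automatic.\<close>

lemma good_C:
  fixes r :: "'a::{finite,field} zorn \<Rightarrow> 'a zorn"
  assumes rs: "conj_to r s" and M: "subgroup M G2" "r \<in> M" "s \<in> M"
    and nc: "\<And>k. k \<in> M \<Longrightarrow> k \<circ> r \<noteq> s \<circ> k"
    and c: "r \<circ> r \<circ> s \<noteq> s \<circ> (r \<circ> r)" "s \<circ> s \<circ> r \<noteq> r \<circ> (s \<circ> s)"
  shows "good r"
proof -
  have a: "r \<in> octonion_auts" "s \<in> octonion_auts" using rs by (auto simp: conj_to_def)
  define H where "H = generate G2 {r, s}"
  note H = generate_pair[OF a M, folded H_def]
  have three: "\<exists>x y. x \<in> conj_orbit G2 H r \<and> y \<in> conj_orbit G2 H r \<and> r \<noteq> x \<and> r \<noteq> y \<and> x \<noteq> y"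
    if "s \<in> H" "r \<in> octonion_auts" "s \<in> octonion_auts" and c: "s \<circ> s \<circ> r \<noteq> r \<circ> (s \<circ> s)" for r s
  proof (intro exI conjI)
    have ss: "s \<circ> s \<in> octonion_auts" "s \<circ> s \<in> H" using that subgroup.m_closed[OF H(1)] by auto
    show "s \<circ> r \<circ> finv s \<in> conj_orbit G2 H r" "(s \<circ> s) \<circ> r \<circ> finv (s \<circ> s) \<in> conj_orbit G2 H r"
      unfolding conj_orbit_G2[OF H(5)] using that ss by blast+
    have nsr: "s \<circ> r \<noteq> r \<circ> s"
    proof
      assume e: "s \<circ> r = r \<circ> s"
      have "s \<circ> s \<circ> r = s \<circ> (s \<circ> r)" by (simp only: o_assoc)
      also have "\<dots> = (s \<circ> r) \<circ> s" by (simp only: e o_assoc)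
      also have "\<dots> = r \<circ> (s \<circ> s)" by (simp only: e o_assoc)
      finally show False using c by simp
    qed
    then show "r \<noteq> s \<circ> r \<circ> finv s" using conj_eq_iff[of s r r] that by auto
    show "r \<noteq> (s \<circ> s) \<circ> r \<circ> finv (s \<circ> s)" using conj_eq_iff[OF ss(1), of r r] c by auto
    show "s \<circ> r \<circ> finv s \<noteq> (s \<circ> s) \<circ> r \<circ> finv (s \<circ> s)"
    proof
      assume "s \<circ> r \<circ> finv s = (s \<circ> s) \<circ> r \<circ> finv (s \<circ> s)"
      then have "(s \<circ> s) \<circ> r = (s \<circ> r \<circ> finv s) \<circ> (s \<circ> s)" using conj_eq_iff[OF ss(1)] by metis
      also have "\<dots> = s \<circ> r \<circ> (finv s \<circ> s) \<circ> s" by (simp only: o_assoc)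
      finally have "s \<circ> (s \<circ> r) = s \<circ> (r \<circ> s)" by (simp add: finv_comp that o_assoc)
      then show False using nsr comp_cancel that by blast
    qed
  qed
  obtain x y where xy: "x \<in> conj_orbit G2 H r" "y \<in> conj_orbit G2 H r" "r \<noteq> x" "r \<noteq> y" "x \<noteq> y"
    using three[of s r] a c H by blast
  obtain x' y' where xy': "x' \<in> conj_orbit G2 H s" "y' \<in> conj_orbit G2 H s" "s \<noteq> x'" "s \<noteq> y'" "x' \<noteq> y'"
    using three[of r s] a c H by blast
  have "r \<circ> s \<noteq> s \<circ> r"
  proof
    assume e: "r \<circ> s = s \<circ> r"
    have "r \<circ> r \<circ> s = r \<circ> (r \<circ> s)" by (simp only: o_assoc)
    also have "\<dots> = (r \<circ> s) \<circ> r" by (simp only: e o_assoc)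
    also have "\<dots> = s \<circ> (r \<circ> r)" by (simp only: e o_assoc)
    finally show False using c by simp
  qed
  then show ?thesis
    using type_C_general[OF rs H(1,2,3,6) _ _ xy xy'] nc H(4) by blast
qed

lemma good_D:
  fixes r :: "'a::{finite,field} zorn \<Rightarrow> 'a zorn"
  assumes rs: "conj_to r s" and M: "subgroup M G2" "r \<in> M" "s \<in> M"
    and nc: "\<And>k. k \<in> M \<Longrightarrow> k \<circ> r \<noteq> s \<circ> k"
    and c: "(r \<circ> s) \<circ> (r \<circ> s) \<noteq> (s \<circ> r) \<circ> (s \<circ> r)"
  shows "good r"
proof -
  have a: "r \<in> octonion_auts" "s \<in> octonion_auts" using rs by (auto simp: conj_to_def)
  define H where "H = generate G2 {r, s}"
  note H = generate_pair[OF a M, folded H_def]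
  have "conj_orbit G2 H r \<noteq> conj_orbit G2 H s"
  proof
    assume e: "conj_orbit G2 H r = conj_orbit G2 H s"
    have "id \<in> H" using subgroup.one_closed[OF H(1)] by simp
    then have "s \<in> conj_orbit G2 H s"
      unfolding conj_orbit_G2[OF H(5)] by (auto intro!: exI[of _ id])
    then have "s \<in> conj_orbit G2 H r" using e by simp
    then obtain h where h: "h \<in> H" "h \<circ> r \<circ> finv h = s" unfolding conj_orbit_G2[OF H(5)] by auto
    then show False using nc conj_eq_iff[of h r s] H by blast
  qed
  moreover have "f [^]\<^bsub>G2\<^esub> (2::nat) = f \<circ> f" for f :: "'a zorn \<Rightarrow> 'a zorn"
    by (simp add: numeral_2_eq_2 nat_pow_def)
  ultimately have "type_D G2 (cls r)"
    unfolding type_D_def H_def using c rs conj_to_refl[OF a(1)]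
    by (intro exI[of _ r] exI[of _ s]) (simp add: cls_iff[OF a(1)])
  then show ?thesis by (simp add: good_def)
qed

section \<open>A conjugation criterion\<close>

definition subsp :: "'a::field zorn set \<Rightarrow> bool" where
  "subsp A \<longleftrightarrow> 0 \<in> A \<and> (\<forall>x\<in>A. \<forall>y\<in>A. x + y \<in> A) \<and> (\<forall>c. \<forall>x\<in>A. c \<bullet> x \<in> A)"

lemma subspD: assumes "subsp A" shows "0 \<in> A" "x \<in> A \<Longrightarrow> y \<in> A \<Longrightarrow> x + y \<in> A" "x \<in> A \<Longrightarrow> c \<bullet> x \<in> A"
    "x \<in> A \<Longrightarrow> y \<in> A \<Longrightarrow> x - y \<in> A" "x \<in> A \<Longrightarrow> - x \<in> A"
proof -
  show *: "0 \<in> A" "x \<in> A \<Longrightarrow> y \<in> A \<Longrightarrow> x + y \<in> A" "x \<in> A \<Longrightarrow> c \<bullet> x \<in> A" for x y c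
    using assms by (auto simp: subsp_def)
  show m: "x \<in> A \<Longrightarrow> - x \<in> A" for x using *(3)[of x "- 1"] by (simp add: zsmul_minus)
  show "x \<in> A \<Longrightarrow> y \<in> A \<Longrightarrow> x - y \<in> A" using *(2)[of x "- y"] m by simp
qed

lemma at_most_one_bad:
  assumes "card (UNIV :: 'a::{finite,field} set) > 2"
    and "\<And>s t :: 'a. P s \<Longrightarrow> P t \<Longrightarrow> s = t" "\<And>s t :: 'a. Q s \<Longrightarrow> Q t \<Longrightarrow> s = t"
  obtains t where "\<not> P t" "\<not> Q t"
proof (rule ccontr)
  assume "\<not> thesis"
  then have "UNIV \<subseteq> {t. P t} \<union> {t. Q t}" using that by blast
  moreover have "card {t. P t} \<le> 1" "card {t. Q t} \<le> 1"
    using assms(2,3) by (auto simp: card_le_Suc0_iff_eq)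
  ultimately have "card (UNIV :: 'a set) \<le> 1 + 1"
    using card_mono[of "{t. P t} \<union> {t. Q t}" UNIV] card_Un_le[of "{t. P t}" "{t. Q t}"] by simp
  then show False using assms(1) by simp
qed

text \<open>The group elements involved act unipotently on a section \<open>\<langle>e\<rangle> + B / A\<close>; conjugating \<open>s\<close> by \<open>k t\<close>
  translates \<open>s e\<close> by \<open>t\<close> times a vector that \<open>R\<close> does not fix, so that \<open>R\<close> commutes with at most
  one of the conjugates.\<close>
lemma section_commute:
  fixes k :: "'a::field \<Rightarrow> 'a zorn \<Rightarrow> 'a zorn"
  assumes A: "subsp A" and B: "subsp B" and AB: "A \<subseteq> B" and y0: "y0 \<in> B"
    and R: "R \<in> octonion_auts" "\<And>y. y \<in> B \<Longrightarrow> R y \<in> B" "\<And>x. x \<in> A \<Longrightarrow> R x \<in> A" "R e - e \<in> B"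
    and S: "S \<in> octonion_auts" "\<And>y. y \<in> B \<Longrightarrow> S y \<in> B" "\<And>x. x \<in> A \<Longrightarrow> S x \<in> A" "S e - e \<in> B"
    and k: "\<And>t. k t \<in> octonion_auts" "\<And>t y. y \<in> B \<Longrightarrow> k t y - y \<in> A" "\<And>t. k t e - e - t \<bullet> y0 \<in> A"
    and z: "R (y0 - S y0) - (y0 - S y0) \<notin> A"
    and T: "\<And>t. T t \<in> octonion_auts" "\<And>t. k t \<circ> S = T t \<circ> k t" "\<And>t y. y \<in> B \<Longrightarrow> T t y \<in> B"
       "\<And>t x. x \<in> A \<Longrightarrow> T t x \<in> A"
    and c: "R \<circ> T t = T t \<circ> R" "R \<circ> T t' = T t' \<circ> R"
  shows "t = t'"
proof -
  define cong where "cong x y \<longleftrightarrow> x - y \<in> A" for x y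
  note sA = subspD[OF A] and sB = subspD[OF B]
  have tr: "cong x y \<Longrightarrow> cong y z \<Longrightarrow> cong x z" for x y z
    using sA(2)[of "x - y" "y - z"] by (simp add: cong_def)
  have sy: "cong x y \<Longrightarrow> cong y x" for x y
    using sA(5)[of "x - y"] by (simp add: cong_def)
  have ad: "cong x y \<Longrightarrow> cong x' y' \<Longrightarrow> cong (x + x') (y + y')" for x y x' y'
    using sA(2)[of "x - y" "x' - y'"] by (simp add: cong_def algebra_simps)
  have su: "cong x y \<Longrightarrow> cong x' y' \<Longrightarrow> cong (x - x') (y - y')" for x y x' y'
    using sA(4)[of "x - y" "x' - y'"] by (simp add: cong_def algebra_simps)
  have re: "cong x x" for x using sA(1) by (simp add: cong_def)
  have pres: "cong x y \<Longrightarrow> cong (f x) (f y)" if "f \<in> octonion_auts" "\<And>x. x \<in> A \<Longrightarrow> f x \<in> A" for f x y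
    using that(2)[of "x - y"] by (simp add: cong_def aut_diff[OF that(1)])
  have TY: "cong (T t y) (S y)" if "y \<in> B" for t y
  proof -
    have "cong y (k t y)" using k(2)[OF that] sy by (simp add: cong_def)
    then have "cong (T t y) (T t (k t y))" using pres T(1,4) by blast
    moreover have "T t (k t y) = k t (S y)" using T(2)[of t] by (metis comp_apply)
    moreover have "cong (k t (S y)) (S y)" using k(2) S(2)[OF that] by (simp add: cong_def)
    ultimately show ?thesis using tr by metis
  qed
  define w where "w = S e - e"
  define z0 where "z0 = y0 - S y0"
  have w: "w \<in> B" "S e = e + w" using S by (auto simp: w_def)
  have z0: "z0 \<in> B" using y0 S(2) sB by (auto simp: z0_def)
  \<comment> \<open>Modulo A the map \<open>T t\<close> agrees with S on B; on e it differs from S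
    by t (y0 - S y0), because \<open>k t\<close> moves e by t y0 and is trivial on B / A.\<close>
  have Te: "cong (T t e) (S e + t \<bullet> z0)" for t
  proof -
    have ke: "cong (k t e) (e + t \<bullet> y0)" using k(3)[of t] by (simp add: cong_def algebra_simps)
    have "T t (k t e) = k t (S e)" using T(2)[of t] by (metis comp_apply)
    also have "\<dots> = k t e + k t w" by (simp add: w aut_add[OF k(1)])
    finally have 1: "T t (k t e) = k t e + k t w" .
    have "cong (T t (k t e)) (T t (e + t \<bullet> y0))" using pres[OF T(1) T(4)] ke by blast
    then have "cong (T t e + t \<bullet> T t y0) (k t e + k t w)"
      using 1 sy by (simp add: aut_add[OF T(1)] aut_smul[OF T(1)])
    moreover have "cong (k t w) w" using k(2)[OF w(1)] by (simp add: cong_def)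
    ultimately have 2: "cong (T t e + t \<bullet> T t y0) (e + t \<bullet> y0 + w)"
      using tr ad ke by blast
    have "cong (t \<bullet> T t y0) (t \<bullet> S y0)"
      using sA(3)[of "T t y0 - S y0" t] TY[OF y0, of t] by (simp add: cong_def zsmul_diff)
    then have "cong (T t e + t \<bullet> T t y0 - t \<bullet> T t y0) (e + t \<bullet> y0 + w - t \<bullet> S y0)"
      using su[OF 2] by blast
    then show ?thesis by (simp add: w z0_def zsmul_diff algebra_simps)
  qed
  define v where "v = R e - e"
  have v: "v \<in> B" "R e = e + v" using R by (auto simp: v_def)
  \<comment> \<open>Both sides of R (T t e) = T t (R e) are computed modulo A; the parameter enters
    only through t (R z0 - z0).\<close>
  have key: "cong (t \<bullet> (R z0 - z0)) (S e + S v - R (S e))" if c: "R \<circ> T t = T t \<circ> R" for t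
  proof -
    have c1: "cong (R (T t e)) (R (S e + t \<bullet> z0))" by (rule pres[OF R(1,3) Te])
    have c2: "R (T t e) = T t (e + v)" using fun_cong[OF c, of e] v(2) by simp
    have c3: "cong (T t (e + v)) (S e + t \<bullet> z0 + S v)"
      using ad[OF Te TY[OF v(1)]] by (simp add: aut_add[OF T(1)])
    have c4: "R (S e + t \<bullet> z0) = R (S e) + t \<bullet> R z0"
      by (simp add: aut_add[OF R(1)] aut_smul[OF R(1)])
    have "cong (R (S e) + t \<bullet> R z0) (S e + t \<bullet> z0 + S v)"
      using tr[OF sy[OF c1[unfolded c2]] c3] by (simp only: c4)
    then show ?thesis using su[OF _ re, of _ _ "R (S e) + t \<bullet> z0"] by (fastforce simp: zsmul_diff algebra_simps)
  qed
  have "cong (t \<bullet> (R z0 - z0)) (t' \<bullet> (R z0 - z0))" using key[OF c(1)] key[OF c(2)] sy tr by blast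
  then have *: "(t - t') \<bullet> (R z0 - z0) \<in> A" by (simp add: cong_def zsmul_diff_left)
  show "t = t'"
  proof (rule ccontr)
    assume "t \<noteq> t'"
    then show False using sA(3)[OF *, of "1 / (t - t')"] z by (simp add: z0_def)
  qed
qed

text \<open>\<open>section_commute\<close> is used twice: for r^2 and the conjugates of s, and for r
  and the conjugates of s^2. As every \<open>k t\<close> lies in M, conjugating s by it cannot make
  it conjugate to r in M.\<close>

lemma section_good:
  fixes k :: "'a::{finite,field} \<Rightarrow> 'a zorn \<Rightarrow> 'a zorn"
  assumes q: "card (UNIV :: 'a set) > 2" and rs: "conj_to r s"
    and M: "subgroup M G2" "r \<in> M" "s \<in> M" "\<And>t. k t \<in> M"
    and nc: "\<And>h. h \<in> M \<Longrightarrow> h \<circ> r \<noteq> s \<circ> h"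
    and A: "subsp A" and B: "subsp B" and AB: "A \<subseteq> B" and y0: "y0 \<in> B"
    and act: "\<And>h y. h \<in> M \<Longrightarrow> y \<in> B \<Longrightarrow> h y \<in> B" "\<And>h x. h \<in> M \<Longrightarrow> x \<in> A \<Longrightarrow> h x \<in> A"
       "\<And>h. h \<in> M \<Longrightarrow> h e - e \<in> B"
    and k: "\<And>t y. y \<in> B \<Longrightarrow> k t y - y \<in> A" "\<And>t. k t e - e - t \<bullet> y0 \<in> A"
    and z: "r (r (y0 - s y0)) - (y0 - s y0) \<notin> A" "r (y0 - s (s y0)) - (y0 - s (s y0)) \<notin> A"
  shows "good r"
proof -
  have Ma: "M \<subseteq> octonion_auts" using subgroup.subset[OF M(1)] by simp
  have cl: "x \<circ> y \<in> M" if "x \<in> M" "y \<in> M" for x y using subgroup.m_closed[OF M(1) that] by simp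
  define T where "T t = k t \<circ> s \<circ> finv (k t)" for t
  have ka: "k t \<in> octonion_auts" for t using M(4) Ma by blast
  have Tk: "k t \<circ> s = T t \<circ> k t" for t
    using conj_eq_iff[OF ka, of t s "T t"] by (simp add: T_def)
  have Tk2: "k t \<circ> (s \<circ> s) = (T t \<circ> T t) \<circ> k t" for t
  proof -
    have "k t (s x) = T t (k t x)" for x using fun_cong[OF Tk] by simp
    then show ?thesis by (simp add: fun_eq_iff)
  qed
  have TM: "T t \<in> M" for t unfolding T_def by (intro cl aut_subgroup_finv[OF M(1)] M)
  have hM: "h \<in> octonion_auts" if "h \<in> M" for h using Ma that by blast
  have rr: "r \<circ> r \<in> M" and ss: "s \<circ> s \<in> M" and TT: "T t \<circ> T t \<in> M" for t
    by (intro cl M TM)+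
  have z': "(r \<circ> r) (y0 - s y0) - (y0 - s y0) \<notin> A" "r (y0 - (s \<circ> s) y0) - (y0 - (s \<circ> s) y0) \<notin> A"
    using z by simp_all
  have 1: "t = t'" if "(r \<circ> r) \<circ> T t = T t \<circ> (r \<circ> r)" "(r \<circ> r) \<circ> T t' = T t' \<circ> (r \<circ> r)" for t t'
    by (rule section_commute[OF A B AB y0 hM[OF rr] act(1)[OF rr] act(2)[OF rr] act(3)[OF rr]
        hM[OF M(3)] act(1)[OF M(3)] act(2)[OF M(3)] act(3)[OF M(3)] ka k z'(1) hM[OF TM] Tk
        act(1)[OF TM] act(2)[OF TM] that])
  have 2: "t = t'" if "r \<circ> (T t \<circ> T t) = (T t \<circ> T t) \<circ> r" "r \<circ> (T t' \<circ> T t') = (T t' \<circ> T t') \<circ> r" for t t'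
    by (rule section_commute[OF A B AB y0 hM[OF M(2)] act(1)[OF M(2)] act(2)[OF M(2)] act(3)[OF M(2)]
        hM[OF ss] act(1)[OF ss] act(2)[OF ss] act(3)[OF ss] ka k z'(2) hM[OF TT] Tk2
        act(1)[OF TT] act(2)[OF TT] that])
  obtain t where t: "(r \<circ> r) \<circ> T t \<noteq> T t \<circ> (r \<circ> r)" "r \<circ> (T t \<circ> T t) \<noteq> (T t \<circ> T t) \<circ> r"
    by (rule at_most_one_bad[OF q, of "\<lambda>t. (r \<circ> r) \<circ> T t = T t \<circ> (r \<circ> r)" "\<lambda>t. r \<circ> (T t \<circ> T t) = (T t \<circ> T t) \<circ> r"])
       (use 1 2 in blast)+
  show ?thesis
  proof (rule good_C[OF _ M(1,2) TM])
    have "conj_to s (T t)" using M(3) Ma ka conj_toI unfolding T_def by blast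
    then show "conj_to r (T t)" using rs conj_to_trans by blast
    show "h \<circ> r \<noteq> T t \<circ> h" if "h \<in> M" for h
    proof
      assume e: "h \<circ> r = T t \<circ> h"
      have "(finv (k t) \<circ> h) \<circ> r = finv (k t) \<circ> T t \<circ> h" by (simp only: e o_assoc[symmetric])
      also have "\<dots> = (finv (k t) \<circ> k t) \<circ> s \<circ> finv (k t) \<circ> h" by (simp only: T_def o_assoc)
      also have "\<dots> = s \<circ> (finv (k t) \<circ> h)" by (simp add: finv_comp[OF ka] o_assoc)
      finally show False using nc cl aut_subgroup_finv[OF M(1)] M(4) that by blast
    qed
  qed (use t in auto)
qed

section \<open>Elements fixing a null line\<close>

lemma conj_apply: "h \<in> octonion_auts \<Longrightarrow> (h \<circ> g \<circ> finv h) (h x) = h (g x)"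
  by (simp add: aut_inv_f)

lemma aut_neq_0: "f \<in> octonion_auts \<Longrightarrow> x \<noteq> 0 \<Longrightarrow> f x \<noteq> 0"
  by (simp add: aut_eq_0)

lemma eigen_null:
  assumes g: "g \<in> octonion_auts" "g y = b \<bullet> y" and b: "b * b \<noteq> 1"
  shows "ztr y = 0" "znorm y = 0"
proof -
  have "b \<noteq> 1" using b by auto
  moreover have "ztr y = b * ztr y" using aut_tr[OF g(1), of y] g(2) by simp
  ultimately show "ztr y = 0" by auto
  have "znorm y = b * b * znorm y" using aut_norm[OF g(1), of y] g(2) by simp
  then show "znorm y = 0" using b by auto
qed

text \<open>g - 1 / a maps everything into the orthogonal complement of x, so it is not surjective,
  and on a finite space not injective either.\<close>

lemma dual_eigenvector:
  fixes g :: "'a::{finite,field} zorn \<Rightarrow> 'a zorn"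
  assumes g: "g \<in> octonion_auts" "g x = a \<bullet> x" and x: "x \<noteq> 0"
  obtains y where "y \<noteq> 0" "g y = (1 / a) \<bullet> y"
proof -
  have a: "a \<noteq> 0" using aut_neq_0[OF g(1) x] g(2) by auto
  define f where "f y = g y - (1 / a) \<bullet> y" for y
  have "zbil (f y) x = 0" for y
  proof -
    have "zbil (g y) x = zbil (g y) ((1 / a) \<bullet> g x)" by (simp add: g(2) a del: zsmul.simps)
    also have "\<dots> = (1 / a) * zbil y x" by (simp only: zbil_smul aut_bil[OF g(1)])
    finally show ?thesis by (simp add: f_def zbil_diff zbil_smul)
  qed
  then have "\<not> surj f" using zbil_nondeg[OF x] zbil_sym by (metis surjD)
  then have "\<not> inj f" using finite_UNIV_inj_surj[of f] by auto
  then obtain y z where yz: "f y = f z" "y \<noteq> z" unfolding inj_def by blast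
  have "g (y - z) = (1 / a) \<bullet> (y - z)"
    using yz(1) by (simp add: f_def aut_diff[OF g(1)] zsmul_diff algebra_simps)
  then show thesis using that[of "y - z"] yz(2) by simp
qed

text \<open>The span of \<open>U1\<close>, \<open>V2\<close> and \<open>V3\<close>. The flag of the
  line \<open>Lx\<close> in \<open>Kx\<close>, together with the coset of \<open>E1\<close> modulo
  \<open>Kx\<close>, provides the sections on which the stabilizer \<open>Px\<close> of the null
  line acts.\<close>

definition Kx :: "'a::field zorn set" where "Kx = {z. U1 \<star> z = 0 \<and> z \<star> U1 = 0}"
definition Lx :: "'a::field zorn set" where "Lx = range (\<lambda>c. c \<bullet> U1)"

lemma Kx_iff [simp]: "(a, (u1, u2, u3), (v1, v2, v3), b) \<in> Kx \<longleftrightarrow>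
    a = 0 \<and> b = 0 \<and> u2 = 0 \<and> u3 = 0 \<and> v1 = 0"
  by (auto simp: Kx_def)
lemma Lx_iff [simp]: "(a, (u1, u2, u3), (v1, v2, v3), b) \<in> Lx \<longleftrightarrow>
    a = 0 \<and> b = 0 \<and> u2 = 0 \<and> u3 = 0 \<and> v1 = 0 \<and> v2 = 0 \<and> v3 = 0"
  by (auto simp: Lx_def)
lemma Kx_cases: assumes "z \<in> Kx" obtains x y2 y3 where "z = (0, (x, 0, 0), (0, y2, y3), 0)"
  using assms by (cases z rule: zorn_cases) auto
lemma Lx_cases: assumes "z \<in> Lx" obtains x where "z = (0, (x, 0, 0), (0, 0, 0), 0)"
  using assms by (cases z rule: zorn_cases) auto
lemma subsp_Kx: "subsp Kx" unfolding subsp_def by (auto simp: zero_prod_def elim!: Kx_cases)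
lemma subsp_Lx: "subsp Lx" unfolding subsp_def by (auto simp: zero_prod_def elim!: Lx_cases)
lemma subsp_0: "subsp {0}" unfolding subsp_def by simp
lemma Lx_Kx: "Lx \<subseteq> Kx" by (auto elim!: Lx_cases)

definition Px :: "('a::field zorn \<Rightarrow> 'a zorn) set" where
  "Px = {h \<in> octonion_auts. \<exists>l. h U1 = l \<bullet> U1}"

lemma PxD: assumes "h \<in> Px" obtains l where "h \<in> octonion_auts" "h U1 = l \<bullet> U1" "l \<noteq> 0"
proof -
  obtain l where l: "h \<in> octonion_auts" "h U1 = l \<bullet> U1" using assms by (auto simp: Px_def)
  then show thesis using that aut_neq_0[OF l(1), of U1] by auto
qed
lemma Px_aut: "h \<in> Px \<Longrightarrow> h \<in> octonion_auts" by (simp add: Px_def)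

lemma Px_comp: assumes "h \<in> Px" "k \<in> Px" shows "h \<circ> k \<in> Px"
proof -
  obtain l where l: "h \<in> octonion_auts" "h U1 = l \<bullet> U1" using PxD[OF assms(1)] .
  obtain m where m: "k \<in> octonion_auts" "k U1 = m \<bullet> U1" using PxD[OF assms(2)] .
  have "(h \<circ> k) U1 = (m * l) \<bullet> U1"
    using m(2) l(2) aut_smul[OF l(1), of m U1] by simp
  then show ?thesis using l m unfolding Px_def by blast
qed
lemma Px_id: "id \<in> Px" by (auto simp: Px_def intro!: exI[of _ 1])

lemma subgroup_Px: "subgroup (Px :: ('a::{finite,field} zorn \<Rightarrow> 'a zorn) set) G2"
  by (rule subgroup_G2I) (auto simp: Px_aut Px_comp Px_id)

lemma Px_Kx: assumes "h \<in> Px" "z \<in> Kx" shows "h z \<in> Kx"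
proof -
  obtain l where l: "h \<in> octonion_auts" "h U1 = l \<bullet> U1" "l \<noteq> 0" using PxD[OF assms(1)] .
  have "l \<bullet> (U1 \<star> h z) = h (U1 \<star> z)" "l \<bullet> (h z \<star> U1) = h (z \<star> U1)"
    by (simp_all only: aut_mul[OF l(1)] l(2) zmul_smul_left zmul_smul_right)
  then have "l \<bullet> (U1 \<star> h z) = 0" "l \<bullet> (h z \<star> U1) = 0"
    using assms(2) aut_0[OF l(1)] by (simp_all only: Kx_def mem_Collect_eq)
  then show ?thesis using l(3) by (simp only: zsmul_eq_0 Kx_def mem_Collect_eq) blast
qed
lemma Px_Lx: assumes "h \<in> Px" "z \<in> Lx" shows "h z \<in> Lx"
proof -
  obtain l where l: "h \<in> octonion_auts" "h U1 = l \<bullet> U1" "l \<noteq> 0" using PxD[OF assms(1)] .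
  obtain c where "z = c \<bullet> U1" using assms(2) by (auto simp: Lx_def)
  then have "h z = (c * l) \<bullet> U1" by (simp only: aut_smul[OF l(1)] l(2) zsmul_zsmul)
  then show ?thesis unfolding Lx_def by blast
qed
text \<open>The equations U1 z = 0 and z U1 = U1 determine \<open>E1\<close> modulo
  \<open>Kx\<close>, and they are not affected by scaling \<open>U1\<close>.\<close>

lemma Px_E1: assumes "h \<in> Px" shows "h E1 - E1 \<in> Kx"
proof -
  obtain l where l: "h \<in> octonion_auts" "h U1 = l \<bullet> U1" "l \<noteq> 0" using PxD[OF assms(1)] .
  have "l \<bullet> (U1 \<star> h E1) = h (U1 \<star> E1)" "l \<bullet> (h E1 \<star> U1) = h (E1 \<star> U1)"
    by (simp_all only: aut_mul[OF l(1)] l(2) zmul_smul_left zmul_smul_right)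
  moreover have "(U1 :: 'a zorn) \<star> E1 = 0" "(E1 :: 'a zorn) \<star> U1 = U1" by simp_all
  ultimately have e: "l \<bullet> (U1 \<star> h E1) = 0" "l \<bullet> (h E1 \<star> U1) = l \<bullet> U1"
    by (simp_all only: l(2) aut_0[OF l(1)])
  have "U1 \<star> h E1 = 0" "h E1 \<star> U1 = U1"
    using e l(3) by (simp_all only: zsmul_eq_0 zsmul_cancel simp_thms)
  then show ?thesis by (cases "h E1" rule: zorn_cases) (auto simp: zero_prod_def)
qed
lemma theta_Px: "theta (t, 0, 0) \<in> Px" "theta' (0, t, t') \<in> Px"
  by (auto simp: Px_def intro!: exI[of _ 1])

text \<open>The eigenvalue on \<open>U1\<close> is a character of \<open>Px\<close>, so a conjugate
  s with eigenvalue b on \<open>U1\<close> is not conjugate to g there. Translating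
  \<open>E1\<close> by multiples of \<open>U1\<close>, the conditions of \<open>section_good\<close>
  become (a^2 - 1) (1 - b) \<noteq> 0 and (a - 1) (1 - b^2) \<noteq> 0.\<close>

lemma good_eigenvalues:
  fixes g :: "'a::{finite,field} zorn \<Rightarrow> 'a zorn"
  assumes q: "card (UNIV :: 'a set) > 2" and g: "g \<in> octonion_auts" "g U1 = a \<bullet> U1"
    and y: "g y = b \<bullet> y" "y \<noteq> 0" and ab: "a \<noteq> b" "a * a \<noteq> 1" "b * b \<noteq> 1"
  shows "good g"
proof -
  note n = eigen_null[OF g(1) y(1) ab(3)]
  have U: "noncen U1" "ztr U1 = (0 :: 'a)" "znorm U1 = (0 :: 'a)" by (simp_all add: noncen_iff)
  obtain h where h: "h \<in> octonion_auts" "h y = U1"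
    by (rule transitive[OF null_noncen[OF y(2) n] U(1)]) (simp_all add: n)
  define s where "s = h \<circ> g \<circ> finv h"
  have gs: "conj_to g s" unfolding s_def using g(1) h(1) by (rule conj_toI)
  have sU: "s U1 = b \<bullet> U1"
    unfolding s_def using conj_apply[OF h(1), of g y] by (simp only: h(2) y(1) aut_smul[OF h(1)])
  have gP: "g \<in> Px" using g by (auto simp: Px_def)
  have sP: "s \<in> Px" using sU gs by (auto simp: Px_def conj_to_def)
  note lin = aut_smul[OF g(1)] aut_diff[OF g(1)] aut_smul[OF Px_aut[OF sP]] aut_diff[OF Px_aut[OF sP]]
  show ?thesis
  proof (rule section_good[OF q gs subgroup_Px gP sP theta_Px(1) _ subsp_0 subsp_Kx])
    show "h \<circ> g \<noteq> s \<circ> h" if hP: "h \<in> Px" for h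
    proof
      assume e: "h \<circ> g = s \<circ> h"
      obtain l where l: "h \<in> octonion_auts" "h U1 = l \<bullet> U1" "l \<noteq> 0" using PxD[OF hP] .
      have "h (g U1) = s (h U1)" using fun_cong[OF e, of U1] by simp
      then have "(a * l) \<bullet> (U1 :: 'a zorn) = (l * b) \<bullet> U1"
        by (simp only: g(2) l(2) lin sU aut_smul[OF l(1)] zsmul_zsmul)
      then show False using l(3) ab(1) by simp
    qed
    show "{0} \<subseteq> (Kx :: 'a zorn set)" using subspD(1)[OF subsp_Kx] by simp
    show "U1 \<in> (Kx :: 'a zorn set)" by simp
    show "h y \<in> Kx" if "h \<in> Px" "y \<in> Kx" for h and y :: "'a zorn" using Px_Kx that .
    show "h x \<in> {0}" if "h \<in> Px" "x \<in> {0}" for h and x :: "'a zorn"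
      using that aut_0 Px_aut by auto
    show "h E1 - E1 \<in> Kx" if "h \<in> Px" for h :: "'a zorn \<Rightarrow> 'a zorn" using Px_E1[OF that] .
    show "theta (t, 0, 0) y - y \<in> {0}" if "y \<in> Kx" for t and y :: "'a zorn"
      using that by (auto elim!: Kx_cases)
    show "theta (t, 0, 0) E1 - E1 - t \<bullet> U1 \<in> {0}" for t :: 'a by simp
    have 1: "U1 - b \<bullet> U1 = (1 - b) \<bullet> (U1 :: 'a zorn)" "U1 - (b * b) \<bullet> U1 = (1 - b * b) \<bullet> (U1 :: 'a zorn)"
      by simp_all
    have "(a * a - 1) * (1 - b) \<noteq> 0" "(a - 1) * (1 - b * b) \<noteq> 0" using ab by auto
    then show "g (g (U1 - s U1)) - (U1 - s U1) \<notin> {0}" "g (U1 - s (s U1)) - (U1 - s (s U1)) \<notin> {0}"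
      by (simp_all only: sU lin zsmul_zsmul 1 g(2)) (simp_all add: algebra_simps)
  qed
qed

text \<open>The invariant bilinear form supplies a second eigenvalue 1 / a, which differs from
  a.\<close>

lemma good_eigenvalue:
  fixes g :: "'a::{finite,field} zorn \<Rightarrow> 'a zorn"
  assumes q: "card (UNIV :: 'a set) > 2" and g: "g \<in> octonion_auts" "g x = a \<bullet> x" "x \<noteq> 0"
    and a: "a * a \<noteq> 1"
  shows "good g"
proof -
  note n = eigen_null[OF g(1,2) a]
  have a0: "a \<noteq> 0" using aut_neq_0[OF g(1,3)] g(2) by auto
  obtain h where h: "h \<in> octonion_auts" "h x = U1"
    by (rule transitive[OF null_noncen[OF g(3) n], of U1]) (simp_all add: n noncen_iff)
  define s where "s = h \<circ> g \<circ> finv h"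
  have gs: "conj_to g s" unfolding s_def using g(1) h(1) by (rule conj_toI)
  have sU: "s U1 = a \<bullet> U1"
    unfolding s_def using conj_apply[OF h(1), of g x] by (simp only: h(2) g(2) aut_smul[OF h(1)])
  have sa: "s \<in> octonion_auts" using gs by (simp add: conj_to_def)
  obtain y where y: "y \<noteq> 0" "s y = (1 / a) \<bullet> y" by (rule dual_eigenvector[OF sa sU]) auto
  have "a \<noteq> 1 / a" "1 / a * (1 / a) \<noteq> 1" using a a0 by (auto simp: field_simps)
  then have "good s" using good_eigenvalues[OF q sa sU y(2,1)] a by blast
  then show ?thesis using good_conj[OF gs] by simp
qed

text \<open>Without eigenvectors on the plane \<open>Kx / Lx\<close>, the matrices commuting with g
  there form a quadratic field. M consists of the elements of \<open>Px\<close> that act on the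
  plane through this field, and s is chosen to act as the field conjugate T - g, where T is the
  trace.\<close>

lemma good_irreducible_null:
  fixes g :: "'a::{finite,field} zorn \<Rightarrow> 'a zorn"
  assumes q: "card (UNIV :: 'a set) > 2" and gP: "g \<in> Px"
    and irr: "\<And>w \<beta>. w \<in> Kx \<Longrightarrow> g w - \<beta> \<bullet> w \<in> Lx \<Longrightarrow> w \<in> Lx"
    and l1: "g U1 = l \<bullet> U1" "l * l = 1"
  shows "good g"
proof -
  have ga: "g \<in> octonion_auts" using gP by (rule Px_aut)
  obtain x2 p r where g2: "g V2 = (0, (x2, 0, 0), (0, p, r), 0)"
    using Px_Kx[OF gP, of V2] by (auto elim!: Kx_cases)
  obtain x3 q' s' where g3: "g V3 = (0, (x3, 0, 0), (0, q', s'), 0)"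
    using Px_Kx[OF gP, of V3] by (auto elim!: Kx_cases)
  have det: "p * s' - q' * r = l"
  proof -
    have "g (V2 \<star> V3) = g V2 \<star> g V3" by (rule aut_mul[OF ga])
    moreover have "(V2 :: 'a zorn) \<star> V3 = (- 1) \<bullet> U1" by simp
    then have "g (V2 \<star> V3) = (- l) \<bullet> U1"
      by (simp only: aut_smul[OF ga] l1(1) zsmul_zsmul) simp
    ultimately show ?thesis by (simp add: g2 g3 algebra_simps)
  qed
  have r0: "r \<noteq> 0"
  proof
    assume "r = 0"
    then have "g V2 - p \<bullet> V2 \<in> Lx" by (simp add: g2 zero_prod_def)
    then show False using irr[of V2 p] by simp
  qed
  have q0: "q' \<noteq> 0"
  proof
    assume "q' = 0"
    then have "g V3 - s' \<bullet> V3 \<in> Lx" by (simp add: g3 zero_prod_def)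
    then show False using irr[of V3 s'] by simp
  qed
  \<comment> \<open>Chosen to conjugate the matrix of g on \<open>V2\<close>, \<open>V3\<close>
    modulo \<open>Lx\<close> into its adjugate; the entries r and q' are nonzero by
    irreducibility.\<close>
  define \<tau> where "\<tau> = sl3 (q' * r, 0, 0) (0, 0, - 1 / r) (0, 1 / q', 0)"
  have \<tau>: "\<tau> \<in> octonion_auts" unfolding \<tau>_def by (rule sl3_aut) (simp add: r0 q0)
  define s where "s = \<tau> \<circ> g \<circ> finv \<tau>"
  have gs: "conj_to g s" unfolding s_def using ga \<tau> by (rule conj_toI)
  have sa: "s \<in> octonion_auts" using gs by (simp add: conj_to_def)
  have \<tau>U: "\<tau> U1 = (q' * r) \<bullet> U1" "\<tau> V2 = (- r) \<bullet> V3" "\<tau> V3 = q' \<bullet> V2"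
    using r0 q0 by (simp_all add: \<tau>_def)
  have qr: "q' * r \<noteq> 0" using r0 q0 by simp
  have st: "s (\<tau> z) = \<tau> (g z)" for z unfolding s_def by (rule conj_apply[OF \<tau>])
  have gexp: "g (0, (x, 0, 0), (0, y2, y3), 0) =
      (0, (x * l + y2 * x2 + y3 * x3, 0, 0), (0, y2 * p + y3 * q', y2 * r + y3 * s'), 0)" for x y2 y3
    by (subst aut_expand[OF ga]) (simp add: l1(1) g2 g3)
  have texp: "\<tau> (0, (x, 0, 0), (0, y2, y3), 0) = (0, (x * (q' * r), 0, 0), (0, y3 * q', - (y2 * r)), 0)"
    for x y2 y3
    by (subst aut_expand[OF \<tau>]) (simp add: \<tau>U)
  have s1: "s U1 = l \<bullet> U1"
    using st[of "(1 / (q' * r)) \<bullet> U1"] qr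
    by (simp only: aut_smul[OF \<tau>] aut_smul[OF ga] \<tau>U l1(1) zsmul_zsmul) simp
  have "\<tau> ((- 1 / r) \<bullet> V2) = V3"
    by (simp only: aut_smul[OF \<tau>] \<tau>U zsmul_zsmul) (simp add: r0)
  then have "s V3 = \<tau> (g ((- 1 / r) \<bullet> V2))"
    using st[of "(- 1 / r) \<bullet> V2"] by simp
  then have "s V3 = (- 1 / r) \<bullet> \<tau> (g V2)" by (simp only: aut_smul[OF \<tau>] aut_smul[OF ga])
  then have s3: "s V3 = (0, ((- 1 / r) * (x2 * (q' * r)), 0, 0), (0, - q', p), 0)"
    by (simp add: g2 texp r0)
  have "\<tau> ((1 / q') \<bullet> V3) = V2"
    by (simp only: aut_smul[OF \<tau>] \<tau>U zsmul_zsmul) (simp add: q0)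
  then have "s V2 = \<tau> (g ((1 / q') \<bullet> V3))"
    using st[of "(1 / q') \<bullet> V3"] by simp
  then have "s V2 = (1 / q') \<bullet> \<tau> (g V3)" by (simp only: aut_smul[OF \<tau>] aut_smul[OF ga])
  then have s2: "s V2 = (0, ((1 / q') * (x3 * (q' * r)), 0, 0), (0, s', - r), 0)"
    by (simp add: g3 texp q0)
  have sexp: "s (0, (x, 0, 0), (0, y2, y3), 0) =
      (0, (x * l + y2 * ((1 / q') * (x3 * (q' * r))) + y3 * ((- 1 / r) * (x2 * (q' * r))), 0, 0),
        (0, y2 * s' - y3 * q', y3 * p - y2 * r), 0)" for x y2 y3
    by (subst aut_expand[OF sa]) (simp add: s1 s2 s3)
  have sP: "s \<in> Px" using sa s1 by (auto simp: Px_def)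
  define T where "T = p + s'"
  have sT: "s w - (T \<bullet> w - g w) \<in> Lx" if "w \<in> Kx" for w
    using that by (elim Kx_cases) (simp add: zero_prod_def gexp sexp T_def algebra_simps)
  note sL = subspD[OF subsp_Lx] and sK = subspD[OF subsp_Kx]
  define M where "M = {h \<in> Px. \<forall>z\<in>Kx. h (g z) - g (h z) \<in> Lx}"
  have Msub: "subgroup M G2"
  proof (rule subgroup_G2I)
    show "M \<subseteq> octonion_auts" using Px_aut by (auto simp: M_def)
    show "id \<in> M" by (simp add: M_def Px_id subspD(1)[OF subsp_Lx])
    fix h k assume hk: "h \<in> M" "k \<in> M"
    have "h (k (g z)) - g (h (k z)) \<in> Lx" if z: "z \<in> Kx" for z
    proof -
      have "h (k (g z) - g (k z)) \<in> Lx" by (rule Px_Lx) (use hk z in \<open>auto simp: M_def\<close>)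
      moreover have "h (g (k z)) - g (h (k z)) \<in> Lx" using hk Px_Kx[of k z] z by (simp add: M_def)
      moreover have "h \<in> octonion_auts" using hk Px_aut by (auto simp: M_def)
      ultimately show ?thesis
        using sL(2)[of "h (k (g z) - g (k z))" "h (g (k z)) - g (h (k z))"] by (simp add: aut_diff)
    qed
    then show "h \<circ> k \<in> M" using hk Px_comp by (auto simp: M_def)
  qed
  have gM: "g \<in> M" using gP by (simp add: M_def subspD(1)[OF subsp_Lx])
  have sM: "s \<in> M"
  proof -
    have "s (g z) - g (s z) \<in> Lx" if z: "z \<in> Kx" for z
    proof -
      have "s (g z) - (T \<bullet> g z - g (g z)) \<in> Lx" using sT[OF Px_Kx[OF gP z]] .
      moreover have "g (s z - (T \<bullet> z - g z)) \<in> Lx" using Px_Lx[OF gP sT[OF z]] .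
      ultimately show ?thesis
        using sL(4)[of "s (g z) - (T \<bullet> g z - g (g z))" "g (s z - (T \<bullet> z - g z))"]
        by (simp add: aut_diff[OF ga] aut_smul[OF ga])
    qed
    then show ?thesis using sP by (simp add: M_def)
  qed
  have kK: "theta' (0, t, 0) y - y \<in> Lx" if "y \<in> Kx" for t and y :: "'a zorn"
    using that by (elim Kx_cases) (simp add: zero_prod_def)
  have kM: "theta' (0, t, 0) \<in> M" for t
  proof -
    have "theta' (0, t, 0) (g z) - g (theta' (0, t, 0) z) \<in> Lx" if z: "z \<in> Kx" for z
      using sL(4)[OF kK[OF Px_Kx[OF gP z]] Px_Lx[OF gP kK[OF z]], of t t] by (simp add: aut_diff[OF ga])
    then show ?thesis using theta_Px(2) by (simp add: M_def)
  qed
  have sirr: "w \<in> Lx" if w: "w \<in> Kx" "s w - \<beta> \<bullet> w \<in> Lx" for w \<beta>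
  proof -
    have "g w - (T - \<beta>) \<bullet> w \<in> Lx"
      using sL(4)[OF sT[OF w(1)] w(2)] by (simp add: zsmul_diff_left algebra_simps)
    then show ?thesis using irr w(1) by blast
  qed
  have V2K: "V2 \<in> Kx" "V2 \<notin> Lx" by simp_all
  define z1 where "z1 = V2 - s V2"
  have z1K: "z1 \<in> Kx" unfolding z1_def using sK(4)[OF V2K(1) Px_Kx[OF sP V2K(1)]] .
  have z1L: "z1 \<notin> Lx"
  proof
    assume "z1 \<in> Lx"
    then have "s V2 - 1 \<bullet> V2 \<in> Lx" using sL(5)[of z1] by (simp only: z1_def zsmul_1 minus_diff_eq)
    then show False using sirr[OF V2K(1)] V2K(2) by blast
  qed
  have neg1: "w + s w \<in> Lx \<Longrightarrow> w \<in> Kx \<Longrightarrow> w \<in> Lx" for w using sirr[of w "- 1"] by (simp add: zsmul_minus add.commute)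
  have neg2: "w + g w \<in> Lx \<Longrightarrow> w \<in> Kx \<Longrightarrow> w \<in> Lx" for w using irr[of w "- 1"] by (simp add: zsmul_minus add.commute)
  have pos2: "g w - w \<in> Lx \<Longrightarrow> w \<in> Kx \<Longrightarrow> w \<in> Lx" for w using irr[of w "1"] by simp
  show ?thesis
  proof (rule section_good[OF q gs Msub gM sM kM _ subsp_Lx subsp_Kx Lx_Kx])
    show "h \<circ> g \<noteq> s \<circ> h" if hM: "h \<in> M" for h
    proof
      assume e: "h \<circ> g = s \<circ> h"
      have hP: "h \<in> Px" using hM by (simp add: M_def)
      obtain m where m: "h \<in> octonion_auts" "h U1 = m \<bullet> U1" "m \<noteq> 0" using PxD[OF hP] .
      define w where "w = h V2"
      have wK: "w \<in> Kx" unfolding w_def using Px_Kx[OF hP V2K(1)] .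
      have wL: "w \<notin> Lx"
      proof
        assume "w \<in> Lx"
        then obtain c where "h V2 = c \<bullet> U1" by (auto simp: Lx_def w_def)
        then have "h V2 = h ((c / m) \<bullet> U1)" using m(3) by (simp only: aut_smul[OF m(1)] m(2) zsmul_zsmul) simp
        then show False by (simp add: aut_inj[OF m(1)])
      qed
      have "h (g V2) = s w" using fun_cong[OF e, of V2] by (simp add: w_def)
      moreover have "h (g V2) - g w \<in> Lx" using hM V2K(1) by (auto simp: M_def w_def)
      ultimately have "s w - g w \<in> Lx" by simp
      then have 2: "T \<bullet> w - g w - g w \<in> Lx"
        using sL(4)[OF _ sT[OF wK], of "s w - g w"] by (simp add: algebra_simps)
      \<comment> \<open>If 2 is invertible, 2 g w = T w modulo \<open>Lx\<close> makes w an
        eigenvector. In characteristic 2 it forces T = 0 and l = 1; a matrix of trace 0 and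
        determinant 1 has the eigenvalue 1, here with eigenvector (p + 1, r).\<close>
      show False
      proof (cases "(2 :: 'a) = 0")
        case False
        have h: "(T / 2) \<bullet> w + (T / 2) \<bullet> w = T \<bullet> w"
          by (simp only: zsmul_add_left[symmetric]) (simp add: False del: zsmul.simps)
        have d: "2 \<bullet> y = y + y" for y :: "'a zorn"
          using zsmul_add_left[of 1 1 y] by (simp only: one_add_one zsmul_1)
        have "2 \<bullet> (g w - (T / 2) \<bullet> w) = - (T \<bullet> w - g w - g w)"
          by (simp only: d h[symmetric]) (simp add: algebra_simps)
        then have "2 \<bullet> (g w - (T / 2) \<bullet> w) \<in> Lx" using sL(5)[OF 2] by simp
        from sL(3)[OF this, of "1 / 2"] have "g w - (T / 2) \<bullet> w \<in> Lx"
          using False by (simp del: zsmul.simps)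
        then show False using irr[OF wK] wL by blast
      next
        case True
        then have m2: "x + x = 0" for x :: 'a by (metis mult_2 mult_zero_left)
        have "g w + g w = (1 + 1) \<bullet> g w" by (simp only: zsmul_add_left) simp
        also have "\<dots> = 0" using m2[of 1] by (simp del: zsmul.simps)
        finally have "T \<bullet> w \<in> Lx" using 2 by (simp add: algebra_simps)
        have T0: "T = 0"
        proof (rule ccontr)
          assume "T \<noteq> 0"
          then show False using sL(3)[OF \<open>T \<bullet> w \<in> Lx\<close>, of "1 / T"] wL by (simp del: zsmul.simps)
        qed
        have mm: "- x = x" for x :: 'a using m2[of x] by (simp add: neg_eq_iff_add_eq_0)
        have "p + s' = p + p" using T0 m2[of p] by (simp only: T_def)
        then have sp: "s' = p" by (rule add_left_imp_eq)
        have "(l - 1) * (l - 1) = 0" using l1(2) mm[of l] m2[of 1] by (simp add: algebra_simps)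
        then have "l = 1" by simp
        then have d: "p * p + q' * r = 1" using det sp mm[of "q' * r"] by (simp add: diff_conv_add_uminus del: add_uminus_conv_diff)
        have "g (0, (0, 0, 0), (0, p + 1, r), 0) - 1 \<bullet> (0, (0, 0, 0), (0, p + 1, r), 0) \<in> Lx"
          using d m2[of p] m2[of 1] m2[of r] m2[of "p * r"] by (simp add: zero_prod_def gexp sp algebra_simps)
        then show False using irr[of "(0, (0, 0, 0), (0, p + 1, r), 0)" 1] r0 by simp
      qed
    qed
    show "V2 \<in> (Kx :: 'a zorn set)" by simp
    show "h y \<in> Kx" if "h \<in> M" "y \<in> Kx" for h y using Px_Kx[of h y] that by (simp add: M_def)
    show "h x \<in> Lx" if "h \<in> M" "x \<in> Lx" for h x using Px_Lx[of h x] that by (simp add: M_def)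
    show "h E1 - E1 \<in> Kx" if "h \<in> M" for h using Px_E1[of h] that by (simp add: M_def)
    show "theta' (0, t, 0) y - y \<in> Lx" if "y \<in> Kx" for t and y :: "'a zorn" using kK that .
    show "theta' (0, t, 0) E1 - E1 - t \<bullet> V2 \<in> Lx" for t :: 'a by (simp add: zero_prod_def)
    show "g (g (V2 - s V2)) - (V2 - s V2) \<notin> Lx"
    proof
      assume a: "g (g (V2 - s V2)) - (V2 - s V2) \<in> Lx"
      have gz: "g z1 \<in> Kx" using Px_Kx[OF gP z1K] .
      have "g (g z1 + z1) - (g z1 + z1) \<in> Lx"
        using a by (simp add: z1_def[symmetric] aut_add[OF ga] algebra_simps)
      then have "g z1 + z1 \<in> Lx" using pos2 sK(2)[OF gz z1K] by blast
      then show False using neg2[of z1] z1K z1L by (simp add: add.commute)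
    qed
    show "g (V2 - s (s V2)) - (V2 - s (s V2)) \<notin> Lx"
    proof
      assume a: "g (V2 - s (s V2)) - (V2 - s (s V2)) \<in> Lx"
      have e: "V2 - s (s V2) = z1 + s z1" by (simp add: z1_def aut_diff[OF sa])
      have sz: "s z1 \<in> Kx" using Px_Kx[OF sP z1K] .
      have "z1 + s z1 \<in> Lx" using pos2[of "z1 + s z1"] a sK(2)[OF z1K sz] by (simp add: e)
      then show False using neg1 z1K z1L by blast
    qed
  qed
qed


section \<open>Special planes: spans of two null vectors with product zero\<close>

lemma anticommute: "ztr x = 0 \<Longrightarrow> ztr y = 0 \<Longrightarrow> x \<star> y + y \<star> x = (- zbil x y) \<bullet> Zid"
  "ztr x = 0 \<Longrightarrow> ztr y = 0 \<Longrightarrow> ztr (x \<star> y) = - zbil x y"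
  by (cases x rule: zorn_cases; cases y rule: zorn_cases; simp add: algebra_simps add_eq_0_iff)+

lemma special_sym:
  assumes "ztr x = 0" "ztr y = 0" "x \<star> y = 0" shows "y \<star> x = 0"
  using anticommute[OF assms(1,2)] assms(3) by (simp del: zsmul.simps)

text \<open>After x has become \<open>U1\<close>, y lies in \<open>Kx\<close>. An element of SL2
  acting on \<open>V2\<close> and \<open>V3\<close> makes its class modulo \<open>Lx\<close> equal
  to that of \<open>V2\<close>, and \<open>theta'\<close> removes the remaining multiple of
  \<open>U1\<close>.\<close>

lemma special_pair:
  assumes x: "x \<noteq> 0" "ztr x = 0" "znorm x = 0" and y: "ztr y = 0" "x \<star> y = 0" "\<And>c. y \<noteq> c \<bullet> x"
  obtains h where "h \<in> octonion_auts" "h x = U1" "h y = V2"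
proof -
  obtain h where h: "h \<in> octonion_auts" "h x = U1"
    by (rule transitive[OF null_noncen[OF x], of U1]) (simp_all add: x noncen_iff)
  have "U1 \<star> h y = h (x \<star> y)" "h y \<star> U1 = h (y \<star> x)"
    by (simp_all only: h(2)[symmetric] aut_mul[OF h(1)])
  then have "h y \<in> Kx" using special_sym[OF x(2) y(1,2)] y(2) aut_0[OF h(1)]
    by (simp only: Kx_def mem_Collect_eq)
  then obtain c y2 y3 where hy: "h y = (0, (c, 0, 0), (0, y2, y3), 0)" by (rule Kx_cases)
  have ne: "\<not> (y2 = 0 \<and> y3 = 0)"
  proof
    assume "y2 = 0 \<and> y3 = 0"
    then have "h y = h (c \<bullet> x)" by (simp only: hy aut_smul[OF h(1)] h(2)) simp
    then show False using y(3) by (simp only: aut_inj[OF h(1)])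
  qed
  obtain q2 q3 where q: "q2 * y2 + q3 * y3 = 1"
  proof (cases "y2 = 0")
    case True then show ?thesis using that[of 0 "1 / y3"] ne by simp
  next
    case False then show ?thesis using that[of "1 / y2" 0] by simp
  qed
  define f where "f = sl3 (1, 0, 0) (0, q2, q3) (0, - y3, y2)"
  have f: "f \<in> octonion_auts" unfolding f_def using q by (intro sl3_aut) simp
  have fU: "f U1 = U1" and fV: "f V2 = (0, (0, 0, 0), (0, y2, y3), 0)" by (simp_all add: f_def)
  have "f (c \<bullet> U1 + V2) = h y" by (simp only: aut_add[OF f] aut_smul[OF f] fU fV hy) simp
  then have e: "finv f (h y) = (0, (c, 0, 0), (0, 1, 0), 0)" "finv f U1 = U1"
    using aut_inv_f(1)[OF f, of "c \<bullet> U1 + V2"] aut_inv_f(1)[OF f, of U1] by (simp_all add: fU)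
  show thesis
  proof (rule that[of "theta' (0, 0, c) \<circ> finv f \<circ> h"])
    show "theta' (0, 0, c) \<circ> finv f \<circ> h \<in> octonion_auts" using f h by (intro aut_comp aut_inv) auto
  qed (simp_all add: h(2) e)
qed

text \<open>The long root elements \<open>k t\<close> attached to the plane of \<open>U1\<close> and
  \<open>V2\<close> are inverted by g and also by s, in which the eigenvalues 1 and - 1 are
  interchanged. Replacing s by its conjugate k 2 \<circ> s multiplies (g s)^2 by k (- 4) and (s g)^2
  by k 4; in odd characteristic this separates the squares if they were equal.\<close>

lemma good_special_pair:
  fixes g :: "'a::{finite,field} zorn \<Rightarrow> 'a zorn"
  assumes 2: "(2 :: 'a) \<noteq> 0" and g: "g \<in> octonion_auts" "g U1 = U1" "g V2 = - V2"
  shows "good g"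
proof -
  define k :: "'a \<Rightarrow> 'a zorn \<Rightarrow> 'a zorn" where "k t = sl3 (1, 0, 0) (t, 1, 0) (0, 0, 1)" for t
  have ka: "k t \<in> octonion_auts" for t unfolding k_def by (rule sl3_aut) simp
  have keq: "k t z = z - (t * zbil z V2) \<bullet> U1 + (t * zbil z U1) \<bullet> V2" for t z
    by (cases z rule: zorn_cases) (simp add: k_def algebra_simps)
  have kk: "k t (k t' z) = k (t + t') z" for t t' z
    by (cases z rule: zorn_cases) (simp add: k_def algebra_simps)
  obtain h :: "'a zorn \<Rightarrow> 'a zorn" where h: "h \<in> octonion_auts" "h V2 = U1" "h U1 = V2"
    by (rule special_pair[of "V2 :: 'a zorn" U1]) (auto simp: zero_prod_def)
  define s where "s = h \<circ> g \<circ> finv h"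
  have gs: "conj_to g s" unfolding s_def using g(1) h(1) by (rule conj_toI)
  have sa: "s \<in> octonion_auts" using gs by (simp add: conj_to_def)
  have sU: "s U1 = - U1" "s V2 = V2"
    unfolding s_def using conj_apply[OF h(1), of g V2] conj_apply[OF h(1), of g U1]
    by (simp_all only: h(2,3) g(2,3) aut_uminus[OF h(1)])
  have bm: "zbil z (- w) = - zbil z w" for z w :: "'a zorn"
    using zbil_uminus[of w z] by (simp only: zbil_sym)
  have gb: "zbil z V2 = - zbil (g z) V2" "zbil z U1 = zbil (g z) U1" for z
    using aut_bil[OF g(1), of z V2] aut_bil[OF g(1), of z U1] by (simp_all only: g(2,3) bm)
  have sb: "zbil z V2 = zbil (s z) V2" "zbil z U1 = - zbil (s z) U1" for z
    using aut_bil[OF sa, of z V2] aut_bil[OF sa, of z U1] by (simp_all only: sU bm)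
  have gk: "g (k t z) = k (- t) (g z)" for t z
    by (simp only: keq aut_add[OF g(1)] aut_diff[OF g(1)] aut_smul[OF g(1)] g(2,3) zsmul_uminus gb[of z])
       (simp add: zsmul_minus del: zsmul.simps zbil.simps)
  have sk: "s (k t z) = k (- t) (s z)" for t z
    by (simp only: keq aut_add[OF sa] aut_diff[OF sa] aut_smul[OF sa] sU zsmul_uminus sb[of z])
       (simp add: zsmul_minus del: zsmul.simps zbil.simps)
  have k0: "k 0 z = z" for z by (simp add: keq)
  define s' where "s' = k 1 \<circ> s \<circ> finv (k 1)"
  have fk: "finv (k 1) = k (- 1)"
  proof
    show "finv (k 1) z = k (- 1) z" for z
      using aut_inv_f(1)[OF ka, of 1 "k (- 1) z"] by (simp add: kk k0)
  qed
  have s': "s' z = k 2 (s z)" for z by (simp add: s'_def fk sk kk)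
  have gs': "conj_to g s'" using conj_to_trans[OF gs conj_toI[OF sa ka[of 1]]] by (simp add: s'_def)
  have gP: "g \<in> Px" using g by (auto simp: Px_def intro!: exI[of _ 1])
  have kU: "k t U1 = U1" for t by (simp add: k_def)
  have sP: "s \<in> Px" "s' \<in> Px"
    using sa sU(1) gs' by (auto simp: Px_def conj_to_def s' k_def intro!: exI[of _ "- 1"])
  have nc: "h \<circ> g \<noteq> f \<circ> h" if hP: "h \<in> Px" and f: "f \<in> octonion_auts" "f U1 = - U1" for h f
  proof
    assume e: "h \<circ> g = f \<circ> h"
    obtain l where l: "h \<in> octonion_auts" "h U1 = l \<bullet> U1" "l \<noteq> 0" using PxD[OF hP] .
    have "l \<bullet> U1 = f (l \<bullet> U1)" using fun_cong[OF e, of U1] by (simp only: comp_apply g(2) l(2))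
    then have "l \<bullet> U1 = l \<bullet> - U1" by (simp only: aut_smul[OF f(1)] f(2))
    then have "l = - l" by simp
    then have "2 * l = 0" by (simp add: eq_neg_iff_add_eq_0)
    then show False using 2 l(3) by simp
  qed
  have s'U: "s' U1 = - U1" by (simp add: s' sU k_def)
  have s'a: "s' \<in> octonion_auts" using gs' by (simp add: conj_to_def)
  show ?thesis
  proof (cases "(g \<circ> s) \<circ> (g \<circ> s) = (s \<circ> g) \<circ> (s \<circ> g)")
    case False
    show ?thesis by (rule good_D[OF gs subgroup_Px gP sP(1) nc[OF _ sa sU(1)] False])
  next
    case True
    have ne: "(g \<circ> s') \<circ> (g \<circ> s') \<noteq> (s' \<circ> g) \<circ> (s' \<circ> g)"
    proof
      assume e: "(g \<circ> s') \<circ> (g \<circ> s') = (s' \<circ> g) \<circ> (s' \<circ> g)"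
      obtain z where z: "g (s (g (s z))) = U2"
        by (rule aut_surj[of "g \<circ> s \<circ> (g \<circ> s)" U2]) (use g sa in \<open>auto intro!: aut_comp\<close>)
      have "s (g (s (g z))) = U2" using fun_cong[OF True, of z] z by simp
      then have "k (- 4) U2 = k 4 U2"
        using fun_cong[OF e, of z] z by (simp add: s' gk sk kk)
      then have "(4 :: 'a) + 4 = 0" by (simp add: k_def eq_neg_iff_add_eq_0)
      moreover have "(2 :: 'a) * 2 * 2 = 4 + 4" by simp
      ultimately have "(2 :: 'a) * 2 * 2 = 0" by (simp only:)
      then show False using 2 by (simp only: mult_eq_0_iff simp_thms)
    qed
    show ?thesis by (rule good_D[OF gs' subgroup_Px gP sP(2) nc[OF _ s'a s'U] ne])
  qed
qed

text \<open>Unitriangular on the flag of \<open>U1\<close>, \<open>V2\<close>, \<open>V3\<close>.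
  These elements form a maximal unipotent subgroup; the six parameters of \<open>uel\<close> reflect
  its six root subgroups.\<close>

definition unip :: "('a::field zorn \<Rightarrow> 'a zorn) \<Rightarrow> 'a \<Rightarrow> 'a \<Rightarrow> 'a \<Rightarrow> bool" where
  "unip g a b c \<longleftrightarrow> g \<in> octonion_auts \<and> g U1 = U1 \<and> g V2 = (0, (a, 0, 0), (0, 1, 0), 0) \<and>
     g V3 = (0, (c, 0, 0), (0, b, 1), 0)"

text \<open>All eigenvalues may be taken to be 1 or - 1, and g to be reducible on
  \<open>Kx / Lx\<close>. Then g is triangular on \<open>Kx\<close> with diagonal l, \<beta>, s, and
  \<beta> s = l because V2 V3 = - U1. If both signs occur, suitable eigenvectors form a pair as in
  \<open>good_special_pair\<close>; otherwise the diagonal is 1, 1, 1.\<close>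

lemma null_line_cases:
  fixes g :: "'a::{finite,field} zorn \<Rightarrow> 'a zorn"
  assumes q: "card (UNIV :: 'a set) > 2" and g: "g \<in> octonion_auts"
    and x: "x \<noteq> 0" "ztr x = 0" "znorm x = 0" "g x = l \<bullet> x"
  shows "good g \<or> (\<exists>g' a b c. conj_to g g' \<and> unip g' a b c)"
proof (cases "good g")
  case ng: False
  have eig: "b * b = 1" if "conj_to g g'" "g' y = b \<bullet> y" "y \<noteq> 0" for g' y b
    using good_eigenvalue[OF q, of g' y b] that good_conj[OF that(1)] ng by (auto simp: conj_to_def)
  have spec: False if 2: "(2 :: 'a) \<noteq> 0" and g': "conj_to g g'" and
     y: "y \<noteq> 0" "ztr y = 0" "znorm y = 0" "g' y = y" "ztr w = 0" "w \<noteq> 0" "y \<star> w = 0" "g' w = - w" for g' y w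
  proof -
    have g'a: "g' \<in> octonion_auts" using g' by (simp add: conj_to_def)
    have "w \<noteq> c \<bullet> y" for c
    proof
      assume e: "w = c \<bullet> y"
      then have "g' w = w" by (simp only: aut_smul[OF g'a] y(4))
      then have "w = - w" using y(8) by simp
      then have "w + w = 0" by (metis add.right_inverse)
      then have "2 \<bullet> w = 0" by (simp add: zsmul_add_left[of 1 1, simplified])
      then show False using 2 y(6) by simp
    qed
    then obtain h where h: "h \<in> octonion_auts" "h y = U1" "h w = V2"
      using special_pair[OF y(1,2,3) y(5,7)] by blast
    define g2 where "g2 = h \<circ> g' \<circ> finv h"
    have c: "conj_to g' g2" unfolding g2_def using g'a h(1) by (rule conj_toI)
    have "g2 U1 = U1" "g2 V2 = - V2" "g2 \<in> octonion_auts"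
      using conj_apply[OF h(1), of g' y] conj_apply[OF h(1), of g' w] c
      by (simp_all only: g2_def[symmetric] h(2,3) y(4,8) aut_uminus[OF h(1)] conj_to_def)
    then have "good g2" using good_special_pair[OF 2] by blast
    then show False using good_conj[OF g'] good_conj[OF c] ng by simp
  qed
  obtain h where h: "h \<in> octonion_auts" "h x = U1"
    by (rule transitive[OF null_noncen[OF x(1-3)], of U1]) (simp_all add: x noncen_iff)
  define g1 where "g1 = h \<circ> g \<circ> finv h"
  have c1: "conj_to g g1" unfolding g1_def using g h(1) by (rule conj_toI)
  have g1: "g1 \<in> octonion_auts" using c1 by (simp add: conj_to_def)
  have g1U: "g1 U1 = l \<bullet> U1"
    using conj_apply[OF h(1), of g x] by (simp only: g1_def h(2) x(4) aut_smul[OF h(1)])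
  have l: "l * l = 1" using eig[OF c1 g1U] by simp
  have g1P: "g1 \<in> Px" using g1 g1U by (auto simp: Px_def)
  have "\<not> good g1" using good_conj[OF c1] ng by simp
  then obtain w \<beta> where w: "w \<in> Kx" "g1 w - \<beta> \<bullet> w \<in> Lx" "w \<notin> Lx"
    using good_irreducible_null[OF q g1P _ g1U l] by blast
  have "w \<noteq> c \<bullet> U1" for c using w(3) by (auto simp: Lx_def)
  moreover have "ztr w = 0" "U1 \<star> w = 0" using w(1) by (auto elim!: Kx_cases simp: zero_prod_def)
  ultimately obtain h2 where h2: "h2 \<in> octonion_auts" "h2 U1 = U1" "h2 w = V2"
    using special_pair[of U1 w] by (auto simp: zero_prod_def)
  define g2 where "g2 = h2 \<circ> g1 \<circ> finv h2"
  have c2: "conj_to g g2" unfolding g2_def using c1 g1 h2(1) conj_toI conj_to_trans by blast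
  have g2: "g2 \<in> octonion_auts" using c2 by (simp add: conj_to_def)
  have g2U: "g2 U1 = l \<bullet> U1"
    using conj_apply[OF h2(1), of g1 U1] by (simp only: g2_def h2(2) g1U aut_smul[OF h2(1)])
  obtain d where "g1 w - \<beta> \<bullet> w = d \<bullet> U1" using w(2) by (auto simp: Lx_def)
  then have "g1 w = \<beta> \<bullet> w + d \<bullet> U1" by (simp add: algebra_simps)
  then have g2V: "g2 V2 = \<beta> \<bullet> V2 + d \<bullet> U1"
    using conj_apply[OF h2(1), of g1 w]
    by (simp only: g2_def h2(2,3) aut_add[OF h2(1)] aut_smul[OF h2(1)])
  have g2P: "g2 \<in> Px" using g2 g2U by (auto simp: Px_def)
  obtain c b s where g23: "g2 V3 = (0, (c, 0, 0), (0, b, s), 0)"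
    using Px_Kx[OF g2P, of V3] by (auto elim!: Kx_cases)
  have "g2 (V2 \<star> V3) = g2 V2 \<star> g2 V3" by (rule aut_mul[OF g2])
  moreover have "(V2 :: 'a zorn) \<star> V3 = (- 1) \<bullet> U1" by simp
  then have "g2 (V2 \<star> V3) = (- l) \<bullet> U1"
    by (simp only: aut_smul[OF g2] g2U zsmul_zsmul) simp
  ultimately have bs: "\<beta> * s = l" by (simp add: g2V g23 algebra_simps)
  have exp: "g2 (0, (x, 0, 0), (0, y2, y3), 0) =
      (0, (x * l + y2 * d + y3 * c, 0, 0), (0, y2 * \<beta> + y3 * b, y3 * s), 0)" for x y2 y3
    by (subst aut_expand[OF g2]) (simp add: g2U g2V g23)
  have pm: "z = 1 \<or> z = - 1" if "z * z = 1" for z :: 'a using that by (simp add: square_eq_1_iff)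
  show ?thesis
  proof (cases "\<beta> = l")
    case False
    define y :: "'a zorn" where "y = (0, (d / (\<beta> - l), 0, 0), (0, 1, 0), 0)"
    have "d + d / (\<beta> - l) * l = \<beta> * (d / (\<beta> - l))" using False by (simp add: field_simps)
    then have gy: "g2 y = \<beta> \<bullet> y" by (simp add: y_def exp algebra_simps)
    have y: "y \<noteq> 0" "ztr y = 0" "znorm y = 0" "U1 \<star> y = 0" "y \<star> U1 = 0"
      by (simp_all add: y_def zero_prod_def)
    have "\<beta> * \<beta> = 1" using eig[OF c2 gy y(1)] .
    then have bl: "(\<beta> = 1 \<and> l = - 1) \<or> (\<beta> = - 1 \<and> l = 1)" using pm[OF \<open>\<beta> * \<beta> = 1\<close>] pm[OF l] False by auto
    have 2: "(2 :: 'a) \<noteq> 0"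
    proof
      assume "(2 :: 'a) = 0"
      then have "1 + 1 = (0 :: 'a)" by simp
      then have "- 1 = (1 :: 'a)" by (rule minus_unique)
      then show False using bl False by auto
    qed
    have Uz: "U1 \<noteq> (0 :: 'a zorn)" "ztr U1 = (0 :: 'a)" "znorm U1 = (0 :: 'a)" by (simp_all add: zero_prod_def)
    show ?thesis using bl
    proof
      assume b: "\<beta> = 1 \<and> l = - 1"
      then have "g2 y = y" "g2 U1 = - U1" using gy g2U by simp_all
      then show ?thesis using spec[OF 2 c2 y(1,2,3) _ Uz(2,1) y(5)] by blast
    next
      assume b: "\<beta> = - 1 \<and> l = 1"
      then have "g2 U1 = U1" "g2 y = - y" using gy g2U by (simp_all add: zsmul_minus del: zsmul.simps) 
      then show ?thesis using spec[OF 2 c2 Uz _ y(2,1,4)] by blast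
    qed
  next
    case bl: True
    have "l \<noteq> 0" using l by auto
    then have s: "s = 1" using bs bl by simp
    show ?thesis
    proof (cases "l = 1")
      case True
      then have "unip g2 d b c" using g2 g2U g2V g23 bl s by (simp add: unip_def)
      then show ?thesis using c2 by blast
    next
      case False
      then have l1: "l = - 1" using pm l by blast
      have 2: "(2 :: 'a) \<noteq> 0"
      proof
        assume "(2 :: 'a) = 0"
        then have "1 + 1 = (0 :: 'a)" by simp
        then have "- 1 = (1 :: 'a)" by (rule minus_unique)
        then show False using l1 False by auto
      qed
      define hh :: 'a where "hh = 1 / 2"
      have "hh + hh = 1" using 2 by (simp add: hh_def)
      then have hz: "z * hh + z * hh = z" for z by (metis distrib_left mult_1_right)
      \<comment> \<open>The diagonal is - 1, - 1, 1. Solving g2 y = y with coefficient 1 at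
        \<open>V3\<close> gives b / 2 at \<open>V2\<close> and then A / 2 at
        \<open>U1\<close>.\<close>
      define A where "A = c + b * hh * d"
      define y :: "'a zorn" where "y = (0, (A * hh, 0, 0), (0, b * hh, 1), 0)"
      have h2: "hh * 2 = 1" using 2 by (simp add: hh_def)
      have gy: "g2 y = y" using hz[of b]
        by (simp add: y_def exp bl l1 s A_def h2 algebra_simps)
      have y: "y \<noteq> 0" "ztr y = 0" "znorm y = 0" "y \<star> U1 = 0"
        by (simp_all add: y_def zero_prod_def)
      have "g2 U1 = - U1" using g2U l1 by simp
      then show ?thesis using spec[OF 2 c2 y(1,2,3) gy _ _ y(4)] by (simp add: zero_prod_def)
    qed
  qed
qed simp

section \<open>Unipotent elements\<close>

lemma aut_eqI:
  assumes f: "f \<in> octonion_auts" and g: "g \<in> octonion_auts"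
    and e: "f E1 = g E1" "f U1 = g U1" "f U2 = g U2" "f U3 = g U3"
  shows "f = g"
proof
  fix z
  have "(V1 :: 'a zorn) = U2 \<star> U3" "(V2 :: 'a zorn) = U3 \<star> U1" "(V3 :: 'a zorn) = U1 \<star> U2"
    by simp_all
  then have v: "f V1 = g V1" "f V2 = g V2" "f V3 = g V3"
    by (simp_all only: aut_mul[OF f] aut_mul[OF g] e)
  have "(E2 :: 'a zorn) = Zid - E1" by simp
  then have "f E2 = g E2" by (simp only: aut_diff[OF f] aut_diff[OF g] aut_Id[OF f] aut_Id[OF g] e)
  then show "f z = g z"
  proof (cases z rule: zorn_cases)
    case (1 a u1 u2 u3 v1 v2 v3 b)
    show ?thesis
      unfolding 1 aut_expand[OF f, of a u1 u2 u3 v1 v2 v3 b] aut_expand[OF g, of a u1 u2 u3 v1 v2 v3 b]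
        e v \<open>f E2 = g E2\<close> ..
  qed
qed

lemma smul3_zero [simp]: "smul3 c 0 = 0" by (simp add: zero_prod_def)

definition uel :: "'a::field \<Rightarrow> 'a \<Rightarrow> 'a \<Rightarrow> 'a \<Rightarrow> 'a \<Rightarrow> 'a \<Rightarrow> 'a zorn \<Rightarrow> 'a zorn" where
  "uel a b c d e f = theta (d, 0, 0) \<circ> theta' (0, c, - a) \<circ> sl3 (1, 0, 0) (0, 1, - b) (0, 0, 1) \<circ>
     sl3 (1, 0, 0) (f, 1, 0) (e, 0, 1)"

lemma uel_aut: "uel a b c d e f \<in> octonion_auts"
  unfolding uel_def by (intro aut_comp sl3_aut theta_aut theta'_aut) simp_all

lemma uel_values:
  "uel a b c d e f U1 = U1" "uel a b c d e f V2 = (0, (a, 0, 0), (0, 1, 0), 0)"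
  "uel a b c d e f V3 = (0, (a * b + c, 0, 0), (0, b, 1), 0)"
  "uel a b c d e f E1 = (1, (d, 0, 0), (0, c, - a), 0)"
  "uel a b c d e f U3 = (a, (2 * a * d + e, 0, 1), (0, a * c - d, - a * a), - a)"
  by (simp_all add: uel_def algebra_simps)

lemma aut_fix4:
  assumes r: "r \<in> octonion_auts" "r U1 = U1" "r V2 = V2" "r V3 = V3" "r E1 = E1"
  obtains e f where "r = sl3 (1, 0, 0) (f, 1, 0) (e, 0, 1)"
proof -
  have *: "\<exists>y. r (0, (0, u2, u3), (0, 0, 0), 0) = (0, (y, u2, u3), (0, 0, 0), 0)" for u2 u3
  proof -
    let ?y = "(0, (0, u2, u3), (0, 0, 0), 0)"
    have "E1 \<star> ?y = ?y" "?y \<star> E1 = 0" by (simp_all add: zero_prod_def)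
    then have "E1 \<star> r ?y = r ?y" "r ?y \<star> E1 = 0"
      using aut_mul[OF r(1), of E1 ?y] aut_mul[OF r(1), of ?y E1] aut_0[OF r(1)] by (simp_all only: r(5))
    moreover have "zbil (r ?y) V2 = - u2" "zbil (r ?y) V3 = - u3"
      using aut_bil[OF r(1), of ?y V2] aut_bil[OF r(1), of ?y V3] unfolding r(3,4) by simp_all
    ultimately show ?thesis by (cases "r ?y" rule: zorn_cases) (simp add: zero_prod_def)
  qed
  obtain f where f: "r U2 = (0, (f, 1, 0), (0, 0, 0), 0)" using *[of 1 0] by blast
  obtain e where e: "r U3 = (0, (e, 0, 1), (0, 0, 0), 0)" using *[of 0 1] by blast
  have "r = sl3 (1, 0, 0) (f, 1, 0) (e, 0, 1)"
    by (rule aut_eqI[OF r(1) sl3_aut]) (simp_all add: r e f)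
  then show thesis using that by blast
qed

text \<open>The coordinates of \<open>g E1\<close> at \<open>V2\<close> and \<open>V3\<close> are
  forced by E1 V2 = E1 V3 = 0; only d remains free.\<close>

lemma unip_E1:
  assumes g: "unip g a b c"
  obtains d where "g E1 = (1, (d, 0, 0), (0, c - a * b, - a), 0)"
proof -
  have ga: "g \<in> octonion_auts" and v: "g V2 = (0, (a, 0, 0), (0, 1, 0), 0)" "g V3 = (0, (c, 0, 0), (0, b, 1), 0)"
    and gP: "g \<in> Px"
    using g by (auto simp: unip_def Px_def intro!: exI[of _ 1])
  obtain d y2 y3 where e: "g E1 = (1, (d, 0, 0), (0, y2, y3), 0)"
    using Px_E1[OF gP] by (cases "g E1" rule: zorn_cases) auto
  have "(E1 :: 'a zorn) \<star> V2 = 0" "(E1 :: 'a zorn) \<star> V3 = 0" by (simp_all add: zero_prod_def)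
  then have "g E1 \<star> g V2 = 0" "g E1 \<star> g V3 = 0"
    by (simp_all only: aut_mul[OF ga, symmetric] aut_0[OF ga])
  then have "a + y3 = 0" "c - y2 + y3 * b = 0" by (simp_all add: e v algebra_simps)
  then have y3: "y3 = - a" by (simp add: eq_neg_iff_add_eq_0 add.commute)
  then have "y2 = c - a * b" using \<open>c - y2 + y3 * b = 0\<close> by (simp add: algebra_simps)
  note this y3
  then show thesis using that e by simp
qed

lemma unip_param:
  assumes g: "unip g a b c" "g E1 = (1, (d, 0, 0), (0, c - a * b, - a), 0)"
  obtains e f where "g = uel a b (c - a * b) d e f"
proof -
  have ga: "g \<in> octonion_auts" and v: "g U1 = U1" "g V2 = (0, (a, 0, 0), (0, 1, 0), 0)"
    "g V3 = (0, (c, 0, 0), (0, b, 1), 0)" using g by (auto simp: unip_def)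
  define k where "k = theta (d, 0, 0) \<circ> theta' (0, c - a * b, - a) \<circ> sl3 (1, 0, 0) (0, 1, - b) (0, 0, 1)"
  have ka: "k \<in> octonion_auts"
    unfolding k_def by (intro aut_comp sl3_aut theta_aut theta'_aut) simp_all
  have kv: "k U1 = g U1" "k V2 = g V2" "k V3 = g V3" "k E1 = g E1"
    unfolding v g(2) by (simp_all add: k_def algebra_simps)
  have ra: "finv k \<circ> g \<in> octonion_auts" using ka ga by blast
  have "(finv k \<circ> g) U1 = U1" "(finv k \<circ> g) V2 = V2" "(finv k \<circ> g) V3 = V3" "(finv k \<circ> g) E1 = E1"
    by (simp_all only: comp_apply kv[symmetric] aut_inv_f[OF ka])
  then obtain e f where "finv k \<circ> g = sl3 (1, 0, 0) (f, 1, 0) (e, 0, 1)"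
    using aut_fix4[OF ra] by blast
  then have "k \<circ> (finv k \<circ> g) = uel a b (c - a * b) d e f" by (simp only: uel_def k_def)
  moreover have "k \<circ> (finv k \<circ> g) = g" by (simp only: o_assoc finv_comp[OF ka]) simp
  ultimately show thesis using that by simp
qed

lemma torus_aut:
  assumes "t1 * t2 * t3 = (1 :: 'a::field)"
  shows "sl3 (t1, 0, 0) (0, t2, 0) (0, 0, t3) \<in> octonion_auts"
  by (rule sl3_aut) (use assms in \<open>simp add: algebra_simps\<close>)

definition fixU1 :: "('a::field zorn \<Rightarrow> 'a zorn) set" where
  "fixU1 = {h \<in> octonion_auts. h U1 = U1}"

lemma subgroup_fixU1: "subgroup (fixU1 :: ('a::{finite,field} zorn \<Rightarrow> 'a zorn) set) G2"
  by (rule subgroup_G2I) (auto simp: fixU1_def)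

lemma fixU1_Px: "h \<in> fixU1 \<Longrightarrow> h \<in> Px" by (auto simp: fixU1_def Px_def intro!: exI[of _ 1])

lemma exists_not_01: "card (UNIV :: 'a::{finite,field} set) > 2 \<Longrightarrow> \<exists>t :: 'a. t \<noteq> 0 \<and> t \<noteq> 1"
proof (rule ccontr)
  assume c: "card (UNIV :: 'a set) > 2" and "\<nexists>t :: 'a. t \<noteq> 0 \<and> t \<noteq> 1"
  then have "UNIV \<subseteq> {0, 1 :: 'a}" by blast
  then have "card (UNIV :: 'a set) \<le> card {0, 1 :: 'a}" by (intro card_mono) auto
  then show False using c by simp
qed

lemma char2: assumes "(2 :: 'a::field) = 0" shows "x + x = (0 :: 'a)" "- x = x"
proof -
  show "x + x = 0" using assms by (metis mult_2 mult_zero_left)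
  then show "- x = x" by (rule minus_unique)
qed

text \<open>On unitriangular elements the coefficient a is a homomorphism to the additive group,
  hence constant on conjugacy classes of M. The torus element with diagonal t^-2, t, t divides a by
  t and keeps b.\<close>

lemma good_regular:
  fixes g :: "'a::{finite,field} zorn \<Rightarrow> 'a zorn"
  assumes q: "card (UNIV :: 'a set) > 2" and g: "unip g a b c" and ab: "a \<noteq> 0" "b \<noteq> 0"
  shows "good g"
proof -
  obtain t :: 'a where t: "t \<noteq> 0" "t \<noteq> 1" using exists_not_01[OF q] by blast
  define z where "z = sl3 (1 / (t * t), 0, 0) (0, t, 0) (0, 0, t)"
  have za: "z \<in> octonion_auts" unfolding z_def by (rule torus_aut) (use t in simp)
  define s where "s = z \<circ> g \<circ> finv z"
  have ga: "g \<in> octonion_auts" using g by (simp add: unip_def)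
  have gs: "conj_to g s" unfolding s_def using ga za by (rule conj_toI)
  have sa: "s \<in> octonion_auts" using gs by (simp add: conj_to_def)
  have zv: "z U1 = (1 / (t * t)) \<bullet> U1" "z V2 = (1 / t) \<bullet> V2" "z V3 = (1 / t) \<bullet> V3"
    using t by (simp_all add: z_def)
  have sz: "s (z x) = z (g x)" for x unfolding s_def by (rule conj_apply[OF za])
  have gv: "g U1 = U1" "g V2 = V2 + a \<bullet> U1" "g V3 = V3 + b \<bullet> V2 + c \<bullet> U1"
    using g by (simp_all add: unip_def)
  define a' where "a' = a / t"
  have "s ((1 / (t * t)) \<bullet> U1) = (1 / (t * t)) \<bullet> U1" using sz[of U1] by (simp only: zv gv)
  then have sU: "s U1 = U1" using t by (simp add: aut_smul[OF sa] zsmul_cancel del: zsmul.simps)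
  have "s ((1 / t) \<bullet> V2) = (1 / t) \<bullet> V2 + (a * (1 / (t * t))) \<bullet> U1"
    using sz[of V2] by (simp only: zv gv aut_add[OF za] aut_smul[OF za] zsmul_zsmul)
  also have "\<dots> = (1 / t) \<bullet> (V2 + a' \<bullet> U1)" using t by (simp add: a'_def)
  finally have s2: "s V2 = V2 + a' \<bullet> U1" using t by (simp only: aut_smul[OF sa] zsmul_cancel) (simp add: zsmul_cancel del: zsmul.simps)
  have "s ((1 / t) \<bullet> V3) = (1 / t) \<bullet> V3 + (b * (1 / t)) \<bullet> V2 + (c * (1 / (t * t))) \<bullet> U1"
    using sz[of V3] by (simp only: zv gv aut_add[OF za] aut_smul[OF za] zsmul_zsmul)
  also have "\<dots> = (1 / t) \<bullet> (V3 + b \<bullet> V2 + (c / t) \<bullet> U1)" using t by simp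
  finally have s3: "s V3 = V3 + b \<bullet> V2 + (c / t) \<bullet> U1" using t by (simp only: aut_smul[OF sa] zsmul_cancel) (simp add: zsmul_cancel del: zsmul.simps)
  define c' where "c' = c / t"
  have us: "unip s a' b c'" using sa sU s2 s3 by (simp add: unip_def c'_def)
  have aa: "a' \<noteq> a" "a' \<noteq> 0" using t ab by (simp_all add: a'_def field_simps)
  define M where "M = {h :: 'a zorn \<Rightarrow> 'a zorn. \<exists>a b c. unip h a b c}"
  have Msub: "subgroup M G2"
  proof (rule subgroup_G2I)
    show "M \<subseteq> octonion_auts" by (auto simp: M_def unip_def)
    show "id \<in> M" by (auto simp: M_def unip_def intro!: exI[of _ 0])
    fix h k assume "h \<in> M" "k \<in> M"
    then obtain x y w x' y' w' where hk: "unip h x y w" "unip k x' y' w'" by (auto simp: M_def)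
    have ha: "h \<in> octonion_auts" using hk by (simp add: unip_def)
    have "(h \<circ> k) V2 = h (V2 + x' \<bullet> U1)" "(h \<circ> k) V3 = h (V3 + y' \<bullet> V2 + w' \<bullet> U1)"
      using hk by (simp_all add: unip_def)
    then have "unip (h \<circ> k) (x + x') (y + y') (w + y' * x + w')"
      using hk ha aut_comp[of h k]
      by (simp add: unip_def aut_add[OF ha] aut_smul[OF ha] del: add_Pair zsmul.simps) (simp add: algebra_simps)
    then show "h \<circ> k \<in> M" by (auto simp: M_def)
  qed
  have nc: "h \<circ> g \<noteq> s \<circ> h" if hM: "h \<in> M" for h
  proof
    assume e: "h \<circ> g = s \<circ> h"
    obtain x y w where h: "unip h x y w" using hM by (auto simp: M_def)
    have ha: "h \<in> octonion_auts" and hv: "h U1 = U1" "h V2 = V2 + x \<bullet> U1" using h by (simp_all add: unip_def)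
    have "h (g V2) = s (h V2)" using fun_cong[OF e, of V2] by simp
    then have "a = a'"
      by (simp only: gv hv s2 sU aut_add[OF ha] aut_smul[OF ha] aut_add[OF sa] aut_smul[OF sa]) simp
    then show False using aa by simp
  qed
  have comm: "r \<circ> r \<circ> s \<noteq> s \<circ> (r \<circ> r)" if r: "unip r a b c" and s: "unip s a' b c'" and aa: "a' \<noteq> a" "a' \<noteq> 0" "a \<noteq> 0"
    for r s :: "'a zorn \<Rightarrow> 'a zorn" and a a' c c'
  proof
    assume e: "r \<circ> r \<circ> s = s \<circ> (r \<circ> r)"
    obtain d1 where d1: "r E1 = (1, (d1, 0, 0), (0, c - a * b, - a), 0)" using unip_E1[OF r] .
    obtain d2 where d2: "s E1 = (1, (d2, 0, 0), (0, c' - a' * b, - a'), 0)" using unip_E1[OF s] .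
    obtain e1 f1 where r': "r = uel a b (c - a * b) d1 e1 f1" using unip_param[OF r d1] .
    obtain e2 f2 where s': "s = uel a' b (c' - a' * b) d2 e2 f2" using unip_param[OF s d2] .
    show False
    proof (cases "(2 :: 'a) = 0")
      case False
      have ra: "r \<in> octonion_auts" and sa: "s \<in> octonion_auts" using r s by (auto simp: unip_def)
      have rv: "r U1 = U1" "r V2 = V2 + a \<bullet> U1" "r V3 = V3 + b \<bullet> V2 + c \<bullet> U1"
        and sv: "s U1 = U1" "s V2 = V2 + a' \<bullet> U1" "s V3 = V3 + b \<bullet> V2 + c' \<bullet> U1"
        using r s by (simp_all add: unip_def)
      have "r (r (s V3)) = s (r (r V3))" using fun_cong[OF e, of V3] by simp
      then have "b = 0 \<or> (2 :: 'a) = 0 \<or> a = a'"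
        by (simp only: rv sv aut_add[OF ra] aut_smul[OF ra] aut_add[OF sa] aut_smul[OF sa]) (simp add: algebra_simps)
      then show False using False ab aa by simp
    next
      \<comment> \<open>In characteristic 2 the square of r moves \<open>V3\<close> by a multiple of
        \<open>U1\<close> only and commutes with s on \<open>Kx\<close>; the difference becomes
        visible in the first u-coordinate of the images of \<open>U3\<close>.\<close>
      case True
      note c2 = char2[OF True]
      have "r (r (s U3)) = s (r (r U3))" using fun_cong[OF e, of U3] by simp
      then have "fst (fst (snd (r (r (s U3))))) = fst (fst (snd (s (r (r U3)))))" by simp
      then have "a' = 0 \<or> a = 0 \<or> b = 0 \<or> a' = a"
        unfolding r' s' uel_def using True c2 by (simp add: algebra_simps) 
      then show False using aa ab by simp
    qed
  qed
  have gM: "g \<in> M" and sM: "s \<in> M" using g us unfolding M_def by blast+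
  show ?thesis
    by (rule good_C[OF gs Msub gM sM nc comm[OF g us aa ab(1)] comm[OF us g _ ab(1) aa(2)]])
       (use aa in auto)
qed

text \<open>A criterion that also serves involutions: with x = s r s^-1 the orbit of r contains r, x
  and r x r^-1, and these are distinct once r commutes with neither s nor x.\<close>

lemma good_C_triple:
  fixes r :: "'a::{finite,field} zorn \<Rightarrow> 'a zorn"
  assumes rs: "conj_to r s" and M: "subgroup M G2" "r \<in> M" "s \<in> M"
    and nc: "\<And>k. k \<in> M \<Longrightarrow> k \<circ> r \<noteq> s \<circ> k"
    and c: "r \<circ> s \<noteq> s \<circ> r" "r \<circ> (s \<circ> r \<circ> finv s) \<noteq> (s \<circ> r \<circ> finv s) \<circ> r"
      "s \<circ> (r \<circ> s \<circ> finv r) \<noteq> (r \<circ> s \<circ> finv r) \<circ> s"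
  shows "good r"
proof -
  have a: "r \<in> octonion_auts" "s \<in> octonion_auts" using rs by (auto simp: conj_to_def)
  define H where "H = generate G2 {r, s}"
  note H = generate_pair[OF a M, folded H_def]
  have three: "\<exists>x y. x \<in> conj_orbit G2 H r \<and> y \<in> conj_orbit G2 H r \<and> r \<noteq> x \<and> r \<noteq> y \<and> x \<noteq> y"
    if "s \<in> H" "r \<in> H" "r \<in> octonion_auts" "s \<in> octonion_auts" and c: "r \<circ> s \<noteq> s \<circ> r"
     "r \<circ> (s \<circ> r \<circ> finv s) \<noteq> (s \<circ> r \<circ> finv s) \<circ> r" for r s
  proof (intro exI conjI)
    let ?x = "s \<circ> r \<circ> finv s"
    have rsa: "r \<circ> s \<in> octonion_auts" "r \<circ> s \<in> H" using that subgroup.m_closed[OF H(1)] by auto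
    show "?x \<in> conj_orbit G2 H r" "(r \<circ> s) \<circ> r \<circ> finv (r \<circ> s) \<in> conj_orbit G2 H r"
      unfolding conj_orbit_G2[OF H(5)] using that rsa by blast+
    have xa: "?x \<in> octonion_auts" using that by blast
    have y: "(r \<circ> s) \<circ> r \<circ> finv (r \<circ> s) = r \<circ> ?x \<circ> finv r"
    proof -
      have e: "s \<circ> r = ?x \<circ> s" using conj_eq_iff[of s r ?x] that by simp
      have "r \<circ> s \<circ> r = r \<circ> (s \<circ> r)" by (simp only: o_assoc)
      also have "\<dots> = r \<circ> (?x \<circ> s)" by (rule arg_cong[where f = "\<lambda>f. r \<circ> f", OF e])
      also have "\<dots> = (r \<circ> ?x \<circ> finv r) \<circ> (r \<circ> s)" using that by (simp add: fun_eq_iff aut_inv_f)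
      finally show ?thesis using conj_eq_iff[OF rsa(1)] by blast
    qed
    show "r \<noteq> ?x" using conj_eq_iff[of s r r] that by auto
    show "?x \<noteq> (r \<circ> s) \<circ> r \<circ> finv (r \<circ> s)" unfolding y
      using conj_eq_iff[of r ?x ?x] that by auto
    show "r \<noteq> (r \<circ> s) \<circ> r \<circ> finv (r \<circ> s)"
    proof
      assume "r = (r \<circ> s) \<circ> r \<circ> finv (r \<circ> s)"
      then have "(r \<circ> s) \<circ> r \<circ> finv (r \<circ> s) = r" by (rule sym)
      then have "r \<circ> s \<circ> r = r \<circ> (r \<circ> s)" unfolding conj_eq_iff[OF rsa(1)] .
      then have "r \<circ> (s \<circ> r) = r \<circ> (r \<circ> s)" by (simp only: o_assoc)
      then show False using comp_cancel[of r "s \<circ> r" "r \<circ> s"] that by simp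
    qed
  qed
  obtain x y where xy: "x \<in> conj_orbit G2 H r" "y \<in> conj_orbit G2 H r" "r \<noteq> x" "r \<noteq> y" "x \<noteq> y"
    using three[of s r] a c H by blast
  obtain x' y' where xy': "x' \<in> conj_orbit G2 H s" "y' \<in> conj_orbit G2 H s" "s \<noteq> x'" "s \<noteq> y'" "x' \<noteq> y'"
    using three[of r s] a c H by metis
  show ?thesis
    using type_C_general[OF rs H(1,2,3,6) _ c(1) xy xy'] nc H(4) by blast
qed

text \<open>With a = c = 0 the coefficient d is preserved by conjugation inside
  \<open>fixU1\<close>, whereas the torus element z multiplies it by t. The further conjugation by k
  replaces the transvection on \<open>Kx / Lx\<close> by an opposite one, so that g and s do not
  commute, nor does either commute with its conjugate by the other.\<close>

lemma good_N4:
  fixes g :: "'a::{finite,field} zorn \<Rightarrow> 'a zorn"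
  assumes q: "card (UNIV :: 'a set) > 2" and g: "unip g 0 b 0" "g E1 = E1 + d \<bullet> U1" and bd: "b \<noteq> 0" "d \<noteq> 0"
  shows "good g"
proof -
  obtain t :: 'a where t: "t \<noteq> 0" "t \<noteq> 1" using exists_not_01[OF q] by blast
  define z where "z = sl3 (t, 0, 0) (0, 1, 0) (0, 0, 1 / t)"
  have za: "z \<in> octonion_auts" unfolding z_def by (rule torus_aut) (use t in simp)
  define k :: "'a zorn \<Rightarrow> 'a zorn" where "k = sl3 (1, 0, 0) (0, 0, 1) (0, - 1, 0)"
  have ka: "k \<in> octonion_auts" unfolding k_def by (rule sl3_aut) simp
  define s0 where "s0 = z \<circ> g \<circ> finv z"
  define s where "s = k \<circ> s0 \<circ> finv k"
  have gv: "g \<in> octonion_auts" "g U1 = U1" "g V2 = V2" "g V3 = V3 + b \<bullet> V2"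
    using g by (simp_all add: unip_def)
  have zv: "z U1 = t \<bullet> U1" "z V2 = V2" "z V3 = t \<bullet> V3" "z E1 = E1" using t by (simp_all add: z_def)
  have kv: "k U1 = U1" "k V2 = V3" "k V3 = - V2" "k E1 = E1" by (simp_all add: k_def)
  have gs0: "conj_to g s0" unfolding s0_def using gv(1) za by (rule conj_toI)
  have s0a: "s0 \<in> octonion_auts" using gs0 by (simp add: conj_to_def)
  have gs: "conj_to g s" using conj_to_trans[OF gs0 conj_toI[OF s0a ka]] by (simp add: s_def)
  have sa: "s \<in> octonion_auts" using gs by (simp add: conj_to_def)
  have sz: "s0 (z x) = z (g x)" for x unfolding s0_def by (rule conj_apply[OF za])
  have sk: "s (k x) = k (s0 x)" for x unfolding s_def by (rule conj_apply[OF ka])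
  note lin = aut_add[OF za] aut_smul[OF za] aut_add[OF gv(1)] aut_smul[OF gv(1)] aut_add[OF s0a]
    aut_smul[OF s0a] aut_add[OF ka] aut_smul[OF ka] aut_uminus[OF ka] aut_add[OF sa] aut_smul[OF sa] aut_uminus[OF sa]
  define b' where "b' = b / t"
  have b': "b' \<noteq> 0" using bd t by (simp add: b'_def)
  have "t \<bullet> s0 U1 = t \<bullet> U1" using sz[of U1] by (simp only: zv gv lin)
  then have s0U: "s0 U1 = U1" using t by (simp only: zsmul_cancel simp_thms)
  have s02: "s0 V2 = V2" using sz[of V2] by (simp only: zv gv)
  have "t \<bullet> s0 V3 = t \<bullet> (V3 + b' \<bullet> V2)" using sz[of V3] t by (simp only: zv gv lin) (simp add: b'_def)
  then have s03: "s0 V3 = V3 + b' \<bullet> V2" using t by (simp only: zsmul_cancel simp_thms)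
  have s0E: "s0 E1 = E1 + (d * t) \<bullet> U1" using sz[of E1] by (simp only: zv g(2) lin zsmul_zsmul)
  have sU: "s U1 = U1" using sk[of U1] by (simp only: kv s0U)
  have s3: "s V3 = V3" using sk[of V2] by (simp only: kv s02)
  have "- s V2 = - (V2 - b' \<bullet> V3)" using sk[of V3] by (simp only: kv s03 lin) simp
  then have s2: "s V2 = V2 - b' \<bullet> V3" by (simp only: neg_equal_iff_equal)
  note lin' = aut_add[OF gv(1)] aut_smul[OF gv(1)] aut_diff[OF gv(1)] aut_add[OF sa] aut_smul[OF sa] aut_diff[OF sa]
  have iv: "finv f y = x" if "f \<in> octonion_auts" "f x = y" for f x y
    using aut_inv_f(1)[OF that(1), of x] that(2) by simp
  have gi: "finv g V2 = V2" "finv g V3 = V3 - b \<bullet> V2"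
    by (rule iv[OF gv(1)]; simp only: gv lin'; simp)+
  have si: "finv s V2 = V2 + b' \<bullet> V3" "finv s V3 = V3"
    by (rule iv[OF sa]; simp only: s2 s3 lin'; simp)+
  have nc: "h \<circ> g \<noteq> s \<circ> h" if hM: "h \<in> fixU1" for h
  proof
    assume e: "h \<circ> g = s \<circ> h"
    define m where "m = finv k \<circ> h"
    have ha: "h \<in> octonion_auts" "h U1 = U1" using hM by (auto simp: fixU1_def)
    have ma: "m \<in> octonion_auts" unfolding m_def using ha ka by blast
    have mU: "m U1 = U1" using iv[OF ka kv(1)] by (simp add: m_def ha)
    have e': "m (g x) = s0 (m x)" for x
    proof -
      have "k (m (g x)) = k (s0 (m x))"
        using fun_cong[OF e, of x] sk[of "m x"] by (simp add: m_def aut_inv_f[OF ka])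
      then show ?thesis by (simp only: aut_inj[OF ka])
    qed
    have mP: "m \<in> Px" using ma mU by (auto simp: Px_def intro!: exI[of _ 1])
    obtain x y2 y3 where m: "m E1 = (1, (x, 0, 0), (0, y2, y3), 0)"
      using Px_E1[OF mP] by (cases "m E1" rule: zorn_cases) auto
    then have mE: "m E1 = E1 + x \<bullet> U1 + y2 \<bullet> V2 + y3 \<bullet> V3" by simp
    have "m (g E1) = s0 (m E1)" by (rule e')
    then have "d = d * t"
      by (simp only: g(2) aut_add[OF ma] aut_smul[OF ma] mU mE aut_add[OF s0a] aut_smul[OF s0a] s0E s0U s02 s03) simp
    then show False using bd t by simp
  qed
  have gM: "g \<in> fixU1" and sM: "s \<in> fixU1" using gv sa sU by (auto simp: fixU1_def)
  show ?thesis
  proof (rule good_C_triple[OF gs subgroup_fixU1 gM sM nc])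
    show "g \<circ> s \<noteq> s \<circ> g"
    proof
      assume "g \<circ> s = s \<circ> g"
      then have "g (s V2) = s (g V2)" by (simp only: fun_eq_iff comp_apply)
      then show False using bd b' by (simp only: gv s2 s3 lin') simp
    qed
    show "g \<circ> (s \<circ> g \<circ> finv s) \<noteq> (s \<circ> g \<circ> finv s) \<circ> g"
    proof
      assume "g \<circ> (s \<circ> g \<circ> finv s) = (s \<circ> g \<circ> finv s) \<circ> g"
      then have "g (s (g (finv s V2))) = s (g (finv s (g V2)))" by (simp only: fun_eq_iff comp_apply)
      then show False using bd b' by (simp only: gv s2 s3 si lin') (simp add: algebra_simps)
    qed
    show "s \<circ> (g \<circ> s \<circ> finv g) \<noteq> (g \<circ> s \<circ> finv g) \<circ> s"
    proof
      assume "s \<circ> (g \<circ> s \<circ> finv g) = (g \<circ> s \<circ> finv g) \<circ> s"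
      then have "s (g (s (finv g V3))) = g (s (finv g (s V3)))" by (simp only: fun_eq_iff comp_apply)
      then show False using bd b' by (simp only: gv s2 s3 gi lin') (simp add: algebra_simps)
    qed
  qed auto
qed


text \<open>Both g and s preserve the plane of \<open>U1\<close> and \<open>V2\<close>; g is trivial
  on it and s is not, which separates them in its stabilizer. The commutators of squares are seen on
  \<open>E1\<close>, where the \<open>U1\<close> coordinates differ by 4 c^2 up to sign.\<close>

lemma good_N1_odd:
  fixes g :: "'a::{finite,field} zorn \<Rightarrow> 'a zorn"
  assumes two: "(2 :: 'a) \<noteq> 0" and g: "unip g 0 0 c" and c: "c \<noteq> 0"
  shows "good g"
proof -
  define k :: "'a zorn \<Rightarrow> 'a zorn" where "k = sl3 (1, 0, 0) (0, 0, 1) (0, - 1, 0)"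
  have ka: "k \<in> octonion_auts" unfolding k_def by (rule sl3_aut) simp
  define s where "s = k \<circ> g \<circ> finv k"
  have gv: "g \<in> octonion_auts" "g U1 = U1" "g V2 = V2" "g V3 = V3 + c \<bullet> U1"
    using g by (simp_all add: unip_def)
  obtain d where "g E1 = (1, (d, 0, 0), (0, c - 0 * 0, - 0), 0)" using unip_E1[OF g] .
  then have gE: "g E1 = E1 + d \<bullet> U1 + c \<bullet> V2" by simp
  have kv: "k U1 = U1" "k V2 = V3" "k V3 = - V2" "k E1 = E1" by (simp_all add: k_def)
  have gs: "conj_to g s" unfolding s_def using gv(1) ka by (rule conj_toI)
  have sa: "s \<in> octonion_auts" using gs by (simp add: conj_to_def)
  have sk: "s (k x) = k (g x)" for x unfolding s_def by (rule conj_apply[OF ka])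
  note lin = aut_add[OF ka] aut_smul[OF ka] aut_uminus[OF ka] aut_uminus[OF sa]
  have sU: "s U1 = U1" using sk[of U1] by (simp only: kv gv)
  have s3: "s V3 = V3" using sk[of V2] by (simp only: kv gv)
  have "- s V2 = - (V2 - c \<bullet> U1)" using sk[of V3] by (simp only: kv gv lin) simp
  then have s2: "s V2 = V2 - c \<bullet> U1" by (simp only: neg_equal_iff_equal)
  have sE: "s E1 = E1 + d \<bullet> U1 + c \<bullet> V3" using sk[of E1] by (simp only: kv gE lin)
  define W :: "'a zorn set" where "W = range (\<lambda>(x, y). x \<bullet> U1 + y \<bullet> V2)"
  define M where "M = {h \<in> octonion_auts. h ` W \<subseteq> W}"
  have Msub: "subgroup M G2" by (rule subgroup_G2I) (auto simp: M_def image_subset_iff)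
  note lin' = aut_add[OF gv(1)] aut_smul[OF gv(1)] aut_diff[OF gv(1)] aut_add[OF sa] aut_smul[OF sa] aut_diff[OF sa]
  have gW: "g w = w" if "w \<in> W" for w
    using that by (auto simp: W_def lin' gv simp del: zsmul.simps add_Pair)
  have gM: "g \<in> M" using gv(1) gW by (auto simp: M_def simp del: split_paired_all)
  have sM: "s \<in> M"
  proof -
    have "s (x \<bullet> U1 + y \<bullet> V2) = (x - y * c) \<bullet> U1 + y \<bullet> V2" for x y
      by (simp only: lin' sU s2) (simp add: zero_prod_def algebra_simps)
    moreover have "x \<bullet> U1 + y \<bullet> V2 \<in> W" for x y
      unfolding W_def by (rule image_eqI[of _ _ "(x, y)"]) (simp_all only: prod.case UNIV_I)
    ultimately have "s w \<in> W" if wW: "w \<in> W" for w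
    proof -
      assume a: "\<And>x y. s (x \<bullet> U1 + y \<bullet> V2) = (x - y * c) \<bullet> U1 + y \<bullet> V2"
        and b: "\<And>x y. x \<bullet> U1 + y \<bullet> V2 \<in> W"
      obtain p where "w = (\<lambda>(x, y). x \<bullet> U1 + y \<bullet> V2) p" using wW unfolding W_def by blast
      then obtain x y where "w = x \<bullet> U1 + y \<bullet> V2" by (cases p) (simp only: prod.case)
      then show ?thesis by (simp only: a b)
    qed
    then show ?thesis using sa by (auto simp: M_def simp del: split_paired_all)
  qed
  have nc: "h \<circ> g \<noteq> s \<circ> h" if hM: "h \<in> M" for h
  proof
    assume e: "h \<circ> g = s \<circ> h"
    have ha: "h \<in> octonion_auts" and hW: "h ` W \<subseteq> W" using hM by (auto simp: M_def)
    have "h ` W = W"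
      by (rule endo_inj_surj[OF _ hW]) (use aut_inj[OF ha] in \<open>auto simp: inj_on_def\<close>)
    moreover have "V2 \<in> W" unfolding W_def by (rule image_eqI[of _ _ "(0, 1)"]) simp_all
    ultimately obtain w where w: "w \<in> W" "h w = V2" by (metis imageE)
    have "h (g w) = s (h w)" using fun_cong[OF e, of w] by simp
    then show False using gW[OF w(1)] w(2) s2 c by simp
  qed
  show ?thesis
  proof (rule good_C[OF gs Msub gM sM nc])
    show "g \<circ> g \<circ> s \<noteq> s \<circ> (g \<circ> g)"
    proof
      assume "g \<circ> g \<circ> s = s \<circ> (g \<circ> g)"
      then have "g (g (s E1)) = s (g (g E1))" by (simp only: fun_eq_iff comp_apply)
      then have "c * c + c * c = - (c * c) - c * c" by (simp only: gv gE sU s2 s3 sE lin') (simp add: zero_prod_def algebra_simps)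
      then have "2 * 2 * (c * c) = 0" by (simp add: algebra_simps eq_neg_iff_add_eq_0)
      then show False using two c by (simp only: mult_eq_0_iff simp_thms)
    qed
    show "s \<circ> s \<circ> g \<noteq> g \<circ> (s \<circ> s)"
    proof
      assume "s \<circ> s \<circ> g = g \<circ> (s \<circ> s)"
      then have "s (s (g E1)) = g (s (s E1))" by (simp only: fun_eq_iff comp_apply)
      then have "c * c + c * c = - (c * c) - c * c" by (simp only: gv gE sU s2 s3 sE lin') (simp add: zero_prod_def algebra_simps)
      then have "2 * 2 * (c * c) = 0" by (simp add: algebra_simps eq_neg_iff_add_eq_0)
      then show False using two c by (simp only: mult_eq_0_iff simp_thms)
    qed
  qed auto
qed

text \<open>Translation by 1 permutes the field without changing the sum of its elements. This will
  exclude q = 3 in characteristic 2.\<close>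

lemma of_nat_card_0: "(of_nat (card (UNIV :: 'a::{finite,field} set)) :: 'a) = 0"
proof -
  have "(\<Sum>x\<in>(UNIV :: 'a set). x + 1) = (\<Sum>x\<in>UNIV. x)"
    by (rule sum.reindex_bij_witness[of _ "\<lambda>x. x - 1" "\<lambda>x. x + 1"]) auto
  then show ?thesis by (simp add: sum.distrib)
qed

lemma conj_orbit_iff:
  assumes "subgroup H G2" shows "t \<in> conj_orbit G2 H s \<longleftrightarrow> (\<exists>k\<in>H. k \<circ> s = t \<circ> k)"
proof -
  have Ha: "H \<subseteq> octonion_auts" using subgroup.subset[OF assms] by simp
  show ?thesis unfolding conj_orbit_G2[OF Ha] using conj_eq_iff[of _ s t] Ha by blast
qed

lemma conj_orbit_conj:
  fixes s :: "'a::field zorn \<Rightarrow> 'a zorn"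
  assumes H: "subgroup H G2" and h: "h \<in> H"
  shows "conj_orbit G2 H (h \<circ> s \<circ> finv h) = conj_orbit G2 H s"
proof (rule Set.set_eqI)
  fix t :: "'a zorn \<Rightarrow> 'a zorn"
  have ha: "h \<in> octonion_auts" using subgroup.subset[OF H] h by auto
  have cl: "x \<circ> y \<in> H" if "x \<in> H" "y \<in> H" for x y using subgroup.m_closed[OF H that] by simp
  have "(k \<circ> h) \<circ> s = t \<circ> (k \<circ> h)" if "k \<circ> (h \<circ> s \<circ> finv h) = t \<circ> k" for k
  proof -
    have "k (h (s x)) = t (k (h x))" for x
      using fun_cong[OF that, of "h x"] by (simp add: aut_inv_f[OF ha])
    then show ?thesis by (simp add: fun_eq_iff)
  qed
  moreover have "(k \<circ> finv h) \<circ> (h \<circ> s \<circ> finv h) = t \<circ> (k \<circ> finv h)" if "k \<circ> s = t \<circ> k" for k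
  proof -
    have "k (s x) = t (k x)" for x using fun_cong[OF that, of x] by simp
    then show ?thesis by (simp add: fun_eq_iff aut_inv_f[OF ha])
  qed
  ultimately show "t \<in> conj_orbit G2 H (h \<circ> s \<circ> finv h) \<longleftrightarrow> t \<in> conj_orbit G2 H s"
    unfolding conj_orbit_iff[OF H] using cl h aut_subgroup_finv[OF H h] by blast
qed

text \<open>Lines of \<open>Kx / Lx\<close> fixed by conjugates of \<open>s\<close> separate the conjugates of \<open>r\<close> and of \<open>s\<close>. The group \<open>H\<close>
  is minimal among those containing \<open>r\<close> and \<open>s\<close> and not preserving the line of \<open>s\<close>; minimality
  makes it generated by the classes of \<open>r\<close> and \<open>s\<close>.\<close>
lemma good_radical_pair:
  fixes r :: "'a::{finite,field} zorn \<Rightarrow> 'a zorn"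
  assumes rs: "conj_to r s" and r: "unip r 0 0 c" "c \<noteq> 0" and s: "unip s 0 b c'" "b \<noteq> 0"
  shows "good r"
proof -
  note sL = subspD[OF subsp_Lx]
  have ra: "r \<in> octonion_auts" and sa: "s \<in> octonion_auts" using r s by (auto simp: unip_def)
  have rM: "r \<in> fixU1" and sM: "s \<in> fixU1" using r s by (auto simp: unip_def fixU1_def)
  have rv: "r (0, (x, 0, 0), (0, y2, y3), 0) = (0, (x + y3 * c, 0, 0), (0, y2, y3), 0)" for x y2 y3
    by (subst aut_expand[OF ra]) (use r in \<open>simp add: unip_def\<close>)
  have sv: "s (0, (x, 0, 0), (0, y2, y3), 0) = (0, (x + y3 * c', 0, 0), (0, y2 + y3 * b, y3), 0)" for x y2 y3
    by (subst aut_expand[OF sa]) (use s in \<open>simp add: unip_def\<close>)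
  have hP: "h \<in> Px" "h \<in> octonion_auts" "h U1 = U1" if "h \<in> fixU1" for h :: "'a zorn \<Rightarrow> 'a zorn"
    using fixU1_Px[OF that] that by (auto simp: fixU1_def)
  have hL: "h z = z" if hf: "h \<in> fixU1" and zL: "z \<in> Lx" for h and z :: "'a zorn"
  proof -
    obtain d where "z = d \<bullet> U1" using zL by (auto simp: Lx_def)
    then show ?thesis using hP[OF hf] by (simp only: aut_smul)
  qed
  define F where "F = {z \<in> Kx. s z - z \<in> Lx}"
  have F_iff: "(0, (x, 0, 0), (0, y2, y3), 0) \<in> F \<longleftrightarrow> y3 = 0" for x y2 y3
    using s(2) by (simp add: F_def sv zero_prod_def)
  define C where "C = {H. subgroup H G2 \<and> H \<subseteq> fixU1 \<and> r \<in> H \<and> s \<in> H \<and> (\<exists>h\<in>H. h V2 \<notin> F)}"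
  define k :: "'a zorn \<Rightarrow> 'a zorn" where "k = sl3 (1, 0, 0) (0, 0, 1) (0, - 1, 0)"
  have ka: "k \<in> octonion_auts" unfolding k_def by (rule sl3_aut) simp
  have "k \<in> fixU1" "k V2 \<notin> F" using ka by (simp_all add: fixU1_def k_def F_iff)
  then have "fixU1 \<in> C" unfolding C_def using subgroup_fixU1 rM sM by blast
  then obtain H where HC: "H \<in> C" and Hmin: "\<And>K. K \<in> C \<Longrightarrow> card H \<le> card K"
    using ex_has_least_nat[of "\<lambda>H. H \<in> C" fixU1 card] by blast
  have H: "subgroup H G2" "H \<subseteq> fixU1" "r \<in> H" "s \<in> H" using HC by (auto simp: C_def)
  have Ha: "H \<subseteq> octonion_auts" using H(2) by (auto simp: fixU1_def)
  obtain h where h: "h \<in> H" "h V2 \<notin> F" using HC by (auto simp: C_def)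
  have hf: "h \<in> fixU1" and ha: "h \<in> octonion_auts" using h H Ha by auto
  note orb = conj_orbit_G2[OF Ha]
  define s2 where "s2 = h \<circ> s \<circ> finv h"
  have cl: "x \<circ> y \<in> H" if "x \<in> H" "y \<in> H" for x y using subgroup.m_closed[OF H(1) that] by simp
  have s2H: "s2 \<in> H" unfolding s2_def using cl h(1) H(4) aut_subgroup_finv[OF H(1)] by blast
  have s2h: "s2 (h z) = h (s z)" for z unfolding s2_def by (rule conj_apply[OF ha])
  obtain x y2 y3 where hv: "h V2 = (0, (x, 0, 0), (0, y2, y3), 0)"
    using Px_Kx[OF hP(1)[OF hf], of V2] by (auto elim!: Kx_cases)
  have y3: "y3 \<noteq> 0" using h(2) by (simp add: hv F_iff)
  obtain x' z2 z3 where hv3: "h V3 = (0, (x', 0, 0), (0, z2, z3), 0)"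
    using Px_Kx[OF hP(1)[OF hf], of V3] by (auto elim!: Kx_cases)
  have det: "y2 * z3 - z2 * y3 = 1"
  proof -
    have "(V2 :: 'a zorn) \<star> V3 = - U1" by simp
    then have "h V2 \<star> h V3 = - U1" using hP[OF hf] by (simp only: aut_mul[symmetric] aut_uminus)
    then show ?thesis by (simp add: hv hv3 algebra_simps)
  qed
  have hexp: "h (0, (p, 0, 0), (0, q, r'), 0) = (0, (p + q * x + r' * x', 0, 0), (0, q * y2 + r' * z2, q * y3 + r' * z3), 0)" for p q r'
    by (subst aut_expand[OF ha]) (simp add: hP(3)[OF hf] hv hv3)
  have s2a: "s2 \<in> octonion_auts" using s2H Ha by blast
  have s2U: "s2 U1 = U1" using s2H H hP by blast
  have s2V: "\<exists>p. s2 V2 = (0, (p, 0, 0), (0, 1 - y3 * b * y2, - (y3 * b * y3)), 0)"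
     "\<exists>p. s2 V3 = (0, (p, 0, 0), (0, y2 * b * y2, 1 + y2 * b * y3), 0)"
  proof -
    have "h (0, (- (z3 * x - y3 * x'), 0, 0), (0, z3, - y3), 0) = V2"
      using det by (simp add: hexp algebra_simps)
    then have "s2 V2 = h (s (0, (- (z3 * x - y3 * x'), 0, 0), (0, z3, - y3), 0))" using s2h by metis
    then show "\<exists>p. s2 V2 = (0, (p, 0, 0), (0, 1 - y3 * b * y2, - (y3 * b * y3)), 0)"
      using det by (intro exI[of _ "- (c' * y3) - b * (x * y3)"]) (simp add: hexp sv algebra_simps)
    have "h (0, (z2 * x - y2 * x', 0, 0), (0, - z2, y2), 0) = V3"
      using det by (simp add: hexp algebra_simps)
    then have "s2 V3 = h (s (0, (z2 * x - y2 * x', 0, 0), (0, - z2, y2), 0))" using s2h by metis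
    then show "\<exists>p. s2 V3 = (0, (p, 0, 0), (0, y2 * b * y2, 1 + y2 * b * y3), 0)"
      using det by (intro exI[of _ "y2 * c' + y2 * b * x"]) (simp add: hexp sv algebra_simps)
  qed
  obtain p2 p3 where s2v: "s2 V2 = (0, (p2, 0, 0), (0, 1 - y3 * b * y2, - (y3 * b * y3)), 0)"
     "s2 V3 = (0, (p3, 0, 0), (0, y2 * b * y2, 1 + y2 * b * y3), 0)" using s2V by blast
  have s2e: "s2 (0, (p, 0, 0), (0, q, r'), 0) = (0, (p + q * p2 + r' * p3, 0, 0),
      (0, q * (1 - y3 * b * y2) + r' * (y2 * b * y2), - (q * (y3 * b * y3)) + r' * (1 + y2 * b * y3)), 0)" for p q r'
    by (subst aut_expand[OF s2a]) (simp add: s2U s2v)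
  have n0: "y3 * b * y3 \<noteq> 0" using y3 s(2) by simp
  define H' where "H' = generate G2 (conj_orbit G2 H r \<union> conj_orbit G2 H s)"
  have oH: "conj_orbit G2 H f \<subseteq> H" if "f \<in> H" for f
    unfolding orb using that cl aut_subgroup_finv[OF H(1)] by auto
  have H'H: "H' \<subseteq> H" unfolding H'_def
    by (rule group.generate_subgroup_incl[OF group_G2 _ H(1)]) (use oH H in blast)
  have id: "id \<in> H" using subgroup.one_closed[OF H(1)] by simp
  have self: "f \<in> conj_orbit G2 H f" for f unfolding orb using id by (auto intro!: exI[of _ id])
  have s2o: "s2 \<in> conj_orbit G2 H s" unfolding orb s2_def using h by blast
  \<comment> \<open>H' contains s2, a conjugate of s that moves \<open>V2\<close> out of F, so it
    meets the condition defining C; minimality then gives H' = H.\<close>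
  have "H' \<in> C"
  proof -
    have "subgroup H' G2" unfolding H'_def
      by (rule group.generate_is_subgroup[OF group_G2]) (use oH H Ha in auto)
    moreover have "r \<in> H'" "s \<in> H'" "s2 \<in> H'" unfolding H'_def using self s2o by (auto intro: generate.incl)
    moreover have "s2 V2 \<notin> F" using n0 by (simp add: s2v F_iff)
    ultimately show ?thesis unfolding C_def using H'H H by blast
  qed
  then have "card H \<le> card H'" by (rule Hmin)
  then have HH: "H' = H" using H'H by (intro card_seteq) auto
  \<comment> \<open>The action of r on \<open>Kx / Lx\<close> is trivial and that of s is
    not.\<close>
  have nc: "k \<circ> r \<noteq> s \<circ> k" if k: "k \<in> H" for k
  proof
    assume e: "k \<circ> r = s \<circ> k"
    have kf: "k \<in> fixU1" using k H by blast
    have kK: "k ` Kx = Kx"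
      by (rule endo_inj_surj) (use Px_Kx[OF hP(1)[OF kf]] aut_inj[OF hP(2)[OF kf]] in \<open>auto simp: inj_on_def simp del: split_paired_all\<close>)
    have "V3 \<in> (Kx :: 'a zorn set)" by simp
    then obtain z where z: "z \<in> Kx" "k z = V3" using kK by (metis imageE)
    have "r z - z \<in> Lx" using z(1) by (elim Kx_cases) (simp add: rv zero_prod_def)
    then have "k (r z - z) = r z - z" using hL[OF kf] by blast
    then have "k (r z) = V3 + (r z - z)" using z(2) aut_diff[OF hP(2)[OF kf]] by (simp add: algebra_simps)
    moreover have "k (r z) = s V3" using fun_cong[OF e, of z] z(2) by simp
    ultimately have "s V3 = V3 + (r z - z)" by (simp only:)
    then have "s V3 - V3 = r z - z" by (simp only: add_diff_cancel_left')
    then have "s V3 - V3 \<in> Lx" using \<open>r z - z \<in> Lx\<close> by (simp only:)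
    then show False using s(2) sv[of 0 0 1] by (simp add: zero_prod_def)
  qed
  have O2: "conj_orbit G2 H s2 = conj_orbit G2 H s"
    unfolding s2_def by (rule conj_orbit_conj[OF H(1) h(1)])
  have rs2: "conj_to r s2" using conj_to_trans[OF rs conj_toI[OF sa ha]] by (simp add: s2_def)
  have gen: "H \<subseteq> generate G2 (conj_orbit G2 H r \<union> conj_orbit G2 H s2)"
    unfolding O2 using HH by (simp add: H'_def)
  have nc2: "k \<circ> r \<noteq> s2 \<circ> k" if k: "k \<in> H" for k
  proof
    assume e: "k \<circ> r = s2 \<circ> k"
    have "(finv h \<circ> k) (r x) = s ((finv h \<circ> k) x)" for x
    proof -
      have "h ((finv h \<circ> k) (r x)) = h (s ((finv h \<circ> k) x))"
        using fun_cong[OF e, of x] s2h[of "finv h (k x)"] by (simp add: aut_inv_f[OF ha])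
      then show ?thesis by (simp only: aut_inj[OF ha])
    qed
    then have "(finv h \<circ> k) \<circ> r = s \<circ> (finv h \<circ> k)" by (simp add: fun_eq_iff)
    then show False using nc cl aut_subgroup_finv[OF H(1) h(1)] k by blast
  qed
  define N where "N = y3 * b * y3"
  have N0: "N \<noteq> 0" using n0 by (simp add: N_def)
  have r2: "r V2 = V2" using rv[of 0 1 0] by simp
  have rs2V: "r (s2 V2) = s2 V2 - (N * c) \<bullet> U1" by (simp add: s2v rv N_def)
  have ncom: "r \<circ> s2 \<noteq> s2 \<circ> r"
  proof
    assume "r \<circ> s2 = s2 \<circ> r"
    then have "r (s2 V2) = s2 (r V2)" by (simp only: fun_eq_iff comp_apply)
    then show False using N0 r(2) by (simp only: r2 rs2V) simp
  qed
  define x1 where "x1 = s2 \<circ> r \<circ> finv s2"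
  define x2 where "x2 = s \<circ> x1 \<circ> finv s"
  have x1e: "x1 (s2 z) = s2 (r z)" for z unfolding x1_def by (rule conj_apply[OF s2a])
  have x2e: "x2 (s z) = s (x1 z)" for z unfolding x2_def by (rule conj_apply[OF sa])
  have x1o: "x1 \<in> conj_orbit G2 H r" unfolding orb x1_def using s2H by blast
  have x1H: "x1 \<in> H" using x1o oH H by blast
  have x1a: "x1 \<in> octonion_auts" using x1H Ha by blast
  have x2o: "x2 \<in> conj_orbit G2 H r"
  proof -
    have "x2 \<in> conj_orbit G2 H x1" unfolding orb x2_def using H by blast
    then show ?thesis unfolding x1_def conj_orbit_conj[OF H(1) s2H] .
  qed
  have rx1: "r \<noteq> x1"
  proof
    assume "r = x1"
    then have "r (s2 z) = s2 (r z)" for z using x1e by metis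
    then show False using ncom by (simp add: fun_eq_iff)
  qed
  \<comment> \<open>w is the preimage of \<open>V2\<close> under s2; it is needed to evaluate x1 =
    s2 r s2^-1 at \<open>V2\<close>.\<close>
  define q where "q = 1 + y3 * b * y2"
  define w :: "'a zorn" where "w = (0, (- (q * p2 + N * p3), 0, 0), (0, q, N), 0)"
  have s2w: "s2 w = V2" by (simp add: w_def s2e q_def N_def algebra_simps)
  have rw: "r w = w + (N * c) \<bullet> U1" by (simp add: w_def rv)
  have x1V2: "x1 V2 = V2 + (N * c) \<bullet> U1"
    using x1e[of w] by (simp only: s2w rw aut_add[OF s2a] aut_smul[OF s2a] s2U)
  have x1K: "\<exists>m. x1 z = z + m \<bullet> U1" if zK: "z \<in> Kx" for z
  proof -
    have "finv s2 \<in> fixU1" using aut_subgroup_finv[OF H(1) s2H] H by blast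
    then have "finv s2 z \<in> Kx" using Px_Kx[OF hP(1)] zK by blast
    then obtain p q' r' where f: "finv s2 z = (0, (p, 0, 0), (0, q', r'), 0)" by (rule Kx_cases)
    then have "r (finv s2 z) = finv s2 z + (r' * c) \<bullet> U1" by (simp add: rv)
    then have "x1 z = z + (r' * c) \<bullet> U1"
      by (simp add: x1_def aut_add[OF s2a] aut_smul[OF s2a] s2U aut_inv_f[OF s2a] del: zsmul.simps)
    then show ?thesis by blast
  qed
  have sU: "s U1 = U1" "s V2 = V2" "s V3 = V3 + b \<bullet> V2 + c' \<bullet> U1" using s by (simp_all add: unip_def)
  have x1U: "x1 U1 = U1" using x1H H hP by blast
  have x12: "x1 \<noteq> x2"
  proof
    assume "x1 = x2"
    then have e: "x1 (s V3) = s (x1 V3)" using x2e by metis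
    obtain m where m: "x1 V3 = V3 + m \<bullet> U1" using x1K[of V3] by auto
    have "b * (N * c) = 0"
      using e by (simp only: sU m aut_add[OF x1a] aut_smul[OF x1a] aut_add[OF sa] aut_smul[OF sa] x1V2 x1U)
        (simp add: algebra_simps)
    then show False using s(2) N0 r(2) by simp
  qed
  have rx2: "r \<noteq> x2"
  proof
    assume "r = x2"
    then have e: "r (s V2) = s (x1 V2)" using x2e by metis
    then have "N * c = 0" by (simp only: sU r2 x1V2 aut_add[OF sa] aut_smul[OF sa]) simp
    then show False using N0 r(2) by simp
  qed
  define t where "t = s2 \<circ> s \<circ> finv s2"
  have te: "t (s2 z) = s2 (s z)" for z unfolding t_def by (rule conj_apply[OF s2a])
  have so: "s \<in> conj_orbit G2 H s2" unfolding O2 by (rule self)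
  have "t \<in> conj_orbit G2 H s" unfolding orb t_def using s2H by blast
  then have to: "t \<in> conj_orbit G2 H s2" by (simp only: O2)
  have s2V2: "s2 V2 \<noteq> V2" using n0 by (simp add: s2v)
  have s2s: "s2 \<noteq> s" using s2V2 sU(2) by auto
  have s2t: "s2 \<noteq> t"
  proof
    assume "s2 = t"
    then have "s2 (s2 V2) = s2 V2" using te[of V2] sU(2) by simp
    then show False using s2V2 aut_inj[OF s2a] by blast
  qed
  have st: "s \<noteq> t"
  proof
    assume "s = t"
    then have "s (s2 V2) = s2 V2" using te[of V2] sU(2) by simp
    then show False using n0 s(2) by (simp add: s2v sv)
  qed
  show ?thesis
    by (rule type_C_general[OF rs2 H(1,3) s2H gen nc2 ncom x1o x2o rx1 rx2 x12 so to s2s s2t st])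
qed


lemma unip_conj:
  assumes g: "g \<in> octonion_auts" and h: "h \<in> octonion_auts"
    and e: "g (finv h U1) = finv h U1" "h (g (finv h V2)) = (0, (a, 0, 0), (0, 1, 0), 0)"
      "h (g (finv h V3)) = (0, (c, 0, 0), (0, b, 1), 0)"
  shows "conj_to g (h \<circ> g \<circ> finv h)" "unip (h \<circ> g \<circ> finv h) a b c"
  using conj_toI[OF g h] e by (auto simp: unip_def conj_to_def aut_inv_f[OF h])

text \<open>In characteristic 2 the partner for \<open>good_radical_pair\<close> is a conjugate
  acting on \<open>Kx / Lx\<close> as a transvection. Conjugation by \<open>theta (0, 0, t)\<close>
  yields one unless t (c + t d + t^2 e) = 0, which has at most three solutions, while q is at least
  4.\<close>

lemma good_N1:
  fixes g :: "'a::{finite,field} zorn \<Rightarrow> 'a zorn"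
  assumes q: "card (UNIV :: 'a set) > 2" and g: "unip g 0 0 c" and c: "c \<noteq> 0"
  shows "good g"
proof (cases "(2 :: 'a) = 0")
  case False then show ?thesis using good_N1_odd g c by blast
next
  case True
  note c2 = char2[OF True]
  obtain d where d: "g E1 = (1, (d, 0, 0), (0, c - 0 * 0, - 0), 0)" using unip_E1[OF g] .
  obtain e f where gu: "g = uel 0 0 (c - 0 * 0) d e f" using unip_param[OF g d] .
  have card3: "card (UNIV :: 'a set) \<noteq> 3"
  proof
    assume "card (UNIV :: 'a set) = 3"
    then have "(2 :: 'a) + 1 = 0" using of_nat_card_0[where 'a = 'a] by simp
    then show False using True by simp
  qed
  have "card {x. poly [:c, d, e:] x = 0} \<le> 2"
  proof -
    have "[:c, d, e:] \<noteq> 0" using c by simp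
    then have "card {x. poly [:c, d, e:] x = 0} \<le> degree [:c, d, e:]" by (rule card_poly_roots_bound)
    also have "\<dots> \<le> 2" by simp
    finally show ?thesis .
  qed
  then have "card (insert 0 {x. poly [:c, d, e:] x = 0}) \<le> 3"
    using card_insert_le_m1[of 3 "{x. poly [:c, d, e:] x = 0}" 0] by simp
  then have "insert 0 {x. poly [:c, d, e:] x = 0} \<noteq> UNIV" using card3 q by auto
  then obtain t where t: "t \<noteq> 0" "c + t * d + t * t * e \<noteq> 0" by (auto simp: algebra_simps)
  define b where "b = t * (c + t * d + t * t * e)"
  have ta: "theta (0, 0, t) \<in> octonion_auts" by simp
  have inv: "finv (theta (0, 0, t)) x = theta (0, 0, - t) x" for x
  proof -
    have "theta (0, 0, t) (theta (0, 0, - t) x) = x" by (cases x rule: zorn_cases) (simp add: algebra_simps)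
    then show ?thesis using aut_inv_f(1)[OF ta, of "theta (0, 0, - t) x"] by simp
  qed
  have ga: "g \<in> octonion_auts" using g by (simp add: unip_def)
  have three: "(3 :: 'a) = 1" using True by (metis add_0 numeral_plus_one semiring_norm(5) one_add_one add.commute numeral_One)
  have "unip (theta (0, 0, t) \<circ> g \<circ> finv (theta (0, 0, t))) 0 b (c + t * t * e)"
    "conj_to g (theta (0, 0, t) \<circ> g \<circ> finv (theta (0, 0, t)))"
    by (rule unip_conj[OF ga ta]; simp add: inv gu uel_def b_def algebra_simps c2 True three)+
  moreover have "b \<noteq> 0" using t by (simp add: b_def)
  ultimately show ?thesis using good_radical_pair[OF _ g c] by blast
qed

text \<open>g and s are transvections of SL3 fixing \<open>U1\<close>. Modulo \<open>U1\<close> the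
  first is trivial on the u-part and the second is not, so no element of M conjugates one into the
  other.\<close>

lemma good_long_root:
  fixes g :: "'a::{finite,field} zorn \<Rightarrow> 'a zorn"
  defines "g \<equiv> sl3 (1, 0, 0) (0, 1, 0) (1, 0, 1)"
  shows "good g"
proof -
  have ga: "g \<in> octonion_auts" unfolding g_def by (rule sl3_aut) simp
  define h :: "'a zorn \<Rightarrow> 'a zorn" where "h = sl3 (0, 0, 1) (1, 0, 0) (0, 1, 0)"
  define s :: "'a zorn \<Rightarrow> 'a zorn" where "s = sl3 (1, 0, 0) (0, 1, 1) (0, 0, 1)"
  define s' :: "'a zorn \<Rightarrow> 'a zorn" where "s' = sl3 (1, 0, 0) (0, 1, 0) (0, - 1, 1)"
  have sa: "s \<in> octonion_auts" "s' \<in> octonion_auts" and ha: "h \<in> octonion_auts"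
    unfolding s_def s'_def h_def by (rule sl3_aut; simp)+
  have gs: "conj_to g s"
  proof -
    have "h \<circ> g = s \<circ> h"
      by (rule aut_eqI) (use ga sa ha in \<open>auto simp: g_def s_def h_def intro!: aut_comp\<close>)
    then show ?thesis using ga sa ha by (auto simp: conj_to_def)
  qed
  have gv: "g U1 = U1" "g U2 = U2" "g U3 = U3 + U1" and sv: "s U1 = U1" "s U2 = U2 + U3" "s U3 = U3"
    and s'v: "s' U1 = U1" "s' U2 = U2" "s' U3 = U3 - U2"
    by (simp_all add: g_def s_def s'_def)
  define M where "M = {h :: 'a zorn \<Rightarrow> 'a zorn. h \<in> octonion_auts \<and> h U1 = U1 \<and> h E1 = E1}"
  have Msub: "subgroup M G2" by (rule subgroup_G2I) (auto simp: M_def)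
  have gM: "g \<in> M" and sM: "s \<in> M" and s'M: "s' \<in> M" using ga sa
    by (auto simp: M_def g_def s_def s'_def)
  have MU: "\<exists>y. k (0, (x, u2, u3), (0, 0, 0), 0) = (0, y, (0, 0, 0), 0)" if "k \<in> M" for k x u2 u3
  proof -
    have k: "k \<in> octonion_auts" "k E1 = E1" using \<open>k \<in> M\<close> by (auto simp: M_def)
    let ?y = "(0, (x, u2, u3), (0, 0, 0), 0)"
    have "E1 \<star> ?y = ?y" "?y \<star> E1 = 0" by (simp_all add: zero_prod_def)
    then have "E1 \<star> k ?y = k ?y" "k ?y \<star> E1 = 0"
      using aut_mul[OF k(1), of E1 ?y] aut_mul[OF k(1), of ?y E1] aut_0[OF k(1)] by (simp_all only: k(2))
    then show ?thesis by (cases "k ?y" rule: zorn_cases) (simp add: zero_prod_def)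
  qed
  have nc: "k \<circ> g \<noteq> s \<circ> k" if kM: "k \<in> M" for k
  proof
    assume e: "k \<circ> g = s \<circ> k"
    have k: "k \<in> octonion_auts" "k U1 = U1" using kM by (auto simp: M_def)
    note lin = aut_add[OF k(1)] aut_add[OF sa(1)] aut_smul[OF sa(1)]
    have sfix: "u2 = 0" if eq: "s (0, (x, u2, u3), (0, 0, 0), 0) = (0, (x, u2, u3), (0, 0, 0), 0) + c \<bullet> U1" for x u2 u3 c
      using eq by (simp add: s_def)
    have 2: "k U2 = s (k U2)" using fun_cong[OF e, of U2] gv by simp
    have 3: "k U3 + U1 = s (k U3)" using fun_cong[OF e, of U3] k(2) by (simp add: gv lin del: add_Pair)
    obtain x2 p2 p3 where k2: "k U2 = (0, (x2, p2, p3), (0, 0, 0), 0)" using MU[OF kM, of 0 1 0] by auto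
    obtain x3 r2 r3 where k3: "k U3 = (0, (x3, r2, r3), (0, 0, 0), 0)" using MU[OF kM, of 0 0 1] by auto
    have "p2 = 0" using 2 sfix[of x2 p2 p3 0] by (simp add: k2)
    moreover have "r2 = 0" using 3 sfix[of x3 r2 r3 1] by (simp add: k3)
    moreover have "(V1 :: 'a zorn) = U2 \<star> U3" by simp
    then have "k V1 = k U2 \<star> k U3" by (simp only: aut_mul[OF k(1)])
    ultimately have "zbil (k V1) (k U1) = 0" by (simp add: k2 k3 k(2) zero_prod_def)
    then show False using aut_bil[OF k(1), of V1 U1] by simp
  qed
  show ?thesis
  proof (cases "(2 :: 'a) = 0")
    case False
    show ?thesis
    proof (rule good_C[OF gs Msub gM sM nc])
      note lin = aut_add[OF ga] aut_add[OF sa(1)]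
      show "g \<circ> g \<circ> s \<noteq> s \<circ> (g \<circ> g)"
      proof
        assume "g \<circ> g \<circ> s = s \<circ> (g \<circ> g)"
        then have "g (g (s U2)) = s (g (g U2))" by (simp only: fun_eq_iff comp_apply)
        then show False using False by (simp only: gv sv lin) simp
      qed
      show "s \<circ> s \<circ> g \<noteq> g \<circ> (s \<circ> s)"
      proof
        assume "s \<circ> s \<circ> g = g \<circ> (s \<circ> s)"
        then have "s (s (g U2)) = g (s (s U2))" by (simp only: fun_eq_iff comp_apply)
        then show False using False by (simp only: gv sv lin) simp
      qed
    qed auto
  next
    case True
    note c2 = char2[OF True]
    \<comment> \<open>In characteristic 2 the involutions g and s generate a dihedral group of order
      8, whose classes are too small. With s' it grows to a symmetric group on four letters, in
      which g lies in the normal four-group and s is a transposition.\<close>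
    define H where "H = generate G2 {g, s, s'}"
    have H: "subgroup H G2" unfolding H_def
      by (rule group.generate_is_subgroup[OF group_G2]) (use ga sa in auto)
    have inH: "g \<in> H" "s \<in> H" "s' \<in> H" unfolding H_def by (auto intro: generate.incl)
    have HM: "H \<subseteq> M" unfolding H_def
      by (rule group.generate_subgroup_incl[OF group_G2 _ Msub]) (use gM sM s'M in blast)
    have Ha: "H \<subseteq> octonion_auts" using HM by (auto simp: M_def)
    have cl: "x \<circ> y \<in> H" if "x \<in> H" "y \<in> H" for x y using subgroup.m_closed[OF H that] by simp
    have co: "t \<in> conj_orbit G2 H f" if "k \<in> H" "k \<circ> f = t \<circ> k" for k f t
      using that conj_orbit_iff[OF H] by blast
    have id: "id \<in> H" using subgroup.one_closed[OF H] by simp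
    have s'o: "s' \<in> conj_orbit G2 H s"
    proof (rule co[of "s \<circ> s'"])
      show "s \<circ> s' \<circ> s = s' \<circ> (s \<circ> s')"
        by (rule aut_eqI) (use sa in \<open>auto simp: s_def s'_def c2 intro!: aut_comp\<close>)
    qed (use cl inH in blast)
    have gen: "H \<subseteq> generate G2 (conj_orbit G2 H g \<union> conj_orbit G2 H s)"
    proof -
      have "g \<in> conj_orbit G2 H g" "s \<in> conj_orbit G2 H s" using co[OF id] by auto
      then have "{g, s, s'} \<subseteq> conj_orbit G2 H g \<union> conj_orbit G2 H s" using s'o by blast
      then show ?thesis unfolding H_def[symmetric]
        using group.mono_generate[OF group_G2, of "{g, s, s'}" "conj_orbit G2 H g \<union> conj_orbit G2 H s"]
        by (simp add: H_def)
    qed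
    define x1 :: "'a zorn \<Rightarrow> 'a zorn" where "x1 = sl3 (1, 0, 0) (1, 1, 0) (1, 0, 1)"
    define x2 :: "'a zorn \<Rightarrow> 'a zorn" where "x2 = sl3 (1, 0, 0) (1, 1, 0) (0, 0, 1)"
    have xa: "x1 \<in> octonion_auts" "x2 \<in> octonion_auts" unfolding x1_def x2_def by (rule sl3_aut; simp)+
    have x1o: "x1 \<in> conj_orbit G2 H g"
    proof (rule co[of s])
      show "s \<circ> g = x1 \<circ> s"
        by (rule aut_eqI) (use sa ga xa in \<open>auto simp: s_def g_def x1_def c2 intro!: aut_comp\<close>)
    qed (use inH in blast)
    have x2o: "x2 \<in> conj_orbit G2 H g"
    proof (rule co[of "s' \<circ> s"])
      show "s' \<circ> s \<circ> g = x2 \<circ> (s' \<circ> s)"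
        by (rule aut_eqI) (use sa ga xa in \<open>auto simp: s_def s'_def g_def x2_def c2 intro!: aut_comp\<close>)
    qed (use cl inH in blast)
    define w where "w = s \<circ> s' \<circ> s"
    have wo: "w \<in> conj_orbit G2 H s"
    proof (rule co[of "s'"])
      show "s' \<circ> s = w \<circ> s'" unfolding w_def
        by (rule aut_eqI) (use sa in \<open>auto simp: s_def s'_def c2 intro!: aut_comp\<close>)
    qed (use inH in blast)
    have "g U2 \<noteq> x1 U2" "g U2 \<noteq> x2 U2" "x1 U3 \<noteq> x2 U3"
      by (simp_all add: g_def x1_def x2_def)
    then have ne: "g \<noteq> x1" "g \<noteq> x2" "x1 \<noteq> x2" by blast+
    have "s U2 \<noteq> s' U2" "s U3 \<noteq> w U3" "s' U2 \<noteq> w U2"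
      by (simp_all add: s_def s'_def w_def)
    then have ne': "s \<noteq> s'" "s \<noteq> w" "s' \<noteq> w" by blast+
    have "(g \<circ> s) U2 \<noteq> (s \<circ> g) U2" by (simp add: g_def s_def)
    then have ncom: "g \<circ> s \<noteq> s \<circ> g" by metis
    have nc': "k \<circ> g \<noteq> s \<circ> k" if "k \<in> H" for k using nc that HM by blast
    show ?thesis
      by (rule type_C_general[OF gs H inH(1,2) gen nc' ncom x1o x2o ne s'o wo ne'])
  qed
qed


lemma kill_c:
  fixes g :: "'a::{finite,field} zorn \<Rightarrow> 'a zorn"
  assumes g: "unip g 0 b c" "g E1 = E1 + d \<bullet> U1 + c \<bullet> V2" and b: "b \<noteq> 0"
  obtains g' where "conj_to g g'" "unip g' 0 b 0" "g' E1 = E1 + (d - c * c / b) \<bullet> U1"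
proof -
  define t where "t = c / b"
  have ga: "g \<in> octonion_auts" and gv: "g U1 = U1" "g V2 = V2" "g V3 = V3 + b \<bullet> V2 + c \<bullet> U1"
    using g by (simp_all add: unip_def)
  have d': "g E1 = (1, (d, 0, 0), (0, c - 0 * b, - 0), 0)" using g(2) by simp
  obtain e f where gu: "g = uel 0 b (c - 0 * b) d e f" using unip_param[OF g(1) d'] .
  let ?h = "theta' (0, 0, t)"
  have ha: "?h \<in> octonion_auts" by simp
  have inv: "finv ?h x = theta' (0, 0, - t) x" for x
  proof -
    have "?h (theta' (0, 0, - t) x) = x" by (cases x rule: zorn_cases) (simp add: algebra_simps)
    then show ?thesis using aut_inv_f(1)[OF ha, of "theta' (0, 0, - t) x"] by simp
  qed
  have tb: "t * b = c" "b * t = c" using b by (simp_all add: t_def)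
  have u: "conj_to g (?h \<circ> g \<circ> finv ?h)" "unip (?h \<circ> g \<circ> finv ?h) 0 b 0"
    by (rule unip_conj[OF ga ha]; simp add: inv gu uel_def tb algebra_simps)+
  have "c * c / b = c * t" by (simp add: t_def)
  then have "(?h \<circ> g \<circ> finv ?h) E1 = E1 + (d - c * c / b) \<bullet> U1"
    by (simp add: inv gu uel_def tb algebra_simps)
  then show thesis using that u by blast
qed

text \<open>Once c is cleared, d \<noteq> 0 is \<open>good_N4\<close>. If d = 0 and e \<noteq> 0,
  conjugation by \<open>theta (0, 0, 1)\<close> introduces c = d = - e; clearing c again leaves - e
  b / (b - e) in place of d, unless b = e and \<open>good_N1\<close> applies. If d = e = 0, the
  element adds f U1 - b U3 to \<open>U2\<close> and is a transvection of SL3.\<close>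

lemma good_unip_b:
  fixes g :: "'a::{finite,field} zorn \<Rightarrow> 'a zorn"
  assumes q: "card (UNIV :: 'a set) > 2" and g: "unip g 0 b c" and b: "b \<noteq> 0"
  shows "good g"
proof -
  obtain d where d: "g E1 = (1, (d, 0, 0), (0, c - 0 * b, - 0), 0)" using unip_E1[OF g] .
  then have "g E1 = E1 + d \<bullet> U1 + c \<bullet> V2" by simp
  then obtain g1 where g1: "conj_to g g1" "unip g1 0 b 0" "g1 E1 = E1 + (d - c * c / b) \<bullet> U1"
    using kill_c[OF g _ b] by blast
  show ?thesis
  proof (cases "d - c * c / b = 0")
    case False
    then show ?thesis using good_N4[OF q g1(2,3) b] good_conj[OF g1(1)] by blast
  next
    case True
    have g1d: "g1 E1 = (1, (0, 0, 0), (0, 0 - 0 * b, - 0), 0)" using g1(3) True by simp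
    obtain e f where gu: "g1 = uel 0 b (0 - 0 * b) 0 e f" using unip_param[OF g1(2) g1d] .
    have g1a: "g1 \<in> octonion_auts" using g1(1) by (simp add: conj_to_def)
    show ?thesis
    proof (cases "e = 0")
      case False
      let ?h = "theta (0, 0, 1 :: 'a)"
      have ha: "?h \<in> octonion_auts" by simp
      have inv: "finv ?h x = theta (0, 0, - 1) x" for x
      proof -
        have "?h (theta (0, 0, - 1) x) = x" by (cases x rule: zorn_cases) (simp add: algebra_simps)
        then show ?thesis using aut_inv_f(1)[OF ha, of "theta (0, 0, - 1) x"] by simp
      qed
      let ?g = "?h \<circ> g1 \<circ> finv ?h"
      have u: "conj_to g1 ?g" "unip ?g 0 (b - e) (- e)"
        by (rule unip_conj[OF g1a ha, where a = 0 and b = "b - e" and c = "- e"]; simp add: inv gu uel_def algebra_simps)+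
      have gE: "?g E1 = E1 + (- e) \<bullet> U1 + (- e) \<bullet> V2"
        by (simp add: inv gu uel_def algebra_simps)
      have gg: "good ?g \<longleftrightarrow> good g" using good_conj[OF g1(1)] good_conj[OF u(1)] by simp
      show ?thesis
      proof (cases "b - e = 0")
        case True
        then have "unip ?g 0 0 (- e)" using u(2) by (simp only: True)
        then show ?thesis using good_N1[OF q] False gg by auto
      next
        case be: False
        obtain g2 where g2: "conj_to ?g g2" "unip g2 0 (b - e) 0" "g2 E1 = E1 + (- e - (- e) * (- e) / (b - e)) \<bullet> U1"
          using kill_c[OF u(2) gE be] by blast
        have "- e - (- e) * (- e) / (b - e) = - (e * b / (b - e))" using be by (simp add: field_simps)
        moreover have "e * b / (b - e) \<noteq> 0" using False b be by simp
        ultimately have "- e - (- e) * (- e) / (b - e) \<noteq> 0" by simp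
        then have "good g2" using good_N4[OF q g2(2,3) be] by blast
        then show ?thesis using good_conj[OF g2(1)] gg by simp
      qed
    next
      case True
      define k where "k = sl3 (f, 0, - b) (- 1 / b, 0, 0) (0, 1, 0)"
      have ka: "k \<in> octonion_auts" unfolding k_def by (rule sl3_aut) (use b in simp)
      let ?r = "sl3 (1, 0, 0) (0, 1, 0) (1, 0, 1) :: 'a zorn \<Rightarrow> 'a zorn"
      have ra: "?r \<in> octonion_auts" by (rule sl3_aut) simp
      have "k \<circ> ?r = g1 \<circ> k"
        by (rule aut_eqI[OF aut_comp[OF ka ra] aut_comp[OF g1a ka]])
          (use b True in \<open>simp_all add: k_def gu uel_def algebra_simps zero_prod_def\<close>)
      then have "conj_to ?r g1" using ka ra g1a by (auto simp: conj_to_def)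
      then show ?thesis using good_long_root good_conj good_conj[OF g1(1)] by blast
    qed
  qed
qed

text \<open>For b = 0 a change of basis in \<open>Kx / Lx\<close> achieves a = 0, because c V2 - a
  V3 is fixed. If c = 0 as well, a nonzero d is turned into a c by a Weyl element, and d = 0 leaves
  a long root element.\<close>

lemma good_unip:
  fixes g :: "'a::{finite,field} zorn \<Rightarrow> 'a zorn"
  assumes q: "card (UNIV :: 'a set) > 2" and g: "unip g a b c" and id: "g \<noteq> id"
  shows "good g"
proof -
  have 0: "good g" if g: "unip g 0 0 c" and id: "g \<noteq> id" for g :: "'a zorn \<Rightarrow> 'a zorn" and c
  proof (cases "c = 0")
    case False then show ?thesis using good_N1[OF q g] by blast
  next
    case c: True
    have ga: "g \<in> octonion_auts" using g by (simp add: unip_def)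
    obtain d where d: "g E1 = (1, (d, 0, 0), (0, c - 0 * 0, - 0), 0)" using unip_E1[OF g] .
    obtain e f where gu: "g = uel 0 0 (c - 0 * 0) d e f" using unip_param[OF g d] .
    text \<open>\<open>SL2\<close> acts on the pair \<open>(e, f)\<close>.\<close>
    obtain f' where f': "conj_to g (uel 0 0 0 d 0 f')" "f' = 0 \<longrightarrow> e = 0 \<and> f = 0"
    proof (cases "e = 0")
      case True then show ?thesis using that[of f] gu c conj_to_refl[OF ga] by simp
    next
      case False
      define k where "k = sl3 (1, 0, 0) (0, 0, 1 / e) (0, - e, f)"
      have ka: "k \<in> octonion_auts" unfolding k_def by (rule sl3_aut) (use False in simp)
      have "k \<circ> uel 0 0 0 d 0 1 = g \<circ> k"
        by (rule aut_eqI[OF aut_comp[OF ka uel_aut] aut_comp[OF ga ka]])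
          (use False c in \<open>simp_all add: k_def gu uel_def field_simps zero_prod_def\<close>)
      then have "conj_to (uel 0 0 0 d 0 1) g" using ka uel_aut ga by (auto simp: conj_to_def)
      then show ?thesis using that[of 1] conj_to_sym by auto
    qed
    show ?thesis
    proof (cases "d = 0")
      case False
      let ?g = "uel 0 0 0 d 0 f'"
      \<comment> \<open>A Weyl element exchanging \<open>U1\<close> and \<open>V2\<close> and
        sending \<open>U3\<close> to \<open>V3\<close>: the shift of \<open>U3\<close> by - d V2
        becomes a shift of \<open>V3\<close> by - d U1.\<close>
      define h where "h = sl3 (0, - 1, 0) (- 1, 0, 0) (0, 0, - 1) \<circ> (swp :: 'a zorn \<Rightarrow> 'a zorn)"
      have ha: "h \<in> octonion_auts" unfolding h_def by (intro aut_comp sl3_aut) simp_all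
      have hv: "h U1 = V2" "h V2 = U1" "h U3 = V3" by (simp_all add: h_def)
      have iv: "finv h V2 = U1" "finv h U1 = V2" "finv h V3 = U3"
        using aut_inv_f(1)[OF ha, of U1] aut_inv_f(1)[OF ha, of V2] aut_inv_f(1)[OF ha, of U3] by (simp_all only: hv)
      have u: "conj_to ?g (h \<circ> ?g \<circ> finv h)" "unip (h \<circ> ?g \<circ> finv h) 0 0 (- d)"
        by (rule unip_conj[OF uel_aut ha]; simp only: iv uel_values; simp add: hv h_def)+
      have "good (h \<circ> ?g \<circ> finv h)" using good_N1[OF q u(2)] False by simp
      then show ?thesis using good_conj[OF u(1)] good_conj[OF f'(1)] by simp
    next
      case d0: True
      have "f' \<noteq> 0"
      proof
        assume "f' = 0"
        then have "g = id" using f'(2) d0 c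
          by (intro aut_eqI[OF ga]) (simp_all add: gu uel_def)
        then show False using id by blast
      qed
      define k where "k = sl3 (f', 0, 0) (0, 0, - 1 / f') (0, 1, 0)"
      have ka: "k \<in> octonion_auts" unfolding k_def by (rule sl3_aut) (use \<open>f' \<noteq> 0\<close> in simp)
      let ?r = "sl3 (1, 0, 0) (0, 1, 0) (1, 0, 1) :: 'a zorn \<Rightarrow> 'a zorn"
      have ra: "?r \<in> octonion_auts" by (rule sl3_aut) simp
      have "k \<circ> ?r = uel 0 0 0 d 0 f' \<circ> k"
        by (rule aut_eqI[OF aut_comp[OF ka ra] aut_comp[OF uel_aut ka]])
          (use \<open>f' \<noteq> 0\<close> d0 in \<open>simp_all add: k_def uel_def zero_prod_def\<close>)
      then have "conj_to ?r (uel 0 0 0 d 0 f')" using ka ra uel_aut by (auto simp: conj_to_def)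
      then show ?thesis using good_long_root good_conj good_conj[OF f'(1)] by blast
    qed
  qed
  show ?thesis
  proof (cases "b = 0")
    case b: True
    have ga: "g \<in> octonion_auts" and gv: "g U1 = U1" "g V2 = V2 + a \<bullet> U1" "g V3 = V3 + c \<bullet> U1"
      using g b by (simp_all add: unip_def)
    show ?thesis
    proof (cases "a = 0")
      case True then show ?thesis using 0 g b id by blast
    next
      case False
      define w where "w = c \<bullet> V2 - a \<bullet> V3"
      have gw: "g w = w"
        by (simp only: w_def gv aut_diff[OF ga] aut_smul[OF ga]) simp
      obtain h where h: "h \<in> octonion_auts" "h U1 = U1" "h w = V2"
        by (rule special_pair[of U1 w]) (use False in \<open>auto simp: w_def zero_prod_def\<close>)
      have iv: "finv h U1 = U1" "finv h V2 = w"
        using aut_inv_f(1)[OF h(1), of U1] aut_inv_f(1)[OF h(1), of w] by (simp_all only: h)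
      have hP: "finv h \<in> Px" using h(1) iv(1) by (auto simp: Px_def intro!: exI[of _ 1])
      obtain x y2 y3 where i3: "finv h V3 = (0, (x, 0, 0), (0, y2, y3), 0)"
        using Px_Kx[OF hP, of V3] by (auto elim!: Kx_cases)
      have "finv h V3 = x \<bullet> U1 + y2 \<bullet> V2 + y3 \<bullet> V3" by (simp add: i3)
      then have "g (finv h V3) = finv h V3 + (y2 * a + y3 * c) \<bullet> U1"
        by (simp only: gv aut_add[OF ga] aut_smul[OF ga]) (simp add: algebra_simps)
      then have h3: "h (g (finv h V3)) = V3 + (y2 * a + y3 * c) \<bullet> U1"
        by (simp only: aut_add[OF h(1)] aut_smul[OF h(1)] aut_inv_f[OF h(1)] h(2))
      have u: "conj_to g (h \<circ> g \<circ> finv h)" "unip (h \<circ> g \<circ> finv h) 0 0 (y2 * a + y3 * c)"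
        by (rule unip_conj[OF ga h(1)]; simp only: iv gv gw h h3; simp)+
      have "h \<circ> g \<circ> finv h \<noteq> id"
      proof
        assume "h \<circ> g \<circ> finv h = id"
        then have "h \<circ> g = h" using conj_eq_iff[OF h(1), of g id] by simp
        then have "g = id" using comp_cancel[OF h(1), of g id] by simp
        then show False using id by blast
      qed
      then show ?thesis using 0[OF u(2)] good_conj[OF u(1)] by simp
    qed
  next
    case b: False
    show ?thesis
    proof (cases "a = 0")
      case True then show ?thesis using good_unip_b[OF q _ b] g by blast
    next
      case False then show ?thesis using good_regular[OF q g _ b] by blast
    qed
  qed
qed

theorem good_null_line:
  fixes g :: "'a::{finite,field} zorn \<Rightarrow> 'a zorn"
  assumes q: "card (UNIV :: 'a set) > 2" and g: "g \<in> octonion_auts" "g \<noteq> id"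
    and x: "x \<noteq> 0" "ztr x = 0" "znorm x = 0" "g x = l \<bullet> x"
  shows "good g"
  using null_line_cases[OF q g(1) x]
proof
  assume "\<exists>g' a b c. conj_to g g' \<and> unip g' a b c"
  then obtain g' a b c where g': "conj_to g g'" "unip g' a b c" by blast
  have "g' \<noteq> id"
  proof
    assume "g' = id"
    then obtain h where h: "h \<in> octonion_auts" "h \<circ> g = h" using g'(1) by (auto simp: conj_to_def)
    then have "g = id" using comp_cancel[OF h(1), of g id] by simp
    then show False using g by blast
  qed
  then show ?thesis using good_unip[OF q g'(2)] good_conj[OF g'(1)] by blast
qed

section \<open>Elements preserving a special null line\<close>

lemma surj_square_char2:
  assumes "(2 :: 'a::{finite,field}) = 0" obtains y where "y * y = (x :: 'a)"
proof -
  note c2 = char2[OF assms]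
  have "inj (\<lambda>y :: 'a. y * y)"
  proof (rule injI)
    fix y z :: 'a assume "y * y = z * z"
    then have "(y - z) * (y + z) = 0" by (simp add: algebra_simps)
    then have "y = z \<or> y = - z" by (simp add: eq_neg_iff_add_eq_0)
    then show "y = z" using c2 by auto
  qed
  then have "surj (\<lambda>y :: 'a. y * y)" by (rule finite_UNIV_inj_surj[OF finite_UNIV])
  then show thesis using that by (metis surjD)
qed

definition LL :: "'a::field zorn set" where
  "LL = {z. \<exists>x y. z = (0, (0, x, 0), (0, 0, y), 0)}"

lemma LL_iff [simp]: "(a, (u1, u2, u3), (v1, v2, v3), b) \<in> LL \<longleftrightarrow>
    a = 0 \<and> u1 = 0 \<and> u3 = 0 \<and> v1 = 0 \<and> v2 = 0 \<and> b = 0"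
  by (auto simp: LL_def)
lemma LL_cases: assumes "z \<in> LL" obtains x y where "z = (0, (0, x, 0), (0, 0, y), 0)"
  using assms by (auto simp: LL_def)
lemma subsp_LL: "subsp LL" unfolding subsp_def by (auto simp: zero_prod_def elim!: LL_cases)

lemma annihilator_LL: assumes "\<And>y. y \<in> LL \<Longrightarrow> z \<star> y = 0" shows "z \<in> LL"
proof -
  have "U2 \<in> (LL :: 'a zorn set)" "V3 \<in> (LL :: 'a zorn set)" by simp_all
  then have "z \<star> U2 = 0" "z \<star> V3 = 0" using assms by blast+
  then show ?thesis by (cases z rule: zorn_cases) (simp add: zero_prod_def)
qed

lemma LL_image:
  fixes h :: "'a::{finite,field} zorn \<Rightarrow> 'a zorn"
  assumes "h \<in> octonion_auts" "\<And>y. y \<in> LL \<Longrightarrow> h y \<in> LL" "y \<in> LL"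
  obtains y' where "y' \<in> LL" "h y' = y"
proof -
  have i: "inj_on h LL" using aut_inj[OF assms(1)] by (blast intro: inj_onI)
  have s: "h ` LL \<subseteq> LL" using assms(2) by blast
  have f: "finite (LL :: 'a zorn set)" by (rule finite_subset[OF subset_UNIV finite_UNIV])
  have "h ` LL = LL" by (rule endo_inj_surj[OF f s i])
  then have "y \<in> h ` LL" using assms(3) by simp
  then show thesis
  proof (rule imageE)
    fix z assume "y = h z" "z \<in> LL"
    then show thesis using that[of z] by simp
  qed
qed

text \<open>For a special plane without eigenvectors s again acts as T - g, and M commutes with g on
  the plane. The section is that of e over \<open>LL\<close>: left multiplication by e induces g on
  \<open>LL\<close>, so every h in M moves e by an element annihilating \<open>LL\<close>, that is,
  by an element of \<open>LL\<close>.\<close>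

theorem good_special_line:
  fixes g :: "'a::{finite,field} zorn \<Rightarrow> 'a zorn"
  assumes q: "card (UNIV :: 'a set) > 2" and g: "g \<in> octonion_auts" "g \<noteq> id"
    and gL: "\<And>y. y \<in> LL \<Longrightarrow> g y \<in> LL"
  shows "good g"
proof (cases "\<exists>y \<beta>. y \<in> LL \<and> y \<noteq> 0 \<and> g y = \<beta> \<bullet> y")
  case True
  then obtain y \<beta> where y: "y \<in> LL" "y \<noteq> 0" "g y = \<beta> \<bullet> y" by blast
  have "ztr y = 0" "znorm y = 0" using y(1) by (auto elim!: LL_cases)
  then show ?thesis using good_null_line[OF q g y(2) _ _ y(3)] by blast
next
  case False
  then have irr: "y = 0" if "y \<in> LL" "g y = \<beta> \<bullet> y" for y \<beta> using that by blast
  obtain a c where g2: "g U2 = (0, (0, a, 0), (0, 0, c), 0)" using gL[of U2] by (auto elim!: LL_cases)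
  obtain d b where g3: "g V3 = (0, (0, d, 0), (0, 0, b), 0)" using gL[of V3] by (auto elim!: LL_cases)
  have gexp: "g (0, (0, x, 0), (0, 0, y), 0) = (0, (0, x * a + y * d, 0), (0, 0, x * c + y * b), 0)" for x y
    by (subst aut_expand[OF g(1)]) (simp add: g2 g3)
  have c0: "c \<noteq> 0"
  proof
    assume "c = 0"
    then have "g U2 = a \<bullet> U2" by (simp add: g2)
    then show False using irr[of U2 a] by (simp add: zero_prod_def)
  qed
  have d0: "d \<noteq> 0"
  proof
    assume "d = 0"
    then have "g V3 = b \<bullet> V3" by (simp add: g3)
    then show False using irr[of V3 b] by (simp add: zero_prod_def)
  qed
  define e :: "'a zorn" where "e = (a, (c, 0, 0), (d, 0, 0), b)"
  have emul: "e \<star> y = g y" if "y \<in> LL" for y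
    using that by (elim LL_cases) (simp add: e_def gexp algebra_simps)
  define \<tau> where "\<tau> = sl3 (c / d, 0, 0) (0, 0, - 1 / c) (0, d, 0) \<circ> swp"
  have \<tau>a: "\<tau> \<in> octonion_auts" unfolding \<tau>_def by (intro aut_comp sl3_aut swp_aut) (simp add: c0 d0)
  have \<tau>v: "\<tau> (0, (0, x, 0), (0, 0, y), 0) = (0, (0, - (y * d), 0), (0, 0, x * c), 0)" for x y
    using c0 d0 by (simp add: \<tau>_def)
  define s where "s = \<tau> \<circ> g \<circ> finv \<tau>"
  have gs: "conj_to g s" unfolding s_def using g(1) \<tau>a by (rule conj_toI)
  have sa: "s \<in> octonion_auts" using gs by (simp add: conj_to_def)
  define T where "T = a + b"
  have sL: "s y = T \<bullet> y - g y" if yL: "y \<in> LL" for y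
  proof -
    obtain x y' where y: "y = (0, (0, x, 0), (0, 0, y'), 0)" by (rule LL_cases[OF yL])
    have ty: "\<tau> (0, (0, y' / c, 0), (0, 0, - (x / d)), 0) = y" using c0 d0 by (simp add: \<tau>v y)
    have "s y = \<tau> (g (0, (0, y' / c, 0), (0, 0, - (x / d)), 0))"
      using conj_apply[OF \<tau>a, of g "(0, (0, y' / c, 0), (0, 0, - (x / d)), 0)"]
      unfolding ty s_def[symmetric] .
    then show ?thesis using c0 d0 by (simp add: gexp \<tau>v y T_def field_simps)
  qed
  define M where "M = {h \<in> octonion_auts. (\<forall>y\<in>LL. h y \<in> LL) \<and> (\<forall>y\<in>LL. h (g y) = g (h y))}"
  have Msub: "subgroup M G2"
    by (rule subgroup_G2I) (auto simp: M_def gL simp del: split_paired_all)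
  note L = subspD[OF subsp_LL]
  have gM: "g \<in> M" using g(1) gL by (simp add: M_def)
  have sM: "s \<in> M"
  proof -
    have "s y \<in> LL" if "y \<in> LL" for y using sL[OF that] L(4)[OF L(3)[OF that] gL[OF that]] by simp
    moreover have "s (g y) = g (s y)" if "y \<in> LL" for y
      using sL[OF that] sL[OF gL[OF that]] by (simp add: aut_diff[OF g(1)] aut_smul[OF g(1)])
    ultimately show ?thesis using sa by (simp add: M_def)
  qed
  have kL: "theta (0, t, 0) y = y" if "y \<in> LL" for t and y :: "'a zorn"
    using that by (elim LL_cases) simp
  have kM: "theta (0, t, 0) \<in> M" for t using kL gL by (simp add: M_def)
  have sirr: "y = 0" if "y \<in> LL" "s y = \<beta> \<bullet> y" for y \<beta>
  proof -
    have "g y = (T - \<beta>) \<bullet> y" using sL[OF that(1)] that(2) by (simp add: zsmul_diff_left algebra_simps)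
    then show ?thesis using irr that(1) by blast
  qed
  \<comment> \<open>The direction in which \<open>theta (0, t, 0)\<close>, which fixes
    \<open>LL\<close> pointwise, moves e.\<close>
  define y0 :: "'a zorn" where "y0 = (0, (0, a - b, 0), (0, 0, - c), 0)"
  have y0: "y0 \<in> LL" "y0 \<noteq> 0" using c0 by (simp_all add: y0_def zero_prod_def)
  define z1 where "z1 = y0 - s y0"
  have sLL: "s y \<in> LL" if "y \<in> LL" for y using sM that by (simp add: M_def)
  have z1L: "z1 \<in> LL" unfolding z1_def using L(4)[OF y0(1) sLL[OF y0(1)]] .
  have z10: "z1 \<noteq> 0" using sirr[OF y0(1), of 1] y0(2) by (auto simp: z1_def)
  show ?thesis
  proof (rule section_good[OF q gs Msub gM sM kM _ subsp_0 subsp_LL _ y0(1)])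
    show "h \<circ> g \<noteq> s \<circ> h" if hM: "h \<in> M" for h
    proof
      assume eq: "h \<circ> g = s \<circ> h"
      have h: "h \<in> octonion_auts" "\<And>y. y \<in> LL \<Longrightarrow> h y \<in> LL" using hM by (auto simp: M_def)
      have gs': "g y = s y" if y: "y \<in> LL" for y
      proof -
        obtain y' where y': "y' \<in> LL" "h y' = y" using LL_image[OF h y] by blast
        have "h (g y') = s (h y')" using fun_cong[OF eq, of y'] by simp
        then show ?thesis using hM y' by (auto simp: M_def)
      qed
      \<comment> \<open>Now g = T - g on \<open>LL\<close>, which forces characteristic 2 and a = b;
        a square root of d / c then produces an eigenvector.\<close>
      have U2: "U2 \<in> (LL :: 'a zorn set)" by simp
      have "g U2 = T \<bullet> U2 - g U2" using gs'[OF U2] sL[OF U2] by simp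
      then have "c = - c" "a = b" by (simp_all add: g2 T_def)
      then have "c + c = 0" by (simp add: eq_neg_iff_add_eq_0)
      then have "2 * c = 0" by simp
      then have two: "(2 :: 'a) = 0" using c0 by simp
      obtain w where w: "w * w = d / c" using surj_square_char2[OF two, of "d / c"] .
      have "d = w * w * c" using w c0 by simp
      then have "g (0, (0, w, 0), (0, 0, 1), 0) = (a + w * c) \<bullet> (0, (0, w, 0), (0, 0, 1), 0)"
        using \<open>a = b\<close> by (simp add: gexp algebra_simps)
      then show False using irr[of "(0, (0, w, 0), (0, 0, 1), 0)"] by (simp add: zero_prod_def)
    qed
    show "{0} \<subseteq> (LL :: 'a zorn set)" using L(1) by simp
    show "h y \<in> LL" if "h \<in> M" "y \<in> LL" for h y using that by (simp add: M_def)
    show "h x \<in> {0}" if "h \<in> M" "x \<in> {0}" for h x using that aut_0[of h] by (simp add: M_def)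
    show "h e - e \<in> LL" if hM: "h \<in> M" for h
    proof (rule annihilator_LL)
      fix y :: "'a zorn" assume y: "y \<in> LL"
      have h: "h \<in> octonion_auts" "\<And>y. y \<in> LL \<Longrightarrow> h y \<in> LL" using hM by (auto simp: M_def)
      obtain y' where y': "y' \<in> LL" "h y' = y" using LL_image[OF h y] by blast
      have "h e \<star> y = h (e \<star> y')" using y'(2) by (simp add: aut_mul[OF h(1)])
      also have "\<dots> = e \<star> y" using hM y' y by (simp add: emul M_def)
      finally have "(h e + (- 1) \<bullet> e) \<star> y = 0"
        by (simp only: zmul_add_left zmul_smul_left) (simp add: zsmul_minus)
      then show "(h e - e) \<star> y = 0" by (simp add: zsmul_minus)
    qed
    show "theta (0, t, 0) y - y \<in> {0}" if "y \<in> LL" for t and y :: "'a zorn" using kL[OF that] by simp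
    show "theta (0, t, 0) e - e - t \<bullet> y0 \<in> {0}" for t
      by (simp add: e_def y0_def zero_prod_def)
    show "g (g (y0 - s y0)) - (y0 - s y0) \<notin> {0}"
    proof
      assume "g (g (y0 - s y0)) - (y0 - s y0) \<in> {0}"
      then have "g (g z1) = z1" by (simp add: z1_def)
      then have "g (g z1 + z1) = 1 \<bullet> (g z1 + z1)" by (simp add: aut_add[OF g(1)] add.commute)
      then have "g z1 + z1 = 0" using irr[OF L(2)[OF gL[OF z1L] z1L]] by blast
      then have "g z1 = (- 1) \<bullet> z1" by (simp add: zsmul_minus eq_neg_iff_add_eq_0)
      then show False using irr z1L z10 by blast
    qed
    show "g (y0 - s (s y0)) - (y0 - s (s y0)) \<notin> {0}"
    proof
      assume "g (y0 - s (s y0)) - (y0 - s (s y0)) \<in> {0}"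
      moreover have "y0 - s (s y0) = z1 + s z1" by (simp add: z1_def aut_diff[OF sa])
      ultimately have "g (z1 + s z1) = 1 \<bullet> (z1 + s z1)" by simp
      then have "z1 + s z1 = 0" using irr[OF L(2)[OF z1L sLL[OF z1L]]] by blast
      then have "s z1 = (- 1) \<bullet> z1" by (simp add: zsmul_minus eq_neg_iff_add_eq_0 add.commute)
      then show False using sirr z1L z10 by blast
    qed
  qed
qed

theorem good_special_span:
  fixes g :: "'a::{finite,field} zorn \<Rightarrow> 'a zorn"
  assumes q: "card (UNIV :: 'a set) > 2" and g: "g \<in> octonion_auts" "g \<noteq> id"
    and x: "x \<noteq> 0" "ztr x = 0" "znorm x = 0" and y: "ztr y = 0" "x \<star> y = 0" "\<And>c. y \<noteq> c \<bullet> x"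
    and gx: "g x = a \<bullet> x + b \<bullet> y" and gy: "g y = a' \<bullet> x + b' \<bullet> y"
  shows "good g"
proof -
  obtain h where h: "h \<in> octonion_auts" "h x = U1" "h y = V2" using special_pair[OF x y] by blast
  define k where "k = sl3 (0, 1, 0) (0, 0, 1) (1, 0, 0) \<circ> h"
  have k: "k \<in> octonion_auts" "k x = U2" "k y = V3"
    using h unfolding k_def by (auto intro!: aut_comp sl3_aut)
  define g' where "g' = k \<circ> g \<circ> finv k"
  have c: "conj_to g g'" unfolding g'_def using g(1) k(1) by (rule conj_toI)
  have g': "g' \<in> octonion_auts" using c by (simp add: conj_to_def)
  have g'id: "g' \<noteq> id"
    using g(2) unfolding g'_def conj_eq_iff[OF k(1)] comp_id id_comp
    by (metis comp_cancel[OF k(1)] comp_id)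
  have "g' U2 = a \<bullet> U2 + b \<bullet> V3" "g' V3 = a' \<bullet> U2 + b' \<bullet> V3"
    using conj_apply[OF k(1), of g x] conj_apply[OF k(1), of g y] unfolding g'_def[symmetric]
    by (simp_all add: k gx gy aut_add aut_smul)
  note v = this
  have "g' z \<in> LL" if zL: "z \<in> LL" for z
  proof -
    obtain p r where z: "z = (0, (0, p, 0), (0, 0, r), 0)" by (rule LL_cases[OF zL])
    show ?thesis unfolding z by (subst aut_expand[OF g']) (simp add: v)
  qed
  then have "good g'" by (rule good_special_line[OF q g' g'id])
  then show ?thesis using good_conj[OF c] by blast
qed

section \<open>Elements preserving a split quaternion subalgebra\<close>

lemma card_squares:
  "card (UNIV :: 'a::{finite,field} set) + 1 \<le> 2 * card (range (\<lambda>x :: 'a. x * x))"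
proof -
  define S where "S = range (\<lambda>x :: 'a. x * x)"
  have S0: "0 \<in> S" unfolding S_def by (rule range_eqI[of _ _ 0]) simp
  have fib: "card {x :: 'a. x * x = s} \<le> 2" if sS: "s \<in> S" for s
  proof -
    obtain y where y: "s = y * y" using sS unfolding S_def by blast
    have "x = y \<or> x = - y" if "x * x = s" for x
    proof -
      have "(x - y) * (x + y) = 0" using that y by (simp add: algebra_simps)
      then show ?thesis by (simp add: eq_neg_iff_add_eq_0)
    qed
    then have "{x. x * x = s} \<subseteq> {y, - y}" by blast
    from card_mono[OF _ this] show ?thesis by (simp add: card_insert_if split: if_splits)
  qed
  have U: "(UNIV :: 'a set) = {0} \<union> (\<Union>s\<in>S - {0}. {x. x * x = s})" by (auto simp: S_def)
  have "card (UNIV :: 'a set) \<le> card {0 :: 'a} + card (\<Union>s\<in>S - {0}. {x :: 'a. x * x = s})"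
    by (subst U) (rule card_Un_le)
  also have "card (\<Union>s\<in>S - {0}. {x :: 'a. x * x = s}) \<le> (\<Sum>s\<in>S - {0}. card {x :: 'a. x * x = s})"
    by (rule card_UN_le) simp
  also have "\<dots> \<le> (\<Sum>s\<in>S - {0}. 2)" by (rule sum_mono) (use fib in blast)
  also have "\<dots> = 2 * (card S - 1)" using S0 by (simp add: card_Diff_singleton)
  finally have "card (UNIV :: 'a set) \<le> 1 + 2 * (card S - 1)" by simp
  moreover have "card S > 0" using S0 by (auto simp: card_gt_0_iff)
  ultimately show ?thesis unfolding S_def by linarith
qed

text \<open>With S the set of squares, A S and C - B S both have more than q / 2 elements, so they
  meet. The count of squares covers characteristic 2 as well.\<close>

lemma binary_form_represents:
  fixes A B C :: "'a::{finite,field}"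
  assumes "A \<noteq> 0" "B \<noteq> 0"
  obtains x y where "A * (x * x) + B * (y * y) = C"
proof -
  define S where "S = range (\<lambda>x :: 'a. x * x)"
  define S1 where "S1 = (\<lambda>s. A * s) ` S"
  define S2 where "S2 = (\<lambda>s. C - B * s) ` S"
  have c1: "card S1 = card S" unfolding S1_def by (rule card_image) (simp add: inj_on_def assms)
  have c2: "card S2 = card S" unfolding S2_def by (rule card_image) (simp add: inj_on_def assms)
  have "S1 \<inter> S2 \<noteq> {}"
  proof
    assume "S1 \<inter> S2 = {}"
    then have "card (S1 \<union> S2) = card S1 + card S2" by (intro card_Un_disjoint) auto
    moreover have "card (S1 \<union> S2) \<le> card (UNIV :: 'a set)" by (intro card_mono) auto
    ultimately show False using card_squares[where 'a = 'a] c1 c2 unfolding S_def[symmetric] by linarith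
  qed
  then obtain z where "z \<in> S1" "z \<in> S2" by blast
  then obtain x y where "z = A * (x * x)" "z = C - B * (y * y)" unfolding S1_def S2_def S_def by blast
  then have "A * (x * x) = C - B * (y * y)" by simp
  then have "A * (x * x) + B * (y * y) = C" by (metis diff_add_cancel)
  then show thesis by (rule that)
qed

section \<open>Two by two matrices and the stabilizer of the standard quaternion algebra\<close>

type_synonym 'a m2 = "'a \<times> 'a \<times> 'a \<times> 'a"

fun mm :: "'a::field m2 \<Rightarrow> 'a m2 \<Rightarrow> 'a m2" where
  "mm (a, b, c, d) (a', b', c', d') = (a * a' + b * c', a * b' + b * d', c * a' + d * c', c * b' + d * d')"
fun madj :: "'a::field m2 \<Rightarrow> 'a m2" where "madj (a, b, c, d) = (d, - b, - c, a)"
fun mdet :: "'a::field m2 \<Rightarrow> 'a" where "mdet (a, b, c, d) = a * d - b * c"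
fun mtr :: "'a::field m2 \<Rightarrow> 'a" where "mtr (a, b, c, d) = a + d"
fun msc :: "'a::field \<Rightarrow> 'a m2 \<Rightarrow> 'a m2" where "msc k (a, b, c, d) = (k * a, k * b, k * c, k * d)"
abbreviation mone :: "'a::field m2" where "mone \<equiv> (1, 0, 0, 1)"

lemma m2_cases: obtains a b c d where "x = (a, b, c, d)" by (cases x)

lemma mm_assoc: "mm (mm x y) z = mm x (mm y z)"
  by (cases x; cases y; cases z) (simp add: algebra_simps)
lemma mm_add: "mm (x + y) z = mm x z + mm y z" "mm z (x + y) = mm z x + mm z y"
  by (cases x; cases y; cases z; simp add: algebra_simps)+
lemma mm_diff: "mm (x - y) z = mm x z - mm y z" "mm z (x - y) = mm z x - mm z y"
  by (cases x; cases y; cases z; simp add: algebra_simps)+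
lemma mm_msc: "mm (msc k x) y = msc k (mm x y)" "mm x (msc k y) = msc k (mm x y)"
  by (cases x; cases y; simp add: algebra_simps)+
lemma msc_msc: "msc k (msc l x) = msc (k * l) x" by (cases x) simp
lemma msc_1 [simp]: "msc 1 x = x" by (cases x) simp
lemma msc_0 [simp]: "msc 0 x = 0" by (cases x) (simp add: zero_prod_def)
lemma msc_zero [simp]: "msc k 0 = 0" by (simp add: zero_prod_def)
lemma msc_add: "msc k (x + y) = msc k x + msc k y" by (cases x; cases y) (simp add: algebra_simps)
lemma msc_diff: "msc k (x - y) = msc k x - msc k y" by (cases x; cases y) (simp add: algebra_simps)
lemma msc_cancel: "k \<noteq> 0 \<Longrightarrow> msc k x = msc k y \<longleftrightarrow> x = y" by (cases x; cases y) auto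
lemma msc_cancel_left: "msc k x = msc l x \<Longrightarrow> x \<noteq> 0 \<Longrightarrow> k = l" by (cases x) (auto simp: zero_prod_def)
lemma mm_mone [simp]: "mm mone x = x" "mm x mone = x" by (cases x; simp)+
lemma mm_scalar [simp]: "mm (k, 0, 0, k) x = msc k x" "mm x (k, 0, 0, k) = msc k x"
  by (cases x; simp add: mult.commute)+
lemma mm_zero [simp]: "mm 0 x = 0" "mm x 0 = 0" by (cases x; simp add: zero_prod_def)+
lemma madj_mm: "madj (mm x y) = mm (madj y) (madj x)" by (cases x; cases y) (simp add: algebra_simps)
lemma madj_madj [simp]: "madj (madj x) = x" by (cases x) simp
lemma madj_msc: "madj (msc k x) = msc k (madj x)" by (cases x) simp
lemma madj_zero [simp]: "madj 0 = 0" by (simp add: zero_prod_def)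
lemma mm_madj: "mm x (madj x) = msc (mdet x) mone" "mm (madj x) x = msc (mdet x) mone"
  by (cases x; simp add: algebra_simps)+
lemma mm_madj': "mm x (mm (madj x) y) = msc (mdet x) y" "mm (madj x) (mm x y) = msc (mdet x) y"
  by (simp_all add: mm_assoc[symmetric] mm_madj mm_msc)
lemma mdet_mm [simp]: "mdet (mm x y) = mdet x * mdet y" by (cases x; cases y) (simp add: algebra_simps)
lemma mdet_madj [simp]: "mdet (madj x) = mdet x" by (cases x) simp
lemma mtr_madj [simp]: "mtr (madj x) = mtr x" by (cases x) simp
lemma mtr_mm: "mtr (mm x y) = mtr (mm y x)" by (cases x; cases y) (simp add: algebra_simps)
lemma mdet_msc: "mdet (msc k x) = k * k * mdet x" by (cases x) (simp add: algebra_simps)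
lemma cayley_hamilton: "mm x x = msc (mtr x) x - msc (mdet x) mone" by (cases x) (simp add: algebra_simps)
lemma mm_cancel: "mdet z \<noteq> 0 \<Longrightarrow> mm x z = mm y z \<longleftrightarrow> x = y"
proof
  assume z: "mdet z \<noteq> 0" "mm x z = mm y z"
  have "mm (mm x z) (madj z) = mm (mm y z) (madj z)" by (simp add: z)
  then show "x = y" using z(1) by (simp add: mm_assoc mm_madj mm_msc msc_cancel)
qed simp
lemma mdet_neq_0: "mdet x \<noteq> 0 \<Longrightarrow> x \<noteq> 0" by (cases x) (auto simp: zero_prod_def)

text \<open>The second matrix of \<open>enc\<close> represents the orthogonal complement of the first quaternion
  algebra, as in the Cayley--Dickson construction.\<close>
fun enc :: "'a::field m2 \<Rightarrow> 'a m2 \<Rightarrow> 'a zorn" where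
  "enc (a, b, c, d) (p, q, r, s) = (a, (b, p, r), (c, - s, q), d)"

lemma enc_cases: obtains x y where "z = enc x y"
proof (cases z rule: zorn_cases)
  case (1 a u1 u2 u3 v1 v2 v3 b)
  then have "z = enc (a, u1, v1, b) (u2, v3, u3, - v2)" by simp
  then show thesis by (rule that)
qed
lemma enc_eq [simp]: "enc x y = enc x' y' \<longleftrightarrow> x = x' \<and> y = y'"
  by (cases x; cases y; cases x'; cases y') auto
lemma enc_add: "enc x y + enc x' y' = enc (x + x') (y + y')"
  by (cases x; cases y; cases x'; cases y') simp
lemma enc_smul: "k \<bullet> enc x y = enc (msc k x) (msc k y)" by (cases x; cases y) simp
lemma enc_0 [simp]: "enc 0 0 = 0" by (simp add: zero_prod_def)
lemma enc_mul: "enc x y \<star> enc x' y' = enc (mm x x' - mm (madj y') y) (mm y' x + mm y (madj x'))"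
  by (cases x; cases y; cases x'; cases y') (simp add: algebra_simps)
lemma ztr_enc [simp]: "ztr (enc x y) = mtr x" by (cases x; cases y) simp
lemma znorm_enc [simp]: "znorm (enc x y) = mdet x + mdet y" by (cases x; cases y) (simp add: algebra_simps)

text \<open>As \<open>madj s\<close> divided by \<open>mdet s\<close> is the inverse of s, this is
  (x, y) \<mapsto> (s x s^-1, t y s^-1). Equal determinants of s and t make it an automorphism, and
  \<open>gam_form\<close> shows that the stabilizer contains no others.\<close>

fun gam :: "'a::field m2 \<Rightarrow> 'a m2 \<Rightarrow> 'a zorn \<Rightarrow> 'a zorn" where
  "gam s t (a, (u1, u2, u3), (v1, v2, v3), b) =
     enc (msc (1 / mdet s) (mm s (mm (a, u1, v1, b) (madj s))))
         (msc (1 / mdet s) (mm t (mm (u2, v3, u3, - v2) (madj s))))"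

lemma gam_enc: "gam s t (enc x y) =
    enc (msc (1 / mdet s) (mm s (mm x (madj s)))) (msc (1 / mdet s) (mm t (mm y (madj s))))"
  by (cases x; cases y) simp

lemma gam_gam: "gam s t (gam s' t' z) = gam (mm s s') (mm t t') z"
  by (cases z rule: enc_cases) (simp add: gam_enc mm_msc msc_msc madj_mm mm_assoc)

lemma gam_comp: "gam s t \<circ> gam s' t' = gam (mm s s') (mm t t')"
  by (rule ext) (simp only: o_apply gam_gam)

lemma gam_scalar: "k \<noteq> 0 \<Longrightarrow> gam (k, 0, 0, k) (k, 0, 0, k) z = z"
  by (cases z rule: enc_cases) (simp add: gam_enc mm_msc madj_msc msc_msc mdet_msc)

lemma gam_aut:
  assumes d: "mdet s = mdet t" "mdet t \<noteq> 0" shows "gam s t \<in> octonion_auts"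
proof (rule autI)
  show "gam s t (x + y) = gam s t x + gam s t y" for x y
    by (cases x rule: enc_cases; cases y rule: enc_cases) (simp add: gam_enc enc_add mm_add msc_add)
  show "gam s t (c \<bullet> x) = c \<bullet> gam s t x" for c x
    by (cases x rule: enc_cases) (simp add: gam_enc enc_smul mm_msc msc_msc mult.commute)
  show "gam s t (x \<star> y) = gam s t x \<star> gam s t y" for x y
    using d by (cases x rule: enc_cases; cases y rule: enc_cases)
      (simp add: gam_enc enc_mul mm_add mm_diff mm_msc msc_add msc_diff msc_msc madj_mm madj_msc mm_assoc mm_madj' )
  show "gam (madj s) (madj t) (gam s t x) = x" for x
    using d by (simp add: gam_gam mm_madj gam_scalar)
  show "gam s t (gam (madj s) (madj t) x) = x" for x
    using d by (simp add: gam_gam mm_madj gam_scalar)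
qed

lemma commute_all: assumes "\<And>x. mm r x = mm x r" obtains k where "r = msc k mone"
proof (cases r rule: m2_cases)
  case (1 a b c d)
  show thesis using assms[of "(1, 0, 0, 0)"] assms[of "(0, 1, 0, 0)"] that[of a] 1 by simp
qed

text \<open>The first component shows that s^-1 s' is scalar, say s' = l s, and the second component
  then gives t' = l t. Pairs (s, t) thus count up to a common scalar.\<close>

lemma gam_eq:
  assumes d: "mdet s = mdet t" "mdet t \<noteq> 0" and d': "mdet s' = mdet t'" "mdet t' \<noteq> 0"
    and e: "gam s t = gam s' t'"
  obtains k where "s' = msc k s" "t' = msc k t"
proof -
  define i where "i = 1 / mdet s"
  define i' where "i' = 1 / mdet s'"
  have ex: "msc i (mm s (mm x (madj s))) = msc i' (mm s' (mm x (madj s')))"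
    and ey: "msc i (mm t (mm x (madj s))) = msc i' (mm t' (mm x (madj s')))" for x
    using fun_cong[OF e, of "enc x x"] unfolding gam_enc enc_eq i_def i'_def by simp_all
  have i: "i * mdet s = 1" "i' * mdet s' = 1" using d d' by (simp_all add: i_def i'_def)
  have comm: "mm (mm (madj s) s') x = mm x (mm (madj s) s')" for x
  proof -
    have "msc (i * mdet s) (mm x (mm (madj s) s')) = mm (madj s) (mm (msc i (mm s (mm x (madj s)))) s')"
      by (simp add: mm_msc mm_assoc mm_madj' msc_msc)
    also have "\<dots> = mm (madj s) (mm (msc i' (mm s' (mm x (madj s')))) s')" by (simp add: ex)
    also have "\<dots> = msc (i' * mdet s') (mm (mm (madj s) s') x)"
      by (simp add: mm_msc mm_assoc mm_madj mm_madj' msc_msc)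
    finally show ?thesis by (simp add: i)
  qed
  obtain k where k: "mm (madj s) s' = msc k mone" by (rule commute_all[OF comm])
  have "msc (mdet s) s' = mm s (mm (madj s) s')" by (simp add: mm_madj')
  also have "\<dots> = msc k s" by (simp add: k mm_msc)
  finally have "msc i (msc (mdet s) s') = msc i (msc k s)" by simp
  then have s': "s' = msc (i * k) s" by (simp add: msc_msc i)
  define l where "l = i * k"
  have s'l: "s' = msc l s" unfolding l_def by (rule s')
  have l0: "l \<noteq> 0" using d' unfolding s'l mdet_msc by auto
  have "msc (i * mdet s) t = msc (i' * l * mdet s) t'"
    using ey[of s] by (simp add: s'l mm_msc madj_msc mm_madj msc_msc mult.assoc)
  moreover have "i' * l * mdet s = 1 / l" using d l0 unfolding i'_def s'l mdet_msc by simp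
  ultimately have "msc l t = msc l (msc (1 / l) t')" using i by simp
  then have "t' = msc l t" using l0 by (simp add: msc_msc)
  then show thesis using that[OF s'l] by blast
qed

lemma gam_neq:
  assumes d: "mdet s = mdet t" "mdet t \<noteq> 0" and d': "mdet s' = mdet t'" "mdet t' \<noteq> 0"
    and n: "s = s' \<and> t \<noteq> t' \<or> s \<noteq> s' \<and> t = t'"
  shows "gam s t \<noteq> gam s' t'"
proof
  assume "gam s t = gam s' t'"
  from gam_eq[OF d d' this] obtain k where k: "s' = msc k s" "t' = msc k t" .
  have "s \<noteq> 0" "t \<noteq> 0" using d mdet_neq_0[of s] mdet_neq_0[of t] by auto
  from n show False
  proof
    assume "s = s' \<and> t \<noteq> t'"
    then show False using k msc_cancel_left[of 1 s k] \<open>s \<noteq> 0\<close> by auto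
  next
    assume "s \<noteq> s' \<and> t = t'"
    then show False using k msc_cancel_left[of 1 t k] \<open>t \<noteq> 0\<close> by auto
  qed
qed

text \<open>\<open>al d\<close> is the sum of \<gamma>(e_i1) d e_1i over i, an intertwiner for every
  d. If it were singular, al d x adj (al d) would vanish for all x, which forces al d = 0; one of
  two choices of d makes it nonzero.\<close>

lemma skolem_noether:
  fixes \<gamma> :: "'a::field m2 \<Rightarrow> 'a m2"
  assumes add: "\<And>x y. \<gamma> (x + y) = \<gamma> x + \<gamma> y" and sc: "\<And>k x. \<gamma> (msc k x) = msc k (\<gamma> x)"
    and mul: "\<And>x y. \<gamma> (mm x y) = mm (\<gamma> x) (\<gamma> y)" and nz: "\<And>x. \<gamma> x = 0 \<Longrightarrow> x = 0"
  obtains s where "mdet s \<noteq> 0" "\<And>x. mm (\<gamma> x) s = mm s x"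
proof -
  let ?e11 = "(1, 0, 0, 0) :: 'a m2" and ?e12 = "(0, 1, 0, 0) :: 'a m2"
  let ?e21 = "(0, 0, 1, 0) :: 'a m2" and ?e22 = "(0, 0, 0, 1) :: 'a m2"
  have z: "\<gamma> (0, 0, 0, 0) = 0" using sc[of 0 "(0, 0, 0, 0)"] by simp
  have mul': "mm (\<gamma> x) (mm (\<gamma> y) w) = mm (\<gamma> (mm x y)) w" for x y w by (simp add: mul mm_assoc)
  define al where "al d = mm (\<gamma> ?e11) (mm d ?e11) + mm (\<gamma> ?e21) (mm d ?e12)" for d :: "'a m2"
  have b: "mm (\<gamma> ?e11) (al d) = mm (al d) ?e11" "mm (\<gamma> ?e12) (al d) = mm (al d) ?e12"
    "mm (\<gamma> ?e21) (al d) = mm (al d) ?e21" "mm (\<gamma> ?e22) (al d) = mm (al d) ?e22" for d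
    unfolding al_def mm_add mul' mm_assoc by (simp_all add: z)
  have com: "mm (\<gamma> x) (al d) = mm (al d) x" for x d
  proof (cases x rule: m2_cases)
    case (1 p q r t)
    have e: "x = msc p ?e11 + msc q ?e12 + msc r ?e21 + msc t ?e22" by (simp add: 1)
    show ?thesis unfolding e add sc mm_add mm_msc b by simp
  qed
  have "\<gamma> ?e11 \<noteq> 0" using nz[of ?e11] by (auto simp: zero_prod_def)
  then obtain p1 p2 p3 p4 where p: "\<gamma> ?e11 = (p1, p2, p3, p4)" "(p1, p2, p3, p4) \<noteq> 0" by (metis m2_cases)
  obtain q1 q2 q3 q4 where r: "\<gamma> ?e21 = (q1, q2, q3, q4)" by (rule m2_cases)
  have "al mone \<noteq> 0 \<or> al (0, 1, 1, 0) \<noteq> 0" using p(2) by (auto simp: al_def p(1) r zero_prod_def)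
  then obtain d where d: "al d \<noteq> 0" by blast
  have "mdet (al d) \<noteq> 0"
  proof
    assume d0: "mdet (al d) = 0"
    have k: "mm (al d) (mm x (madj (al d))) = 0" for x
    proof -
      have "mm (al d) (mm x (madj (al d))) = mm (\<gamma> x) (mm (al d) (madj (al d)))"
        by (simp add: mm_assoc[symmetric] com)
      then show ?thesis by (simp add: mm_madj d0)
    qed
    obtain a1 a2 a3 a4 where a: "al d = (a1, a2, a3, a4)" by (rule m2_cases)
    have "a1 = 0 \<and> a3 = 0" using k[of ?e12] unfolding a by (simp add: zero_prod_def)
    moreover have "a2 = 0 \<and> a4 = 0" using k[of ?e21] unfolding a by (simp add: zero_prod_def)
    ultimately show False using d a by (simp add: zero_prod_def)
  qed
  then show thesis using com by (rule that)
qed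

text \<open>h preserves the span of \<open>U2\<close> and \<open>U3\<close>, since it is cut out by
  products with \<open>E1\<close> and \<open>V1\<close>; on it U2 U3 = V1 makes the determinant
  1.\<close>

lemma aut_fixing_quaternions:
  fixes h :: "'a::field zorn \<Rightarrow> 'a zorn"
  assumes h: "h \<in> octonion_auts" and fix_h: "\<And>x. h (enc x 0) = enc x 0"
  obtains t where "mdet t = 1" "h = gam mone t"
proof -
  have e: "h E1 = E1" "h U1 = U1" "h V1 = V1" "h E2 = E2"
    using fix_h[of "(1, 0, 0, 0)"] fix_h[of "(0, 1, 0, 0)"] fix_h[of "(0, 0, 1, 0)"] fix_h[of "(0, 0, 0, 1)"]
    by (simp_all add: zero_prod_def)
  have P: "\<exists>p2 p3. h y = (0, (0, p2, p3), (0, 0, 0), 0)"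
    if y: "E1 \<star> y = y" "y \<star> E1 = 0" "V1 \<star> y = 0" for y
  proof -
    have "E1 \<star> h y = h y" "h y \<star> E1 = 0" "V1 \<star> h y = 0"
      using aut_mul[OF h, of E1 y] aut_mul[OF h, of y E1] aut_mul[OF h, of V1 y] y
      by (simp_all only: e aut_0[OF h])
    then show ?thesis by (cases "h y" rule: zorn_cases) (auto simp: zero_prod_def)
  qed
  obtain p2 p3 where p: "h U2 = (0, (0, p2, p3), (0, 0, 0), 0)" using P[of U2] by (auto simp: zero_prod_def)
  obtain r2 r3 where r: "h U3 = (0, (0, r2, r3), (0, 0, 0), 0)" using P[of U3] by (auto simp: zero_prod_def)
  have "h (U2 \<star> U3) = h U2 \<star> h U3" by (rule aut_mul[OF h])
  then have d: "p2 * r3 - p3 * r2 = 1" using e(3) by (simp add: p r zero_prod_def)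
  have dt: "mdet (p2, r2, p3, r3) = 1" using d by (simp add: algebra_simps)
  have "h = gam mone (p2, r2, p3, r3)"
    by (rule aut_eqI[OF h gam_aut]) (use dt in \<open>simp_all add: e p r\<close>)
  then show thesis using dt that by blast
qed

lemma gam_form:
  fixes g :: "'a::field zorn \<Rightarrow> 'a zorn"
  assumes g: "g \<in> octonion_auts" and pres: "\<And>x. \<exists>x'. g (enc x 0) = enc x' 0"
  obtains s t where "mdet s = mdet t" "mdet t \<noteq> 0" "g = gam s t"
proof -
  define \<gamma> where "\<gamma> x = (SOME x'. g (enc x 0) = enc x' 0)" for x
  have \<gamma>: "g (enc x 0) = enc (\<gamma> x) 0" for x unfolding \<gamma>_def by (rule someI_ex[OF pres])
  obtain s where s: "mdet s \<noteq> 0" "\<And>x. mm (\<gamma> x) s = mm s x"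
  proof (rule skolem_noether[of \<gamma>])
    show "\<gamma> (x + y) = \<gamma> x + \<gamma> y" for x y
      using aut_add[OF g, of "enc x 0" "enc y 0"] by (simp add: enc_add \<gamma>)
    show "\<gamma> (msc k x) = msc k (\<gamma> x)" for k x
      using aut_smul[OF g, of k "enc x 0"] by (simp add: enc_smul \<gamma>)
    show "\<gamma> (mm x y) = mm (\<gamma> x) (\<gamma> y)" for x y
      using aut_mul[OF g, of "enc x 0" "enc y 0"] by (simp add: enc_mul \<gamma>)
    show "x = 0" if "\<gamma> x = 0" for x
    proof -
      have "g (enc x 0) = 0" using \<gamma>[of x] that by simp
      then have "enc x 0 = enc 0 0" unfolding aut_eq_0[OF g] by simp
      then show ?thesis unfolding enc_eq by blast
    qed
  qed blast
  define t0 :: "'a m2" where "t0 = (mdet s, 0, 0, 1)"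
  have t0: "mdet s = mdet t0" "mdet t0 \<noteq> 0" using s(1) by (simp_all add: t0_def)
  note k = gam_aut[OF t0]
  have kx: "gam s t0 (enc x 0) = g (enc x 0)" for x
    using s(1) by (simp add: gam_enc \<gamma> mm_assoc[symmetric] s(2)[symmetric])
      (simp add: mm_assoc mm_madj mm_msc msc_msc)
  define h where "h = finv (gam s t0) \<circ> g"
  have h: "h \<in> octonion_auts" unfolding h_def by (intro aut_comp aut_inv k g)
  have "h (enc x 0) = enc x 0" for x using aut_inv_f(1)[OF k, of "enc x 0"] by (simp add: h_def kx)
  from aut_fixing_quaternions[OF h this] obtain t where t: "mdet t = 1" "h = gam mone t" .
  have "g = gam s t0 \<circ> h" unfolding h_def o_assoc finv_comp(2)[OF k] by simp
  then have "g = gam s (mm t0 t)" by (simp add: t gam_comp)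
  then show thesis using that[of s "mm t0 t"] t t0 by simp
qed


section \<open>Classes of the automorphisms \<open>gam s t\<close>\<close>

definition irr2 :: "'a::field m2 \<Rightarrow> bool" where
  "irr2 s \<longleftrightarrow> (\<forall>l x y. mm s (x, 0, y, 0) = msc l (x, 0, y, 0) \<longrightarrow> x = 0 \<and> y = 0)"

lemma irr2_c: assumes "irr2 (a, b, c, d)" shows "c \<noteq> 0"
  using assms[unfolded irr2_def, rule_format, of 1 0 a] by auto

lemma irr2_root: assumes "irr2 s" shows "l * l - mtr s * l + mdet s \<noteq> 0"
proof (cases s rule: m2_cases)
  case (1 a b c d)
  have c: "c \<noteq> 0" using assms unfolding 1 by (rule irr2_c)
  show ?thesis
  proof
    assume "l * l - mtr s * l + mdet s = 0"
    then have e: "(l - d) * (l - a) = b * c" by (simp add: 1 algebra_simps)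
    have "mm s (l - d, 0, c, 0) = msc l (l - d, 0, c, 0)"
      using e by (simp add: 1 algebra_simps)
    then show False using assms c unfolding irr2_def by blast
  qed
qed

text \<open>An eigenvector (x, y) of s yields the nilpotent matrix z whose kernel and image are the
  eigenline; s z s^-1 is a multiple of z, which spans an invariant null line.\<close>

lemma good_reducible_left:
  fixes s t :: "'a::{finite,field} m2"
  assumes q: "card (UNIV :: 'a set) > 2" and d: "mdet s = mdet t" "mdet t \<noteq> 0" and id: "gam s t \<noteq> id"
    and r: "\<not> irr2 s"
  shows "good (gam s t)"
proof -
  obtain l x y where e: "mm s (x, 0, y, 0) = msc l (x, 0, y, 0)" and nz: "\<not> (x = 0 \<and> y = 0)"
    using r unfolding irr2_def by blast
  obtain a b c f where s: "s = (a, b, c, f)" by (rule m2_cases)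
  have e1: "a * x + b * y = l * x" "c * x + f * y = l * y" using e by (simp_all add: s)
  define z where "z = (- (x * y), x * x, - (y * y), x * y)"
  have "mm s (mm z (madj s)) = (- ((a * x + b * y) * (c * x + f * y)), (a * x + b * y) * (a * x + b * y),
      - ((c * x + f * y) * (c * x + f * y)), (a * x + b * y) * (c * x + f * y))"
    by (simp add: s z_def algebra_simps)
  then have "mm s (mm z (madj s)) = msc (l * l) z" unfolding e1 by (simp add: z_def algebra_simps)
  then have g: "gam s t (enc z 0) = (l * l / mdet s) \<bullet> enc z 0" by (simp add: gam_enc enc_smul msc_msc)
  have "z \<noteq> 0" using nz by (auto simp: z_def zero_prod_def)
  then have "enc z 0 \<noteq> 0" using enc_eq[of z 0 0 0] by simp
  then show ?thesis by (rule good_null_line[OF q gam_aut[OF d] id _ _ _ g]) (simp_all add: z_def zero_prod_def)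
qed

text \<open>The matrices whose columns lie in an eigenline of t form a plane stable under y
  \<mapsto> t y s^-1, and the octonion product vanishes on it.\<close>

lemma good_reducible_right:
  fixes s t :: "'a::{finite,field} m2"
  assumes q: "card (UNIV :: 'a set) > 2" and d: "mdet s = mdet t" "mdet t \<noteq> 0" and id: "gam s t \<noteq> id"
    and r: "\<not> irr2 t"
  shows "good (gam s t)"
proof -
  obtain l x y where e: "mm t (x, 0, y, 0) = msc l (x, 0, y, 0)" and nz: "\<not> (x = 0 \<and> y = 0)"
    using r unfolding irr2_def by blast
  obtain a b c f where s: "s = (a, b, c, f)" by (rule m2_cases)
  obtain a' b' c' f' where t: "t = (a', b', c', f')" by (rule m2_cases)
  have e1: "a' * x + b' * y = l * x" "c' * x + f' * y = l * y" using e by (simp_all add: t)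
  define i where "i = 1 / mdet s"
  define P where "P = enc 0 (x, 0, y, 0)"
  define Q where "Q = enc 0 (0, x, 0, y)"
  have "mm t (mm (x, 0, y, 0) (madj s)) = ((a' * x + b' * y) * f, (a' * x + b' * y) * (- b),
      (c' * x + f' * y) * f, (c' * x + f' * y) * (- b))"
    "mm t (mm (0, x, 0, y) (madj s)) = ((a' * x + b' * y) * (- c), (a' * x + b' * y) * a,
      (c' * x + f' * y) * (- c), (c' * x + f' * y) * a)"
    by (simp_all add: s t algebra_simps)
  then have g: "gam s t P = (i * l * f) \<bullet> P + (i * l * (- b)) \<bullet> Q"
     "gam s t Q = (i * l * (- c)) \<bullet> P + (i * l * a) \<bullet> Q"
    unfolding e1 P_def Q_def gam_enc i_def[symmetric]
    by (simp_all only: enc_smul enc_add mm_zero msc_zero mm.simps) (simp_all add: zero_prod_def mult.assoc)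
  have nz': "(x, 0, y, 0) \<noteq> (0 :: 'a m2)" using nz by (simp add: zero_prod_def)
  show ?thesis
  proof (rule good_special_span[OF q gam_aut[OF d] id _ _ _ _ _ _ g])
    show "P \<noteq> 0" using nz' unfolding P_def using enc_eq[of 0 "(x, 0, y, 0)" 0 0] by simp
    show "ztr P = 0" "ztr Q = 0" "znorm P = 0" by (simp_all add: P_def Q_def zero_prod_def)
    show "P \<star> Q = 0" by (simp add: P_def Q_def enc_mul) (simp add: zero_prod_def)
    show "Q \<noteq> k \<bullet> P" for k using nz unfolding P_def Q_def enc_smul enc_eq by auto
  qed
qed

text \<open>A matrix conjugating an irreducible s into its adjugate. Its determinant is - 1 so that
  it can be paired with the conjugating matrix of \<open>skew_conjugate\<close> in the other
  component.\<close>

definition tau :: "'a::field m2 \<Rightarrow> 'a m2" where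
  "tau s = (case s of (a, b, c, d) \<Rightarrow> (- 1, (a - d) / c, 0, 1))"

lemma tau: assumes "irr2 s" shows "mm (tau s) s = mm (madj s) (tau s)" "mdet (tau s) = - 1"
proof -
  obtain a b c d where s: "s = (a, b, c, d)" by (rule m2_cases)
  have c: "c \<noteq> 0" using assms unfolding s by (rule irr2_c)
  show "mm (tau s) s = mm (madj s) (tau s)" "mdet (tau s) = - 1"
    using c by (simp_all add: s tau_def field_simps)
qed

text \<open>x is the conjugate of the adjugate of t by the shear with entry l = mu / c. One entry of
  its commutator with t is l c (a - d + l c), which explains the excluded values of mu.\<close>

lemma skew_conjugate:
  fixes t :: "'a::field m2"
  assumes "irr2 t" "mu \<noteq> 0" "\<And>a b c d. t = (a, b, c, d) \<Longrightarrow> mu \<noteq> d - a"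
  obtains x y where "mdet y = - 1" "mm y t = mm x y" "mm t x \<noteq> mm x t" "mtr x = mtr t" "mdet x = mdet t"
    "mtr (mm t x) = 2 * mdet t + mu * mu"
proof (cases t rule: m2_cases)
  case (1 a b c d)
  have c: "c \<noteq> 0" using assms(1) unfolding 1 by (rule irr2_c)
  define l where "l = mu / c"
  have lc: "l * c = mu" using c by (simp add: l_def)
  define k :: "'a m2" where "k = (1, l, 0, 1)"
  define x where "x = mm k (mm (madj t) (madj k))"
  have k: "mm (madj k) k = mone" by (simp add: k_def)
  have x: "x = (d - l * c, - b + l * (a - d) + l * l * c, - c, a + l * c)"
    by (simp add: x_def k_def 1 algebra_simps)
  show thesis
  proof
    show "mdet (mm k (tau t)) = - 1" using tau(2)[OF assms(1)] by (simp add: k_def)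
    have "mm x (mm k (tau t)) = mm k (mm (madj t) (mm (mm (madj k) k) (tau t)))" by (simp only: x_def mm_assoc)
    then show "mm (mm k (tau t)) t = mm x (mm k (tau t))"
      by (simp add: k tau(1)[OF assms(1)] mm_assoc)
    show "mm t x \<noteq> mm x t"
    proof
      assume "mm t x = mm x t"
      then have "a * (d - l * c) + b * (- c) = (d - l * c) * a + (- b + l * (a - d) + l * l * c) * c"
        by (simp only: 1 x mm.simps prod.inject)
      then have "c * l * (a - d + l * c) = 0" by (simp add: algebra_simps)
      moreover have "a - d + mu \<noteq> 0"
      proof
        assume "a - d + mu = 0"
        moreover have "mu = (a - d + mu) + (d - a)" by simp
        ultimately have "mu = d - a" by (metis add_0)
        then show False using assms(3)[OF 1] by blast
      qed
      ultimately show False using c assms(2) lc by auto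
    qed
    show "mtr x = mtr t" "mdet x = mdet t" by (simp_all add: x 1 algebra_simps)
    show "mtr (mm t x) = 2 * mdet t + mu * mu" unfolding lc[symmetric] by (simp add: x 1 algebra_simps)
  qed
qed

text \<open>By the Cayley-Hamilton identity t^2 is the trace times t up to a scalar matrix.\<close>

lemma square_commute:
  assumes "mtr t \<noteq> 0" "mm (mm t t) x = mm x (mm t t)" shows "mm t x = mm x t"
proof -
  have "msc (mtr t) (mm t x) = msc (mtr t) (mm x t)"
    using assms(2) unfolding cayley_hamilton mm_diff mm_msc by simp
  then show ?thesis using assms(1) by (simp add: msc_cancel)
qed

lemma product_commute:
  assumes "mtr (mm t x) \<noteq> 0" "mm (mm t x) (mm t x) = mm (mm x t) (mm x t)" shows "mm t x = mm x t"
proof -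
  have "msc (mtr (mm t x)) (mm t x) = msc (mtr (mm t x)) (mm x t)"
    using assms(2) unfolding cayley_hamilton mtr_mm[of x t] by (simp add: mult.commute)
  then show ?thesis using assms(1) by (simp add: msc_cancel)
qed

lemma madj_not_scalar_multiple:
  assumes "irr2 s" "mtr s \<noteq> 0" shows "madj s \<noteq> msc k s"
proof (cases s rule: m2_cases)
  case (1 a b c d)
  have c: "c \<noteq> 0" using assms(1) unfolding 1 by (rule irr2_c)
  show ?thesis
  proof
    assume "madj s = msc k s"
    then have "d = k * a" "- c = k * c" unfolding 1 madj.simps msc.simps prod.inject by blast+
    have "(k + 1) * c = k * c + c" by (simp add: algebra_simps)
    also have "\<dots> = 0" unfolding \<open>- c = k * c\<close>[symmetric] by simp
    finally have "(k + 1) * c = 0" .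
    then have "k = - 1" using c by (simp add: eq_neg_iff_add_eq_0)
    then show False using \<open>d = k * a\<close> assms(2) by (simp add: 1)
  qed
qed

lemma gam_conj:
  fixes s t :: "'a::{finite,field} m2"
  assumes d: "mdet s = mdet t" "mdet t \<noteq> 0" and s': "mdet s' = mdet s" "mdet t' = mdet t"
    and y: "mdet y = mdet y'" "mdet y' \<noteq> 0" "mm y s = mm s' y" "mm y' t = mm t' y'"
  shows "conj_to (gam s t) (gam s' t')"
proof -
  have "gam s' t' \<in> octonion_auts" by (rule gam_aut) (simp_all add: d s')
  moreover have "gam y y' \<circ> gam s t = gam s' t' \<circ> gam y y'" by (simp only: gam_comp y)
  ultimately show ?thesis unfolding conj_to_def using gam_aut[OF d] gam_aut[OF y(1,2)] by blast
qed

text \<open>The group M of the quaternion case. In one component, chosen by p, all its elements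
  commute with the given irreducible matrix; this keeps the matrix apart from its adjugate unless
  the two are proportional.\<close>

definition gamC :: "'a::field m2 \<Rightarrow> 'a m2 \<Rightarrow> bool \<Rightarrow> ('a zorn \<Rightarrow> 'a zorn) set" where
  "gamC s t p = {gam y z |y z. mdet y = mdet z \<and> mdet z \<noteq> 0 \<and> (if p then mm y s = mm s y else mm z t = mm t z)}"

lemma gamC_I: "mdet y = mdet z \<Longrightarrow> mdet z \<noteq> 0 \<Longrightarrow> (if p then mm y s = mm s y else mm z t = mm t z) \<Longrightarrow>
    gam y z \<in> gamC s t p"
  unfolding gamC_def by blast

lemma subgroup_gamC: "subgroup (gamC s t p :: ('a::{finite,field} zorn \<Rightarrow> 'a zorn) set) G2"
proof (rule subgroup_G2I)
  show "gamC s t p \<subseteq> octonion_auts" unfolding gamC_def using gam_aut by blast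
  have "gam mone mone = (id :: 'a zorn \<Rightarrow> _)" by (rule ext) (simp add: gam_scalar)
  moreover have "gam mone mone \<in> gamC s t p" by (rule gamC_I) simp_all
  ultimately show "id \<in> gamC s t p" by simp
  fix f g assume "f \<in> gamC s t p" "g \<in> gamC s t p"
  then obtain y z y' z' where *: "f = gam y z" "g = gam y' z'" "mdet y = mdet z" "mdet z \<noteq> 0"
     "mdet y' = mdet z'" "mdet z' \<noteq> 0" "if p then mm y s = mm s y else mm z t = mm t z"
     "if p then mm y' s = mm s y' else mm z' t = mm t z'" unfolding gamC_def by blast
  have "if p then mm (mm y y') s = mm s (mm y y') else mm (mm z z') t = mm t (mm z z')"
    using *(7,8) by (cases p) (simp_all add: mm_assoc, (simp add: mm_assoc[symmetric])+)
  then show "f \<circ> g \<in> gamC s t p" unfolding *(1,2) gam_comp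
    by (intro gamC_I) (simp_all add: *)
qed

lemma gamC_left:
  fixes s t x :: "'a::{finite,field} m2"
  assumes i: "irr2 s" and ts: "mtr s \<noteq> 0" and d: "mdet s = mdet t" "mdet t \<noteq> 0" and x: "mdet x = mdet t"
    and k: "k \<in> gamC s t True"
  shows "k \<circ> gam s t \<noteq> gam (madj s) x \<circ> k"
proof
  assume e: "k \<circ> gam s t = gam (madj s) x \<circ> k"
  obtain y z where yz: "k = gam y z" "mdet y = mdet z" "mdet z \<noteq> 0" "mm y s = mm s y"
    using k unfolding gamC_def by auto
  obtain u where "mm (madj s) y = msc u (mm y s)"
    by (rule gam_eq[of "mm y s" "mm z t" "mm (madj s) y" "mm x z"])
      (use e yz d x in \<open>auto simp: gam_comp\<close>)
  then have "mm (madj s) y = mm (msc u s) y" by (simp add: yz mm_msc)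
  then have "madj s = msc u s" using yz mm_cancel[of y] by simp
  then show False using madj_not_scalar_multiple[OF i ts] by blast
qed

lemma gamC_right:
  fixes s t x :: "'a::{finite,field} m2"
  assumes i: "irr2 t" and ts: "mtr t \<noteq> 0" and d: "mdet s = mdet t" "mdet t \<noteq> 0" and x: "mdet x = mdet s"
    and k: "k \<in> gamC s t False"
  shows "k \<circ> gam s t \<noteq> gam x (madj t) \<circ> k"
proof
  assume e: "k \<circ> gam s t = gam x (madj t) \<circ> k"
  obtain y z where yz: "k = gam y z" "mdet y = mdet z" "mdet z \<noteq> 0" "mm z t = mm t z"
    using k unfolding gamC_def by auto
  obtain u where "mm (madj t) z = msc u (mm z t)"
    by (rule gam_eq[of "mm y s" "mm z t" "mm x y" "mm (madj t) z"])
      (use e yz d x in \<open>auto simp: gam_comp\<close>)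
  then have "mm (madj t) z = mm (msc u t) z" by (simp add: yz mm_msc)
  then have "madj t = msc u t" using yz mm_cancel[of z] by simp
  then show False using madj_not_scalar_multiple[OF i ts] by blast
qed


lemma exists_shift:
  fixes y :: "'a::{finite,field}"
  assumes "card (UNIV :: 'a set) > 2" obtains x where "x \<noteq> 0" "x \<noteq> y"
proof -
  have "\<exists>x :: 'a. x \<noteq> 0 \<and> x \<noteq> y"
  proof (rule ccontr)
    assume "\<not> ?thesis"
    then have "(UNIV :: 'a set) \<subseteq> {0, y}" by auto
    from card_mono[OF _ this] show False using assms by (simp add: card_insert_if split: if_splits)
  qed
  then show thesis using that by blast
qed

text \<open>In the left component s commutes with its adjugate, so the commutators live in the right
  one, where a nonzero trace reduces commuting with t^2 to commuting with t.\<close>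

lemma good_C_quaternion:
  fixes s t :: "'a::{finite,field} m2"
  assumes q: "card (UNIV :: 'a set) > 2" and d: "mdet s = mdet t" "mdet t \<noteq> 0"
    and i: "irr2 s" "irr2 t" and tr: "mtr s \<noteq> 0" "mtr t \<noteq> 0"
  shows "good (gam s t)"
proof -
  obtain a b c e where t: "t = (a, b, c, e)" by (rule m2_cases)
  obtain mu where mu: "mu \<noteq> 0" "mu \<noteq> e - a" using exists_shift[OF q] by blast
  have "\<exists>x y. mdet y = - 1 \<and> mm y t = mm x y \<and> mm t x \<noteq> mm x t \<and> mtr x = mtr t \<and> mdet x = mdet t"
    by (rule skew_conjugate[OF i(2) mu(1)]) (use mu(2) t in blast)+
  then obtain x y where x: "mdet y = - 1" "mm y t = mm x y" "mm t x \<noteq> mm x t" "mtr x = mtr t" "mdet x = mdet t"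
    by blast
  define r where "r = gam s t"
  define r' where "r' = gam (madj s) x"
  note tau = tau[OF i(1)]
  have c: "conj_to r r'" unfolding r_def r'_def
    by (rule gam_conj[OF d _ _ _ _ tau(1) x(2)]) (simp_all add: x tau)
  have ss: "mm s (mm s (madj s)) = mm (madj s) (mm s s)" "mm (madj s) (mm (madj s) s) = mm s (mm (madj s) (madj s))"
    by (simp_all add: mm_madj mm_madj' mm_msc)
  show ?thesis unfolding r_def[symmetric]
  proof (rule good_C[OF c subgroup_gamC[of s t True]])
    show "r \<in> gamC s t True" "r' \<in> gamC s t True" unfolding r_def r'_def
      by (rule gamC_I; use d x(5) in \<open>simp add: mm_madj\<close>)+
    show "k \<circ> r \<noteq> r' \<circ> k" if "k \<in> gamC s t True" for k
      unfolding r_def r'_def by (rule gamC_left[OF i(1) tr(1) d x(5) that])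
    show "r \<circ> r \<circ> r' \<noteq> r' \<circ> (r \<circ> r)" unfolding r_def r'_def gam_comp
    proof (rule gam_neq)
      have "mm (mm t t) x \<noteq> mm x (mm t t)" using square_commute[OF tr(2)] x(3) by blast
      then show "mm (mm s s) (madj s) = mm (madj s) (mm s s) \<and> mm (mm t t) x \<noteq> mm x (mm t t) \<or>
        mm (mm s s) (madj s) \<noteq> mm (madj s) (mm s s) \<and> mm (mm t t) x = mm x (mm t t)" by (simp add: mm_assoc ss)
    qed (use d x(5) in simp_all)
    show "r' \<circ> r' \<circ> r \<noteq> r \<circ> (r' \<circ> r')" unfolding r_def r'_def gam_comp
    proof (rule gam_neq)
      have "mtr x \<noteq> 0" using tr x(4) by simp
      then have "mm (mm x x) t \<noteq> mm t (mm x x)" using square_commute[of x t] x(3) by auto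
      then show "mm (mm (madj s) (madj s)) s = mm s (mm (madj s) (madj s)) \<and> mm (mm x x) t \<noteq> mm t (mm x x) \<or>
        mm (mm (madj s) (madj s)) s \<noteq> mm s (mm (madj s) (madj s)) \<and> mm (mm x x) t = mm t (mm x x)"
        by (simp add: mm_assoc ss)
    qed (use d x(5) in simp_all)
  qed
qed

text \<open>The excluded case, that all nonzero squares equal \<open>- 2 n\<close>, forces \<open>q = 3\<close> and \<open>n = 1\<close>; but
  over the field with three elements no irreducible \<open>x\<^sup>2 - t x + 1\<close> has \<open>t \<noteq> 0\<close>.\<close>
lemma skew_conjugate_trace:
  fixes s t :: "'a::{finite,field} m2"
  assumes q: "card (UNIV :: 'a set) > 2" and d: "mdet s = mdet t" "mdet t \<noteq> 0"
    and i: "irr2 s" "irr2 t" and tr: "mtr s \<noteq> 0" "mtr t = 0"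
  obtains x y where "mdet y = - 1" "mm y t = mm x y" "mm t x \<noteq> mm x t" "mdet x = mdet t" "mtr (mm t x) \<noteq> 0"
proof -
  \<comment> \<open>In characteristic 2 a square root of \<open>mdet t\<close> would be an
    eigenvalue of the traceless t.\<close>
  have two: "(2 :: 'a) \<noteq> 0"
  proof
    assume two: "(2 :: 'a) = 0"
    obtain l where "l * l = mdet t" using surj_square_char2[OF two] .
    then have "l * l - mtr t * l + mdet t = 0" using char2(1)[OF two] by (simp add: tr)
    then show False using irr2_root[OF i(2)] by blast
  qed
  have "\<exists>mu. mu \<noteq> 0 \<and> 2 * mdet t + mu * mu \<noteq> 0"
  proof (rule ccontr)
    assume "\<not> ?thesis"
    then have all: "mu * mu = - (2 * mdet t)" if "mu \<noteq> 0" for mu using that by (metis add_eq_0_iff)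
    have one: "mu * mu = 1" if "mu \<noteq> 0" for mu :: 'a using all[OF that] all[of 1] by simp
    have "(2 :: 'a) * 2 = 1" using one[OF two] .
    then have "(4 :: 'a) = 1" by simp
    moreover have "(3 :: 'a) = 4 - 1" by simp
    ultimately have three: "(3 :: 'a) = 0" by simp
    have "- (2 * mdet t) = 1" using all[of 1] by simp
    moreover have "mdet t = 3 * mdet t + - (2 * mdet t)" by simp
    ultimately have "mdet t = 1" using three by simp
    then have "(- mtr s) * (- mtr s) - mtr s * (- mtr s) + mdet s = 3" using one[OF tr(1)] d(1) by simp
    then show False using irr2_root[OF i(1), of "- mtr s"] three by simp
  qed
  then obtain mu where mu: "mu \<noteq> 0" "2 * mdet t + mu * mu \<noteq> 0" by blast
  obtain a b c e where t: "t = (a, b, c, e)" by (rule m2_cases)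
  \<comment> \<open>The trace of t x involves only the square of mu, so the forbidden value e - a
    may be replaced by its negative.\<close>
  have "\<exists>mu'. mu' \<noteq> 0 \<and> mu' \<noteq> e - a \<and> mu' * mu' = mu * mu"
  proof (cases "mu = e - a")
    case True
    then have "- mu \<noteq> e - a" using two mu(1) by (metis add_eq_0_iff2 mult_2 mult_eq_0_iff)
    then show ?thesis using mu by (intro exI[of _ "- mu"]) simp
  qed (use mu in blast)
  then obtain mu' where mu': "mu' \<noteq> 0" "mu' \<noteq> e - a" "mu' * mu' = mu * mu" by blast
  have "\<exists>x y. mdet y = - 1 \<and> mm y t = mm x y \<and> mm t x \<noteq> mm x t \<and> mdet x = mdet t \<and>
      mtr (mm t x) = 2 * mdet t + mu' * mu'"
    by (rule skew_conjugate[OF i(2) mu'(1)]) (use mu'(2) t in blast)+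
  then show thesis using that mu'(3) mu(2) by metis
qed

text \<open>For traceless t the square of t is scalar, so squares give nothing. The comparison of (t
  x)^2 with (x t)^2 reduces to t x \<noteq> x t as soon as t x has nonzero trace; in the left
  component both products are the scalar \<open>mdet s\<close>.\<close>

lemma good_D_quaternion_left:
  fixes s t :: "'a::{finite,field} m2"
  assumes q: "card (UNIV :: 'a set) > 2" and d: "mdet s = mdet t" "mdet t \<noteq> 0"
    and i: "irr2 s" "irr2 t" and tr: "mtr s \<noteq> 0" "mtr t = 0"
  shows "good (gam s t)"
proof -
  obtain x y where x: "mdet y = - 1" "mm y t = mm x y" "mm t x \<noteq> mm x t" "mdet x = mdet t" "mtr (mm t x) \<noteq> 0"
    using skew_conjugate_trace[OF q d i tr] by blast
  define r where "r = gam s t"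
  define r' where "r' = gam (madj s) x"
  note tau = tau[OF i(1)]
  have c: "conj_to r r'" unfolding r_def r'_def
    by (rule gam_conj[OF d _ _ _ _ tau(1) x(2)]) (simp_all add: x tau)
  show ?thesis unfolding r_def[symmetric]
  proof (rule good_D[OF c subgroup_gamC[of s t True]])
    show "r \<in> gamC s t True" "r' \<in> gamC s t True" unfolding r_def r'_def
      by (rule gamC_I; use d x(4) in \<open>simp add: mm_madj\<close>)+
    show "k \<circ> r \<noteq> r' \<circ> k" if "k \<in> gamC s t True" for k
      unfolding r_def r'_def by (rule gamC_left[OF i(1) tr(1) d x(4) that])
    show "(r \<circ> r') \<circ> (r \<circ> r') \<noteq> (r' \<circ> r) \<circ> (r' \<circ> r)" unfolding r_def r'_def gam_comp
    proof (rule gam_neq)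
      have "mm (mm t x) (mm t x) \<noteq> mm (mm x t) (mm x t)" using product_commute[OF x(5)] x(3) by blast
      then show "mm (mm s (madj s)) (mm s (madj s)) = mm (mm (madj s) s) (mm (madj s) s) \<and>
          mm (mm t x) (mm t x) \<noteq> mm (mm x t) (mm x t) \<or>
        mm (mm s (madj s)) (mm s (madj s)) \<noteq> mm (mm (madj s) s) (mm (madj s) s) \<and>
          mm (mm t x) (mm t x) = mm (mm x t) (mm x t)" by (simp add: mm_madj)
    qed (use d x(4) in simp_all)
  qed
qed

lemma good_D_quaternion_right:
  fixes s t :: "'a::{finite,field} m2"
  assumes q: "card (UNIV :: 'a set) > 2" and d: "mdet s = mdet t" "mdet t \<noteq> 0"
    and i: "irr2 s" "irr2 t" and tr: "mtr s = 0" "mtr t \<noteq> 0"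
  shows "good (gam s t)"
proof -
  have d': "mdet t = mdet s" "mdet s \<noteq> 0" using d by simp_all
  obtain x y where x: "mdet y = - 1" "mm y s = mm x y" "mm s x \<noteq> mm x s" "mdet x = mdet s" "mtr (mm s x) \<noteq> 0"
    using skew_conjugate_trace[OF q d' i(2,1) tr(2,1)] by blast
  define r where "r = gam s t"
  define r' where "r' = gam x (madj t)"
  note tau = tau[OF i(2)]
  have c: "conj_to r r'" unfolding r_def r'_def
    by (rule gam_conj[OF d _ _ _ _ x(2) tau(1)]) (simp_all add: x tau)
  show ?thesis unfolding r_def[symmetric]
  proof (rule good_D[OF c subgroup_gamC[of s t False]])
    show "r \<in> gamC s t False" "r' \<in> gamC s t False" unfolding r_def r'_def
      by (rule gamC_I; use d x(4) in \<open>simp add: mm_madj\<close>)+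
    show "k \<circ> r \<noteq> r' \<circ> k" if "k \<in> gamC s t False" for k
      unfolding r_def r'_def by (rule gamC_right[OF i(2) tr(2) d x(4) that])
    show "(r \<circ> r') \<circ> (r \<circ> r') \<noteq> (r' \<circ> r) \<circ> (r' \<circ> r)" unfolding r_def r'_def gam_comp
    proof (rule gam_neq)
      have "mm (mm s x) (mm s x) \<noteq> mm (mm x s) (mm x s)" using product_commute[OF x(5)] x(3) by blast
      then show "mm (mm s x) (mm s x) = mm (mm x s) (mm x s) \<and>
          mm (mm t (madj t)) (mm t (madj t)) \<noteq> mm (mm (madj t) t) (mm (madj t) t) \<or>
        mm (mm s x) (mm s x) \<noteq> mm (mm x s) (mm x s) \<and>
          mm (mm t (madj t)) (mm t (madj t)) = mm (mm (madj t) t) (mm (madj t) t)" by (simp add: mm_madj)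
    qed (use d x(4) in simp_all)
  qed
qed

text \<open>Here \<open>gam s t\<close> is an involution. It fixes enc (x s) y whenever t y = y s.
  If y0 is an intertwiner of determinant c g, so is y0 (w + s), up to its determinant; the norm of
  the fixed vector becomes n x^2 + c g (w^2 + n), which has a zero.\<close>

lemma good_traceless_quaternion:
  fixes s t :: "'a::{finite,field} m2"
  assumes q: "card (UNIV :: 'a set) > 2" and d: "mdet s = mdet t" "mdet t \<noteq> 0" and id: "gam s t \<noteq> id"
    and i: "irr2 s" "irr2 t" and tr: "mtr s = 0" "mtr t = 0"
  shows "good (gam s t)"
proof -
  obtain a b c a' where s0: "s = (a, b, c, a')" by (rule m2_cases)
  obtain e f g e' where t0: "t = (e, f, g, e')" by (rule m2_cases)
  have "a' = - a" "e' = - e" using tr by (simp_all add: s0 t0 eq_neg_iff_add_eq_0 add.commute)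
  then have s: "s = (a, b, c, - a)" and t: "t = (e, f, g, - e)" using s0 t0 by simp_all
  have c: "c \<noteq> 0" "g \<noteq> 0" using i irr2_c unfolding s t by blast+
  define n where "n = mdet s"
  have n: "n \<noteq> 0" using d unfolding n_def by simp
  define y0 :: "'a m2" where "y0 = (c, e - a, 0, g)"
  have "- (a * a + b * c) = - (e * e + f * g)" using d(1) by (simp add: s t)
  then have dd: "a * a + b * c = e * e + f * g" by (simp only: neg_equal_iff_equal)
  have y0: "mm t y0 = mm y0 s" using dd by (simp add: s t y0_def algebra_simps)
  obtain x w where xw: "n * (x * x) + (c * g) * (w * w) = - (c * g * n)"
    using binary_form_represents[of n "c * g"] n c by (metis mult_eq_0_iff)
  define y where "y = mm y0 (msc w mone + s)"
  have ty: "mm t y = mm y s" unfolding y_def mm_assoc[symmetric] y0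
    by (simp add: mm_assoc mm_add mm_msc)
  define z where "z = enc (msc x s) y"
  have "gam s t z = 1 \<bullet> z"
    unfolding z_def gam_enc
    using n by (simp add: mm_assoc[symmetric] ty mm_msc, simp add: mm_assoc mm_madj mm_msc msc_msc n_def)
  moreover have "y \<noteq> 0" using c by (simp add: y_def y0_def s zero_prod_def)
  then have "z \<noteq> 0" unfolding z_def using enc_eq[of "msc x s" y 0 0] by simp
  moreover have "znorm z = 0"
  proof -
    have "mdet (msc w mone + s) = w * w + n" by (simp add: s n_def algebra_simps)
    then have "znorm z = x * x * n + (c * g) * (w * w + n)"
      by (simp add: z_def mdet_msc y_def n_def) (simp add: y0_def)
    also have "\<dots> = (n * (x * x) + (c * g) * (w * w)) + c * g * n" by (simp add: algebra_simps)
    finally show ?thesis by (simp add: xw)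
  qed
  moreover have "ztr z = 0" by (simp add: z_def s)
  ultimately show ?thesis using good_null_line[OF q gam_aut[OF d] id] by blast
qed

theorem good_quaternion:
  fixes g :: "'a::{finite,field} zorn \<Rightarrow> 'a zorn"
  assumes q: "card (UNIV :: 'a set) > 2" and g: "g \<in> octonion_auts" "g \<noteq> id"
    and pres: "\<And>x. \<exists>x'. g (enc x 0) = enc x' 0"
  shows "good g"
proof -
  obtain s t where st: "mdet s = mdet t" "mdet t \<noteq> 0" "g = gam s t" by (rule gam_form[OF g(1) pres])
  show ?thesis
    using good_reducible_left[OF q st(1,2)] good_reducible_right[OF q st(1,2)]
      good_C_quaternion[OF q st(1,2)] good_D_quaternion_left[OF q st(1,2)]
      good_D_quaternion_right[OF q st(1,2)] good_traceless_quaternion[OF q st(1,2)] g(2)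
    unfolding st(3) by blast
qed

section \<open>Elements centralizing a quadratic subalgebra without invariant lines\<close>

definition sp :: "'a::field zorn \<Rightarrow> 'a zorn \<Rightarrow> 'a zorn set" where
  "sp c x = {a \<bullet> x + b \<bullet> (c \<star> x) |a b. True}"

text \<open>Up to a unit of \<open>F[c]\<close>, \<open>cr c\<close> is the component in the orthogonal complement of \<open>F[c]\<close>
  of the product, i.e. the cross product of that three-dimensional hermitian space.\<close>
definition cr :: "'a::field zorn \<Rightarrow> 'a zorn \<Rightarrow> 'a zorn \<Rightarrow> 'a zorn" where
  "cr c x y = c \<star> (x \<star> y) - (x \<star> y) \<star> c"

lemma spI: "a \<bullet> x + b \<bullet> (c \<star> x) \<in> sp c x" unfolding sp_def by blast
lemma spE: assumes "y \<in> sp c x" obtains a b where "y = a \<bullet> x + b \<bullet> (c \<star> x)"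
  using assms unfolding sp_def by blast

lemma zmul_diff: "(x - y) \<star> z = x \<star> z - y \<star> z" "z \<star> (x - y) = z \<star> x - z \<star> y"
  using zmul_add_left[of "x - y" y z] zmul_add_right[of z "x - y" y] by (simp_all add: eq_diff_eq)
lemma zmul_zero [simp]: "0 \<star> x = 0" "x \<star> 0 = 0"
  using zmul_diff(1)[of x x x] zmul_diff(2)[of x x x] by simp_all
lemma zmul_alt: "c \<star> (c \<star> x) = ztr c \<bullet> (c \<star> x) - znorm c \<bullet> x"
  by (cases c rule: zorn_cases; cases x rule: zorn_cases) (simp add: algebra_simps)

lemma subsp_sp: "subsp (sp c x)"
  unfolding subsp_def
proof (intro conjI ballI allI)
  show "0 \<in> sp c x" using spI[of 0 x 0 c] by simp
  fix y z k assume "y \<in> sp c x" "z \<in> sp c x"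
  then obtain a b a' b' where "y = a \<bullet> x + b \<bullet> (c \<star> x)" "z = a' \<bullet> x + b' \<bullet> (c \<star> x)" by (metis spE)
  then show "y + z \<in> sp c x" using spI[of "a + a'" x "b + b'" c] by (simp add: zsmul_add_left algebra_simps)
next
  fix y k assume "y \<in> sp c x"
  then obtain a b where "y = a \<bullet> x + b \<bullet> (c \<star> x)" by (rule spE)
  then show "k \<bullet> y \<in> sp c x" using spI[of "k * a" x "k * b" c] by (simp add: zsmul_add)
qed
lemmas spD = subspD[OF subsp_sp]

lemma sp_self: "x \<in> sp c x" using spI[of 1 x 0 c] by simp
lemma sp_mul: "y \<in> sp c x \<Longrightarrow> c \<star> y \<in> sp c x"
proof (elim spE)
  fix a b assume "y = a \<bullet> x + b \<bullet> (c \<star> x)"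
  then have "c \<star> y = (- (b * znorm c)) \<bullet> x + (a + b * ztr c) \<bullet> (c \<star> x)"
    by (simp add: zmul_add_right zmul_smul_right zmul_alt zsmul_add_left zsmul_diff zsmul_minus)
  then show ?thesis using spI by metis
qed
lemma sp_trans: "z \<in> sp c y \<Longrightarrow> y \<in> sp c x \<Longrightarrow> z \<in> sp c x"
  by (elim spE[of z]) (simp add: spD(2,3) sp_mul)
lemma sp_0: "y \<in> sp c 0 \<Longrightarrow> y = 0" by (elim spE) simp
lemma sp_aut:
  assumes "f \<in> octonion_auts" "f c = c" "y \<in> sp c x" shows "f y \<in> sp c (f x)"
proof -
  obtain a b where "y = a \<bullet> x + b \<bullet> (c \<star> x)" using assms(3) by (rule spE)
  then have "f y = a \<bullet> f x + b \<bullet> (c \<star> f x)"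
    by (simp add: aut_add[OF assms(1)] aut_smul[OF assms(1)] aut_mul[OF assms(1)] assms(2))
  then show ?thesis using spI by metis
qed

lemma cr_add: "cr c (x + y) z = cr c x z + cr c y z" "cr c z (x + y) = cr c z x + cr c z y"
  by (simp_all add: cr_def zmul_add_left zmul_add_right)
lemma cr_smul: "cr c (k \<bullet> x) z = k \<bullet> cr c x z" "cr c z (k \<bullet> x) = k \<bullet> cr c z x"
  by (simp_all add: cr_def zmul_smul_left zmul_smul_right zsmul_diff)
lemma cr_aut: "f \<in> octonion_auts \<Longrightarrow> f c = c \<Longrightarrow> f (cr c x y) = cr c (f x) (f y)"
  by (simp add: cr_def aut_diff aut_mul)
lemma cr_swap: assumes "ztr x = 0" "ztr y = 0" shows "cr c y x = - cr c x y"
proof -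
  have "x \<star> y = (- zbil x y) \<bullet> Zid - y \<star> x" using anticommute(1)[OF assms] by (simp add: eq_diff_eq)
  then show ?thesis by (simp only: cr_def zmul_diff zmul_smul_left zmul_smul_right zmul_Id) simp
qed
lemma cr_self: assumes "ztr x = 0" shows "cr c x x = 0"
  by (simp only: cr_def quadratic assms zsmul_0 zmul_diff zmul_smul_left zmul_smul_right zmul_Id) simp

text \<open>Common axioms for both shapes of the complement of F[c]. If F[c] is a field, A = B is a
  three-dimensional hermitian space; if it is split, A and B are the dual Peirce spaces
  \<open>UU\<close> and \<open>VV\<close>, and the cross product maps each into the other.\<close>

locale line_geometry =
  fixes c :: "'a::field zorn" and A B :: "'a zorn set"
  assumes subA: "subsp A" and subB: "subsp B"
    and mulA: "x \<in> A \<Longrightarrow> c \<star> x \<in> A" and mulB: "x \<in> B \<Longrightarrow> c \<star> x \<in> B"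
    and trA: "x \<in> A \<Longrightarrow> ztr x = 0" and trB: "x \<in> B \<Longrightarrow> ztr x = 0"
    and crA: "x \<in> A \<Longrightarrow> y \<in> A \<Longrightarrow> cr c x y \<in> B" and crB: "x \<in> B \<Longrightarrow> y \<in> B \<Longrightarrow> cr c x y \<in> A"
    and crmA: "x \<in> A \<Longrightarrow> y \<in> A \<Longrightarrow> cr c (c \<star> x) y \<in> sp c (cr c x y)"
    and crmB: "x \<in> B \<Longrightarrow> y \<in> B \<Longrightarrow> cr c (c \<star> x) y \<in> sp c (cr c x y)"
    and depA: "x \<in> A \<Longrightarrow> y \<in> A \<Longrightarrow> x \<noteq> 0 \<Longrightarrow> cr c x y = 0 \<Longrightarrow> y \<in> sp c x"
    and depB: "x \<in> B \<Longrightarrow> y \<in> B \<Longrightarrow> x \<noteq> 0 \<Longrightarrow> cr c x y = 0 \<Longrightarrow> y \<in> sp c x"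
    and symA: "x \<in> A \<Longrightarrow> y \<in> sp c x \<Longrightarrow> y \<noteq> 0 \<Longrightarrow> x \<in> sp c y"
    and symB: "x \<in> B \<Longrightarrow> y \<in> sp c x \<Longrightarrow> y \<noteq> 0 \<Longrightarrow> x \<in> sp c y"
begin

lemma swap: "line_geometry c B A"
  by unfold_locales (fact subA subB mulA mulB trA trB crA crB crmA crmB depA depB symA symB)+

lemma spA: "x \<in> A \<Longrightarrow> y \<in> sp c x \<Longrightarrow> y \<in> A"
  by (elim spE) (simp add: subspD[OF subA] mulA)

lemma cr_sp_left:
  assumes "x \<in> A" "y \<in> A" "x' \<in> sp c x" shows "cr c x' y \<in> sp c (cr c x y)"
proof -
  obtain a b where "x' = a \<bullet> x + b \<bullet> (c \<star> x)" using assms(3) by (rule spE)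
  then have "cr c x' y = a \<bullet> cr c x y + b \<bullet> cr c (c \<star> x) y" by (simp add: cr_add cr_smul)
  then show ?thesis using crmA[OF assms(1,2)] by (simp add: spD(2,3) sp_self)
qed

lemma cr_sp_right:
  assumes "x \<in> A" "y \<in> A" "y' \<in> sp c y" shows "cr c x y' \<in> sp c (cr c x y)"
proof -
  have "y' \<in> A" by (rule spA[OF assms(2,3)])
  have "cr c y' x \<in> sp c (cr c y x)" by (rule cr_sp_left[OF assms(2,1,3)])
  then have "- cr c x y' \<in> sp c (- cr c x y)"
    using cr_swap[OF trA[OF assms(1)] trA[OF \<open>y' \<in> A\<close>]] cr_swap[OF trA[OF assms(1)] trA[OF assms(2)]] by simp
  then have "- cr c x y' \<in> sp c (cr c x y)" by (rule sp_trans) (rule spD(5)[OF sp_self])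
  then show ?thesis using spD(5) by fastforce
qed

lemma cr_sp:
  assumes "x \<in> A" "y \<in> A" "x' \<in> sp c x" "y' \<in> sp c y" shows "cr c x' y' \<in> sp c (cr c x y)"
  using sp_trans[OF cr_sp_left[OF assms(1) spA[OF assms(2,4)] assms(3)] cr_sp_right[OF assms(1,2,4)]] .

definition fixed_lines :: "('a zorn \<Rightarrow> 'a zorn) \<Rightarrow> bool" where
  "fixed_lines f \<longleftrightarrow> (\<exists>w. w \<noteq> 0 \<and> (w \<in> A \<or> w \<in> B) \<and> f w \<in> sp c w)"

text \<open>r maps x \<times> r x to r x \<times> r^2 x, which lies on the line of r x \<times> x =
  - (x \<times> r x). So either this cross product spans an invariant line or x does.\<close>

lemma square_line_aux:
  assumes r: "r \<in> octonion_auts" "r c = c" "\<And>x. x \<in> A \<Longrightarrow> r x \<in> A" and x: "x \<in> A" "x \<noteq> 0" "r (r x) \<in> sp c x"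
  shows "fixed_lines r"
proof (cases "cr c x (r x) = 0")
  case True
  then have "r x \<in> sp c x" using depA x r(3) by blast
  then show ?thesis unfolding fixed_lines_def using x by blast
next
  case False
  have rx: "r x \<in> A" by (rule r(3)[OF x(1)])
  have "r (cr c x (r x)) = cr c (r x) (r (r x))" by (rule cr_aut[OF r(1,2)])
  also have "\<dots> \<in> sp c (cr c (r x) x)" by (rule cr_sp_right[OF rx x(1,3)])
  also have "cr c (r x) x = - cr c x (r x)" by (rule cr_swap[OF trA[OF x(1)] trA[OF rx]])
  finally have "r (cr c x (r x)) \<in> sp c (cr c x (r x))" by (rule sp_trans) (rule spD(5)[OF sp_self])
  then show ?thesis unfolding fixed_lines_def using False crA[OF x(1) rx] by blast
qed

text \<open>Cross products of vectors of a plane all lie on one line, so j \<times> r j and its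
  image r j \<times> r^2 j are on the same line.\<close>

lemma plane_line:
  assumes r: "r \<in> octonion_auts" "r c = c" "\<And>x. x \<in> A \<Longrightarrow> r x \<in> A" and xy: "x \<in> A" "y \<in> A"
    and j: "j \<in> A" "j \<noteq> 0"
    and pl: "\<And>z. z \<in> {j, r j, r (r j)} \<Longrightarrow> \<exists>a\<in>sp c x. \<exists>b\<in>sp c y. z = a + b"
  shows "fixed_lines r"
proof (cases "cr c j (r j) = 0")
  case True
  then have "r j \<in> sp c j" using depA j r(3) by blast
  then show ?thesis unfolding fixed_lines_def using j by blast
next
  case False
  let ?p = "cr c x y"
  have P: "cr c z z' \<in> sp c ?p" if z: "z \<in> {j, r j, r (r j)}" "z' \<in> {j, r j, r (r j)}" for z z'
  proof -
    obtain a b where ab: "a \<in> sp c x" "b \<in> sp c y" "z = a + b" using pl[OF z(1)] by blast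
    obtain a' b' where ab': "a' \<in> sp c x" "b' \<in> sp c y" "z' = a' + b'" using pl[OF z(2)] by blast
    have "cr c a a' \<in> sp c (cr c x x)" "cr c b b' \<in> sp c (cr c y y)"
      by (rule cr_sp; fact xy ab ab')+
    then have d: "cr c a a' = 0" "cr c b b' = 0" using sp_0 unfolding cr_self[OF trA[OF xy(1)]] cr_self[OF trA[OF xy(2)]] by blast+
    have e: "cr c a b' \<in> sp c ?p" by (rule cr_sp; fact xy ab ab')
    have "cr c b a' \<in> sp c (cr c y x)" by (rule cr_sp; fact xy ab ab')
    then have "cr c b a' \<in> sp c (- ?p)" unfolding cr_swap[OF trA[OF xy(1)] trA[OF xy(2)]] .
    then have "cr c b a' \<in> sp c ?p" by (rule sp_trans) (rule spD(5)[OF sp_self])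
    then have "cr c a b' + cr c b a' \<in> sp c ?p" using e by (rule spD(2)[rotated])
    moreover have "cr c z z' = cr c a b' + cr c b a'" unfolding ab(3) ab'(3) cr_add d by simp
    ultimately show ?thesis by simp
  qed
  let ?z = "cr c j (r j)"
  have "?z \<in> sp c ?p" by (rule P) simp_all
  then have p: "?p \<in> sp c ?z" using symB[OF crA[OF xy]] False by blast
  have "r ?z = cr c (r j) (r (r j))" by (rule cr_aut[OF r(1,2)])
  also have "\<dots> \<in> sp c ?p" by (rule P) simp_all
  finally have "r ?z \<in> sp c ?z" using p by (rule sp_trans)
  then show ?thesis unfolding fixed_lines_def using False crA[OF j(1) r(3)[OF j(1)]] by blast
qed

text \<open>D = T t - T t' commutes with R, and as the \<open>k t\<close> are transvections with
  centre w, its image lies in the plane spanned by the lines of w and S w. If t \<noteq> t', then D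
  x0 is nonzero because S does not fix the line of w, and \<open>plane_line\<close> yields a line
  fixed by R.\<close>

lemma one_commuting_conjugate:
  fixes k :: "'a \<Rightarrow> 'a zorn \<Rightarrow> 'a zorn"
  assumes R: "R \<in> octonion_auts" "R c = c" "\<And>x. x \<in> A \<Longrightarrow> R x \<in> A" "\<not> fixed_lines R"
    and S: "S \<in> octonion_auts" "S c = c" "\<And>x. x \<in> A \<Longrightarrow> S x \<in> A" "\<not> fixed_lines S"
    and k: "\<And>t x. x \<in> A \<Longrightarrow> k t x = x + t \<bullet> N x" "\<And>x. x \<in> A \<Longrightarrow> N x \<in> sp c w"
    and w: "w \<in> A" "w \<noteq> 0" "x0 \<in> A" "N x0 = w"
    and T: "\<And>t x. T t x = k t (S (k (- t) x))"
    and c: "\<And>x. R (T t x) = T t (R x)" "\<And>x. R (T t' x) = T t' (R x)"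
  shows "t = t'"
proof (rule ccontr)
  assume tt: "t \<noteq> t'"
  note SA = subspD[OF subA]
  have NA: "N x \<in> A" if "x \<in> A" for x using spA[OF w(1) k(2)[OF that]] .
  have SN: "S (N x) \<in> sp c (S w)" if "x \<in> A" for x by (rule sp_aut[OF S(1,2) k(2)[OF that]])
  have Tx: "\<exists>a\<in>sp c w. T t x = S x - t \<bullet> S (N x) + a" if x: "x \<in> A" for t x
  proof -
    have "k (- t) x = x - t \<bullet> N x" using k(1)[OF x] by (simp add: zsmul_minus)
    then have 1: "S (k (- t) x) = S x - t \<bullet> S (N x)" by (simp add: aut_diff[OF S(1)] aut_smul[OF S(1)])
    have 2: "S x - t \<bullet> S (N x) \<in> A" using SA S(3) NA x by simp
    have "T t x = S x - t \<bullet> S (N x) + t \<bullet> N (S x - t \<bullet> S (N x))" unfolding T 1 by (rule k(1)[OF 2])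
    then show ?thesis using spD(3)[OF k(2)[OF 2]] by blast
  qed
  define D where "D x = T t x - T t' x" for x
  have Dx: "\<exists>a\<in>sp c w. D x = a + (t' - t) \<bullet> S (N x)" if x: "x \<in> A" for x
  proof -
    obtain a where a: "a \<in> sp c w" "T t x = S x - t \<bullet> S (N x) + a" using Tx[OF x] by blast
    obtain b where b: "b \<in> sp c w" "T t' x = S x - t' \<bullet> S (N x) + b" using Tx[OF x] by blast
    have "D x = (a - b) + (t' - t) \<bullet> S (N x)" by (simp add: D_def a b zsmul_diff_left)
    then show ?thesis using spD(4)[OF a(1) b(1)] by blast
  qed
  have RD: "R (D x) = D (R x)" for x by (simp add: D_def aut_diff[OF R(1)] c)
  have j0: "D x0 \<noteq> 0"
  proof
    assume D0: "D x0 = 0"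
    obtain a where a: "a \<in> sp c w" "D x0 = a + (t' - t) \<bullet> S w" using Dx[OF w(3)] unfolding w(4) by blast
    have "(t' - t) \<bullet> S w = - a" using D0 a(2) by (simp add: eq_neg_iff_add_eq_0 add.commute)
    then have "(1 / (t' - t)) \<bullet> (t' - t) \<bullet> S w \<in> sp c w" using spD(3)[OF spD(5)[OF a(1)]] by simp
    moreover have "(1 / (t' - t)) \<bullet> (t' - t) \<bullet> S w = S w" using tt by simp
    ultimately have Sw: "S w \<in> sp c w" by simp
    show False using S(4) Sw w(1,2) unfolding fixed_lines_def by blast
  qed
  have DA: "D x \<in> A" if x: "x \<in> A" for x
  proof -
    obtain a where "a \<in> sp c w" "D x = a + (t' - t) \<bullet> S (N x)" using Dx[OF x] by blast
    then show ?thesis using SA spA[OF w(1)] S(3) NA[OF x] by simp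
  qed
  have "fixed_lines R"
  proof (rule plane_line[OF R(1-3) w(1) S(3)[OF w(1)] DA[OF w(3)] j0])
    fix z assume "z \<in> {D x0, R (D x0), R (R (D x0))}"
    then have "z = D x0 \<or> z = D (R x0) \<or> z = D (R (R x0))" by (simp add: RD)
    then obtain x where x: "x \<in> A" "z = D x" using w(3) R(3) by blast
    obtain a where "a \<in> sp c w" "D x = a + (t' - t) \<bullet> S (N x)" using Dx[OF x(1)] by blast
    then show "\<exists>a\<in>sp c w. \<exists>b\<in>sp c (S w). z = a + b" using x(2) spD(3)[OF SN[OF x(1)]] by blast
  qed
  then show False using R(4) by blast
qed

end

lemma (in line_geometry) square_line:
  assumes r: "r \<in> octonion_auts" "r c = c" "\<And>x. x \<in> A \<Longrightarrow> r x \<in> A" "\<And>x. x \<in> B \<Longrightarrow> r x \<in> B"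
    and n: "\<not> fixed_lines r"
  shows "\<not> fixed_lines (r \<circ> r)"
proof
  assume "fixed_lines (r \<circ> r)"
  then obtain w where w: "w \<noteq> 0" "w \<in> A \<or> w \<in> B" "r (r w) \<in> sp c w" unfolding fixed_lines_def by auto
  interpret BA: line_geometry c B A by (rule swap)
  have "BA.fixed_lines r \<longleftrightarrow> fixed_lines r" unfolding fixed_lines_def BA.fixed_lines_def by blast
  then show False using square_line_aux[OF r(1-3)] BA.square_line_aux[OF r(1,2,4)] w n by blast
qed

lemma good_without_lines:
  fixes c :: "'a::{finite,field} zorn" and k :: "'a \<Rightarrow> 'a zorn \<Rightarrow> 'a zorn"
  assumes LG: "line_geometry c A B"
    and q: "card (UNIV :: 'a set) > 2" and rs: "conj_to r s"
    and r: "r c = c" "\<And>x. x \<in> A \<Longrightarrow> r x \<in> A" "\<And>x. x \<in> B \<Longrightarrow> r x \<in> B" "\<not> line_geometry.fixed_lines c A B r"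
    and s: "s c = c" "\<And>x. x \<in> A \<Longrightarrow> s x \<in> A" "\<And>x. x \<in> B \<Longrightarrow> s x \<in> B" "\<not> line_geometry.fixed_lines c A B s"
    and nc: "\<And>h. h \<in> octonion_auts \<Longrightarrow> h c = c \<Longrightarrow> h \<circ> r \<noteq> s \<circ> h"
    and k: "\<And>t. k t \<in> octonion_auts" "\<And>t. k t c = c" "\<And>t. k t \<circ> k (- t) = id"
      "\<And>t x. x \<in> A \<Longrightarrow> k t x = x + t \<bullet> N x" "\<And>x. x \<in> A \<Longrightarrow> N x \<in> sp c w"
    and w: "w \<in> A" "w \<noteq> 0" "x0 \<in> A" "N x0 = w"
  shows "good r"
proof -
  interpret line_geometry c A B by (rule LG)
  have ra: "r \<in> octonion_auts" and sa: "s \<in> octonion_auts" using rs by (simp_all add: conj_to_def)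
  define s' where "s' t = k t \<circ> s \<circ> k (- t)" for t
  have kk: "k t (k (- t) x) = x" "k (- t) (k t x) = x" for t x
    using fun_cong[OF k(3)[of t], of x] fun_cong[OF k(3)[of "- t"], of x] by simp_all
  have fk: "finv (k t) = k (- t)" for t
  proof
    fix x show "finv (k t) x = k (- t) x" using aut_inv_f(1)[OF k(1), of t "k (- t) x"] by (simp add: kk)
  qed
  have cs: "conj_to r (s' t)" for t
    using conj_to_trans[OF rs conj_toI[OF sa k(1)[of t]]] unfolding fk s'_def .
  define M where "M = {h \<in> octonion_auts. h c = c}"
  have M: "subgroup M G2" by (rule subgroup_G2I) (auto simp: M_def)
  have rM: "r \<in> M" and s'M: "s' t \<in> M" for t
    using ra r(1) sa s(1) k by (auto simp: M_def s'_def intro!: aut_comp)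
  have nc': "h \<circ> r \<noteq> s' t \<circ> h" if h: "h \<in> M" for h t
  proof
    assume e: "h \<circ> r = s' t \<circ> h"
    have "k (- t) \<circ> h \<circ> r = k (- t) \<circ> (s' t \<circ> h)" unfolding e[symmetric] by (simp add: comp_assoc)
    also have "\<dots> = s \<circ> (k (- t) \<circ> h)" by (rule ext) (simp add: s'_def kk)
    finally show False using nc[of "k (- t) \<circ> h"] h k by (auto simp: M_def)
  qed
  obtain t where t: "\<not> (r \<circ> r \<circ> s' t = s' t \<circ> (r \<circ> r))" "\<not> (s' t \<circ> s' t \<circ> r = r \<circ> (s' t \<circ> s' t))"
  proof (rule at_most_one_bad[OF q])
    fix t t' :: 'a
    assume e: "r \<circ> r \<circ> s' t = s' t \<circ> (r \<circ> r)" "r \<circ> r \<circ> s' t' = s' t' \<circ> (r \<circ> r)"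
    show "t = t'"
    proof (rule one_commuting_conjugate[of "r \<circ> r" s k N w x0 s'])
      show "\<not> fixed_lines (r \<circ> r)" by (rule square_line[OF ra r])
      show "(r \<circ> r) (s' t x) = s' t ((r \<circ> r) x)" "(r \<circ> r) (s' t' x) = s' t' ((r \<circ> r) x)" for x
        using fun_cong[OF e(1), of x] fun_cong[OF e(2), of x] by simp_all
    qed (use ra sa r s k w in \<open>auto simp: s'_def\<close>)
  next
    fix t t' :: 'a
    assume e: "s' t \<circ> s' t \<circ> r = r \<circ> (s' t \<circ> s' t)" "s' t' \<circ> s' t' \<circ> r = r \<circ> (s' t' \<circ> s' t')"
    \<comment> \<open>Conjugating the second condition by k (- t) moves the parameter from s to r,
      so that the same lemma applies to s^2 with parameter - t.\<close>
    define r' where "r' t = k t \<circ> r \<circ> k (- t)" for t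
    have C: "(s \<circ> s) (r' (- t) x) = r' (- t) ((s \<circ> s) x)" if "s' t \<circ> s' t \<circ> r = r \<circ> (s' t \<circ> s' t)" for t x
      using arg_cong[OF fun_cong[OF that, of "k t x"], of "k (- t)"] by (simp add: s'_def r'_def kk)
    have "- t = - t'"
    proof (rule one_commuting_conjugate[of "s \<circ> s" r k N w x0 r'])
      show "\<not> fixed_lines (s \<circ> s)" by (rule square_line[OF sa s])
      show "(s \<circ> s) (r' (- t) x) = r' (- t) ((s \<circ> s) x)" "(s \<circ> s) (r' (- t') x) = r' (- t') ((s \<circ> s) x)" for x
        using C e by blast+
    qed (use ra sa r s k w in \<open>auto simp: r'_def\<close>)
    then show "t = t'" by simp
  qed blast
  show ?thesis by (rule good_C[OF cs[of t] M rM s'M[of t] nc']) (use t in blast)+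
qed

section \<open>The split case: Peirce spaces of \<open>E1\<close>\<close>

definition UU :: "'a::field zorn set" where "UU = {x. \<exists>u. x = (0, u, 0, 0)}"
definition VV :: "'a::field zorn set" where "VV = {x. \<exists>v. x = (0, 0, v, 0)}"

lemma UU_iff [simp]: "(a, u, v, b) \<in> UU \<longleftrightarrow> a = 0 \<and> v = 0 \<and> b = 0" by (auto simp: UU_def)
lemma VV_iff [simp]: "(a, u, v, b) \<in> VV \<longleftrightarrow> a = 0 \<and> u = 0 \<and> b = 0" by (auto simp: VV_def)
lemma UU_cases: assumes "x \<in> UU" obtains u1 u2 u3 where "x = (0, (u1, u2, u3), (0, 0, 0), 0)"
  using assms by (cases x rule: zorn_cases) (auto simp: zero_prod_def)
lemma VV_cases: assumes "x \<in> VV" obtains v1 v2 v3 where "x = (0, (0, 0, 0), (v1, v2, v3), 0)"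
  using assms by (cases x rule: zorn_cases) (auto simp: zero_prod_def)

lemma cross3_eq_0:
  assumes "cross3 x y = 0" "x \<noteq> 0" obtains k where "y = smul3 k (x :: 'a::field vec3)"
proof -
  obtain x1 x2 x3 where x: "x = (x1, x2, x3)" by (rule vec3_cases)
  obtain y1 y2 y3 where y: "y = (y1, y2, y3)" by (rule vec3_cases)
  have e: "x2 * y3 = x3 * y2" "x3 * y1 = x1 * y3" "x1 * y2 = x2 * y1"
    using assms(1) by (simp_all add: x y zero_prod_def)
  consider "x1 \<noteq> 0" | "x2 \<noteq> 0" | "x3 \<noteq> 0" using assms(2) by (auto simp: x zero_prod_def)
  then show thesis
  proof cases
    case 1 then show thesis using e by (intro that[of "y1 / x1"]) (simp add: x y field_simps)
  next
    case 2 then show thesis using e by (intro that[of "y2 / x2"]) (simp add: x y field_simps)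
  next
    case 3 then show thesis using e by (intro that[of "y3 / x3"]) (simp add: x y field_simps)
  qed
qed

lemma split_geometry: "line_geometry E1 UU (VV :: 'a::field zorn set)"
proof
  show "subsp (UU :: 'a zorn set)" "subsp (VV :: 'a zorn set)"
    unfolding subsp_def by (auto simp: zero_prod_def UU_def VV_def)
  fix x y :: "'a zorn"
  show "E1 \<star> x \<in> UU" if xU: "x \<in> UU" by (rule UU_cases[OF xU]) (simp add: zero_prod_def)
  show "E1 \<star> x \<in> VV" if xU: "x \<in> VV" by (rule VV_cases[OF xU]) (simp add: zero_prod_def)
  show "ztr x = 0" if xU: "x \<in> UU" by (rule UU_cases[OF xU]) simp
  show "ztr x = 0" if xU: "x \<in> VV" by (rule VV_cases[OF xU]) simp
  have crU: "\<exists>u u'. x = (0, u, 0, 0) \<and> y = (0, u', 0, 0) \<and> cr E1 x y = (0, 0, - cross3 u u', 0)"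
    if xU: "x \<in> UU" and yU: "y \<in> UU"
    by (rule UU_cases[OF xU]; rule UU_cases[OF yU]) (simp add: cr_def zero_prod_def)
  have crV: "\<exists>u u'. x = (0, 0, u, 0) \<and> y = (0, 0, u', 0) \<and> cr E1 x y = (0, - cross3 u u', 0, 0)"
    if xU: "x \<in> VV" and yU: "y \<in> VV"
    by (rule VV_cases[OF xU]; rule VV_cases[OF yU]) (simp add: cr_def zero_prod_def)
  show "cr E1 x y \<in> VV" if "x \<in> UU" "y \<in> UU" using crU[OF that] by auto
  show "cr E1 x y \<in> UU" if "x \<in> VV" "y \<in> VV" using crV[OF that] by auto
  have eU: "E1 \<star> x = x" if xU: "x \<in> UU" by (rule UU_cases[OF xU]) simp
  have eV: "E1 \<star> x = 0" if xU: "x \<in> VV" by (rule VV_cases[OF xU]) (simp add: zero_prod_def)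
  show "cr E1 (E1 \<star> x) y \<in> sp E1 (cr E1 x y)" if "x \<in> UU" "y \<in> UU" using eU[OF that(1)] sp_self by simp
  show "cr E1 (E1 \<star> x) y \<in> sp E1 (cr E1 x y)" if "x \<in> VV" "y \<in> VV"
    using eV[OF that(1)] spD(1) by (simp add: cr_def)
  show "y \<in> sp E1 x" if xy: "x \<in> UU" "y \<in> UU" "x \<noteq> 0" "cr E1 x y = 0"
  proof -
    obtain u u' where u: "x = (0, u, 0, 0)" "y = (0, u', 0, 0)" "cr E1 x y = (0, 0, - cross3 u u', 0)"
      using crU[OF xy(1,2)] by blast
    have "- cross3 u u' = 0" using xy(4) unfolding u(3) pair_eq_0 by blast
    then have "cross3 u u' = 0" by (simp only: neg_equal_0_iff_equal)
    moreover have "u \<noteq> 0" using xy(3) unfolding u(1) pair_eq_0 by blast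
    ultimately obtain k where "u' = smul3 k u" by (rule cross3_eq_0)
    then have "y = k \<bullet> x + 0 \<bullet> (E1 \<star> x)" using u by simp
    then show ?thesis using spI by metis
  qed
  show "y \<in> sp E1 x" if xy: "x \<in> VV" "y \<in> VV" "x \<noteq> 0" "cr E1 x y = 0"
  proof -
    obtain u u' where u: "x = (0, 0, u, 0)" "y = (0, 0, u', 0)" "cr E1 x y = (0, - cross3 u u', 0, 0)"
      using crV[OF xy(1,2)] by blast
    have "- cross3 u u' = 0" using xy(4) unfolding u(3) pair_eq_0 by blast
    then have "cross3 u u' = 0" by (simp only: neg_equal_0_iff_equal)
    moreover have "u \<noteq> 0" using xy(3) unfolding u(1) pair_eq_0 by blast
    ultimately obtain k where "u' = smul3 k u" by (rule cross3_eq_0)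
    then have "y = k \<bullet> x + 0 \<bullet> (E1 \<star> x)" using u by simp
    then show ?thesis using spI by metis
  qed
  show "x \<in> sp E1 y" if xy: "x \<in> UU" "y \<in> sp E1 x" "y \<noteq> 0"
  proof -
    obtain a b where "y = a \<bullet> x + b \<bullet> (E1 \<star> x)" using xy(2) by (rule spE)
    then have y: "y = (a + b) \<bullet> x" using eU[OF xy(1)] by (simp add: zsmul_add_left)
    then have "x = (1 / (a + b)) \<bullet> y" using xy(3) by auto
    then show ?thesis using spD(3)[OF sp_self] by metis
  qed
  show "x \<in> sp E1 y" if xy: "x \<in> VV" "y \<in> sp E1 x" "y \<noteq> 0"
  proof -
    obtain a b where "y = a \<bullet> x + b \<bullet> (E1 \<star> x)" using xy(2) by (rule spE)
    then have y: "y = a \<bullet> x" using eV[OF xy(1)] by simp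
    then have "x = (1 / a) \<bullet> y" using xy(3) by auto
    then show ?thesis using spD(3)[OF sp_self] by metis
  qed
qed

section \<open>The field case: the hermitian space orthogonal to F[c]\<close>

lemma binary_norm_neq_0:
  fixes a b :: "'a::field"
  assumes irr: "\<And>l. l * l - t * l + n \<noteq> 0" and ab: "a \<noteq> 0 \<or> b \<noteq> 0"
  shows "a * a + t * a * b + n * b * b \<noteq> 0"
proof (cases "b = 0")
  case False
  have "a * a + t * a * b + n * b * b = b * b * ((- a / b) * (- a / b) - t * (- a / b) + n)"
    using False by (simp add: field_simps)
  then show ?thesis using irr[of "- a / b"] False by simp
qed (use ab in simp)

text \<open>a + b c is invertible in F[c]: its product with the conjugate a + t b - b c is the norm
  a^2 + t a b + n b^2, which is nonzero because the polynomial of c has no root.\<close>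

lemma sp_unit:
  assumes irr: "\<And>l. l * l - ztr c * l + znorm c \<noteq> 0" and ab: "a \<noteq> 0 \<or> b \<noteq> 0"
  shows "x \<in> sp c (a \<bullet> x + b \<bullet> (c \<star> x))"
proof -
  define t where "t = ztr c"
  define n where "n = znorm c"
  define y where "y = a \<bullet> x + b \<bullet> (c \<star> x)"
  define k where "k = a * a + t * a * b + n * b * b"
  have k: "k \<noteq> 0" unfolding k_def by (rule binary_norm_neq_0) (use assms in \<open>auto simp: t_def n_def\<close>)
  have "c \<star> y = a \<bullet> (c \<star> x) + b \<bullet> (t \<bullet> (c \<star> x) - n \<bullet> x)"
    by (simp add: y_def zmul_add_right zmul_smul_right zmul_alt t_def n_def)
  then have "(a + t * b) \<bullet> y + (- b) \<bullet> (c \<star> y) =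
    (a + t * b) \<bullet> y + (- b) \<bullet> (a \<bullet> (c \<star> x) + b \<bullet> (t \<bullet> (c \<star> x) - n \<bullet> x))" by simp
  also have "\<dots> = k \<bullet> x"
    by (simp add: y_def k_def zsmul_add zsmul_diff zsmul_add_left zsmul_minus algebra_simps)
  finally have "k \<bullet> x \<in> sp c y" using spI by metis
  from spD(3)[OF this, of "1 / k"] show ?thesis using k unfolding y_def by simp
qed

lemma dot3_0 [simp]: "dot3 0 x = 0" "dot3 x 0 = 0" and cross3_0 [simp]: "cross3 0 x = 0" "cross3 x 0 = 0"
  by (cases x rule: vec3_cases; simp add: zero_prod_def)+

text \<open>The orthogonal complement of \<open>Zid\<close> and \<open>Cf t n\<close> in
  coordinates, where \<open>Cf t n\<close> is the normal form of
  \<open>transitive_normal_form\<close> for trace t and norm n.\<close>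

definition WW :: "'a::field \<Rightarrow> 'a \<Rightarrow> 'a zorn set" where
  "WW t n = {x. \<exists>p u1 u2 u3 v2 v3. x = (p, (u1, u2, u3), (p * t + n * u1, v2, v3), - p)}"

abbreviation Cf :: "'a::field \<Rightarrow> 'a \<Rightarrow> 'a zorn" where "Cf t n \<equiv> (0, (1, 0, 0), (- n, 0, 0), t)"

lemma WW_cases: assumes "x \<in> WW t n"
  obtains p u1 u2 u3 v2 v3 where "x = (p, (u1, u2, u3), (p * t + n * u1, v2, v3), - p)"
  using assms unfolding WW_def by blast

lemma WW_iff: "x \<in> WW t n \<longleftrightarrow> ztr x = 0 \<and> zbil (Cf t n) x = 0"
proof
  assume "x \<in> WW t n"
  then show "ztr x = 0 \<and> zbil (Cf t n) x = 0" by (rule WW_cases) (simp add: algebra_simps)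
next
  assume a: "ztr x = 0 \<and> zbil (Cf t n) x = 0"
  show "x \<in> WW t n"
  proof (cases x rule: zorn_cases)
    case (1 a u1 u2 u3 v1 v2 v3 b)
    have "a + b = 0" using a by (simp add: 1)
    then have b: "b = - a" by (simp add: eq_neg_iff_add_eq_0 add.commute)
    have "(a * t + n * u1) - v1 = 0" using a by (simp add: 1 algebra_simps)
    then have "v1 = a * t + n * u1" by simp
    then show ?thesis unfolding WW_def 1 b by blast
  qed
qed

lemma zbil_mul_left: "zbil (c \<star> x) (c \<star> y) = znorm c * zbil x y"
  and zbil_mul_right: "zbil (x \<star> c) (y \<star> c) = znorm c * zbil x y"
  by (cases c rule: zorn_cases; cases x rule: zorn_cases; cases y rule: zorn_cases; simp add: algebra_simps)+
lemma ztr_mul: "ztr (x \<star> y) = ztr x * ztr y - zbil x y"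
  by (cases x rule: zorn_cases; cases y rule: zorn_cases) (simp add: algebra_simps)

lemma subsp_WW: "subsp (WW t n)"
  unfolding subsp_def Ball_def WW_iff by (simp add: zbil_add zbil_smul)

lemma WW_mul: "x \<in> WW t n \<Longrightarrow> Cf t n \<star> x \<in> WW t n"
  unfolding WW_iff ztr_mul using zbil_mul_left[of "Cf t n" Zid x] by (simp add: zbil_Id)

lemma WW_cr: "cr (Cf t n) x y \<in> WW t n"
proof -
  have "zbil c (c \<star> z) = znorm c * ztr z" "zbil c (z \<star> c) = znorm c * ztr z" for c z :: "'a zorn"
    using zbil_mul_left[of c Zid z] zbil_mul_right[of Zid c z] by (simp_all add: zbil_Id)
  moreover have "ztr (u - v) = ztr u - ztr v" for u v :: "'a zorn"
    using ztr_add[of "u - v" v] by (simp add: eq_diff_eq)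
  ultimately show ?thesis
    unfolding WW_iff cr_def zbil_sym[of "Cf t n"] zbil_diff
    by (simp only: zbil_sym[of _ "Cf t n"] ztr_mul) (simp add: zbil_sym mult.commute)
qed

text \<open>Conjugate linearity of the cross product: t - c is the conjugate of c.\<close>

lemma WW_crm:
  assumes "x \<in> WW t n" "y \<in> WW t n"
  shows "cr (Cf t n) (Cf t n \<star> x) y = t \<bullet> cr (Cf t n) x y + (- 1) \<bullet> (Cf t n \<star> cr (Cf t n) x y)"
  by (rule WW_cases[OF assms(1)]; rule WW_cases[OF assms(2)]) (simp add: cr_def algebra_simps)

text \<open>The identity \<open>(x \<times> y) \<times> z = h(z, x) y - h(z, y) x\<close> for the hermitian form \<open>h\<close>, evaluated on a basis.\<close>
lemma WW_cr_cr:
  assumes x: "x \<in> WW t n" and y: "y \<in> WW t n"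
    and z: "z \<in> {U2, U3, V2, V3, (0, (1, 0, 0), (n, 0, 0), 0), (1, (0, 0, 0), (t, 0, 0), - 1)}"
  shows "cr (Cf t n) (cr (Cf t n) x y) z =
    ((2 * n * zbil z x - t * zbil (Cf t n \<star> z) x) \<bullet> y + (2 * zbil (Cf t n \<star> z) x - t * zbil z x) \<bullet> (Cf t n \<star> y)) -
    ((2 * n * zbil z y - t * zbil (Cf t n \<star> z) y) \<bullet> x + (2 * zbil (Cf t n \<star> z) y - t * zbil z y) \<bullet> (Cf t n \<star> x))"
proof -
  obtain p u1 u2 u3 v2 v3 where x': "x = (p, (u1, u2, u3), (p * t + n * u1, v2, v3), - p)" by (rule WW_cases[OF x])
  obtain p' u1' u2' u3' v2' v3' where y': "y = (p', (u1', u2', u3'), (p' * t + n * u1', v2', v3'), - p')"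
    by (rule WW_cases[OF y])
  consider "z = U2" | "z = U3" | "z = V2" | "z = V3" | "z = (0, (1, 0, 0), (n, 0, 0), 0)" | "z = (1, (0, 0, 0), (t, 0, 0), - 1)"
    using z by blast
  then show ?thesis
  proof cases
    case 1 show ?thesis unfolding 1 x' y' cr_def by (simp add: algebra_simps zero_prod_def)
  next
    case 2 show ?thesis unfolding 2 x' y' cr_def by (simp add: algebra_simps zero_prod_def)
  next
    case 3 show ?thesis unfolding 3 x' y' cr_def by (simp add: algebra_simps zero_prod_def)
  next
    case 4 show ?thesis unfolding 4 x' y' cr_def by (simp add: algebra_simps zero_prod_def)
  next
    case 5 show ?thesis unfolding 5 x' y' cr_def by (simp add: algebra_simps zero_prod_def)
  next
    case 6 show ?thesis unfolding 6 x' y' cr_def by (simp add: algebra_simps zero_prod_def)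
  qed
qed

text \<open>Meant for the two coefficients in \<open>WW_cr_cr\<close>; as linear forms in q and p
  they have determinant 4 n - t^2.\<close>

lemma det2_kernel:
  fixes p q :: "'a::field"
  assumes "2 * n * q - t * p = 0" "2 * p - t * q = 0" "t * t - 4 * n \<noteq> 0"
  shows "q = 0"
proof -
  have "(t * t - 4 * n) * q = - (2 * (2 * n * q - t * p) + t * (2 * p - t * q))" by (simp add: algebra_simps)
  then show ?thesis using assms by simp
qed

lemma WW_nondeg:
  assumes x: "x \<in> WW t n" "x \<noteq> 0" and d: "t * t - 4 * n \<noteq> 0"
  obtains z where "z \<in> {U2, U3, V2, V3, (0, (1, 0, 0), (n, 0, 0), 0), (1, (0, 0, 0), (t, 0, 0), - 1)}" "zbil z x \<noteq> 0"
proof (rule ccontr)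
  assume "\<not> thesis"
  then have z: "zbil z x = 0"
    if "z \<in> {U2, U3, V2, V3, (0, (1, 0, 0), (n, 0, 0), 0), (1, (0, 0, 0), (t, 0, 0), - 1)}" for z
    using that \<open>\<And>z. _ \<Longrightarrow> zbil z x \<noteq> 0 \<Longrightarrow> thesis\<close> by blast
  obtain p u1 u2 u3 v2 v3 where x': "x = (p, (u1, u2, u3), (p * t + n * u1, v2, v3), - p)" by (rule WW_cases[OF x(1)])
  have 0: "u2 = 0" "u3 = 0" "v2 = 0" "v3 = 0" using z[of U2] z[of U3] z[of V2] z[of V3] by (simp_all add: x')
  have 5: "- (p * t + n * u1) - u1 * n = 0" using z[of "(0, (1, 0, 0), (n, 0, 0), 0)"] by (simp add: x')
  have 6: "- p + - p - u1 * t = 0" using z[of "(1, (0, 0, 0), (t, 0, 0), - 1)"] by (simp add: x')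
  have "(t * t - 4 * n) * u1 = 2 * (- (p * t + n * u1) - u1 * n) - t * (- p + - p - u1 * t)" by (simp add: algebra_simps)
  also have "\<dots> = 0" unfolding 5 6 by simp
  finally have u1: "u1 = 0" using d mult_eq_0_iff by blast
  have tp: "t * p = 0" "2 * p = 0" using 5 6 u1 by (simp_all add: mult.commute)
  have "(t * t - 4 * n) * p = t * (t * p) - 2 * n * (2 * p)" by (simp add: algebra_simps)
  also have "\<dots> = 0" unfolding tp by simp
  finally have "p = 0" using d mult_eq_0_iff by blast
  then show False using 0 u1 x(2) by (simp add: x' zero_prod_def)
qed

text \<open>The axiom with content is dependence. If x \<times> y = 0, the double product formula
  with some z not orthogonal to x expresses a unit of F[c] times y as a multiple of x.\<close>

lemma field_geometry:
  fixes t n :: "'a::field"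
  assumes irr: "\<And>l. l * l - t * l + n \<noteq> 0" and d: "t * t - 4 * n \<noteq> 0"
  shows "line_geometry (Cf t n) (WW t n) (WW t n)"
proof -
  have irr': "l * l - ztr (Cf t n) * l + znorm (Cf t n) \<noteq> 0" for l using irr by simp
  have dep: "y \<in> sp (Cf t n) x" if x: "x \<in> WW t n" "x \<noteq> 0" and y: "y \<in> WW t n" and c0: "cr (Cf t n) x y = 0" for x y
  proof -
    obtain z where z: "z \<in> {U2, U3, V2, V3, (0, (1, 0, 0), (n, 0, 0), 0), (1, (0, 0, 0), (t, 0, 0), - 1)}" "zbil z x \<noteq> 0"
      by (rule WW_nondeg[OF x d])
    define a where "a = 2 * n * zbil z x - t * zbil (Cf t n \<star> z) x"
    define b where "b = 2 * zbil (Cf t n \<star> z) x - t * zbil z x"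
    have ab: "a \<noteq> 0 \<or> b \<noteq> 0" using det2_kernel[OF _ _ d] z(2) unfolding a_def b_def by blast
    have "cr (Cf t n) 0 z = 0" unfolding cr_def by simp
    then have "cr (Cf t n) (cr (Cf t n) x y) z = 0" unfolding c0 .
    then have "a \<bullet> y + b \<bullet> (Cf t n \<star> y) =
      (2 * n * zbil z y - t * zbil (Cf t n \<star> z) y) \<bullet> x + (2 * zbil (Cf t n \<star> z) y - t * zbil z y) \<bullet> (Cf t n \<star> x)"
      unfolding WW_cr_cr[OF x(1) y z(1)] a_def[symmetric] b_def[symmetric] right_minus_eq .
    then have "a \<bullet> y + b \<bullet> (Cf t n \<star> y) \<in> sp (Cf t n) x" using spI by metis
    then show ?thesis by (rule sp_trans[OF sp_unit[OF irr' ab]])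
  qed
  have sym: "x \<in> sp (Cf t n) y" if y: "y \<in> sp (Cf t n) x" "y \<noteq> 0" for x y
  proof -
    obtain a b where ab: "y = a \<bullet> x + b \<bullet> (Cf t n \<star> x)" using y(1) by (rule spE)
    then have "a \<noteq> 0 \<or> b \<noteq> 0" using y(2) by auto
    then show ?thesis unfolding ab by (rule sp_unit[OF irr'])
  qed
  show ?thesis
  proof unfold_locales
    show "subsp (WW t n)" by (rule subsp_WW)
    fix x y assume x: "x \<in> WW t n"
    show "Cf t n \<star> x \<in> WW t n" by (rule WW_mul[OF x])
    show "ztr x = 0" using x by (simp add: WW_iff)
    show "x \<in> sp (Cf t n) y" if "y \<in> sp (Cf t n) x" "y \<noteq> 0" by (rule sym[OF that])
    assume y: "y \<in> WW t n"
    show "cr (Cf t n) x y \<in> WW t n" by (rule WW_cr)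
    show "cr (Cf t n) (Cf t n \<star> x) y \<in> sp (Cf t n) (cr (Cf t n) x y)" unfolding WW_crm[OF x y] by (rule spI)
    show "y \<in> sp (Cf t n) x" if "x \<noteq> 0" "cr (Cf t n) x y = 0" by (rule dep[OF x that(1) y that(2)])
  qed
qed

section \<open>Fixed vectors over the algebraic closure\<close>

text \<open>Applied to coordinates, such a functional carries vectors found over the closure back to
  F and commutes with maps defined over F (\<open>zmap_ext\<close>). It is chosen not to vanish at a
  coordinate that has to survive.\<close>

lemma alg_closure_functional:
  fixes k :: "'a::field alg_closure"
  assumes "k \<noteq> 0"
  obtains \<psi> :: "'a alg_closure \<Rightarrow> 'a"
  where "\<And>x y. \<psi> (x + y) = \<psi> x + \<psi> y" "\<And>a x. \<psi> (x * to_ac a) = \<psi> x * a" "\<psi> k \<noteq> 0"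
proof -
  interpret vector_space_pair "\<lambda>(a :: 'a) x. to_ac a * x" "(*) :: 'a \<Rightarrow> 'a \<Rightarrow> 'a"
    by unfold_locales (simp_all add: algebra_simps)
  obtain \<psi> where \<psi>: "Vector_Spaces.linear (\<lambda>(a :: 'a) x. to_ac a * x) ((*) :: 'a \<Rightarrow> 'a \<Rightarrow> 'a) \<psi>" "\<psi> k = 1"
    using linear_independent_extend[of "{k}" "\<lambda>_. 1"] assms by auto
  interpret \<psi>: Vector_Spaces.linear "\<lambda>(a :: 'a) x. to_ac a * x" "(*) :: 'a \<Rightarrow> 'a \<Rightarrow> 'a" \<psi> by (rule \<psi>(1))
  show thesis
    by (rule that[of \<psi>]) (use \<psi>.add \<psi>.scale \<psi>(2) in \<open>simp_all add: mult.commute\<close>)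
qed

fun zmap :: "('a \<Rightarrow> 'b) \<Rightarrow> 'a zorn \<Rightarrow> 'b zorn" where
  "zmap f (a, (u1, u2, u3), (v1, v2, v3), b) = (f a, (f u1, f u2, f u3), (f v1, f v2, f v3), f b)"

abbreviation inc :: "'a::field zorn \<Rightarrow> 'a alg_closure zorn" where "inc \<equiv> zmap to_ac"

lemma inc_hom: "inc (x + y) = inc x + inc y" "inc (k \<bullet> x) = to_ac k \<bullet> inc x" "inc (x \<star> y) = inc x \<star> inc y"
  by (cases x rule: zorn_cases; cases y rule: zorn_cases; simp)+
lemma inc_tr_norm: "ztr (inc x) = to_ac (ztr x)" "znorm (inc x) = to_ac (znorm x)"
  by (cases x rule: zorn_cases; simp)+
lemma inc_basis: "inc E1 = E1" "inc U1 = U1" "inc U2 = U2" "inc U3 = U3" "inc V1 = V1" "inc V2 = V2"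
  "inc V3 = V3" "inc E2 = E2" "inc Zid = Zid"
  by (simp_all add: zero_prod_def)

definition ext :: "('a::field zorn \<Rightarrow> 'a zorn) \<Rightarrow> 'a alg_closure zorn \<Rightarrow> 'a alg_closure zorn" where
  "ext g z = (case z of (a, (u1, u2, u3), (v1, v2, v3), b) \<Rightarrow>
    a \<bullet> inc (g E1) + u1 \<bullet> inc (g U1) + u2 \<bullet> inc (g U2) + u3 \<bullet> inc (g U3) +
    v1 \<bullet> inc (g V1) + v2 \<bullet> inc (g V2) + v3 \<bullet> inc (g V3) + b \<bullet> inc (g E2))"

lemma ext_eq: "ext g (a, (u1, u2, u3), (v1, v2, v3), b) =
    a \<bullet> inc (g E1) + u1 \<bullet> inc (g U1) + u2 \<bullet> inc (g U2) + u3 \<bullet> inc (g U3) +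
    v1 \<bullet> inc (g V1) + v2 \<bullet> inc (g V2) + v3 \<bullet> inc (g V3) + b \<bullet> inc (g E2)"
  by (simp only: ext_def prod.case)

lemma ext_add: "ext g (x + y) = ext g x + ext g y"
  by (cases x rule: zorn_cases; cases y rule: zorn_cases)
    (simp only: ext_eq plus_prod_def fst_conv snd_conv zsmul_add_left ac_simps)
lemma ext_smul: "ext g (k \<bullet> x) = k \<bullet> ext g x"
  by (cases x rule: zorn_cases) (simp only: ext_eq zsmul.simps smul3.simps zsmul_add zsmul_zsmul)

lemma ext_inc: assumes "g \<in> octonion_auts" shows "ext g (inc x) = inc (g x)"
proof (cases x rule: zorn_cases)
  case (1 a u1 u2 u3 v1 v2 v3 b)
  have e: "g x = a \<bullet> g E1 + u1 \<bullet> g U1 + u2 \<bullet> g U2 + u3 \<bullet> g U3 + v1 \<bullet> g V1 + v2 \<bullet> g V2 + v3 \<bullet> g V3 + b \<bullet> g E2"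
    unfolding 1 by (rule aut_expand[OF assms])
  show ?thesis unfolding e inc_hom unfolding 1 zmap.simps ext_eq by (rule refl)
qed

lemma linear_eqI:
  fixes f h :: "'a::field alg_closure zorn \<Rightarrow> 'a alg_closure zorn"
  assumes f: "\<And>x y. f (x + y) = f x + f y" "\<And>k x. f (k \<bullet> x) = k \<bullet> f x"
    and h: "\<And>x y. h (x + y) = h x + h y" "\<And>k x. h (k \<bullet> x) = k \<bullet> h x"
    and e: "\<And>x. f (inc x) = h (inc x)"
  shows "f x = h x"
proof -
  note b = e[of E1, unfolded inc_basis] e[of U1, unfolded inc_basis] e[of U2, unfolded inc_basis]
    e[of U3, unfolded inc_basis] e[of V1, unfolded inc_basis] e[of V2, unfolded inc_basis]
    e[of V3, unfolded inc_basis] e[of E2, unfolded inc_basis]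
  show ?thesis
  proof (cases x rule: zorn_cases)
    case (1 a1 u1 u2 u3 v1 v2 v3 b1)
    have x: "x = a1 \<bullet> E1 + u1 \<bullet> U1 + u2 \<bullet> U2 + u3 \<bullet> U3 + v1 \<bullet> V1 + v2 \<bullet> V2 + v3 \<bullet> V3 + b1 \<bullet> E2"
      unfolding 1 by (rule zorn_expand)
    show ?thesis unfolding x by (simp only: f h b)
  qed
qed

lemma ext_mul:
  assumes g: "g \<in> octonion_auts" shows "ext g (x \<star> y) = ext g x \<star> ext g y"
proof -
  have 1: "ext g (x \<star> inc y) = ext g x \<star> ext g (inc y)" for x y
    by (rule linear_eqI[where f = "\<lambda>x. ext g (x \<star> inc y)" and h = "\<lambda>x. ext g x \<star> ext g (inc y)"])
      (simp_all only: ext_add ext_smul zmul_add_left zmul_smul_left inc_hom(3)[symmetric] ext_inc[OF g] aut_mul[OF g])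
  show ?thesis
    by (rule linear_eqI[where f = "\<lambda>y. ext g (x \<star> y)" and h = "\<lambda>y. ext g x \<star> ext g y"])
      (simp_all only: ext_add ext_smul zmul_add_right zmul_smul_right 1)
qed

lemma ext_comp: assumes "g \<in> octonion_auts" "h \<in> octonion_auts" shows "ext (g \<circ> h) x = ext g (ext h x)"
  by (rule linear_eqI[where f = "ext (g \<circ> h)" and h = "\<lambda>x. ext g (ext h x)"])
    (simp_all add: ext_add ext_smul ext_inc assms aut_comp[OF assms])

lemma ext_id: "ext id x = x"
  by (rule linear_eqI[where f = "ext id" and h = "\<lambda>x. x"]) (simp_all add: ext_add ext_smul ext_inc)

lemma ext_aut: assumes g: "g \<in> octonion_auts" shows "ext g \<in> octonion_auts"
proof (rule autI[where h = "ext (finv g)"])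
  show "ext (finv g) (ext g x) = x" "ext g (ext (finv g) x) = x" for x
    using ext_comp[OF aut_inv[OF g] g] ext_comp[OF g aut_inv[OF g]] by (simp_all add: finv_comp[OF g] ext_id)
  show "ext g (x + y) = ext g x + ext g y" for x y by (rule ext_add)
  show "ext g (c \<bullet> x) = c \<bullet> ext g x" for c x by (rule ext_smul)
  show "ext g (x \<star> y) = ext g x \<star> ext g y" for x y by (rule ext_mul[OF g])
qed

lemma zmap_0:
  fixes \<psi> :: "'b::ab_group_add \<Rightarrow> 'a::ab_group_add"
  assumes "\<And>x y. \<psi> (x + y) = \<psi> x + \<psi> y"
  shows "\<psi> 0 = 0" "\<psi> (x - y) = \<psi> x - \<psi> y"
  using assms[of 0 0] assms[of "x - y" y] by (simp_all add: eq_diff_eq)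

lemma zmap_ext:
  fixes \<psi> :: "'a::field alg_closure \<Rightarrow> 'a"
  assumes \<psi>: "\<And>x y. \<psi> (x + y) = \<psi> x + \<psi> y" "\<And>a x. \<psi> (x * to_ac a) = \<psi> x * a" and g: "g \<in> octonion_auts"
  shows "zmap \<psi> (ext g z) = g (zmap \<psi> z)"
proof -
  have a: "zmap \<psi> (x + y) = zmap \<psi> x + zmap \<psi> y" for x y
    by (cases x rule: zorn_cases; cases y rule: zorn_cases) (simp add: \<psi>)
  have s: "zmap \<psi> (k \<bullet> inc x) = \<psi> k \<bullet> x" for k x
    by (cases x rule: zorn_cases) (simp add: \<psi>)
  show ?thesis
  proof (cases z rule: zorn_cases)
    case (1 a' u1 u2 u3 v1 v2 v3 b)
    have e: "g (zmap \<psi> z) = \<psi> a' \<bullet> g E1 + \<psi> u1 \<bullet> g U1 + \<psi> u2 \<bullet> g U2 + \<psi> u3 \<bullet> g U3 +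
        \<psi> v1 \<bullet> g V1 + \<psi> v2 \<bullet> g V2 + \<psi> v3 \<bullet> g V3 + \<psi> b \<bullet> g E2"
      unfolding 1 zmap.simps by (rule aut_expand[OF g])
    show ?thesis unfolding e unfolding 1 ext_eq by (simp only: a s)
  qed
qed

lemma aut_finite_order:
  fixes g :: "'a::{finite,field} zorn \<Rightarrow> 'a zorn"
  assumes g: "g \<in> octonion_auts" obtains n where "n > 0" "g ^^ n = id"
proof -
  have b: "bij (g ^^ i)" for i
  proof (induction i)
    case 0
    show ?case unfolding funpow.simps by (rule bij_id)
  next
    case (Suc i)
    show ?case unfolding funpow.simps by (rule bij_comp[OF Suc aut_bij[OF g]])
  qed
  have "\<not> inj (\<lambda>i :: nat. g ^^ i)" using finite_imageD[of "\<lambda>i :: nat. g ^^ i" UNIV] by auto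
  then obtain i j where "g ^^ i = g ^^ j" "i \<noteq> j" unfolding inj_def by blast
  then obtain i j where ij: "g ^^ i = g ^^ j" "i < j" by (metis linorder_neqE_nat)
  have "i + (j - i) = j" using ij(2) by simp
  then have e: "g ^^ j = g ^^ i \<circ> g ^^ (j - i)" using funpow_add[of i "j - i" g] by argo
  have "(g ^^ i) ((g ^^ (j - i)) x) = (g ^^ i) x" for x using fun_cong[OF e, of x] unfolding ij(1) o_apply by (rule sym)
  then have "(g ^^ (j - i)) x = id x" for x using injD[OF bij_is_inj[OF b[of i]]] unfolding id_apply by blast
  then have "g ^^ (j - i) = id" by (rule HOL.ext)
  then show thesis using that[of "j - i"] ij(2) by simp
qed

lemma ext_power: assumes "g \<in> octonion_auts" shows "ext (g ^^ n) x = (ext g ^^ n) x \<and> g ^^ n \<in> octonion_auts"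
proof (induction n arbitrary: x)
  case 0
  show ?case unfolding funpow.simps ext_id by (intro conjI aut_id) (rule id_apply[symmetric])
next
  case (Suc n)
  then have IH: "g ^^ n \<in> octonion_auts" "ext (g ^^ n) x = (ext g ^^ n) x" for x by blast+
  show ?case unfolding funpow.simps ext_comp[OF assms IH(1)] IH(2)
    by (intro conjI aut_comp assms IH(1)) (rule o_apply[symmetric])
qed

text \<open>The value p(f) y of a polynomial in f, by Horner's scheme.\<close>

definition act :: "('a::field zorn \<Rightarrow> 'a zorn) \<Rightarrow> 'a zorn \<Rightarrow> 'a poly \<Rightarrow> 'a zorn" where
  "act f y p = fold_coeffs (\<lambda>a w. a \<bullet> y + f w) p 0"

text \<open>As f has finite order, X^n - 1 annihilates y, and it splits into linear factors. Where
  applying one more factor first leads into A, the vector before it is an eigenvector modulo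
  A.\<close>

lemma quotient_eigenvector:
  fixes f :: "'a::alg_closed_field zorn \<Rightarrow> 'a zorn"
  assumes f: "f \<in> octonion_auts" "n > 0" "f ^^ n = id"
    and A: "subsp A" and B: "subsp B" "\<And>x. x \<in> B \<Longrightarrow> f x \<in> B" and y: "y \<in> B" "y \<notin> A"
  obtains w \<mu> where "w \<in> B" "w \<notin> A" "f w - \<mu> \<bullet> w \<in> A"
proof -
  have pC: "act f y (pCons a p) = a \<bullet> y + f (act f y p)" for a p
    by (cases "p = 0 \<and> a = 0") (auto simp: act_def aut_0[OF f(1)])
  have z: "act f y 0 = 0" by (simp add: act_def)
  have add: "act f y (p + q) = act f y p + act f y q" for p q
    by (induction p q rule: poly_induct2) (simp_all add: z pC aut_add[OF f(1)] zsmul_add_left)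
  have sm: "act f y (smult k p) = k \<bullet> act f y p" for k p
    by (induction p) (simp_all add: z pC aut_smul[OF f(1)] zsmul_add)
  have lin: "act f y ([:- x, 1:] * p) = f (act f y p) - x \<bullet> act f y p" for x p
  proof -
    have "act f y ([:- x, 1:] * p) = act f y (smult (- x) p + pCons 0 p)" by simp
    also have "\<dots> = (- x) \<bullet> act f y p + (0 \<bullet> y + f (act f y p))" by (simp only: add sm pC)
    finally show ?thesis by (simp add: zsmul_minus)
  qed
  have mon: "act f y (monom 1 k) = (f ^^ k) y" for k
    by (induction k) (simp_all add: monom_0 monom_Suc pC z aut_0[OF f(1)])
  have inB: "act f y p \<in> B" for p
    by (induction p) (simp_all add: z pC subspD[OF B(1)] B(2) y(1))
  define p :: "'a poly" where "p = monom 1 n + smult (- 1) 1"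
  have "coeff p n = 1" using f(2) by (cases n) (simp_all add: p_def)
  then have p0: "p \<noteq> 0" by auto
  have one: "act f y 1 = y" using mon[of 0] by (simp add: monom_0 one_pCons)
  have "act f y p = 0" by (simp only: p_def add sm mon one f(3)) (simp add: zsmul_minus)
  obtain M where M: "p = smult (lead_coeff p) (\<Prod>x\<in>#M. [:- x, 1:])" using alg_closed_imp_factorization[OF p0] by blast
  have "lead_coeff p \<bullet> act f y (\<Prod>x\<in>#M. [:- x, 1:]) = 0"
    using \<open>act f y p = 0\<close> unfolding sm[symmetric] M[symmetric] .
  then have "act f y (\<Prod>x\<in>#M. [:- x, 1:]) = 0" using p0 by simp
  then have "act f y (\<Prod>x\<in>#M. [:- x, 1:]) \<in> A" using subspD(1)[OF A] by simp
  then have "\<exists>w \<mu>. w \<in> B \<and> w \<notin> A \<and> f w - \<mu> \<bullet> w \<in> A"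
  proof (induction M)
    case empty
    then show ?case using y one by simp
  next
    case (add x M)
    show ?case
    proof (cases "act f y (\<Prod>x\<in>#M. [:- x, 1:]) \<in> A")
      case False
      have "act f y ([:- x, 1:] * (\<Prod>x\<in>#M. [:- x, 1:])) \<in> A" using add.prems by simp
      then show ?thesis using False inB unfolding lin by blast
    next
      case True
      then show ?thesis by (rule add.IH)
    qed
  qed
  then show thesis using that by blast
qed

lemma dependent3:
  fixes p q r :: "'a::field vec3"
  assumes "dot3 p (cross3 q r) = 0"
  obtains x y z where "x \<noteq> 0 \<or> y \<noteq> 0 \<or> z \<noteq> 0" "smul3 x p + smul3 y q + smul3 z r = 0"
proof (cases "p = 0")
  case True
  then show thesis using that[of 1 0 0] by simp
next
  case p: False
  show thesis
  proof (cases "cross3 p q = 0")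
    case True
    then obtain k where "q = smul3 k p" using p by (rule cross3_eq_0)
    then have "smul3 k p + smul3 (- 1) q + smul3 0 r = 0" by (cases p rule: vec3_cases) (simp add: zero_prod_def)
    then show thesis using that[of k "- 1" 0] by simp
  next
    case False
    have "\<exists>x. dot3 (cross3 p q) x \<noteq> 0"
    proof (cases "cross3 p q" rule: vec3_cases)
      case (1 a b c)
      then have "dot3 (cross3 p q) (1, 0, 0) \<noteq> 0 \<or> dot3 (cross3 p q) (0, 1, 0) \<noteq> 0 \<or> dot3 (cross3 p q) (0, 0, 1) \<noteq> 0"
        using False by (simp add: zero_prod_def)
      then show ?thesis by blast
    qed
    then obtain x where "dot3 (cross3 p q) x \<noteq> 0" by blast
    then show thesis
      using that[of "dot3 (cross3 q r) x" "dot3 (cross3 r p) x" "dot3 (cross3 p q) x"] cramer3[of p q r x]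
      by (simp add: assms)
  qed
qed

lemma dependent4:
  fixes p q r s :: "'a::field vec3"
  obtains x y z w where "x \<noteq> 0 \<or> y \<noteq> 0 \<or> z \<noteq> 0 \<or> w \<noteq> 0" "smul3 x p + smul3 y q + smul3 z r + smul3 w s = 0"
proof (cases "dot3 p (cross3 q r) = 0")
  case True
  then obtain x y z where "x \<noteq> 0 \<or> y \<noteq> 0 \<or> z \<noteq> 0" "smul3 x p + smul3 y q + smul3 z r = 0" by (rule dependent3)
  then show thesis using that[of x y z 0] by simp
next
  case False
  have "smul3 (- k) s = - smul3 k s" for k by (cases s rule: vec3_cases) simp
  then show thesis
    using that[of "dot3 (cross3 q r) s" "dot3 (cross3 r p) s" "dot3 (cross3 p q) s" "- dot3 p (cross3 q r)"]
      cramer3[of p q r s] False by simp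
qed

text \<open>After moving the null line to \<open>U1\<close>, f - 1 maps the four-dimensional span of
  \<open>E1\<close>, \<open>U1\<close>, \<open>V2\<close>, \<open>V3\<close> into the
  three-dimensional \<open>Kx\<close>. It has a kernel there, and the span contains no nonzero
  scalar.\<close>

lemma null_line_fixed:
  fixes g :: "'a::field zorn \<Rightarrow> 'a zorn"
  assumes g: "g \<in> octonion_auts" and y: "y \<noteq> 0" "ztr y = 0" "znorm y = 0" "g y = \<mu> \<bullet> y"
  shows "\<exists>z. noncen z \<and> g z = z"
proof -
  obtain h where h: "h \<in> octonion_auts" "h y = U1"
    by (rule transitive[of y U1]) (use y null_noncen[of y] in \<open>simp_all add: noncen_iff\<close>)
  define f where "f = h \<circ> g \<circ> finv h"
  have f: "f \<in> octonion_auts" unfolding f_def by (intro aut_comp aut_inv g h(1))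
  have fh: "f (h z) = h (g z)" for z unfolding f_def by (rule conj_apply[OF h(1)])
  have "f U1 = \<mu> \<bullet> U1" using fh[of y] by (simp only: h(2) y(4) aut_smul[OF h(1)])
  then have P: "f \<in> Px" using f unfolding Px_def by blast
  have K: "\<exists>x y2 y3. f z - z = (0, (x, 0, 0), (0, y2, y3), 0)" if "f z - z \<in> Kx" for z
    by (rule Kx_cases[OF that]) blast
  have D: "f z - z \<in> Kx" if "z \<in> Kx" for z by (rule subspD(4)[OF subsp_Kx Px_Kx[OF P that] that])
  obtain a1 a2 a3 where a: "f E1 - E1 = (0, (a1, 0, 0), (0, a2, a3), 0)" using K[OF Px_E1[OF P]] by blast
  obtain b1 b2 b3 where b: "f U1 - U1 = (0, (b1, 0, 0), (0, b2, b3), 0)" using K[OF D, of U1] by auto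
  obtain c1 c2 c3 where c: "f V2 - V2 = (0, (c1, 0, 0), (0, c2, c3), 0)" using K[OF D, of V2] by auto
  obtain d1 d2 d3 where d: "f V3 - V3 = (0, (d1, 0, 0), (0, d2, d3), 0)" using K[OF D, of V3] by auto
  obtain x y z w where nz: "x \<noteq> 0 \<or> y \<noteq> 0 \<or> z \<noteq> 0 \<or> w \<noteq> 0"
    and 0: "smul3 x (a1, a2, a3) + smul3 y (b1, b2, b3) + smul3 z (c1, c2, c3) + smul3 w (d1, d2, d3) = 0"
    by (rule dependent4)
  define v where "v = x \<bullet> E1 + y \<bullet> U1 + z \<bullet> V2 + w \<bullet> V3"
  have "f v - v = x \<bullet> (f E1 - E1) + y \<bullet> (f U1 - U1) + z \<bullet> (f V2 - V2) + w \<bullet> (f V3 - V3)"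
    by (simp only: v_def aut_add[OF f] aut_smul[OF f] zsmul_diff) simp
  also have "\<dots> = 0" unfolding a b c d using 0 by (simp add: zero_prod_def)
  finally have fv: "f v = v" by simp
  have "noncen v" using nz by (auto simp: v_def noncen_iff)
  moreover obtain v' where v': "h v' = v" using aut_surj[OF h(1)] by blast
  moreover have "g v' = v'" using fh[of v'] unfolding v' fv using v' aut_inj[OF h(1)] by metis
  ultimately show ?thesis using aut_noncen[OF h(1)] by metis
qed

lemma traceless_noncen: "(2 :: 'a::field) \<noteq> 0 \<Longrightarrow> ztr y = 0 \<Longrightarrow> y \<noteq> 0 \<Longrightarrow> noncen (y :: 'a zorn)"
  unfolding noncen_def by (auto simp: zero_prod_def simp flip: mult_2)

lemma eigenvector_cases:
  fixes g :: "'a::field zorn \<Rightarrow> 'a zorn"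
  assumes g: "g \<in> octonion_auts" and y: "y \<noteq> 0" "ztr y = 0" "g y = \<mu> \<bullet> y"
  shows "(\<exists>z. noncen z \<and> g z = z) \<or> znorm y \<noteq> 0 \<and> (\<mu> = 1 \<or> \<mu> = - 1)"
proof (cases "znorm y = 0")
  case False
  then have "\<mu> * \<mu> = 1" using eigen_null(2)[OF g y(3)] by blast
  then have "(\<mu> - 1) * (\<mu> + 1) = 0" by (simp add: algebra_simps)
  then show ?thesis using False by (auto simp: eq_neg_iff_add_eq_0)
next
  case True
  then show ?thesis by (intro disjI1 null_line_fixed[OF g y(1,2) _ y(3)])
qed

text \<open>In odd characteristic two orthogonal traceless eigenvectors with eigenvalue - 1 and
  nonzero norm have a fixed traceless product. In characteristic 2 \<open>Zid\<close> itself is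
  traceless, so eigenvectors are taken modulo scalars; the defect k vanishes by comparing norms if
  \<mu> = 1 and is absorbed by a shift otherwise.\<close>

lemma fixed_noncentral_closed:
  fixes g :: "'a::alg_closed_field zorn \<Rightarrow> 'a zorn"
  assumes g: "g \<in> octonion_auts" "n > 0" "g ^^ n = id"
  shows "\<exists>z. noncen z \<and> g z = z"
proof (cases "(2 :: 'a) = 0")
  case two: False
  have B: "subsp {z :: 'a zorn. ztr z = 0}" unfolding subsp_def by (simp del: split_paired_All)
  obtain y \<mu> where y: "y \<in> {z. ztr z = 0}" "y \<notin> {0}" "g y - \<mu> \<bullet> y \<in> {0}"
    by (rule quotient_eigenvector[OF g subsp_0 B, of U1]) (auto simp: aut_tr[OF g(1)] simp del: split_paired_all)
  then have y': "ztr y = 0" "y \<noteq> 0" "g y = \<mu> \<bullet> y" by simp_all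
  show ?thesis
  proof (rule ccontr)
    assume n: "\<not> ?thesis"
    have m1: "znorm w \<noteq> 0 \<and> \<nu> = - 1" if w: "w \<noteq> 0" "ztr w = 0" "g w = \<nu> \<bullet> w" for w \<nu>
      using eigenvector_cases[OF g(1) w] n traceless_noncen[OF two w(2,1)] w(3) by auto
    have my: "znorm y \<noteq> 0" "g y = (- 1) \<bullet> y" using m1[OF y'(2,1,3)] y'(3) by simp_all
    define C where "C = {z. ztr z = 0 \<and> zbil y z = 0}"
    have C: "subsp C" unfolding subsp_def C_def by (simp add: zbil_add zbil_smul del: split_paired_All)
    have gC: "g z \<in> C" if "z \<in> C" for z
    proof -
      have "zbil y (g z) = - zbil ((- 1) \<bullet> y) (g z)" by (simp only: zbil_smul) simp
      also have "\<dots> = - zbil y z" unfolding my(2)[symmetric] aut_bil[OF g(1)] ..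
      finally show ?thesis using that by (simp add: C_def aut_tr[OF g(1)])
    qed
    obtain z0 where z0: "z0 \<in> C" "z0 \<notin> {0}"
    proof (cases y rule: zorn_cases)
      case (1 a u1 u2 u3 v1 v2 v3 b)
      show thesis
      proof (cases "u1 = 0 \<and> v1 = 0")
        case True
        then show thesis using that[of U1] by (simp add: C_def 1 zero_prod_def)
      next
        case False
        then show thesis using that[of "(0, (u1, 0, 0), (- v1, 0, 0), 0)"] by (simp add: C_def 1 zero_prod_def)
      qed
    qed
    obtain w \<nu> where w: "w \<in> C" "w \<notin> {0}" "g w - \<nu> \<bullet> w \<in> {0}"
      by (rule quotient_eigenvector[OF g subsp_0 C gC z0]) blast
    then have w': "ztr w = 0" "zbil y w = 0" "w \<noteq> 0" "g w = \<nu> \<bullet> w" by (simp_all add: C_def)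
    have mw: "znorm w \<noteq> 0" "g w = (- 1) \<bullet> w" using m1[OF w'(3,1,4)] w'(4) by simp_all
    have "g (y \<star> w) = y \<star> w" by (simp only: aut_mul[OF g(1)] my mw zmul_smul_left zmul_smul_right) simp
    moreover have "ztr (y \<star> w) = 0" by (simp add: ztr_mul y' w')
    moreover have "y \<star> w \<noteq> 0" using my(1) mw(1) znorm_mul[of y w] by (metis mult_eq_0_iff znorm_0)
    ultimately show False using n traceless_noncen[OF two] by blast
  qed
next
  case two: True
  note c2 = char2[OF two]
  define A :: "'a zorn set" where "A = {z. \<not> noncen z}"
  have A: "subsp A" unfolding subsp_def
  proof (intro conjI ballI allI)
    show "0 \<in> A" unfolding A_def noncen_def by (auto intro!: exI[of _ 0])
    fix x y :: "'a zorn" and c assume x: "x \<in> A"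
    then obtain k where k: "x = k \<bullet> Zid" unfolding A_def noncen_def by blast
    show "c \<bullet> x \<in> A" unfolding A_def noncen_def k zsmul_zsmul by blast
    assume "y \<in> A"
    then obtain l where l: "y = l \<bullet> Zid" unfolding A_def noncen_def by blast
    show "x + y \<in> A" unfolding A_def noncen_def k l zsmul_add_left[symmetric] by blast
  qed
  have B: "subsp {z :: 'a zorn. ztr z = 0}" unfolding subsp_def by (simp del: split_paired_All)
  obtain w \<mu> where w: "w \<in> {z. ztr z = 0}" "w \<notin> A" "g w - \<mu> \<bullet> w \<in> A"
    by (rule quotient_eigenvector[OF g A B, of U1])
      (auto simp: A_def noncen_iff aut_tr[OF g(1)] simp del: split_paired_all)
  then obtain k where "g w - \<mu> \<bullet> w = k \<bullet> Zid" unfolding A_def noncen_def by blast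
  then have k: "g w = \<mu> \<bullet> w + k \<bullet> Zid" by (simp only: diff_eq_eq add.commute)
  have w': "ztr w = 0" "noncen w" using w unfolding A_def by blast+
  show ?thesis
  proof (cases "\<mu> = 1")
    case True
    then have gw: "g w = w + k \<bullet> Zid" using k by simp
    have "znorm w = znorm (w + k \<bullet> Zid)" unfolding gw[symmetric] aut_norm[OF g(1)] ..
    also have "\<dots> = znorm w + k * k" unfolding znorm_add by (simp add: zbil_smul(2) zbil_Id w' del: zsmul.simps)
    finally have "k = 0" by simp
    then show ?thesis using gw w'(2) by auto
  next
    case False
    define s where "s = k / (\<mu> - 1)"
    have s: "k + s = \<mu> * s" using False by (simp add: s_def field_simps)
    define y where "y = w + s \<bullet> Zid"
    have "g y = \<mu> \<bullet> w + (k + s) \<bullet> Zid"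
      by (simp only: y_def aut_add[OF g(1)] aut_smul[OF g(1)] aut_Id[OF g(1)] k zsmul_add_left add.assoc)
    then have gy: "g y = \<mu> \<bullet> y" unfolding s y_def zsmul_add zsmul_zsmul .
    have ty: "ztr y = 0" by (simp add: y_def w' c2)
    have ny: "noncen y"
    proof (rule ccontr)
      assume "\<not> noncen y"
      then have "y - s \<bullet> Zid \<in> A" using subspD(4)[OF A, of y "s \<bullet> Zid"] unfolding A_def noncen_def by blast
      then show False using w(2) by (simp add: y_def)
    qed
    then have y0: "y \<noteq> 0" by (auto simp: noncen_def intro!: exI[of _ 0])
    show ?thesis using eigenvector_cases[OF g(1) y0 ty gy] False c2(2)[of 1] by auto
  qed
qed

theorem fixed_noncentral:
  fixes g :: "'a::{finite,field} zorn \<Rightarrow> 'a zorn"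
  assumes g: "g \<in> octonion_auts"
  obtains c where "noncen c" "g c = c"
proof -
  obtain n where n: "n > 0" "g ^^ n = id" by (rule aut_finite_order[OF g])
  have "(ext g ^^ n) x = x" for x using ext_power[OF g, of n x] by (simp add: n(2) ext_id)
  then have "ext g ^^ n = id" by (simp add: fun_eq_iff del: split_paired_All)
  from fixed_noncentral_closed[OF ext_aut[OF g] n(1) this]
  obtain z where z: "noncen z" "ext g z = z" by blast
  show thesis
  proof (cases z rule: zorn_cases)
    case (1 a u1 u2 u3 v1 v2 v3 b)
    have "\<exists>k\<in>{u1, u2, u3, v1, v2, v3, a - b}. k \<noteq> 0" using z(1) unfolding 1 noncen_iff by auto
    then obtain k where k: "k \<in> {u1, u2, u3, v1, v2, v3, a - b}" "k \<noteq> 0" by blast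
    obtain \<psi> :: "'a alg_closure \<Rightarrow> 'a" where \<psi>: "\<And>x y. \<psi> (x + y) = \<psi> x + \<psi> y"
      "\<And>a x. \<psi> (x * to_ac a) = \<psi> x * a" "\<psi> k \<noteq> 0"
      by (rule alg_closure_functional[OF k(2)]) (rule that)
    have "noncen (zmap \<psi> z)" using k(1) \<psi>(3) unfolding 1 zmap.simps noncen_iff
      by (auto simp: zmap_0(2)[OF \<psi>(1)])
    moreover have "g (zmap \<psi> z) = zmap \<psi> z" using zmap_ext[OF \<psi>(1,2) g, of z] z(2) by simp
    ultimately show thesis by (rule that)
  qed
qed

section \<open>Fixed vectors in the complement of F[c]\<close>

lemma UU_Peirce: "z \<in> UU \<longleftrightarrow> E1 \<star> z = z \<and> z \<star> E1 = 0"
  by (cases z rule: zorn_cases) (auto simp: zero_prod_def)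
lemma VV_Peirce: "z \<in> VV \<longleftrightarrow> E2 \<star> z = z \<and> z \<star> E2 = 0"
  by (cases z rule: zorn_cases) (auto simp: zero_prod_def)

lemma Zid_diff_E1: "Zid - E1 = E2" "Zid - E2 = E1" by (simp_all add: zero_prod_def)

lemma aut_E2: assumes f: "f \<in> octonion_auts" shows "f E2 = Zid - f E1"
  unfolding Zid_diff_E1(1)[symmetric] aut_diff[OF f] aut_Id[OF f] ..

lemma aut_UU_VV:
  assumes f: "f \<in> octonion_auts" "f E1 = E1"
  shows "x \<in> UU \<Longrightarrow> f x \<in> UU" "x \<in> VV \<Longrightarrow> f x \<in> VV"
proof -
  have f2: "f E2 = E2" unfolding aut_E2[OF f(1)] f(2) by (rule Zid_diff_E1)
  show "f x \<in> UU" if "x \<in> UU"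
    using that aut_mul[OF f(1), of E1 x] aut_mul[OF f(1), of x E1] unfolding UU_Peirce f(2) by (simp only: aut_0[OF f(1)])
  show "f x \<in> VV" if "x \<in> VV"
    using that aut_mul[OF f(1), of E2 x] aut_mul[OF f(1), of x E2] unfolding VV_Peirce f2 by (simp only: aut_0[OF f(1)])
qed

lemma swap_UU:
  assumes f: "f \<in> octonion_auts" "f E1 = E2" and x: "x \<in> UU" shows "f x \<in> VV"
  using x aut_mul[OF f(1), of E1 x] aut_mul[OF f(1), of x E1] unfolding UU_Peirce VV_Peirce f(2)
  by (simp only: aut_0[OF f(1)])

text \<open>Invariance of the trace under conjugation, without denominators: for A with columns p,
  q, r and C with columns a, b, c the left-hand side is the trace of adj(C) A C.\<close>

lemma cofactor_trace:
  "dot3 (cross3 b c) (colmul p q r a) + dot3 (cross3 c a) (colmul p q r b) + dot3 (cross3 a b) (colmul p q r c) =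
    (dot3 p (1, 0, 0) + dot3 q (0, 1, 0) + dot3 r (0, 0, 1)) * dot3 a (cross3 b c)"
  by (cases a rule: vec3_cases; cases b rule: vec3_cases; cases c rule: vec3_cases;
      cases p rule: vec3_cases; cases q rule: vec3_cases; cases r rule: vec3_cases) (simp add: algebra_simps)

lemma cofactor_trace':
  "dot3 (cross3 b c) (colmul a b c p) + dot3 (cross3 c a) (colmul a b c q) + dot3 (cross3 a b) (colmul a b c r) =
    (dot3 p (1, 0, 0) + dot3 q (0, 1, 0) + dot3 r (0, 0, 1)) * dot3 a (cross3 b c)"
  by (cases a rule: vec3_cases; cases b rule: vec3_cases; cases c rule: vec3_cases;
      cases p rule: vec3_cases; cases q rule: vec3_cases; cases r rule: vec3_cases) (simp add: algebra_simps)

lemma char_poly_at_1: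
  "dot3 (p - (1, 0, 0)) (cross3 (q - (0, 1, 0)) (r - (0, 0, 1))) =
    dot3 p (cross3 q r) - 1 - (dot3 (cross3 q r) (1, 0, 0) + dot3 (cross3 r p) (0, 1, 0) + dot3 (cross3 p q) (0, 0, 1)) +
    (dot3 p (1, 0, 0) + dot3 q (0, 1, 0) + dot3 r (0, 0, 1))"
  by (cases p rule: vec3_cases; cases q rule: vec3_cases; cases r rule: vec3_cases) (simp add: algebra_simps)

text \<open>If \<open>A\<close> is the matrix of \<open>g\<close> on \<open>UU\<close>, then \<open>h\<close> conjugates \<open>A\<close> into its cofactor matrix; equality of
  the traces makes \<open>1\<close> a root of the characteristic polynomial of \<open>A\<close>.\<close>
lemma fixed_complement_split:
  fixes g h :: "'a::field zorn \<Rightarrow> 'a zorn"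
  assumes g: "g \<in> octonion_auts" "g E1 = E1" and h: "h \<in> octonion_auts" "h E1 = E2"
    and c: "\<And>x. h (g x) = g (h x)"
  shows "\<exists>w\<in>UU. w \<noteq> 0 \<and> g w = w"
proof -
  have U: "U1 \<in> (UU :: 'a zorn set)" "U2 \<in> (UU :: 'a zorn set)" "U3 \<in> (UU :: 'a zorn set)" by (simp_all add: zero_prod_def)
  have gU: "\<exists>p. g x = (0, p, 0, 0)" if "x \<in> UU" for x using aut_UU_VV(1)[OF g that] unfolding UU_def by blast
  have hU: "\<exists>p. h x = (0, 0, p, 0)" if "x \<in> UU" for x using swap_UU[OF h that] unfolding VV_def by blast
  obtain p q r where g123: "g U1 = (0, p, 0, 0)" "g U2 = (0, q, 0, 0)" "g U3 = (0, r, 0, 0)"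
    using gU[OF U(1)] gU[OF U(2)] gU[OF U(3)] by blast
  obtain c1 c2 c3 where h123: "h U1 = (0, 0, c1, 0)" "h U2 = (0, 0, c2, 0)" "h U3 = (0, 0, c3, 0)"
    using hU[OF U(1)] hU[OF U(2)] hU[OF U(3)] by blast
  have e: "U2 \<star> U3 = (V1 :: 'a zorn)" "U3 \<star> U1 = (V2 :: 'a zorn)" "U1 \<star> U2 = (V3 :: 'a zorn)" "V1 \<star> U1 = (E2 :: 'a zorn)"
    by (simp_all add: zero_prod_def)
  have UUm: "(0, u, 0, 0) \<star> (0, u', 0, 0) = (0, 0, cross3 u u', 0 :: 'a)"
    "(0, 0, u, 0) \<star> (0, 0, u', 0) = (0, - cross3 u u', 0, 0 :: 'a)"
    "(0, 0, u, 0) \<star> (0, u', 0, 0) = (0, 0, 0, dot3 u u')"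
    "(0, u, 0, 0) \<star> (0, 0, u', 0) = (dot3 u u', 0, 0, 0)" for u u'
    by simp_all
  have gV: "g V1 = (0, 0, cross3 q r, 0)" "g V2 = (0, 0, cross3 r p, 0)" "g V3 = (0, 0, cross3 p q, 0)"
    unfolding e[symmetric] aut_mul[OF g(1)] g123 UUm by (rule refl)+
  have "g (V1 \<star> U1) = E2" unfolding e aut_E2[OF g(1)] g(2) by (rule Zid_diff_E1)
  then have det: "dot3 p (cross3 q r) = 1" unfolding aut_mul[OF g(1)] gV g123 UUm by (simp add: dot3_sym)
  have "h V1 = (0, - cross3 c2 c3, 0, 0)" unfolding e(1)[symmetric] aut_mul[OF h(1)] h123 UUm ..
  moreover have "h (V1 \<star> U1) = E1" unfolding e aut_E2[OF h(1)] h(2) by (rule Zid_diff_E1)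
  ultimately have "dot3 (- cross3 c2 c3) c1 = 1" unfolding aut_mul[OF h(1)] h123 by (simp add: UUm)
  moreover have "dot3 (- x) y = - dot3 y x" for x y :: "'a vec3"
    by (cases x rule: vec3_cases; cases y rule: vec3_cases) (simp add: algebra_simps)
  ultimately have detC: "dot3 c1 (cross3 c2 c3) \<noteq> 0" by auto
  have gvec: "g (0, 0, v, 0) = (0, 0, colmul (cross3 q r) (cross3 r p) (cross3 p q) v, 0)" for v
  proof (cases v rule: vec3_cases)
    case (1 v1 v2 v3)
    have "(0, 0, v, 0) = v1 \<bullet> V1 + v2 \<bullet> V2 + v3 \<bullet> V3" by (simp add: 1 zero_prod_def)
    then have "g (0, 0, v, 0) = v1 \<bullet> g V1 + v2 \<bullet> g V2 + v3 \<bullet> g V3" by (simp only: aut_add[OF g(1)] aut_smul[OF g(1)])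
    then show ?thesis unfolding gV by (simp add: 1)
  qed
  have hvec: "h (0, u, 0, 0) = (0, 0, colmul c1 c2 c3 u, 0)" for u
  proof (cases u rule: vec3_cases)
    case (1 v1 v2 v3)
    have "(0, u, 0, 0) = v1 \<bullet> U1 + v2 \<bullet> U2 + v3 \<bullet> U3" by (simp add: 1 zero_prod_def)
    then have "h (0, u, 0, 0) = v1 \<bullet> h U1 + v2 \<bullet> h U2 + v3 \<bullet> h U3" by (simp only: aut_add[OF h(1)] aut_smul[OF h(1)])
    then show ?thesis unfolding h123 by (simp add: 1)
  qed
  have comm: "colmul c1 c2 c3 p = colmul (cross3 q r) (cross3 r p) (cross3 p q) c1"
    "colmul c1 c2 c3 q = colmul (cross3 q r) (cross3 r p) (cross3 p q) c2"
    "colmul c1 c2 c3 r = colmul (cross3 q r) (cross3 r p) (cross3 p q) c3"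
    using c[of U1] c[of U2] c[of U3] unfolding g123 h123 gvec hvec prod.inject by blast+
  have "(dot3 p (1, 0, 0) + dot3 q (0, 1, 0) + dot3 r (0, 0, 1)) * dot3 c1 (cross3 c2 c3) =
    dot3 (cross3 c2 c3) (colmul c1 c2 c3 p) + dot3 (cross3 c3 c1) (colmul c1 c2 c3 q) +
    dot3 (cross3 c1 c2) (colmul c1 c2 c3 r)" by (rule cofactor_trace'[symmetric])
  also have "\<dots> = (dot3 (cross3 q r) (1, 0, 0) + dot3 (cross3 r p) (0, 1, 0) + dot3 (cross3 p q) (0, 0, 1)) *
    dot3 c1 (cross3 c2 c3)" unfolding comm by (rule cofactor_trace)
  finally have "(dot3 p (1, 0, 0) + dot3 q (0, 1, 0) + dot3 r (0, 0, 1)) * dot3 c1 (cross3 c2 c3) =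
    (dot3 (cross3 q r) (1, 0, 0) + dot3 (cross3 r p) (0, 1, 0) + dot3 (cross3 p q) (0, 0, 1)) * dot3 c1 (cross3 c2 c3)" .
  then have "dot3 p (1, 0, 0) + dot3 q (0, 1, 0) + dot3 r (0, 0, 1) =
    dot3 (cross3 q r) (1, 0, 0) + dot3 (cross3 r p) (0, 1, 0) + dot3 (cross3 p q) (0, 0, 1)"
    using detC mult_cancel_right by blast
  then have "dot3 (p - (1, 0, 0)) (cross3 (q - (0, 1, 0)) (r - (0, 0, 1))) = 0" unfolding char_poly_at_1 det by simp
  then obtain x y z where xyz: "x \<noteq> 0 \<or> y \<noteq> 0 \<or> z \<noteq> 0"
    "smul3 x (p - (1, 0, 0)) + smul3 y (q - (0, 1, 0)) + smul3 z (r - (0, 0, 1)) = 0" by (rule dependent3)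
  define w where "w = x \<bullet> U1 + y \<bullet> U2 + z \<bullet> U3"
  have we: "w = (0, (x, y, z), 0, 0)" by (simp add: w_def zero_prod_def)
  have "g w = x \<bullet> g U1 + y \<bullet> g U2 + z \<bullet> g U3" by (simp only: w_def aut_add[OF g(1)] aut_smul[OF g(1)])
  also have "\<dots> = (0, smul3 x p + smul3 y q + smul3 z r, 0, 0)" unfolding g123 by simp
  also have "smul3 x p + smul3 y q + smul3 z r = (x, y, z)"
    using xyz(2) by (cases p rule: vec3_cases; cases q rule: vec3_cases; cases r rule: vec3_cases)
      (simp add: zero_prod_def algebra_simps)
  finally have "g w = w" by (simp add: we)
  moreover have "w \<in> UU" "w \<noteq> 0" using xyz(1) by (auto simp: we zero_prod_def)
  ultimately show ?thesis by blast
qed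

lemma inc_diff: "inc (x - y) = inc x - inc y"
  by (cases x rule: zorn_cases; cases y rule: zorn_cases) simp

lemma idempotent_conj:
  assumes "ztr e = 1" "znorm e = 0" obtains h where "h \<in> octonion_auts" "h e = E1"
proof (rule transitive[of e E1])
  show "noncen e" unfolding noncen_def
  proof (intro allI notI)
    fix k assume "e = k \<bullet> Zid"
    then have "k + k = 1" "k * k = 0" using assms by (simp_all add: zero_prod_def)
    then show False by simp
  qed
qed (use assms in \<open>simp_all add: noncen_iff\<close>)

text \<open>Over the closure F[c] splits because the discriminant is nonzero. There h exchanges the
  two idempotents, so the split case yields a fixed vector, which is brought back by a
  functional.\<close>

lemma fixed_complement:
  fixes g h :: "'a::field zorn \<Rightarrow> 'a zorn"
  assumes g: "g \<in> octonion_auts" "g c = c" and h: "h \<in> octonion_auts" "h c = ztr c \<bullet> Zid - c"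
    and com: "\<And>x. h (g x) = g (h x)" and d: "ztr c * ztr c - 4 * znorm c \<noteq> 0"
  obtains w where "w \<noteq> 0" "ztr w = 0" "zbil c w = 0" "g w = w"
proof -
  define t where "t = to_ac (ztr c)"
  define n where "n = to_ac (znorm c)"
  have dd: "t * t - 4 * n \<noteq> 0"
  proof
    assume "t * t - 4 * n = 0"
    then have "to_ac (ztr c * ztr c - 4 * znorm c) = 0" unfolding t_def n_def by simp
    then show False using d unfolding to_ac_eq_0_iff by blast
  qed
  obtain p1 where "poly [:n, - t, 1:] p1 = 0" using alg_closed_imp_poly_has_root[of "[:n, - t, 1:]"] by auto
  then have p1: "n = t * p1 - p1 * p1" by (simp add: algebra_simps)
  define p2 where "p2 = t - p1"
  have pp: "p1 - p2 \<noteq> 0"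
  proof
    assume "p1 - p2 = 0"
    then have "t = p1 + p1" by (simp add: p2_def)
    then show False using dd unfolding p1 by (simp add: algebra_simps)
  qed
  define C where "C = inc c"
  \<comment> \<open>The idempotent of the extended F[c] belonging to the root p1.\<close>
  define e where "e = (1 / (p1 - p2)) \<bullet> (C - p2 \<bullet> Zid)"
  have trC: "ztr C = t" "znorm C = n" unfolding C_def t_def n_def by (simp_all add: inc_tr_norm)
  have "ztr (C - p2 \<bullet> Zid) = p1 - p2" "znorm (C - p2 \<bullet> Zid) = 0"
  proof -
    have *: "C - p2 \<bullet> Zid = C + (- p2) \<bullet> Zid" by (simp add: zsmul_minus del: zsmul.simps)
    show "ztr (C - p2 \<bullet> Zid) = p1 - p2" unfolding * by (simp add: trC p2_def)
    have "znorm (C - p2 \<bullet> Zid) = n + p2 * p2 - p2 * t"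
      unfolding * znorm_add zbil_smul zbil_Id znorm_smul trC by simp
    also have "\<dots> = 0" unfolding p1 p2_def by (simp add: algebra_simps)
    finally show "znorm (C - p2 \<bullet> Zid) = 0" .
  qed
  then have "ztr e = 1" "znorm e = 0" using pp unfolding e_def by simp_all
  then obtain f where f: "f \<in> octonion_auts" "f e = E1" by (rule idempotent_conj)
  note G = ext_aut[OF g(1)] and H = ext_aut[OF h(1)]
  have Ge: "ext g e = e" unfolding e_def aut_smul[OF G] aut_diff[OF G] aut_Id[OF G] C_def ext_inc[OF g(1)] g(2) ..
  have hc: "inc (h c) = t \<bullet> Zid - C"
    unfolding h(2) inc_diff inc_hom(2) inc_basis t_def C_def ..
  have He: "ext h e = Zid - e"
  proof -
    have "ext h e = (1 / (p1 - p2)) \<bullet> (t \<bullet> Zid - C - p2 \<bullet> Zid)"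
      unfolding e_def aut_smul[OF H] aut_diff[OF H] aut_Id[OF H] C_def ext_inc[OF h(1)] hc[unfolded C_def] ..
    also have "t \<bullet> Zid - C - p2 \<bullet> Zid = (p1 - p2) \<bullet> Zid - (C - p2 \<bullet> Zid)"
    proof -
      have t: "t = p1 + p2" by (simp add: p2_def)
      show ?thesis unfolding t by (simp add: zsmul_add_left zsmul_diff_left del: zsmul.simps)
    qed
    also have "(1 / (p1 - p2)) \<bullet> \<dots> = Zid - e" unfolding zsmul_diff e_def using pp by (simp del: zsmul.simps)
    finally show ?thesis .
  qed
  define g' where "g' = f \<circ> ext g \<circ> finv f"
  define h' where "h' = f \<circ> ext h \<circ> finv f"
  have fg: "g' (f x) = f (ext g x)" and fh: "h' (f x) = f (ext h x)" for x
    unfolding g'_def h'_def by (rule conj_apply[OF f(1)])+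
  have g': "g' \<in> octonion_auts" "g' E1 = E1"
    using fg[of e] unfolding f(2) Ge g'_def by (auto intro!: aut_comp aut_inv f(1) G simp del: split_paired_all)
  have h': "h' \<in> octonion_auts" "h' E1 = E2"
    using fh[of e] unfolding f(2) He aut_diff[OF f(1)] aut_Id[OF f(1)] h'_def Zid_diff_E1
    by (auto intro!: aut_comp aut_inv f(1) H simp del: split_paired_all)
  have GH: "ext h (ext g x) = ext g (ext h x)" for x
  proof -
    have "h \<circ> g = g \<circ> h" using com by (simp add: fun_eq_iff del: split_paired_All)
    then show ?thesis using ext_comp[OF h(1) g(1), of x] ext_comp[OF g(1) h(1), of x] by simp
  qed
  have com': "h' (g' x) = g' (h' x)" for x
  proof -
    obtain y where "f y = x" using aut_surj[OF f(1)] by blast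
    then have x: "x = f y" by simp
    show ?thesis unfolding x fg fh GH ..
  qed
  obtain w' where w': "w' \<in> UU" "w' \<noteq> 0" "g' w' = w'" using fixed_complement_split[OF g' h' com'] by blast
  obtain z where "f z = w'" using aut_surj[OF f(1)] by blast
  then have w'z: "w' = f z" by simp
  have z0: "z \<noteq> 0" using w'(2) unfolding w'z aut_eq_0[OF f(1)] .
  have gz: "ext g z = z" using w'(3) unfolding w'z fg aut_inj[OF f(1)] .
  have tz: "ztr z = 0" using UU_cases[OF w'(1)] unfolding w'z by (metis aut_tr[OF f(1)] add_0 ztr.simps)
  have "zbil e z = 0"
  proof -
    have "zbil e z = zbil E1 w'" unfolding w'z f(2)[symmetric] by (rule aut_bil[OF f(1), symmetric])
    also have "\<dots> = 0" by (rule UU_cases[OF w'(1)]) simp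
    finally show ?thesis .
  qed
  then have "zbil (C - p2 \<bullet> Zid) z = 0" using pp unfolding e_def zbil_smul by simp
  then have bz: "zbil C z = 0" unfolding zbil_diff zbil_smul zbil_Id tz by simp
  show thesis
  proof (cases z rule: zorn_cases)
    case (1 a u1 u2 u3 v1 v2 v3 b)
    have "\<exists>k\<in>{a, u1, u2, u3, v1, v2, v3, b}. k \<noteq> 0" using z0 unfolding 1 by (auto simp: zero_prod_def)
    then obtain k where k: "k \<in> {a, u1, u2, u3, v1, v2, v3, b}" "k \<noteq> 0" by blast
    obtain \<psi> :: "'a alg_closure \<Rightarrow> 'a" where \<psi>: "\<And>x y. \<psi> (x + y) = \<psi> x + \<psi> y"
      "\<And>a x. \<psi> (x * to_ac a) = \<psi> x * a" "\<psi> k \<noteq> 0"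
      by (rule alg_closure_functional[OF k(2)]) (rule that)
    have \<psi>0: "\<psi> 0 = 0" "\<psi> (x - y) = \<psi> x - \<psi> y" for x y using zmap_0[OF \<psi>(1)] by blast+
    have "zmap \<psi> z \<noteq> 0" using k(1) \<psi>(3) unfolding 1 zmap.simps by (auto simp: zero_prod_def)
    moreover have "ztr (zmap \<psi> z) = 0" using tz \<psi>0(1) unfolding 1 zmap.simps ztr.simps \<psi>(1)[symmetric] by simp
    moreover have "zbil c (zmap \<psi> z) = 0"
    proof (cases c rule: zorn_cases)
      case c: (1 a' u1' u2' u3' v1' v2' v3' b')
      have "zbil c (zmap \<psi> z) = \<psi> (zbil C z)"
        unfolding C_def c 1 by (simp add: \<psi>(1) \<psi>0 \<psi>(2) \<psi>(2)[unfolded mult.commute[of _ "to_ac _"]] mult.commute)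
      then show ?thesis by (simp add: bz \<psi>0)
    qed
    moreover have "g (zmap \<psi> z) = zmap \<psi> z" using zmap_ext[OF \<psi>(1,2) g(1), of z] gz by simp
    ultimately show thesis by (rule that)
  qed
qed

section \<open>All conjugacy classes\<close>

lemma conj_neq_id: "h \<in> octonion_auts \<Longrightarrow> g \<noteq> id \<Longrightarrow> h \<circ> g \<circ> finv h \<noteq> id"
  unfolding conj_eq_iff comp_id id_comp by (metis comp_cancel comp_id)

lemma good_conjI: "g \<in> octonion_auts \<Longrightarrow> h \<in> octonion_auts \<Longrightarrow> good (h \<circ> g \<circ> finv h) \<Longrightarrow> good g"
  using good_conj[OF conj_toI] by blast

text \<open>h is semilinear over F[c], since it maps F[c] onto itself; hence it still permutes the
  lines over F[c].\<close>

lemma twisted_conjugate: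
  assumes r: "r \<in> octonion_auts" "r c = c" and h: "h \<in> octonion_auts" "h c = ztr c \<bullet> Zid - c"
  shows "(h \<circ> r \<circ> finv h) c = c"
    "(h \<circ> r \<circ> finv h) w \<in> sp c w \<Longrightarrow> r (finv h w) \<in> sp c (finv h w)"
proof -
  have hc: "h (ztr c \<bullet> Zid - c) = c" unfolding aut_diff[OF h(1)] aut_smul[OF h(1)] aut_Id[OF h(1)] h(2) by simp
  have rc: "r (ztr c \<bullet> Zid - c) = ztr c \<bullet> Zid - c" unfolding aut_diff[OF r(1)] aut_smul[OF r(1)] aut_Id[OF r(1)] r(2) ..
  show "(h \<circ> r \<circ> finv h) c = c" using conj_apply[OF h(1), of r "ztr c \<bullet> Zid - c"] unfolding hc rc .
  define w' where "w' = finv h w"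
  have w: "w = h w'" unfolding w'_def aut_inv_f(2)[OF h(1)] ..
  assume "(h \<circ> r \<circ> finv h) w \<in> sp c w"
  then have "h (r w') \<in> sp c (h w')" unfolding w conj_apply[OF h(1)] .
  then obtain a b where "h (r w') = a \<bullet> h w' + b \<bullet> (c \<star> h w')" by (rule spE)
  also have "\<dots> = a \<bullet> h w' + b \<bullet> (h (ztr c \<bullet> Zid - c) \<star> h w')" unfolding hc ..
  also have "\<dots> = h (a \<bullet> w' + b \<bullet> ((ztr c \<bullet> Zid - c) \<star> w'))" by (simp only: aut_add[OF h(1)] aut_smul[OF h(1)] aut_mul[OF h(1)])
  finally have "r w' = a \<bullet> w' + b \<bullet> ((ztr c \<bullet> Zid - c) \<star> w')" unfolding aut_inj[OF h(1)] .
  also have "\<dots> = (a + b * ztr c) \<bullet> w' + (- b) \<bullet> (c \<star> w')"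
    unfolding zmul_diff zmul_smul_left zmul_Id zsmul_diff zsmul_zsmul zsmul_add_left zsmul_minus by simp
  finally show "r (finv h w) \<in> sp c (finv h w)" using spI unfolding w'_def by metis
qed

lemma twisted_conjugate_not_conj:
  assumes r: "r \<in> octonion_auts" "r c = c" and h: "h \<in> octonion_auts" "h c = ztr c \<bullet> Zid - c"
    and d: "ztr c * ztr c - 4 * znorm c \<noteq> 0"
    and nf: "\<And>w. w \<noteq> 0 \<Longrightarrow> ztr w = 0 \<Longrightarrow> zbil c w = 0 \<Longrightarrow> r w \<noteq> w"
    and k: "k \<in> octonion_auts" "k c = c"
  shows "k \<circ> r \<noteq> (h \<circ> r \<circ> finv h) \<circ> k"
proof
  assume e: "k \<circ> r = (h \<circ> r \<circ> finv h) \<circ> k"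
  define f where "f = finv h \<circ> k"
  have f: "f \<in> octonion_auts" unfolding f_def by (intro aut_comp aut_inv h k)
  have "h (ztr c \<bullet> Zid - c) = c" unfolding aut_diff[OF h(1)] aut_smul[OF h(1)] aut_Id[OF h(1)] h(2) by simp
  then have fc: "f c = ztr c \<bullet> Zid - c"
    using aut_inv_f(1)[OF h(1), of "ztr c \<bullet> Zid - c"] unfolding f_def o_apply k(2) by (simp only:)
  have "f (r x) = r (f x)" for x
  proof -
    have "k (r x) = h (r (finv h (k x)))" using fun_cong[OF e, of x] unfolding o_apply .
    then show ?thesis unfolding f_def o_apply using aut_inv_f(1)[OF h(1)] by simp
  qed
  from fixed_complement[OF r f fc this d] nf show False by metis
qed

text \<open>Lines over F[c] in \<open>UU\<close> or \<open>VV\<close> are ordinary null lines, so an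
  invariant one is covered by \<open>good_null_line\<close>. Otherwise \<open>swp\<close> provides
  the twisted conjugate and the transvections adding t U1 to \<open>U2\<close> the one-parameter
  group.\<close>

lemma good_split:
  fixes g :: "'a::{finite,field} zorn \<Rightarrow> 'a zorn"
  assumes q: "card (UNIV :: 'a set) > 2" and g: "g \<in> octonion_auts" "g \<noteq> id" and gE: "g E1 = E1"
  shows "good g"
proof (cases "line_geometry.fixed_lines E1 UU VV g")
  case True
  then obtain w where w: "w \<noteq> 0" "w \<in> UU \<or> w \<in> VV" "g w \<in> sp E1 w"
    unfolding line_geometry.fixed_lines_def[OF split_geometry] by blast
  have "E1 \<star> w = w \<or> E1 \<star> w = 0" "ztr w = 0" "znorm w = 0"
    using w(2) by (auto elim!: UU_cases VV_cases simp: zero_prod_def)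
  moreover obtain a b where "g w = a \<bullet> w + b \<bullet> (E1 \<star> w)" using w(3) by (rule spE)
  ultimately have "g w = (a + b) \<bullet> w \<or> g w = a \<bullet> w" by (auto simp: zsmul_add_left simp del: split_paired_all)
  then show ?thesis using good_null_line[OF q g w(1) \<open>ztr w = 0\<close> \<open>znorm w = 0\<close>] by blast
next
  case False
  define s where "s = swp \<circ> g \<circ> finv swp"
  have gs: "conj_to g s" unfolding s_def by (rule conj_toI[OF g(1) swp_aut])
  have sa: "s \<in> octonion_auts" using gs by (simp add: conj_to_def)
  have sw: "swp E1 = ztr (E1 :: 'a zorn) \<bullet> Zid - E1" by (simp add: zero_prod_def)
  have sE: "s E1 = E1" unfolding s_def by (rule twisted_conjugate(1)[OF g(1) gE swp_aut sw])
  have fs: "finv swp w = swp w" for w :: "'a zorn"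
  proof -
    have "swp (swp w) = w" by (cases w) simp
    then show ?thesis using aut_inv_f(1)[OF swp_aut, of "swp w"] by simp
  qed
  define k :: "'a \<Rightarrow> 'a zorn \<Rightarrow> 'a zorn" where "k t = sl3 (1, 0, 0) (t, 1, 0) (0, 0, 1)" for t
  define N :: "'a zorn \<Rightarrow> 'a zorn" where "N = (\<lambda>(a, (u1, u2, u3), v, b). (0, (u2, 0, 0), 0, 0))"
  have ka: "k t \<in> octonion_auts" for t unfolding k_def by (rule sl3_aut) simp
  show ?thesis
  proof (rule good_without_lines[OF split_geometry q gs gE aut_UU_VV[OF g(1) gE] False sE aut_UU_VV[OF sa sE],
        where k = k and N = N and w = U1 and ?x0.0 = U2])
    show "\<not> line_geometry.fixed_lines E1 UU VV s"
    proof
      assume "line_geometry.fixed_lines E1 UU VV s"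
      then obtain w where w: "w \<noteq> 0" "w \<in> UU \<or> w \<in> VV" "s w \<in> sp E1 w"
        unfolding line_geometry.fixed_lines_def[OF split_geometry] by blast
      have "g (swp w) \<in> sp E1 (swp w)"
        using twisted_conjugate(2)[OF g(1) gE swp_aut sw, of w] w(3) unfolding s_def fs by blast
      moreover have "swp w \<noteq> 0" "swp w \<in> UU \<or> swp w \<in> VV" using w(1,2) aut_neq_0[OF swp_aut]
        by (auto elim!: UU_cases VV_cases simp: zero_prod_def)
      ultimately show False using False unfolding line_geometry.fixed_lines_def[OF split_geometry] by blast
    qed
    \<comment> \<open>A fixed w orthogonal to \<open>E1\<close> is the sum of the fixed vectors E1 w
      in \<open>UU\<close> and w E1 in \<open>VV\<close>, one of which would span an invariant
      line.\<close>
    have nf: "g w \<noteq> w" if w: "w \<noteq> 0" "ztr w = 0" "zbil E1 w = 0" for w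
    proof
      assume gw: "g w = w"
      have "E1 \<star> w \<in> UU" "w \<star> E1 \<in> VV" "E1 \<star> w + w \<star> E1 = w"
        using w(2,3) by (cases w rule: zorn_cases; simp add: zero_prod_def)+
      moreover have "g (E1 \<star> w) = E1 \<star> w" "g (w \<star> E1) = w \<star> E1" by (simp_all only: aut_mul[OF g(1)] gE gw)
      moreover have "E1 \<star> w \<noteq> 0 \<or> w \<star> E1 \<noteq> 0" using w(1) \<open>E1 \<star> w + w \<star> E1 = w\<close> by (metis add_0)
      ultimately show False using False sp_self unfolding line_geometry.fixed_lines_def[OF split_geometry] by metis
    qed
    show "h \<circ> g \<noteq> s \<circ> h" if "h \<in> octonion_auts" "h E1 = E1" for h
      unfolding s_def by (rule twisted_conjugate_not_conj[OF g(1) gE swp_aut sw _ nf that]) simp_all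
    show "k t \<in> octonion_auts" for t by (rule ka)
    show "k t E1 = E1" for t by (simp add: k_def)
    show "k t \<circ> k (- t) = id" for t
      by (rule aut_eqI[OF aut_comp[OF ka ka] aut_id]) (simp_all add: k_def)
    show "k t x = x + t \<bullet> N x" if x: "x \<in> UU" for t x
      by (rule UU_cases[OF x]) (simp add: k_def N_def)
    show "N x \<in> sp E1 U1" if x: "x \<in> UU" for x
    proof (rule UU_cases[OF x])
      fix u1 u2 u3 assume "x = (0, (u1, u2, u3), (0, 0, 0), 0)"
      then have "N x = u2 \<bullet> U1" by (simp add: N_def zero_prod_def)
      then show ?thesis using spD(3)[OF sp_self] by metis
    qed
  qed (simp_all add: N_def zero_prod_def)
qed

text \<open>At (z - t y, 2 y) the form takes the value z^2 + (4 n - t^2) y^2, which avoids dividing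
  by 2.\<close>

lemma norm_form_represents:
  fixes t n :: "'a::{finite,field}"
  assumes d: "t * t - 4 * n \<noteq> 0"
  obtains x y where "x * x + t * x * y + n * y * y = k"
proof -
  have "4 * n - t * t \<noteq> 0" using d by (metis right_minus_eq)
  then obtain z y where "1 * (z * z) + (4 * n - t * t) * (y * y) = k" by (rule binary_form_represents[OF one_neq_zero])
  then have "(z - t * y) * (z - t * y) + t * (z - t * y) * (2 * y) + n * (2 * y) * (2 * y) = k"
    by (simp add: algebra_simps)
  then show thesis by (rule that)
qed

lemma cross3_surj:
  assumes "v \<noteq> (0 :: 'a::field vec3)" obtains q r where "cross3 q r = v"
proof (cases v rule: vec3_cases)
  case (1 a b c)
  consider "a \<noteq> 0" | "b \<noteq> 0" | "c \<noteq> 0" using assms by (auto simp: 1 zero_prod_def)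
  then show thesis
  proof cases
    case 1 then show thesis using that[of "(- b / a, 1, 0)" "(- c, 0, a)"] by (simp add: \<open>v = _\<close>)
  next
    case 2 then show thesis using that[of "(0, - c / b, 1)" "(b, - a, 0)"] by (simp add: \<open>v = _\<close>)
  next
    case 3 then show thesis using that[of "(1, 0, - a / c)" "(0, c, - b)"] by (simp add: \<open>v = _\<close>)
  qed
qed

text \<open>A matrix of determinant 1 with first column u and first cofactor column v / (u.v)
  carries the standard pair to (u, v); its inverse is used.\<close>

lemma move_to_quaternion:
  assumes "dot3 u v \<noteq> (0 :: 'a::field)"
  obtains k where "k \<in> octonion_auts" "k E1 = E1" "k (a, u, v, b) = (a, (1, 0, 0), (dot3 u v, 0, 0), b)"
proof -
  define \<rho> where "\<rho> = dot3 u v"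
  have \<rho>: "\<rho> \<noteq> 0" using assms by (simp add: \<rho>_def)
  have "smul3 (1 / \<rho>) v \<noteq> 0"
    using \<rho> unfolding \<rho>_def by (cases v rule: vec3_cases; cases u rule: vec3_cases) (auto simp: zero_prod_def)
  then obtain q r where qr: "cross3 q r = smul3 (1 / \<rho>) v" by (rule cross3_surj)
  have "dot3 u (smul3 (1 / \<rho>) v) = dot3 u v / \<rho>"
    by (cases v rule: vec3_cases; cases u rule: vec3_cases) (simp add: algebra_simps add_divide_distrib)
  then have "dot3 u (cross3 q r) = 1" unfolding qr using \<rho> by (simp add: \<rho>_def)
  then have l: "sl3 u q r \<in> octonion_auts" by (rule sl3_aut)
  have "smul3 \<rho> (smul3 (1 / \<rho>) v) = v" using \<rho> by (cases v rule: vec3_cases) simp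
  then have "sl3 u q r (a, (1, 0, 0), (\<rho>, 0, 0), b) = (a, u, v, b)" by (simp add: qr)
  moreover have "sl3 u q r E1 = E1" by (simp add: zero_prod_def)
  ultimately show thesis
    using that[OF aut_inv[OF l]] aut_inv_f(1)[OF l] unfolding \<rho>_def by metis
qed


lemma sp_norm:
  assumes "w \<in> WW t n"
  shows "znorm (a \<bullet> w + b \<bullet> (Cf t n \<star> w)) = (a * a + t * a * b + n * b * b) * znorm w"
  by (rule WW_cases[OF assms]) (simp add: algebra_simps)

text \<open>On the complement w c is the conjugate of c times w, so the commutator is (2 c - t) w,
  and 2 c - t has norm 4 n - t^2.\<close>

lemma WW_commutator_norm:
  assumes "w \<in> WW t n"
  shows "znorm (Cf t n \<star> w - w \<star> Cf t n) = (4 * n - t * t) * znorm w"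
  by (rule WW_cases[OF assms]) (simp add: algebra_simps)

text \<open>For null w this makes w and c w span a special plane.\<close>

lemma WW_special:
  assumes "w \<in> WW t n" shows "w \<star> (Cf t n \<star> w) = (- znorm w) \<bullet> (t \<bullet> Zid - Cf t n)"
  by (rule WW_cases[OF assms]) (simp add: algebra_simps zero_prod_def)

lemma enc_closed:
  "(\<exists>x. z = enc x 0) \<Longrightarrow> (\<exists>x. z' = enc x 0) \<Longrightarrow> \<exists>x. z + z' = enc x 0"
  "(\<exists>x. z = enc x 0) \<Longrightarrow> \<exists>x. k \<bullet> z = enc x 0"
  "(\<exists>x. z = enc x 0) \<Longrightarrow> (\<exists>x. z' = enc x 0) \<Longrightarrow> \<exists>x. z - z' = enc x 0"
  "(\<exists>x. z = enc x 0) \<Longrightarrow> (\<exists>x. z' = enc x 0) \<Longrightarrow> \<exists>x. z \<star> z' = enc x 0"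
proof -
  show 1: "\<exists>x. z + z' = enc x 0" if "\<exists>x. z = enc x 0" "\<exists>x. z' = enc x 0" for z z' :: "'a zorn"
    using that by (elim exE) (simp add: enc_add)
  show 2: "\<exists>x. k \<bullet> z = enc x 0" if "\<exists>x. z = enc x 0" for z :: "'a zorn" and k using that by (elim exE) (simp add: enc_smul)
  show "\<exists>x. z \<star> z' = enc x 0" if "\<exists>x. z = enc x 0" "\<exists>x. z' = enc x 0" for z z' :: "'a zorn"
    using that by (elim exE) (simp add: enc_mul)
  show "\<exists>x. z - z' = enc x 0" if "\<exists>x. z = enc x 0" "\<exists>x. z' = enc x 0" for z z' :: "'a zorn"
    using 1[OF that(1) 2[OF that(2), of "- 1"]] by (simp add: zsmul_minus)
qed

text \<open>\<open>F[c] + F[c] w\<close> is a quaternion algebra. Its norm is isotropic, so it contains a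
  nontrivial idempotent, and it can be moved into the standard copy of the matrix algebra.\<close>
lemma good_nonnull_line:
  fixes g :: "'a::{finite,field} zorn \<Rightarrow> 'a zorn" and t n :: 'a
  defines "c \<equiv> Cf t n"
  assumes q: "card (UNIV :: 'a set) > 2" and g: "g \<in> octonion_auts" "g \<noteq> id" and gc: "g c = c"
    and irr: "\<And>l. l * l - t * l + n \<noteq> 0" and d: "t * t - 4 * n \<noteq> 0"
    and w: "w \<in> WW t n" "znorm w \<noteq> 0" "g w \<in> sp c w"
  shows "good g"
proof -
  have irr': "l * l - ztr c * l + znorm c \<noteq> 0" for l using irr by (simp add: c_def)
  \<comment> \<open>The idempotent sought is \<alpha> + \<beta> c + v with v on the line of w: its
    trace 2 \<alpha> + t \<beta> has to be 1 and its norm m + N(v) has to be 0. As the discriminant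
    is nonzero, 2 and t are not both 0.\<close>
  have "\<exists>\<alpha> \<beta>. 2 * \<alpha> + t * \<beta> = 1"
  proof (cases "t = 0")
    case True
    then have "(2 :: 'a) \<noteq> 0" using d mult_eq_0_iff[of "2 :: 'a" 2] by auto
    then show ?thesis by (intro exI[of _ "1 / 2"] exI[of _ 0]) simp
  next
    case False
    then show ?thesis by (intro exI[of _ 0] exI[of _ "1 / t"]) simp
  qed
  then obtain \<alpha> \<beta> where ab: "2 * \<alpha> + t * \<beta> = 1" by blast
  define m where "m = \<alpha> * \<alpha> + t * \<alpha> * \<beta> + n * \<beta> * \<beta>"
  have "\<alpha> \<noteq> 0 \<or> \<beta> \<noteq> 0" using ab by auto
  then have m: "m \<noteq> 0" unfolding m_def by (rule binary_norm_neq_0[OF irr])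
  obtain x y where xy: "x * x + t * x * y + n * y * y = - m / znorm w" by (rule norm_form_represents[OF d])
  have xy0: "x \<noteq> 0 \<or> y \<noteq> 0" using xy m w(2) by auto
  define v where "v = x \<bullet> w + y \<bullet> (c \<star> w)"
  have vW: "v \<in> WW t n" unfolding v_def c_def
    by (intro subspD(2)[OF subsp_WW] subspD(3)[OF subsp_WW] WW_mul w(1))
  have Nv: "znorm v = - m" unfolding v_def c_def sp_norm[OF w(1)] xy using w(2) by simp
  have wv: "w \<in> sp c v" unfolding v_def by (rule sp_unit[OF irr' xy0])
  have vw: "v \<in> sp c w" unfolding v_def by (rule spI)
  have gv: "g v \<in> sp c v"
    by (rule sp_trans[OF sp_trans[OF sp_aut[OF g(1) gc vw] w(3)] wv])
  define e where "e = (\<alpha> \<bullet> Zid + \<beta> \<bullet> c) + v"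
  have vW': "ztr v = 0" "zbil c v = 0" using vW unfolding WW_iff c_def by blast+
  have Nx: "znorm (\<alpha> \<bullet> Zid + \<beta> \<bullet> c) = m" by (simp add: c_def m_def algebra_simps)
  have "ztr e = 1" using ab by (simp add: e_def vW' c_def mult.commute)
  moreover have "znorm e = 0" unfolding e_def znorm_add[of "\<alpha> \<bullet> Zid + \<beta> \<bullet> c" v] Nx Nv zbil_add zbil_smul zbil_Id vW' by simp
  ultimately obtain h where h: "h \<in> octonion_auts" "h e = E1" by (rule idempotent_conj)
  obtain a u r b where hc: "h c = (a, u, r, b)" by (cases "h c") blast
  have ce: "c \<star> e - e \<star> c = c \<star> v - v \<star> c"
    unfolding e_def zmul_add_left zmul_add_right zmul_smul_left zmul_smul_right zmul_Id by simp
  \<comment> \<open>The commutator of h c with \<open>E1\<close> involves only the off-diagonal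
    parts u and r and has norm u.r; comparison with the commutator of c and v shows that u.r is
    nonzero.\<close>
  have "znorm (h c \<star> E1 - E1 \<star> h c) = znorm (c \<star> v - v \<star> c)"
    unfolding h(2)[symmetric] aut_mul[OF h(1), symmetric] aut_diff[OF h(1), symmetric] aut_norm[OF h(1)] ce ..
  also have "\<dots> = (4 * n - t * t) * (- m)" unfolding c_def WW_commutator_norm[OF vW] Nv ..
  finally have "dot3 u r = (4 * n - t * t) * (- m)"
    unfolding hc by (cases u rule: vec3_cases; cases r rule: vec3_cases) (simp add: algebra_simps)
  then have "dot3 u r \<noteq> 0" using m d by auto
  then obtain k where k: "k \<in> octonion_auts" "k E1 = E1" "k (a, u, r, b) = (a, (1, 0, 0), (dot3 u r, 0, 0), b)"
    by (rule move_to_quaternion)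
  define \<rho> where "\<rho> = dot3 u r"
  have \<rho>: "\<rho> \<noteq> 0" using \<open>dot3 u r \<noteq> 0\<close> by (simp add: \<rho>_def)
  define f where "f = k \<circ> h"
  have f: "f \<in> octonion_auts" unfolding f_def by (rule aut_comp[OF k(1) h(1)])
  define c1 where "c1 = (a, (1 :: 'a, 0 :: 'a, 0 :: 'a), (\<rho>, 0 :: 'a, 0 :: 'a), b)"
  have fe: "f e = E1" and fc: "f c = c1" by (simp_all add: f_def h(2) hc k(2,3) c1_def \<rho>_def)
  define g1 where "g1 = f \<circ> g \<circ> finv f"
  have g1: "g1 \<in> octonion_auts" unfolding g1_def by (intro aut_comp aut_inv f g)
  have fg: "g1 (f z) = f (g z)" for z unfolding g1_def by (rule conj_apply[OF f])
  have g1c: "g1 c1 = c1" using fg[of c] unfolding fc gc .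
  \<comment> \<open>\<open>E1\<close> and c1 generate the standard quaternion algebra. g1 fixes c1,
    and g1 E1 lies in the algebra because the line of v is invariant under g.\<close>
  define Q where "Q z \<longleftrightarrow> (\<exists>x. z = enc x 0)" for z :: "'a zorn"
  have Qe: "Q E1" "Q E2" "Q U1" "Q V1" "Q Zid" "Q c1" unfolding Q_def c1_def
    by (rule exI[of _ "(1, 0, 0, 0)"], simp add: zero_prod_def) (rule exI[of _ "(0, 0, 0, 1)"], simp add: zero_prod_def,
      rule exI[of _ "(0, 1, 0, 0)"], simp add: zero_prod_def, rule exI[of _ "(0, 0, 1, 0)"], simp add: zero_prod_def,
      rule exI[of _ "(1, 0, 0, 1)"], simp add: zero_prod_def, rule exI[of _ "(a, 1, \<rho>, b)"], simp add: zero_prod_def)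
  have Qc: "Q z \<Longrightarrow> Q z' \<Longrightarrow> Q (z + z')" "Q z \<Longrightarrow> Q (k \<bullet> z)" "Q z \<Longrightarrow> Q z' \<Longrightarrow> Q (z - z')"
    "Q z \<Longrightarrow> Q z' \<Longrightarrow> Q (z \<star> z')" for z z' k
    unfolding Q_def by (rule enc_closed; assumption)+
  have fv: "f v = E1 - (\<alpha> \<bullet> Zid + \<beta> \<bullet> c1)"
    using fe unfolding e_def aut_add[OF f] aut_smul[OF f] aut_Id[OF f] fc by (simp only: eq_diff_eq add.commute)
  have Qv: "Q (f v)" unfolding fv by (intro Qc Qe)
  obtain a' b' where gv': "g v = a' \<bullet> v + b' \<bullet> (c \<star> v)" using gv by (rule spE)
  have "g1 E1 = f (g e)" using fg[of e] unfolding fe .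
  also have "\<dots> = (\<alpha> \<bullet> Zid + \<beta> \<bullet> c1) + (a' \<bullet> f v + b' \<bullet> (c1 \<star> f v))"
    unfolding e_def aut_add[OF g(1)] aut_smul[OF g(1)] aut_Id[OF g(1)] gc gv'
    by (simp only: aut_add[OF f] aut_smul[OF f] aut_Id[OF f] aut_mul[OF f] fc)
  finally have Q1: "Q (g1 E1)" by (simp only:) (intro Qc Qe Qv)
  have Q2: "Q (g1 E2)" unfolding aut_E2[OF g1] by (intro Qc Qe Q1)
  have "U1 = (E1 \<star> c1) \<star> E2" by (simp add: c1_def zero_prod_def)
  then have "g1 U1 = (g1 E1 \<star> c1) \<star> g1 E2" by (simp only: aut_mul[OF g1] g1c)
  then have Q3: "Q (g1 U1)" by (simp only:) (intro Qc Qe Q1 Q2)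
  have "V1 = (1 / \<rho>) \<bullet> ((E2 \<star> c1) \<star> E1)" using \<rho> by (simp add: c1_def zero_prod_def)
  then have "g1 V1 = (1 / \<rho>) \<bullet> ((g1 E2 \<star> c1) \<star> g1 E1)" by (simp only: aut_mul[OF g1] aut_smul[OF g1] g1c)
  then have Q4: "Q (g1 V1)" by (simp only:) (intro Qc Qe Q1 Q2)
  have "\<exists>x'. g1 (enc x 0) = enc x' 0" for x
  proof (cases x rule: m2_cases)
    case (1 x1 x2 x3 x4)
    have "enc x 0 = x1 \<bullet> E1 + x2 \<bullet> U1 + x3 \<bullet> V1 + x4 \<bullet> E2" by (simp add: 1 zero_prod_def)
    then have "g1 (enc x 0) = x1 \<bullet> g1 E1 + x2 \<bullet> g1 U1 + x3 \<bullet> g1 V1 + x4 \<bullet> g1 E2"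
      by (simp only: aut_add[OF g1] aut_smul[OF g1])
    moreover have "Q (x1 \<bullet> g1 E1 + x2 \<bullet> g1 U1 + x3 \<bullet> g1 V1 + x4 \<bullet> g1 E2)" by (intro Qc Q1 Q2 Q3 Q4)
    ultimately show ?thesis unfolding Q_def by simp
  qed
  then have "good g1" by (rule good_quaternion[OF q g1 conj_neq_id[OF f g(2), folded g1_def]])
  then show ?thesis unfolding g1_def by (rule good_conjI[OF g(1) f])
qed

text \<open>An invariant line with nonzero norm leads to an invariant quaternion algebra, a null one
  to the special plane of w and c w. Without invariant lines, transitivity supplies the twisting
  automorphism, since c and t - c have the same trace and norm.\<close>

lemma good_field:
  fixes g :: "'a::{finite,field} zorn \<Rightarrow> 'a zorn" and t n :: 'a
  defines "c \<equiv> Cf t n"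
  assumes q: "card (UNIV :: 'a set) > 2" and g: "g \<in> octonion_auts" "g \<noteq> id" and gc: "g c = c"
    and irr: "\<And>l. l * l - t * l + n \<noteq> 0" and d: "t * t - 4 * n \<noteq> 0"
  shows "good g"
proof -
  note geo = field_geometry[OF irr d, folded c_def]
  have irr': "l * l - ztr c * l + znorm c \<noteq> 0" for l using irr by (simp add: c_def)
  have tn: "ztr c = t" "znorm c = n" by (simp_all add: c_def)
  note lines = line_geometry.fixed_lines_def[OF geo]
  show ?thesis
  proof (cases "line_geometry.fixed_lines c (WW t n) (WW t n) g")
    case True
    then obtain w where w: "w \<noteq> 0" "w \<in> WW t n" "g w \<in> sp c w" unfolding lines by blast
    show ?thesis
    proof (cases "znorm w = 0")
      case False
      then show ?thesis using good_nonnull_line[OF q g _ irr d w(2) False] gc w(3) unfolding c_def by blast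
    next
      case True
      have W: "ztr w = 0" "ztr (c \<star> w) = 0" using w(2) WW_mul[OF w(2)] unfolding WW_iff c_def by blast+
      have wc: "w \<star> (c \<star> w) = 0" unfolding c_def WW_special[OF w(2)] True by simp
      have ind: "c \<star> w \<noteq> k \<bullet> w" for k
      proof
        assume "c \<star> w = k \<bullet> w"
        then have "(- k) \<bullet> w + 1 \<bullet> (c \<star> w) = 0" by (simp add: zsmul_minus)
        then have "w \<in> sp c 0" using sp_unit[OF irr', of "- k" 1 w] by simp
        then show False using sp_0 w(1) by blast
      qed
      obtain a b where gw: "g w = a \<bullet> w + b \<bullet> (c \<star> w)" using w(3) by (rule spE)
      have "g (c \<star> w) = c \<star> (a \<bullet> w + b \<bullet> (c \<star> w))" unfolding aut_mul[OF g(1)] gc gw ..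
      also have "\<dots> = (- (b * n)) \<bullet> w + (a + b * t) \<bullet> (c \<star> w)"
        unfolding zmul_add_right zmul_smul_right zmul_alt tn by (simp add: zsmul_add_left zsmul_diff zsmul_minus)
      finally have gcw: "g (c \<star> w) = (- (b * n)) \<bullet> w + (a + b * t) \<bullet> (c \<star> w)" .
      show ?thesis by (rule good_special_span[OF q g w(1) W(1) True W(2) wc ind gw gcw])
    qed
  next
    case False
    have nc: "noncen c" "noncen (t \<bullet> Zid - c)" by (simp_all add: c_def noncen_iff zero_prod_def)
    obtain \<tau> where \<tau>: "\<tau> \<in> octonion_auts" "\<tau> c = t \<bullet> Zid - c"
      by (rule transitive[OF nc]) (simp_all add: c_def zero_prod_def)
    have \<tau>': "\<tau> c = ztr c \<bullet> Zid - c" unfolding tn by (rule \<tau>(2))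
    define s where "s = \<tau> \<circ> g \<circ> finv \<tau>"
    have gs: "conj_to g s" unfolding s_def by (rule conj_toI[OF g(1) \<tau>(1)])
    have sa: "s \<in> octonion_auts" using gs by (simp add: conj_to_def)
    have sc: "s c = c" unfolding s_def by (rule twisted_conjugate(1)[OF g(1) gc \<tau>(1) \<tau>'])
    have pres: "f w \<in> WW t n" if "f \<in> octonion_auts" "f c = c" "w \<in> WW t n" for f w
      using that(3) aut_tr[OF that(1), of w] aut_bil[OF that(1), of c w] unfolding WW_iff that(2) c_def[symmetric] by simp
    \<comment> \<open>These shears fix c, whose off-diagonal parts lie in the first coordinate; on
      the complement they are transvections over F[c] with centre the line of
      \<open>U2\<close>.\<close>
    define k :: "'a \<Rightarrow> 'a zorn \<Rightarrow> 'a zorn" where "k t = sl3 (1, 0, 0) (0, 1, 0) (0, t, 1)" for t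
    define N :: "'a zorn \<Rightarrow> 'a zorn" where "N = (\<lambda>(a, (u1, u2, u3), (v1, v2, v3), b). (0, (0, u3, 0), (0, 0, - v2), 0))"
    have ka: "k t \<in> octonion_auts" for t unfolding k_def by (rule sl3_aut) simp
    show ?thesis
    proof (rule good_without_lines[OF geo q gs gc pres[OF g(1) gc] pres[OF g(1) gc] False sc pres[OF sa sc] pres[OF sa sc],
          where k = k and N = N and w = U2 and ?x0.0 = U3])
      show "\<not> line_geometry.fixed_lines c (WW t n) (WW t n) s"
      proof
        assume "line_geometry.fixed_lines c (WW t n) (WW t n) s"
        then obtain w where w: "w \<noteq> 0" "w \<in> WW t n" "s w \<in> sp c w" unfolding lines by blast
        have "g (finv \<tau> w) \<in> sp c (finv \<tau> w)"
          using twisted_conjugate(2)[OF g(1) gc \<tau>(1) \<tau>', of w] w(3) unfolding s_def by blast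
        moreover have "finv \<tau> w \<noteq> 0" by (rule aut_neq_0[OF aut_inv[OF \<tau>(1)] w(1)])
        moreover have "finv \<tau> w \<in> WW t n"
        proof -
          define w' where "w' = finv \<tau> w"
          have w': "\<tau> w' = w" unfolding w'_def by (rule aut_inv_f(2)[OF \<tau>(1)])
          have tr: "ztr w' = 0" using w(2) aut_tr[OF \<tau>(1), of w'] unfolding w' WW_iff by simp
          have "zbil c w' = zbil (t \<bullet> Zid - c) w" using aut_bil[OF \<tau>(1), of c w'] unfolding w' \<tau>(2) by (rule sym)
          also have "\<dots> = 0" using w(2) unfolding zbil_diff zbil_smul zbil_Id WW_iff c_def by simp
          finally show ?thesis using tr unfolding WW_iff w'_def[symmetric] c_def by blast
        qed
        ultimately show False using False unfolding lines by blast
      qed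
      have nf: "g w \<noteq> w" if w: "w \<noteq> 0" "ztr w = 0" "zbil c w = 0" for w
        using False sp_self[of w c] w unfolding lines WW_iff c_def[symmetric] by metis
      show "h \<circ> g \<noteq> s \<circ> h" if "h \<in> octonion_auts" "h c = c" for h
        unfolding s_def by (rule twisted_conjugate_not_conj[OF g(1) gc \<tau>(1) \<tau>' _ nf that]) (simp_all add: tn d[simplified])
      show "k t \<in> octonion_auts" for t by (rule ka)
      show "k t c = c" for t by (simp add: k_def c_def)
      show "k t \<circ> k (- t) = id" for t
        by (rule aut_eqI[OF aut_comp[OF ka ka] aut_id]) (simp_all add: k_def)
      show "k t x = x + t \<bullet> N x" for t x
        by (cases x rule: zorn_cases) (simp add: k_def N_def)
      show "N x \<in> sp c U2" for x
      proof (cases x rule: zorn_cases)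
        case (1 a u1 u2 u3 v1 v2 v3 b)
        have "N x = u3 \<bullet> U2 + (- v2) \<bullet> (c \<star> U2)" by (simp add: 1 N_def c_def zero_prod_def)
        then show ?thesis using spI by metis
      qed
    qed (simp_all add: N_def zero_prod_def WW_iff)
  qed
qed

text \<open>The roots of x^2 - t x + n decide: a double root l makes c - l a fixed null vector, two
  roots give a fixed idempotent, and without roots F[c] is a field, with nonzero discriminant
  because finite fields are perfect.\<close>

theorem good_nontrivial:
  fixes g :: "'a::{finite,field} zorn \<Rightarrow> 'a zorn"
  assumes q: "card (UNIV :: 'a set) > 2" and g: "g \<in> octonion_auts" "g \<noteq> id"
  shows "good g"
proof -
  obtain c where c: "noncen c" "g c = c" by (rule fixed_noncentral[OF g(1)])
  define t where "t = ztr c"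
  define n where "n = znorm c"
  have shift: "ztr (c - l \<bullet> Zid) = t - 2 * l" "znorm (c - l \<bullet> Zid) = l * l - t * l + n" for l
  proof -
    have e: "c - l \<bullet> Zid = c + (- l) \<bullet> Zid" by (simp add: zsmul_minus del: zsmul.simps)
    show "ztr (c - l \<bullet> Zid) = t - 2 * l" unfolding e by (simp add: t_def)
    have "znorm (c - l \<bullet> Zid) = n + (- l) * (- l) * 1 + (- l) * t"
      unfolding e znorm_add zbil_smul zbil_Id znorm_smul n_def t_def by simp
    then show "znorm (c - l \<bullet> Zid) = l * l - t * l + n" by (simp add: algebra_simps)
  qed
  have gfix: "g (c - l \<bullet> Zid) = c - l \<bullet> Zid" for l unfolding aut_diff[OF g(1)] aut_smul[OF g(1)] aut_Id[OF g(1)] c(2) ..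
  show ?thesis
  proof (cases "\<exists>l. l * l - t * l + n = 0")
    case True
    then obtain l where l: "l * l - t * l + n = 0" by blast
    show ?thesis
    proof (cases "t - 2 * l = 0")
      case True
      have "c - l \<bullet> Zid \<noteq> 0" using c(1) unfolding noncen_def by (metis right_minus_eq)
      then show ?thesis
        by (rule good_null_line[OF q g, where l = 1]) (simp_all only: shift l True gfix zsmul_1)
    next
      case False
      \<comment> \<open>With the second root l' = t - l this is (c - l') / (l - l').\<close>
      define e where "e = (1 / (2 * l - t)) \<bullet> (c - (t - l) \<bullet> Zid)"
      have "2 * l - t \<noteq> 0" using False by (metis right_minus_eq)
      moreover have "(t - l) * (t - l) - t * (t - l) + n = 0" using l by (simp add: algebra_simps)
      moreover have "t - 2 * (t - l) = 2 * l - t" by simp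
      ultimately have "ztr e = 1" "znorm e = 0" unfolding e_def ztr_smul znorm_smul shift by simp_all
      then obtain h where h: "h \<in> octonion_auts" "h e = E1" by (rule idempotent_conj)
      have ge: "g e = e" unfolding e_def aut_smul[OF g(1)] gfix ..
      have "(h \<circ> g \<circ> finv h) E1 = E1" using conj_apply[OF h(1), of g e] unfolding ge h(2) .
      then have "good (h \<circ> g \<circ> finv h)"
        by (rule good_split[OF q aut_comp[OF aut_comp[OF h(1) g(1)] aut_inv[OF h(1)]] conj_neq_id[OF h(1) g(2)]])
      then show ?thesis by (rule good_conjI[OF g(1) h(1)])
    qed
  next
    case False
    have d: "t * t - 4 * n \<noteq> 0"
    proof
      assume 0: "t * t - 4 * n = 0"
      show False
      proof (cases "(2 :: 'a) = 0")
        case two: True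
        have "(4 :: 'a) = 2 * 2" by simp
        then have "t = 0" using 0 unfolding two by simp
        moreover obtain l where "l * l = n" using surj_square_char2[OF two] .
        ultimately have "l * l - t * l + n = 0" using char2(1)[OF two] by simp
        then show False using False by blast
      next
        case two: False
        define l where "l = t / 2"
        have "t = 2 * l" using two by (simp add: l_def)
        then have "4 * (l * l - t * l + n) = - (t * t - 4 * n)" by (simp add: algebra_simps)
        also have "\<dots> = 0" unfolding 0 by simp
        finally have "2 * 2 * (l * l - t * l + n) = 0" by simp
        then have "l * l - t * l + n = 0" using two mult_eq_0_iff by blast
        then show False using False by blast
      qed
    qed
    obtain h where h: "h \<in> octonion_auts" "h c = Cf t n"
      using transitive_normal_form[OF c(1)] unfolding t_def n_def by blast
    have "(h \<circ> g \<circ> finv h) (Cf t n) = Cf t n" using conj_apply[OF h(1), of g c] unfolding c(2) h(2) .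
    then have "good (h \<circ> g \<circ> finv h)"
      using good_field[OF q aut_comp[OF aut_comp[OF h(1) g(1)] aut_inv[OF h(1)]] conj_neq_id[OF h(1) g(2)] _ _ d] False
      by blast
    then show ?thesis by (rule good_conjI[OF g(1) h(1)])
  qed
qed

theorem mainTheorem15:
  assumes "card (UNIV :: 'a::{finite,field} set) > 2"
  shows "\<forall>Cl \<in> conj_classes (G2 :: ('a::{finite,field} zorn \<Rightarrow> 'a zorn) monoid).
           Cl \<noteq> {\<one>\<^bsub>G2 :: ('a zorn \<Rightarrow> 'a zorn) monoid\<^esub>} \<longrightarrow>
           type_C G2 Cl \<or> type_D G2 Cl \<or> type_F G2 Cl"
proof (intro ballI impI)
  fix Cl assume Cl: "Cl \<in> conj_classes (G2 :: ('a zorn \<Rightarrow> 'a zorn) monoid)"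
    and nt: "Cl \<noteq> {\<one>\<^bsub>G2 :: ('a zorn \<Rightarrow> 'a zorn) monoid\<^esub>}"
  obtain g where g: "g \<in> octonion_auts" "Cl = cls g" using Cl unfolding conj_classes_def G2_simps by blast
  have "g \<noteq> id"
  proof
    assume "g = id"
    have "s \<in> Cl \<longleftrightarrow> s = id" for s
    proof
      assume "s \<in> Cl"
      then have "conj_to g s" unfolding g(2) cls_iff[OF g(1)] .
      then obtain h where h: "h \<in> octonion_auts" "h \<circ> g = s \<circ> h" unfolding conj_to_def by blast
      have "s \<circ> h = id \<circ> h" using h(2) unfolding \<open>g = id\<close> comp_id id_comp by (rule sym)
      then show "s = id" unfolding comp_cancel_right[OF h(1)] .
    next
      assume "s = id"
      have "conj_to g s" using conj_to_refl[OF g(1)] unfolding \<open>g = id\<close> \<open>s = id\<close> by assumption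
      then show "s \<in> Cl" unfolding g(2) cls_iff[OF g(1)] .
    qed
    then show False using nt unfolding G2_simps by blast
  qed
  then have "good g" by (rule good_nontrivial[OF assms g(1)])
  then show "type_C G2 Cl \<or> type_D G2 Cl \<or> type_F G2 Cl" unfolding good_def g(2) .
qed

end
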